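(* There exist constants $b_+ > 0$ and $b_- < 0$ such that \[ |f_+(r) - r^{-3} - b_+ r^{-4}| = O(r^{-6}) \qquad \text{and} \qquad |f_-(r) - r^{-3} - b_- r^{-4}| = O(r^{-6}) \] as $r\to\infty$. These constants satisfy \[ 0 <\frac{\left(\tfrac{3\sqrt{2}}{2}\right)^{\frac{2}{3}}}{9}\, b_+\leq 0.1 \qquad \text{and} \qquad \frac{\left(\tfrac{3\sqrt{2}}{2}\right)^{\frac{2}{3}}}{9}\, b_- \leq -0.11 . \] Consequently, the sum satisfies $b_+ + b_- \leq - 9 \cdot 10^{-2} \cdot\left(\tfrac{3\sqrt{2}}{2}\right)^{-\frac{2}{3}} < 0$, and in particular it is non-zero.
   Context: Write points of $\mathbb{R}^8$ as $\xi=(x,y) \in \mathbb{R}^5\times\mathbb{R}^3$ and set $u=|x|$, $v=|y|$. Let $\mathbf{C}_0 = \{(x,y)\in\mathbb{R}^8 : u^2 = 2v^2\}$, the quadratic area-minimizing cone $C(\mathbb{S}^4\times\mathbb{S}^2)$. Let $U_+=\{u>\sqrt2\, v\}$ and $U_-=\{u<\sqrt2\, v\}$ be the two components of $\mathbb{R}^8\setminus\mathbf{C}_0$, and let $\nu_{\mathbf{C}_0}$ be the unit normal of $\mathbf{C}_0\setminus\{0\}$ pointing into $U_+$, so that $|\xi|\,\nu_{\mathbf{C}_0}(\xi)=\frac{\sqrt2}{2}(x,-2y)$ for $\xi=(x,y)\in\mathbf{C}_0\setminus\{0\}$. By Hardt and Simon, there exist smooth area-minimizing hypersurfaces $S_\pm\subset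 U_\pm$, unique up to dilation and invariant under $O(5)\times O(3)$, whose dilations foliate $U_\pm$. For some constant $R_0$, outside $B_{R_0}\subset\mathbb{R}^8$ the hypersurface $S_\pm$ is the normal graph over $\mathbf{C}_0$ of the function $\pm r f_\pm(r)$, where $r=|\xi|$, in the direction $\nu_{\mathbf{C}_0}$, with $f_\pm$ smooth. That is, it consists of the points \[ \xi \pm |\xi|\, f_\pm(|\xi|)\,\nu_{\mathbf{C}_0}(\xi) = (x,y)\pm \tfrac{\sqrt2}{2} f_\pm(|\xi|)\,(x,-2y), \qquad \xi=(x,y)\in\mathbf{C}_0 . \] The scale of $S_\pm$ is normalized so that $|f_\pm(r)-r^{-3}|\le O(r^{-3-\varepsilon_0})$ as $r\to\infty$ for some $\varepsilon_0>0$. The functions $f_+$ and $f_-$ in the claim are these functions. *)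

theory Defs
  imports "HOL-Analysis.Analysis" "HOL-Library.Landau_Symbols"
begin

text \<open>Meaningful for open sets only: derivatives are taken in the whole space.\<close>

primrec Ck_on :: "nat \<Rightarrow> 'a::real_normed_vector set \<Rightarrow> ('a \<Rightarrow> 'b::real_normed_vector) \<Rightarrow> bool" where
  "Ck_on 0 U f \<longleftrightarrow> continuous_on U f"
| "Ck_on (Suc k) U f \<longleftrightarrow>
     (\<forall>x\<in>U. f differentiable (at x)) \<and>
     (\<forall>h. Ck_on k U (\<lambda>x. frechet_derivative f (at x) h))"

definition smooth_on :: "'a::real_normed_vector set \<Rightarrow> ('a \<Rightarrow> 'b::real_normed_vector) \<Rightarrow> bool" where
  "smooth_on U f \<longleftrightarrow> (\<forall>k. Ck_on k U f)"

definition smooth_hypersurface :: "'a::euclidean_space set \<Rightarrow> bool" where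
  "smooth_hypersurface S \<longleftrightarrow>
     (\<forall>p\<in>S. \<exists>W (g :: 'a \<Rightarrow> real). open W \<and> p \<in> W \<and> smooth_on W g \<and>
        (\<forall>q\<in>W. frechet_derivative g (at q) \<noteq> (\<lambda>_. 0)) \<and>
        S \<inter> W = {q \<in> W. g q = 0})"

definition divergence :: "('a::euclidean_space \<Rightarrow> 'a) \<Rightarrow> 'a \<Rightarrow> real" where
  "divergence X p = (\<Sum>b\<in>Basis. frechet_derivative X (at p) b \<bullet> b)"

definition test_fields :: "'a::euclidean_space set \<Rightarrow> ('a \<Rightarrow> 'a) set" where
  "test_fields U = {X. Ck_on 1 UNIV X \<and> (\<forall>p. norm (X p) \<le> 1) \<and>
     (\<exists>K. compact K \<and> K \<subseteq> U \<and> (\<forall>p. p \<notin> K \<longrightarrow> X p = 0))}"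

text \<open>De Giorgi perimeter of \<open>E\<close> in the open set \<open>U\<close>, that is, the mass in \<open>U\<close> of the
  current that bounds \<open>E\<close>.\<close>

definition perimeter :: "'a::euclidean_space set \<Rightarrow> 'a set \<Rightarrow> ereal" where
  "perimeter E U =
     (SUP X\<in>test_fields U. ereal (set_lebesgue_integral lebesgue E (divergence X)))"

definition perimeter_minimizing :: "'a::euclidean_space set \<Rightarrow> bool" where
  "perimeter_minimizing E \<longleftrightarrow> E \<in> sets lebesgue \<and>
     (\<forall>U. open U \<and> bounded U \<longrightarrow>
        perimeter E U < \<infinity> \<and>
        (\<forall>F K. F \<in> sets lebesgue \<and> compact K \<and> K \<subseteq> U \<and> (E - F) \<union> (F - E) \<subseteq> K \<longrightarrow>
           perimeter E U \<le> perimeter F U))"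

text \<open>The support of the distributional derivative of the indicator function of \<open>E\<close>; unlike
  \<^term>\<open>frontier E\<close> it does not change when \<open>E\<close> is modified on a null set.\<close>

definition boundary_support :: "'a::euclidean_space set \<Rightarrow> 'a set" where
  "boundary_support E = {p. \<forall>r>0. 0 < emeasure lebesgue (E \<inter> ball p r) \<and>
                                   0 < emeasure lebesgue (ball p r - E)}"

definition area_minimizing :: "'a::euclidean_space set \<Rightarrow> bool" where
  "area_minimizing S \<longleftrightarrow> (\<exists>E. perimeter_minimizing E \<and> S = boundary_support E)"

definition dilations_foliate :: "'a::real_vector set \<Rightarrow> 'a set \<Rightarrow> bool" where
  "dilations_foliate S U \<longleftrightarrow>
     (\<Union>c\<in>{0<..}. (*\<^sub>R) c ` S) = U \<and>
     (\<forall>c>0. \<forall>d>0. c \<noteq> d \<longrightarrow> (*\<^sub>R) c ` S \<inter> (*\<^sub>R) d ` S = {})"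

type_synonym R8 = "(real^5) \<times> (real^3)"

definition C0 :: "R8 set" where
  "C0 = {(x, y). (norm x)\<^sup>2 = 2 * (norm y)\<^sup>2}"

definition U_plus :: "R8 set" where
  "U_plus = {(x, y). norm x > sqrt 2 * norm y}"

definition U_minus :: "R8 set" where
  "U_minus = {(x, y). norm x < sqrt 2 * norm y}"

definition O5_O3_invariant :: "R8 set \<Rightarrow> bool" where
  "O5_O3_invariant S \<longleftrightarrow>
     (\<forall>(A :: real^5 \<Rightarrow> real^5) (B :: real^3 \<Rightarrow> real^3).
        orthogonal_transformation A \<and> orthogonal_transformation B \<longrightarrow> map_prod A B ` S = S)"

definition hardt_simon_leaf :: "R8 set \<Rightarrow> R8 set \<Rightarrow> bool" where
  "hardt_simon_leaf U S \<longleftrightarrow>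
     S \<subseteq> U \<and> smooth_hypersurface S \<and> area_minimizing S \<and>
     O5_O3_invariant S \<and> dilations_foliate S U"

text \<open>The following two lemmas justify the formula: on \<^term>\<open>C0 - {0}\<close> this is the unit normal
  that points in the direction in which \<open>|x|\<^sup>2 - 2 |y|\<^sup>2\<close> increases, i.e. into \<^term>\<open>U_plus\<close>.\<close>

definition nu_C0 :: "R8 \<Rightarrow> R8" where
  "nu_C0 \<xi> = (sqrt 2 / (2 * norm \<xi>)) *\<^sub>R (fst \<xi>, - 2 *\<^sub>R snd \<xi>)"

lemma norm_nu_C0:
  assumes "\<xi> \<in> C0" "\<xi> \<noteq> 0"
  shows "norm (nu_C0 \<xi>) = 1"
proof -
  obtain x y where \<xi>: "\<xi> = (x, y)" by (cases \<xi>)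
  have x2: "(norm x)\<^sup>2 = 2 * (norm y)\<^sup>2" using assms(1) by (simp add: \<xi> C0_def)
  have n: "(norm \<xi>)\<^sup>2 = 3 * (norm y)\<^sup>2" by (simp add: \<xi> norm_Pair x2)
  have "(norm (nu_C0 \<xi>))\<^sup>2 = (sqrt 2 / (2 * norm \<xi>))\<^sup>2 * (norm (x, - 2 *\<^sub>R y))\<^sup>2"
    by (simp only: nu_C0_def norm_scaleR power_mult_distrib power2_abs \<xi> fst_conv snd_conv)
  also have "\<dots> = (sqrt 2 / (2 * norm \<xi>))\<^sup>2 * ((norm x)\<^sup>2 + 4 * (norm y)\<^sup>2)"
    by (simp add: norm_Pair power_mult_distrib)
  also have "\<dots> = 3 * (norm y)\<^sup>2 / (norm \<xi>)\<^sup>2"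
    by (simp add: x2 power_mult_distrib power_divide field_simps)
  also have "\<dots> = 1" unfolding n[symmetric] using assms(2) by simp
  finally show ?thesis by (simp add: power2_eq_1_iff) (use norm_ge_zero[of "nu_C0 \<xi>"] in linarith)
qed

lemma nu_C0_gradient:
  assumes "\<xi> \<noteq> 0"
  shows "((\<lambda>(x, y). (norm x)\<^sup>2 - 2 * (norm y)\<^sup>2) has_derivative
           (\<lambda>h. (2 * sqrt 2 * norm \<xi>) * (nu_C0 \<xi> \<bullet> h))) (at \<xi>)"
proof -
  have "((\<lambda>\<eta>::R8. fst \<eta> \<bullet> fst \<eta> - 2 * (snd \<eta> \<bullet> snd \<eta>)) has_derivative
          (\<lambda>h. (2 * sqrt 2 * norm \<xi>) * (nu_C0 \<xi> \<bullet> h))) (at \<xi>)"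
    using assms
    by (auto intro!: derivative_eq_intros
        simp: nu_C0_def fun_eq_iff inner_commute algebra_simps)
  then show ?thesis by (simp add: case_prod_unfold power2_norm_eq_inner)
qed

definition normal_graph_point :: "real \<Rightarrow> (real \<Rightarrow> real) \<Rightarrow> R8 \<Rightarrow> R8" where
  "normal_graph_point \<sigma> f \<xi> = \<xi> + (\<sigma> * norm \<xi> * f (norm \<xi>)) *\<^sub>R nu_C0 \<xi>"

text \<open>\<open>normal_graph_near_infinity \<sigma> S f\<close>: up to a bounded set, \<open>S\<close> is the normal graph of
  \<open>\<sigma> r f(r)\<close> over the part of the cone outside a ball. Only the values of \<open>f\<close> at large radii
  matter.\<close>

definition normal_graph_near_infinity :: "real \<Rightarrow> R8 set \<Rightarrow> (real \<Rightarrow> real) \<Rightarrow> bool" where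
  "normal_graph_near_infinity \<sigma> S f \<longleftrightarrow>
     (\<exists>R0>0. smooth_on {R0<..} f \<and>
        (let G = normal_graph_point \<sigma> f ` {\<xi> \<in> C0. norm \<xi> > R0}
         in G \<subseteq> S \<and> bounded (S - G)))"

definition normalized_scale :: "(real \<Rightarrow> real) \<Rightarrow> bool" where
  "normalized_scale f \<longleftrightarrow>
     (\<exists>\<epsilon>>0. (\<lambda>r. f r - r powr (-3)) \<in> O[at_top](\<lambda>r. r powr (-3 - \<epsilon>)))"

end

theory Submission
  imports Defs
begin

text \<open>The leaves are minimal hypersurfaces with symmetry group \<open>O(5) \<times> O(3)\<close>, so each is determined by
a plane curve, and the expansion of \<open>f\<close> is the asymptotic expansion of a solution of an ordinary
differential equation along that curve. The proof has four layers.

First variation. A leaf is the support of the boundary of a perimeter minimizing set \<open>E\<close>, and near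
each of its points it is the zero set of a \<open>C\<^sup>2\<close> function \<open>g\<close> with nonzero gradient \<open>n\<close>. Disjointness
of the dilations makes the leaf a null set (\<open>negligible_if_dilations_disjoint\<close>); connectedness of the
two sides \<open>{g < 0}\<close> and \<open>{g > 0}\<close> of a small chart then shows that \<open>E\<close> is one of them up to a null
set (\<open>locally_one_side\<close>). If the divergence of the unit normal \<open>n / |n|\<close> had a sign \<open>s\<close> at a point,
the level set of \<open>g + s R (R\<^sup>2 - |x - p|\<^sup>2)\<^sup>3\<close> would bound a competitor, and its unit normal field
would calibrate it: the perimeter, which is a supremum over test fields, would drop by a definite amount
(\<open>no_calibrated_competitor\<close>). So the mean curvature vanishes (\<open>area_minimizing_stationary\<close>).

Reduction to an angle equation. Invariance turns this into an equation for the profile curve in the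
quarter plane of \<open>(|x|, |y|)\<close>. Because the dilations of the leaf foliate \<open>U_plus\<close> or \<open>U_minus\<close>, each
ray from the origin inside the sector meets the curve exactly once, so in logarithmic polar coordinates
\<open>exp w (cos \<theta>, sin \<theta>)\<close> it is a graph over the angle. At a radial tangent the angle would have a strict
extremum, which uniqueness on the neighbouring rays excludes (\<open>no_radial_tangency\<close>). With
\<open>w' = tan \<alpha>\<close> minimality reads \<open>\<alpha>' = 7 - M(\<theta>) tan \<alpha>\<close>, where \<open>M(\<theta>) = l cot \<theta> - k tan \<theta>\<close> and
\<open>(k, l)\<close> is \<open>(4, 2)\<close> for \<open>U_plus\<close> and \<open>(2, 4)\<close>, after exchanging the axes, for \<open>U_minus\<close>. The angle
\<open>\<theta>\<close> runs from the axis \<open>0\<close> to the cone \<open>\<theta>0\<close>.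

Asymptotics. Put \<open>T = cot \<alpha>\<close> and \<open>\<delta> = \<theta>0 - \<theta>\<close>. As functions of \<open>w\<close> these satisfy \<open>\<delta>' = -T\<close> and
\<open>T' = 12 \<delta> - 7 T\<close> up to terms of second order, a system with exponents \<open>-3\<close> and \<open>-4\<close>. The
combinations \<open>exp (3 w) (4 \<delta> - T)\<close> and \<open>exp (4 w) (3 \<delta> - T)\<close> isolate the two modes and
converge with errors \<open>exp (-3 w)\<close> and \<open>exp (-2 w)\<close> (\<open>mode_expansion\<close>). The first limit is \<open>1\<close> by the
normalization of the scale, the second is \<open>-b\<close>; since \<open>\<delta> = arctan (f r)\<close> and
\<open>exp w = r sqrt (1 + f(r)\<^sup>2)\<close>, this is the claimed expansion of \<open>f\<close> (\<open>expansion\<close>).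

Bounds on \<open>b\<close>. The function \<open>j = m sin \<alpha>\<close> with \<open>m = cos(\<theta>)^k sin(\<theta>)^l\<close> satisfies \<open>j' = 7 m cos \<alpha>\<close>
and tends to \<open>0\<close> at the axis. This selects the solution and yields a comparison principle on the
whole interval \<open>(0, \<theta>0)\<close>: a function that satisfies the equation for \<open>T\<close> as a differential
inequality lies on one side of \<open>T\<close> (\<open>comparison\<close>). Barriers are sought in the form
\<open>sqrt 2 z\<^sup>3 h(z) / E(z)\<close> with \<open>tan \<delta> = sqrt 2 z\<^sup>3 / 3\<close>, where \<open>E\<close> is the polynomial in \<open>z\<close> that vanishes at
the axis, and \<open>h\<close> is a polynomial with \<open>h(0) = 1\<close>. Since \<open>z\<close> decays like \<open>exp (-w)\<close>, the coefficient
\<open>h'(0)\<close> bounds \<open>b\<close>, and the differential inequality becomes the positivity of an explicit rational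
polynomial on an interval. Three choices of \<open>h\<close> give \<open>b_plus > 0\<close>, the upper bound on \<open>b_plus\<close>
and the upper bound on \<open>b_minus\<close>; the bound on the sum follows from the last two.\<close>

section \<open>Continuously differentiable maps\<close>

text \<open>The derivative is an explicit argument, so that gradients can be given by formulas and differentiated
again to obtain Hessians.\<close>

definition C1_on :: "'a::real_normed_vector set \<Rightarrow> ('a \<Rightarrow> 'b::real_normed_vector) \<Rightarrow> ('a \<Rightarrow> 'a \<Rightarrow> 'b) \<Rightarrow> bool" where
  "C1_on U f f' \<longleftrightarrow> (\<forall>x\<in>U. (f has_derivative f' x) (at x)) \<and> (\<forall>h. continuous_on U (\<lambda>x. f' x h))"

lemma C1_onI:
  assumes "\<And>x. x \<in> U \<Longrightarrow> (f has_derivative f' x) (at x)" "\<And>h. continuous_on U (\<lambda>x. f' x h)"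
  shows "C1_on U f f'"
  using assms by (auto simp: C1_on_def)

lemma C1_onD:
  assumes "C1_on U f f'"
  shows "x \<in> U \<Longrightarrow> (f has_derivative f' x) (at x)" "continuous_on U (\<lambda>x. f' x h)"
  using assms by (auto simp: C1_on_def)

lemma C1_on_continuous: "C1_on U f f' \<Longrightarrow> continuous_on U f"
  by (meson C1_on_def continuous_at_imp_continuous_on has_derivative_continuous)

lemma C1_on_subset: "C1_on U f f' \<Longrightarrow> V \<subseteq> U \<Longrightarrow> C1_on V f f'"
  by (auto simp: C1_on_def intro: continuous_on_subset)

lemma C1_on_iff_Ck_on: "C1_on U f (\<lambda>x. frechet_derivative f (at x)) \<longleftrightarrow> Ck_on 1 U f"
  by (auto simp: C1_on_def frechet_derivative_works)

lemma C1_on_imp_Ck_on: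
  assumes "C1_on U f f'" shows "Ck_on 1 U f"
proof -
  have e: "f' x = frechet_derivative f (at x)" if "x \<in> U" for x
    using assms frechet_derivative_at that by (fastforce simp: C1_on_def)
  have "C1_on U f (\<lambda>x. frechet_derivative f (at x))"
    using assms by (auto simp: C1_on_def e cong: continuous_on_cong)
  then show ?thesis by (simp only: C1_on_iff_Ck_on)
qed

lemma divergence_eq:
  assumes "(X has_derivative X') (at p)"
  shows "divergence X p = (\<Sum>b\<in>Basis. X' b \<bullet> b)"
  using frechet_derivative_at[OF assms] by (simp add: divergence_def)

lemma C1_on_continuous_divergence:
  fixes X :: "'a::euclidean_space \<Rightarrow> 'a"
  assumes "C1_on U X X'" shows "continuous_on U (divergence X)"
proof -
  have "continuous_on U (\<lambda>x. \<Sum>b\<in>Basis. X' x b \<bullet> b)"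
    using assms by (intro continuous_intros) (auto simp: C1_on_def)
  then show ?thesis
    by (rule continuous_on_eq) (use assms in \<open>auto simp: C1_on_def divergence_eq\<close>)
qed

lemma C1_on_const: "C1_on U (\<lambda>x. c) (\<lambda>x h. 0)"
  by (auto simp: C1_on_def)

lemma C1_on_add:
  "C1_on U f f' \<Longrightarrow> C1_on U g g' \<Longrightarrow> C1_on U (\<lambda>x. f x + g x) (\<lambda>x h. f' x h + g' x h)"
  by (auto simp: C1_on_def intro!: derivative_eq_intros continuous_intros)

lemma C1_on_diff:
  "C1_on U f f' \<Longrightarrow> C1_on U g g' \<Longrightarrow> C1_on U (\<lambda>x. f x - g x) (\<lambda>x h. f' x h - g' x h)"
  by (auto simp: C1_on_def intro!: derivative_eq_intros continuous_intros)

lemma C1_on_scaleR: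
  "C1_on U f f' \<Longrightarrow> C1_on U X X' \<Longrightarrow>
    C1_on U (\<lambda>x. f x *\<^sub>R X x) (\<lambda>x h. f x *\<^sub>R X' x h + f' x h *\<^sub>R X x)"
  using C1_on_continuous[of U f f'] C1_on_continuous[of U X X']
  by (auto simp: C1_on_def intro!: has_derivative_scaleR continuous_intros)

lemma C1_on_mult:
  fixes f g :: "'a::real_normed_vector \<Rightarrow> real"
  shows "C1_on U f f' \<Longrightarrow> C1_on U g g' \<Longrightarrow>
    C1_on U (\<lambda>x. f x * g x) (\<lambda>x h. f x * g' x h + f' x h * g x)"
  using C1_on_scaleR[of U f f' g g'] by simp

lemma C1_on_inner:
  "C1_on U f f' \<Longrightarrow> C1_on U X X' \<Longrightarrow>
    C1_on U (\<lambda>x. f x \<bullet> X x) (\<lambda>x h. f x \<bullet> X' x h + f' x h \<bullet> X x)"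
  using C1_on_continuous[of U f f'] C1_on_continuous[of U X X']
  by (auto simp: C1_on_def intro!: has_derivative_inner continuous_intros)

lemma C1_on_real_compose:
  fixes f :: "'a::real_normed_vector \<Rightarrow> real" and \<sigma> :: "real \<Rightarrow> real"
  assumes f: "C1_on U f f'" and "f ` U \<subseteq> T"
    and \<sigma>: "\<And>t. t \<in> T \<Longrightarrow> (\<sigma> has_real_derivative \<sigma>' t) (at t)" and c: "continuous_on T \<sigma>'"
  shows "C1_on U (\<lambda>x. \<sigma> (f x)) (\<lambda>x h. f' x h * \<sigma>' (f x))"
proof (rule C1_onI)
  show "((\<lambda>x. \<sigma> (f x)) has_derivative (\<lambda>h. f' x h * \<sigma>' (f x))) (at x)" if "x \<in> U" for x
    using has_derivative_compose[OF C1_onD(1)[OF f that] \<sigma>[THEN has_field_derivative_imp_has_derivative]] assms(2) that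
    by (auto simp: mult.commute)
  show "continuous_on U (\<lambda>x. f' x h * \<sigma>' (f x))" for h
    by (intro continuous_intros C1_onD(2)[OF f] continuous_on_compose2[OF c C1_on_continuous[OF f]] assms(2))
qed

lemma has_derivative_zero_outside_closed:
  assumes "(f has_derivative f') (at x)" "closed K" "x \<notin> K" "\<And>y. y \<notin> K \<Longrightarrow> f y = 0"
  shows "f' = (\<lambda>_. 0)"
proof -
  have "(f has_derivative (\<lambda>_. 0)) (at x)"
    by (rule has_derivative_transform_within_open[where f="\<lambda>_. 0" and s="- K"])
       (use assms in auto)
  then show ?thesis using assms(1) has_derivative_unique by blast
qed

lemma continuous_on_extend_by_zero:
  fixes f :: "'a::t2_space \<Rightarrow> 'b::real_normed_vector"
  assumes f: "continuous_on W f" and W: "open W" and K: "closed K" "K \<subseteq> W"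
    and z: "\<And>x. x \<in> W - K \<Longrightarrow> f x = 0"
  shows "continuous_on UNIV (\<lambda>x. if x \<in> W then f x else 0)"
proof -
  have "continuous_on (W \<union> - K) (\<lambda>x. if x \<in> W then f x else 0)"
  proof (rule continuous_on_open_Un)
    show "continuous_on W (\<lambda>x. if x \<in> W then f x else 0)"
      using f by (rule continuous_on_eq) simp
    show "continuous_on (- K) (\<lambda>x. if x \<in> W then f x else 0)"
    proof (rule continuous_on_eq)
      show "continuous_on (- K) (\<lambda>_. 0 :: 'b)" by simp
      show "0 = (if x \<in> W then f x else 0)" if "x \<in> - K" for x
        using z[of x] that by simp
    qed
  qed (use W K in auto)
  moreover have "W \<union> - K = UNIV" using K by auto
  ultimately show ?thesis by simp
qed

text \<open>Turns fields that are defined near a point and cut off there into test fields on the whole space.\<close>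

lemma C1_on_extend_by_zero:
  assumes X: "C1_on W X X'" and W: "open W" and K: "closed K" "K \<subseteq> W"
    and z: "\<And>x. x \<in> W - K \<Longrightarrow> X x = 0"
  shows "C1_on UNIV (\<lambda>x. if x \<in> W then X x else 0) (\<lambda>x h. if x \<in> W then X' x h else 0)"
proof (rule C1_onI)
  let ?X = "\<lambda>x. if x \<in> W then X x else 0"
  have zero: "X' x = (\<lambda>_. 0)" if "x \<in> W - K" for x
  proof -
    have "(X has_derivative (\<lambda>_. 0)) (at x)"
      by (rule has_derivative_transform_within_open[where f="\<lambda>_. 0" and s="W - K"])
         (use that z W K in auto)
    then show ?thesis using C1_onD(1)[OF X] has_derivative_unique that by blast
  qed
  show "(?X has_derivative (\<lambda>h. if x \<in> W then X' x h else 0)) (at x)" for x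
  proof (cases "x \<in> W")
    case True
    then show ?thesis
      by (auto intro!: has_derivative_transform_within_open[where f=X and s=W] C1_onD(1)[OF X] W)
  next
    case False
    have "(?X has_derivative (\<lambda>_. 0)) (at x)"
    proof (rule has_derivative_transform_within_open[where f="\<lambda>_. 0"])
      show "open (- K)" "x \<in> - K" using K False by auto
    qed (use z in auto)
    then show ?thesis using False by simp
  qed
  show "continuous_on UNIV (\<lambda>x. if x \<in> W then X' x h else 0)" for h
    by (rule continuous_on_extend_by_zero[OF C1_onD(2)[OF X] W K]) (simp add: zero)
qed

section \<open>The divergence theorem for fields of compact support\<close>

lemma integrable_continuous_compact_support:
  fixes f :: "'a::euclidean_space \<Rightarrow> real"
  assumes "continuous_on UNIV f" "compact K" "\<And>x. x \<notin> K \<Longrightarrow> f x = 0"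
  shows "integrable lborel f"
proof -
  have "integrable lborel (\<lambda>x. indicator K x *\<^sub>R f x)"
    by (rule borel_integrable_compact) (use assms(2) continuous_on_subset[OF assms(1)] in auto)
  moreover have "(\<lambda>x. indicator K x *\<^sub>R f x) = f"
    using assms(3) by (auto simp: indicator_def fun_eq_iff)
  ultimately show ?thesis by simp
qed

lemma has_derivative_line:
  fixes x b :: "'a::real_normed_vector"
  shows "((\<lambda>u. x + u *\<^sub>R b) has_derivative (\<lambda>h. h *\<^sub>R b)) (at u within T)"
  using has_derivative_add[OF has_derivative_const[of x] has_derivative_scaleR_left[OF has_derivative_ident]]
  by simp

text \<open>Translation invariance makes the integral of every difference quotient vanish, and the quotients
are dominated by a multiple of the indicator of a ball.\<close>

lemma integral_directional_derivative_eq_0: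
  fixes f :: "'a::euclidean_space \<Rightarrow> real"
  assumes f: "C1_on UNIV f f'" and K: "compact K" "\<And>x. x \<notin> K \<Longrightarrow> f x = 0"
  shows "integrable lborel (\<lambda>x. f' x b)" "(\<integral>x. f' x b \<partial>lborel) = 0"
proof -
  have z: "f' x b = 0" if "x \<notin> K" for x
    using has_derivative_zero_outside_closed[OF C1_onD(1)[OF f] compact_imp_closed[OF K(1)] that K(2)] by simp
  have cf': "continuous_on UNIV (\<lambda>x. f' x b)" and cf: "continuous_on UNIV f"
    using C1_onD(2)[OF f] C1_on_continuous[OF f] by auto
  show int': "integrable lborel (\<lambda>x. f' x b)"
    by (rule integrable_continuous_compact_support[OF cf' K(1) z])
  have int: "integrable lborel f"
    by (rule integrable_continuous_compact_support[OF cf K])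
  obtain M where M: "M > 0" "\<And>x. \<bar>f' x b\<bar> \<le> M"
  proof -
    have "bounded ((\<lambda>x. f' x b) ` K)"
      by (intro compact_imp_bounded compact_continuous_image K continuous_on_subset[OF cf']) auto
    then obtain M where "M > 0" "\<And>x. x \<in> K \<Longrightarrow> \<bar>f' x b\<bar> \<le> M"
      by (auto simp: bounded_pos)
    then show ?thesis using z that[of M] by (metis abs_zero less_eq_real_def)
  qed
  obtain R where R: "K \<subseteq> cball 0 R" "R > 0"
    using compact_imp_bounded[OF K(1)] by (auto simp: bounded_pos subset_iff)
  define s where "s = (\<lambda>i x. (f (x + (1 / Suc i) *\<^sub>R b) - f x) * Suc i)"
  have trans: "integrable lborel (\<lambda>x. f (x + t *\<^sub>R b))"
       "(\<integral>x. f (x + t *\<^sub>R b) \<partial>lborel) = (\<integral>x. f x \<partial>lborel)" for t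
  proof -
    have m: "f \<in> borel_measurable borel" using cf by (rule borel_measurable_continuous_onI)
    have "integrable (distr lborel borel ((+) (t *\<^sub>R b))) f" using int by (simp add: lborel_distr_plus)
    then show "integrable lborel (\<lambda>x. f (x + t *\<^sub>R b))"
      using m by (subst (asm) integrable_distr_eq) (auto simp: add.commute)
    have "(\<integral>x. f x \<partial>lborel) = (\<integral>x. f x \<partial>(distr lborel borel ((+) (t *\<^sub>R b))))"
      by (simp add: lborel_distr_plus)
    also have "\<dots> = (\<integral>x. f (x + t *\<^sub>R b) \<partial>lborel)"
      using m by (subst integral_distr) (auto simp: add.commute)
    finally show "(\<integral>x. f (x + t *\<^sub>R b) \<partial>lborel) = (\<integral>x. f x \<partial>lborel)" by simp
  qed
  have mvt: "\<bar>f (x + t *\<^sub>R b) - f x\<bar> \<le> M * t" if "t \<ge> 0" for x t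
  proof -
    have d: "((\<lambda>u. f (x + u *\<^sub>R b)) has_derivative (\<lambda>h. h * f' (x + u *\<^sub>R b) b)) (at u within {0..t})" for u
    proof -
      have l: "linear (f' (x + u *\<^sub>R b))" using C1_onD(1)[OF f] has_derivative_linear by blast
      have "((\<lambda>u. x + u *\<^sub>R b) has_derivative (\<lambda>h. h *\<^sub>R b)) (at u within {0..t})"
        by (rule has_derivative_line)
      from has_derivative_compose[OF this C1_onD(1)[OF f]]
      show ?thesis by (simp add: linear_scale[OF l])
    qed
    have "norm (f (x + t *\<^sub>R b) - f (x + 0 *\<^sub>R b)) \<le> M * norm (t - 0)"
    proof (rule differentiable_bound[where S="{0..t}" and f'="\<lambda>u h. h * f' (x + u *\<^sub>R b) b"])
      show "onorm (\<lambda>h. h * f' (x + u *\<^sub>R b) b) \<le> M" if "u \<in> {0..t}" for u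
        by (rule onorm_le) (use M in \<open>auto simp: abs_mult mult.commute[of M] intro!: mult_left_mono\<close>)
    qed (use d that in auto)
    then show ?thesis using that by simp
  qed
  have d1: "(\<lambda>x. f' x b) \<in> borel_measurable lborel" using int' by auto
  have d2: "s i \<in> borel_measurable lborel" for i
    using trans(1) int unfolding s_def by (auto intro!: borel_measurable_times borel_measurable_diff)
  have d3: "integrable lborel (\<lambda>x. M * indicator (cball 0 (R + norm b)) x :: real)"
    by (intro integrable_mult_right)
      (simp add: integrable_indicator_iff emeasure_bounded_finite[OF bounded_cball, unfolded infinity_ennreal_def])
  have d4: "AE x in lborel. (\<lambda>i. s i x) \<longlonglongrightarrow> f' x b"
  proof (rule AE_I2)
    fix x
    have "((\<lambda>t. x + t *\<^sub>R b) has_derivative (\<lambda>h. h *\<^sub>R b)) (at 0)"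
      by (rule has_derivative_line)
    from has_derivative_compose[OF this C1_onD(1)[OF f]]
    have "((\<lambda>t. f (x + t *\<^sub>R b)) has_derivative (\<lambda>h. f' x (h *\<^sub>R b))) (at 0)" by simp
    moreover have "f' x (h *\<^sub>R b) = f' x b * h" for h
      using linear_scale[OF has_derivative_linear[OF C1_onD(1)[OF f]]] by simp
    ultimately have "((\<lambda>t. f (x + t *\<^sub>R b)) has_real_derivative f' x b) (at 0)"
      by (simp add: has_field_derivative_def)
    then have "((\<lambda>h. (f (x + h *\<^sub>R b) - f x) / h) \<longlongrightarrow> f' x b) (at 0)"
      by (simp add: DERIV_def)
    moreover have "filterlim (\<lambda>i. 1 / real (Suc i)) (at 0) sequentially"
      unfolding filterlim_at using LIMSEQ_inverse_real_of_nat by (simp add: inverse_eq_divide)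
    ultimately have "(\<lambda>i. (f (x + (1 / real (Suc i)) *\<^sub>R b) - f x) / (1 / real (Suc i))) \<longlonglongrightarrow> f' x b"
      by (rule filterlim_compose)
    then show "(\<lambda>i. s i x) \<longlonglongrightarrow> f' x b" by (simp add: s_def)
  qed
  have d5: "AE x in lborel. norm (s i x) \<le> M * indicator (cball 0 (R + norm b)) x" for i
  proof (rule AE_I2)
    fix x
    show "norm (s i x) \<le> M * indicator (cball 0 (R + norm b)) x"
    proof (cases "x \<in> cball 0 (R + norm b)")
      case True
      have "\<bar>f (x + (1 / Suc i) *\<^sub>R b) - f x\<bar> * Suc i \<le> M * (1 / Suc i) * Suc i"
        by (rule mult_right_mono[OF mvt]) simp_all
      then show ?thesis using True by (simp add: s_def abs_mult)
    next
      case False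
      then have n: "norm x > R + norm b" by simp
      have "norm x \<le> norm (x + (1 / Suc i) *\<^sub>R b) + norm ((1 / Suc i) *\<^sub>R b)"
        by (metis add_diff_cancel norm_triangle_ineq4)
      moreover have "norm ((1 / Suc i) *\<^sub>R b) \<le> norm b"
        by (simp add: divide_le_eq mult_le_cancel_left1)
      ultimately have "norm (x + (1 / Suc i) *\<^sub>R b) > R" using n by linarith
      moreover have "norm x > R" using n norm_ge_zero[of b] by linarith
      ultimately have "x \<notin> K" "x + (1 / Suc i) *\<^sub>R b \<notin> K" using R by auto
      then show ?thesis using False K(2) by (simp add: s_def)
    qed
  qed
  have "(\<lambda>i. \<integral>x. s i x \<partial>lborel) \<longlonglongrightarrow> (\<integral>x. f' x b \<partial>lborel)"
    by (rule integral_dominated_convergence[OF d1 d2 d3 d4 d5])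
  moreover have "(\<integral>x. s i x \<partial>lborel) = 0" for i
    using trans int by (simp add: s_def)
  ultimately show "(\<integral>x. f' x b \<partial>lborel) = 0"
    by (simp add: LIMSEQ_const_iff)
qed

lemma integral_divergence_eq_0:
  fixes X :: "'a::euclidean_space \<Rightarrow> 'a"
  assumes X: "C1_on UNIV X X'" and K: "compact K" "\<And>x. x \<notin> K \<Longrightarrow> X x = 0"
  shows "integrable lborel (divergence X)" "(\<integral>x. divergence X x \<partial>lborel) = 0"
proof -
  have d: "divergence X = (\<lambda>x. \<Sum>b\<in>Basis. X' x b \<bullet> b)"
    using divergence_eq[OF C1_onD(1)[OF X]] by auto
  have c: "C1_on UNIV (\<lambda>x. X x \<bullet> b) (\<lambda>x h. X' x h \<bullet> b)" for b
    using C1_on_inner[OF X C1_on_const[of _ b]] by simp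
  have "integrable lborel (\<lambda>x. X' x b \<bullet> b)" "(\<integral>x. X' x b \<bullet> b \<partial>lborel) = 0" for b
    using integral_directional_derivative_eq_0[OF c K(1)] K(2) by auto
  then show "integrable lborel (divergence X)" "(\<integral>x. divergence X x \<partial>lborel) = 0"
    by (auto simp: d)
qed

section \<open>Flux through a regular level set\<close>

lemma DERIV_pos_part_power2: "((\<lambda>t. (max 0 t)\<^sup>2) has_real_derivative 2 * max 0 t) (at (t::real))"
proof (cases t "0::real" rule: linorder_cases)
  case less
  have "((\<lambda>_. 0) has_real_derivative 2 * max 0 t) (at t)" using less by simp
  then show ?thesis
    by (rule has_field_derivative_transform_within_open[where S="{..<0}"]) (use less in auto)
next
  case equal
  have "((\<lambda>h. (max 0 h)\<^sup>2 / h) \<longlongrightarrow> 0) (at (0::real))"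
  proof (rule tendsto_sandwich[where f="\<lambda>h. - \<bar>h\<bar>" and h="\<lambda>h. \<bar>h\<bar>"])
    show "\<forall>\<^sub>F h in at (0::real). - \<bar>h\<bar> \<le> (max 0 h)\<^sup>2 / h"
      by (intro always_eventually allI) (auto simp: max_def power2_eq_square)
    show "\<forall>\<^sub>F h in at (0::real). (max 0 h)\<^sup>2 / h \<le> \<bar>h\<bar>"
      by (intro always_eventually allI) (auto simp: max_def power2_eq_square)
  qed (auto intro!: tendsto_eq_intros)
  then show ?thesis using equal by (simp add: DERIV_def)
next
  case greater
  have "((\<lambda>t. t\<^sup>2) has_real_derivative 2 * max 0 t) (at t)"
    using greater by (auto intro!: derivative_eq_intros)
  then show ?thesis
    by (rule has_field_derivative_transform_within_open[where S="{0<..}"]) (use greater in auto)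
qed

lemma DERIV_pos_part_power3: "((\<lambda>t. (max 0 t)^3) has_real_derivative 3 * (max 0 t)\<^sup>2) (at (t::real))"
proof -
  have e: "(max 0 t)^3 = (max 0 t)\<^sup>2 * t" for t :: real
    by (simp add: max_def power2_eq_square power3_eq_cube)
  have "((\<lambda>t. (max 0 t)\<^sup>2 * t) has_real_derivative 2 * max 0 t * t + 1 * (max 0 t)\<^sup>2) (at t)"
    by (rule DERIV_mult[OF DERIV_pos_part_power2 DERIV_ident])
  moreover have "2 * max 0 t * t + 1 * (max 0 t)\<^sup>2 = 3 * (max 0 t)\<^sup>2"
    by (auto simp: max_def power2_eq_square)
  ultimately show ?thesis unfolding e by metis
qed

text \<open>A \<open>C^1\<close> approximation, as \<open>k \<rightarrow> \<infinity>\<close>, of the indicator of the negative numbers; it decreases in \<open>s\<close>,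
which is what gives the flux below its sign.\<close>

definition soft_step :: "real \<Rightarrow> real \<Rightarrow> real" where
  "soft_step k s = k * (max 0 (- s))\<^sup>2 / (1 + k * (max 0 (- s))\<^sup>2)"

lemma DERIV_soft_step:
  assumes "k \<ge> 0"
  shows "(soft_step k has_real_derivative - 2 * k * max 0 (- s) / (1 + k * (max 0 (- s))\<^sup>2)\<^sup>2) (at s)"
proof -
  have m: "((\<lambda>s. (max 0 (- s))\<^sup>2) has_real_derivative - 2 * max 0 (- s)) (at s)"
    using DERIV_chain2[where f="\<lambda>t. (max 0 t)\<^sup>2" and g=uminus, OF DERIV_pos_part_power2 DERIV_minus[OF DERIV_ident]]
    by simp
  have *: "((\<lambda>s. k * P s / (1 + k * P s)) has_real_derivative k * P' / (1 + k * P s)\<^sup>2) (at s)"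
    if "(P has_real_derivative P') (at s)" "1 + k * P s \<noteq> 0" for P P'
    using that by (auto intro!: derivative_eq_intros simp: power2_eq_square) (simp add: algebra_simps)
  have "1 + k * (max 0 (- s))\<^sup>2 \<noteq> 0"
    using assms by (smt (verit) mult_nonneg_nonneg zero_le_power2)
  from *[OF m this] show ?thesis
    unfolding soft_step_def by (simp add: mult.assoc mult.left_commute)
qed

lemma soft_step_bounds: "k \<ge> 0 \<Longrightarrow> 0 \<le> soft_step k s \<and> soft_step k s \<le> 1"
proof -
  assume "k \<ge> 0"
  then have "k * (max 0 (- s))\<^sup>2 \<ge> 0" by simp
  then show ?thesis unfolding soft_step_def by (simp add: divide_le_eq)
qed

lemma soft_step_limit: "(\<lambda>k. soft_step (real k) s) \<longlonglongrightarrow> (if s < 0 then 1 else 0)"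
proof (cases "s < 0")
  case True
  define a where "a = (max 0 (- s))\<^sup>2"
  have a: "a > 0" using True by (simp add: a_def)
  have "(\<lambda>k. 1 - inverse (1 + real k * a)) \<longlonglongrightarrow> 1 - 0"
    using a by (intro tendsto_intros tendsto_inverse_0_at_top filterlim_tendsto_add_at_top[OF tendsto_const]
      filterlim_at_top_mult_tendsto_pos[OF tendsto_const _ filterlim_real_sequentially])
  moreover have "1 - inverse (1 + real k * a) = soft_step (real k) s" for k
  proof -
    have "1 + real k * a > 0" using a by (simp add: add_pos_nonneg)
    then show ?thesis unfolding soft_step_def a_def[symmetric] by (simp add: field_simps)
  qed
  ultimately show ?thesis using True by simp
qed (simp add: soft_step_def)

lemma sum_inner_product: "(\<Sum>b\<in>Basis. (x \<bullet> b) * (y \<bullet> b)) = x \<bullet> (y :: 'a::euclidean_space)"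
  by (rule euclidean_inner[symmetric])

lemma divergence_scaleR:
  assumes "(f has_derivative f') (at p)" "(X has_derivative X') (at p)"
  shows "divergence (\<lambda>x. f x *\<^sub>R X x) p = f p * divergence X p + (\<Sum>b\<in>Basis. f' b * (X p \<bullet> b))"
  using divergence_eq[OF has_derivative_scaleR[OF assms]] divergence_eq[OF assms(2)]
  by (simp add: inner_add_left sum.distrib sum_distrib_left)

lemma divergence_cong:
  assumes "open A" "p \<in> A" "\<And>x. x \<in> A \<Longrightarrow> X x = Y x"
  shows "divergence X p = divergence Y p"
proof -
  have "(X has_derivative D) (at p) \<longleftrightarrow> (Y has_derivative D) (at p)" for D
    using has_derivative_transform_within_open[OF _ assms(1,2)] assms(3) by metis
  then have "frechet_derivative X (at p) = frechet_derivative Y (at p)"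
    by (simp add: frechet_derivative_def)
  then show ?thesis by (simp add: divergence_def)
qed

text \<open>The boundary of \<open>{g < 0}\<close> has outer normal \<open>n\<close>, so this is Gauss' theorem for a field that
points outward along it. Replacing the indicator by \<open>soft_step k \<circ> g\<close> avoids the surface
integral: the total divergence of the cut-off field is \<open>0\<close>, and the derivative of the soft step
contributes a multiple of \<open>n \<cdot> V\<close> with the right sign.\<close>

lemma integral_divergence_sublevel_nonneg:
  fixes V :: "'a::euclidean_space \<Rightarrow> 'a" and g :: "'a \<Rightarrow> real"
  assumes g: "C1_on W g (\<lambda>x h. n x \<bullet> h)" and V: "C1_on W V V'"
    and W: "open W" and K: "compact K" "K \<subseteq> W" and z: "\<And>x. x \<in> W - K \<Longrightarrow> V x = 0"
    and pos: "\<And>x. x \<in> W \<Longrightarrow> n x \<bullet> V x \<ge> 0"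
  shows "0 \<le> (\<integral>x. indicator {x\<in>W. g x < 0} x * divergence V x \<partial>lborel)"
proof -
  have cK: "closed K" using K compact_imp_closed by blast
  have zd: "divergence V x = 0" if "x \<in> W - K" for x
  proof -
    have "divergence V x = divergence (\<lambda>_. 0) x"
      by (rule divergence_cong[of "W - K"]) (use that z W cK in auto)
    then show ?thesis using divergence_eq[OF has_derivative_const[of "0::'a" "at x"]] by simp
  qed
  define D where "D = (\<lambda>x. if x \<in> W then divergence V x else 0)"
  have D: "continuous_on UNIV D"
    unfolding D_def by (rule continuous_on_extend_by_zero[OF C1_on_continuous_divergence[OF V] W cK K(2) zd])
  have Di: "integrable lborel D"
    by (rule integrable_continuous_compact_support[OF D K(1)]) (use zd K in \<open>auto simp: D_def\<close>)
  define \<eta>' where "\<eta>' = (\<lambda>k s. - 2 * k * max 0 (- s) / (1 + k * (max 0 (- s))\<^sup>2)\<^sup>2 :: real)"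
  define s where "s = (\<lambda>(k::nat) x. if x \<in> W then soft_step (real k) (g x) * divergence V x else 0)"
  have cg: "C1_on W (\<lambda>x. soft_step (real k) (g x)) (\<lambda>x h. (n x \<bullet> h) * \<eta>' (real k) (g x))" for k :: nat
  proof (rule C1_on_real_compose[OF g, of UNIV])
    show "continuous_on UNIV (\<eta>' (real k))"
    proof -
      have "(1 + real k * (max 0 (- s))\<^sup>2)\<^sup>2 \<noteq> 0" for s :: real
        by (smt (verit) mult_nonneg_nonneg of_nat_0_le_iff zero_le_power2 zero_eq_power2)
      then show ?thesis unfolding \<eta>'_def by (intro continuous_intros) auto
    qed
    show "(soft_step (real k) has_real_derivative \<eta>' (real k) t) (at t)" for t
      unfolding \<eta>'_def by (rule DERIV_soft_step) simp
  qed simp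
  have sc: "continuous_on UNIV (s k)" for k
    unfolding s_def
    by (rule continuous_on_extend_by_zero[OF _ W cK K(2)])
       (auto intro!: continuous_intros C1_on_continuous[OF cg] C1_on_continuous_divergence[OF V] simp: zd)
  have si: "integrable lborel (s k)" for k
    by (rule integrable_continuous_compact_support[OF sc K(1)]) (use zd in \<open>auto simp: s_def\<close>)
  have nonneg: "0 \<le> (\<integral>x. s k x \<partial>lborel)" for k
  proof -
    define Z where "Z = (\<lambda>x. if x \<in> W then soft_step (real k) (g x) *\<^sub>R V x else 0)"
    have Z1: "\<exists>Z'. C1_on UNIV Z Z'"
      unfolding Z_def by (rule exI, rule C1_on_extend_by_zero[OF C1_on_scaleR[OF cg V] W cK K(2)]) (simp add: z)
    then obtain Z' where Z': "C1_on UNIV Z Z'" by blast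
    have Z0: "Z x = 0" if "x \<notin> K" for x using z that by (auto simp: Z_def)
    note I = integral_divergence_eq_0[OF Z' K(1) Z0]
    have "divergence Z x \<le> s k x" for x
    proof (cases "x \<in> W")
      case True
      have "divergence Z x = divergence (\<lambda>x. soft_step (real k) (g x) *\<^sub>R V x) x"
        by (rule divergence_cong[OF W True]) (simp add: Z_def)
      also have "\<dots> = soft_step (real k) (g x) * divergence V x
          + (\<Sum>b\<in>Basis. (n x \<bullet> b) * \<eta>' (real k) (g x) * (V x \<bullet> b))"
        by (rule divergence_scaleR[OF C1_onD(1)[OF cg True] C1_onD(1)[OF V True]])
      also have "\<dots> = soft_step (real k) (g x) * divergence V x + \<eta>' (real k) (g x) * (n x \<bullet> V x)"
        using sum_inner_product[of "n x" "V x"]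
        by (simp add: sum_distrib_left[symmetric] mult.assoc mult.left_commute[of _ "\<eta>' (real k) (g x)"])
      finally have e: "divergence Z x = \<dots>" .
      have "\<eta>' (real k) (g x) * (n x \<bullet> V x) \<le> 0"
      proof (rule mult_nonpos_nonneg[OF _ pos[OF True]])
        have "- 2 * real k * max 0 (- g x) \<le> 0" by simp
        then show "\<eta>' (real k) (g x) \<le> 0"
          unfolding \<eta>'_def by (rule divide_nonpos_nonneg) (rule zero_le_power2)
      qed
      then show ?thesis using e True by (simp add: s_def)
    next
      case False
      have "divergence Z x = divergence (\<lambda>_. 0) x"
        by (rule divergence_cong[of "- K"]) (use False K cK Z0 in auto)
      then show ?thesis
        using divergence_eq[OF has_derivative_const[of "0::'a" "at x"]] False by (simp add: s_def)
    qed
    then have "(\<integral>x. divergence Z x \<partial>lborel) \<le> (\<integral>x. s k x \<partial>lborel)"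
      by (intro integral_mono[OF I(1) si])
    then show ?thesis using I by simp
  qed
  have gm: "{x\<in>W. g x < 0} \<in> sets borel"
  proof -
    have "open {x\<in>W. g x < 0}"
      using continuous_open_preimage[OF C1_on_continuous[OF g] W, of "{..<0}"]
      by (simp add: vimage_def Int_def conj_commute)
    then show ?thesis by simp
  qed
  have e: "indicator {x\<in>W. g x < 0} x * divergence V x = indicator {x\<in>W. g x < 0} x * D x" for x
    by (auto simp: D_def indicator_def)
  have l1: "(\<lambda>x. indicator {x\<in>W. g x < 0} x * D x) \<in> borel_measurable lborel"
    using gm Di by (auto intro!: borel_measurable_times)
  have l2: "AE x in lborel. (\<lambda>k. s k x) \<longlonglongrightarrow> indicator {x\<in>W. g x < 0} x * D x"
  proof (rule AE_I2)
    fix x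
    show "(\<lambda>k. s k x) \<longlonglongrightarrow> indicator {x\<in>W. g x < 0} x * D x"
    proof (cases "x \<in> W")
      case True
      have "(\<lambda>k. soft_step (real k) (g x) * divergence V x) \<longlonglongrightarrow> (if g x < 0 then 1 else 0) * divergence V x"
        by (intro tendsto_intros soft_step_limit)
      then show ?thesis using True by (cases "g x < 0") (simp_all add: s_def D_def)
    qed (simp add: s_def D_def)
  qed
  have l3: "AE x in lborel. norm (s k x) \<le> norm (D x)" for k
  proof (rule AE_I2)
    fix x
    have "\<bar>soft_step (real k) (g x)\<bar> * \<bar>divergence V x\<bar> \<le> \<bar>divergence V x\<bar>"
      using soft_step_bounds[of "real k" "g x"] by (intro mult_left_le_one_le) auto
    then show "norm (s k x) \<le> norm (D x)" by (simp add: s_def D_def abs_mult)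
  qed
  have "(\<lambda>k. \<integral>x. s k x \<partial>lborel) \<longlonglongrightarrow> (\<integral>x. indicator {x\<in>W. g x < 0} x * D x \<partial>lborel)"
    by (rule integral_dominated_convergence[OF l1 _ integrable_norm[OF Di] l2 l3]) (use si in auto)
  then have "0 \<le> (\<integral>x. indicator {x\<in>W. g x < 0} x * D x \<partial>lborel)"
    by (rule LIMSEQ_le_const) (use nonneg in auto)
  then show ?thesis by (simp add: e)
qed

lemma C1_on_radial_quadratic:
  fixes p :: "'a::euclidean_space"
  shows "C1_on UNIV (\<lambda>x. c - (x - p) \<bullet> (x - p)) (\<lambda>x h. - (2 * ((x - p) \<bullet> h)))"
proof (rule C1_onI)
  have "((\<lambda>x. x - p) has_derivative (\<lambda>h. h)) (at x)" for x
    using has_derivative_diff[OF has_derivative_ident has_derivative_const[of p]] by simp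
  from has_derivative_diff[OF has_derivative_const[of c] has_derivative_inner[OF this this]]
  show "((\<lambda>x. c - (x - p) \<bullet> (x - p)) has_derivative (\<lambda>h. - (2 * ((x - p) \<bullet> h)))) (at x)" for x
    by (simp add: inner_commute)
  show "continuous_on UNIV (\<lambda>x. - (2 * ((x - p) \<bullet> h)))" for h
    by (intro continuous_intros)
qed

text \<open>A partition-of-unity quotient of two \<open>C^1\<close> functions of \<open>r2\<^sup>2 - |x - p|\<^sup>2\<close>.\<close>

lemma radial_cutoff_exists:
  fixes p :: "'a::euclidean_space"
  assumes "0 < r1" "r1 < r2"
  obtains \<zeta> \<zeta>' where "C1_on UNIV \<zeta> \<zeta>'" "\<And>x. 0 \<le> \<zeta> x \<and> \<zeta> x \<le> (1::real)"
    "\<And>x. dist p x \<le> r1 \<Longrightarrow> \<zeta> x = 1" "\<And>x. dist p x \<ge> r2 \<Longrightarrow> \<zeta> x = 0"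
proof -
  define P where "P = (\<lambda>t::real. (max 0 t)\<^sup>2)"
  define A where "A = r2\<^sup>2 - r1\<^sup>2"
  have A: "A > 0" using assms by (simp add: A_def power_strict_mono)
  define \<sigma> where "\<sigma> = (\<lambda>t. P t / (P t + P (A - t)))"
  have den: "P t + P (A - t) > 0" for t
  proof (cases "t > 0")
    case True
    then show ?thesis by (auto intro!: add_pos_nonneg simp: P_def)
  next
    case False
    then show ?thesis using A by (auto intro!: add_nonneg_pos simp: P_def)
  qed
  have dP: "(P has_real_derivative 2 * max 0 t) (at t)" for t
    unfolding P_def by (rule DERIV_pos_part_power2)
  have dP2: "((\<lambda>t. P (A - t)) has_real_derivative - (2 * max 0 (A - t))) (at t)" for t
    using DERIV_chain2[where f=P and g="\<lambda>t. A - t", OF dP DERIV_diff[OF DERIV_const DERIV_ident]] by simp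
  define \<sigma>' where "\<sigma>' = (\<lambda>t. (2 * max 0 t * (P t + P (A - t)) - P t * (2 * max 0 t + - (2 * max 0 (A - t))))
       / ((P t + P (A - t)) * (P t + P (A - t))))"
  have d: "(\<sigma> has_real_derivative \<sigma>' t) (at t)" for t
    unfolding \<sigma>_def \<sigma>'_def using den[of t]
    by (intro DERIV_divide[OF dP DERIV_add[OF dP dP2]]) auto
  have c: "continuous_on UNIV \<sigma>'"
  proof -
    have "continuous_on UNIV P" "continuous_on UNIV (\<lambda>t. P (A - t))"
      unfolding P_def by (intro continuous_intros)+
    moreover have "(P t + P (A - t)) * (P t + P (A - t)) \<noteq> 0" for t using den[of t] by simp
    ultimately show ?thesis
      unfolding \<sigma>'_def by (intro continuous_on_divide continuous_intros) auto
  qed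
  define q where "q = (\<lambda>x. r2\<^sup>2 - (x - p) \<bullet> (x - p))"
  have q: "C1_on UNIV q (\<lambda>x h. - (2 * ((x - p) \<bullet> h)))"
    unfolding q_def by (rule C1_on_radial_quadratic)
  have qd: "q x = r2\<^sup>2 - (dist p x)\<^sup>2" for x
    by (simp add: q_def dist_norm power2_norm_eq_inner inner_diff_left inner_diff_right inner_commute)
  have 1: "C1_on UNIV (\<lambda>x. \<sigma> (q x)) (\<lambda>x h. - (2 * ((x - p) \<bullet> h)) * \<sigma>' (q x))"
    using C1_on_real_compose[where T=UNIV and \<sigma>=\<sigma> and \<sigma>'=\<sigma>', OF q _ d c] by simp
  have 2: "0 \<le> \<sigma> (q x) \<and> \<sigma> (q x) \<le> 1" for x
  proof -
    have "P (q x) \<ge> 0" "P (A - q x) \<ge> 0" by (simp_all add: P_def)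
    then show ?thesis using den[of "q x"] unfolding \<sigma>_def by simp
  qed
  have 3: "\<sigma> (q x) = 1" if "dist p x \<le> r1" for x
  proof -
    have "(dist p x)\<^sup>2 \<le> r1\<^sup>2" using that by (simp add: power_mono)
    then have "P (A - q x) = 0" by (simp add: qd A_def P_def)
    then show ?thesis using den[of "q x"] by (simp add: \<sigma>_def)
  qed
  have 4: "\<sigma> (q x) = 0" if "dist p x \<ge> r2" for x
  proof -
    have "(dist p x)\<^sup>2 \<ge> r2\<^sup>2" using that assms by (simp add: power_mono)
    then show ?thesis by (simp add: qd P_def \<sigma>_def)
  qed
  show thesis
    by (rule that[of "\<lambda>x. \<sigma> (q x)" "\<lambda>x h. - (2 * ((x - p) \<bullet> h)) * \<sigma>' (q x)"])
      (use 1 2 3 4 in auto)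
qed

section \<open>Stationarity of perimeter minimizers\<close>

text \<open>\<open>|n|\<^sup>3\<close> times the divergence of \<open>n / |n|\<close>: the mean curvature of the level sets of a function
with gradient \<open>n\<close> and Hessian \<open>n'\<close>, cleared of denominators.\<close>

definition curvature_num :: "('a::euclidean_space \<Rightarrow> 'a) \<Rightarrow> ('a \<Rightarrow> 'a \<Rightarrow> 'a) \<Rightarrow> 'a \<Rightarrow> real" where
  "curvature_num n n' x = (\<Sum>b\<in>Basis. n' x b \<bullet> b) * (n x \<bullet> n x) - (\<Sum>b\<in>Basis. (n x \<bullet> b) * (n x \<bullet> n' x b))"

lemma C1_on_normalize:
  fixes n :: "'a::euclidean_space \<Rightarrow> 'a"
  assumes n: "C1_on W n n'" and nz: "\<And>x. x \<in> W \<Longrightarrow> n x \<noteq> 0"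
  obtains N' where "C1_on W (\<lambda>x. n x /\<^sub>R norm (n x)) N'"
    "\<And>x. x \<in> W \<Longrightarrow> divergence (\<lambda>x. n x /\<^sub>R norm (n x)) x = curvature_num n n' x / norm (n x) ^ 3"
proof -
  define \<sigma> where "\<sigma> = (\<lambda>t. inverse (sqrt t))"
  define \<sigma>' where "\<sigma>' = (\<lambda>t. - inverse (2 * sqrt t ^ 3))"
  have d: "(\<sigma> has_real_derivative \<sigma>' t) (at t)" if "t \<in> {0<..}" for t
  proof -
    have t: "t > 0" using that by simp
    have "(\<sigma> has_real_derivative - (inverse (sqrt t) * (inverse (sqrt t) / 2) * inverse (sqrt t))) (at t)"
      unfolding \<sigma>_def using t by (intro DERIV_inverse' DERIV_real_sqrt) auto
    then show ?thesis by (simp only: \<sigma>'_def power3_eq_cube) (simp only: divide_inverse inverse_mult_distrib mult.assoc mult.left_commute[of _ "inverse 2"])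
  qed
  have c: "continuous_on {0<..} \<sigma>'"
    unfolding \<sigma>'_def by (intro continuous_intros) auto
  have nn: "C1_on W (\<lambda>x. n x \<bullet> n x) (\<lambda>x h. n x \<bullet> n' x h + n' x h \<bullet> n x)"
    by (rule C1_on_inner[OF n n])
  have s: "C1_on W (\<lambda>x. \<sigma> (n x \<bullet> n x)) (\<lambda>x h. (n x \<bullet> n' x h + n' x h \<bullet> n x) * \<sigma>' (n x \<bullet> n x))"
    using nz by (intro C1_on_real_compose[where T="{0<..}", OF nn _ d c]) auto
  have e: "\<sigma> (n x \<bullet> n x) *\<^sub>R n x = n x /\<^sub>R norm (n x)" for x
    by (simp add: \<sigma>_def norm_eq_sqrt_inner)
  have 1: "\<exists>N'. C1_on W (\<lambda>x. n x /\<^sub>R norm (n x)) N'"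
    using C1_on_scaleR[OF s n] unfolding e by blast
  have 2: "divergence (\<lambda>x. n x /\<^sub>R norm (n x)) x = curvature_num n n' x / norm (n x) ^ 3" if x: "x \<in> W" for x
  proof -
    have "divergence (\<lambda>x. n x /\<^sub>R norm (n x)) x = \<sigma> (n x \<bullet> n x) * divergence n x
       + (\<Sum>b\<in>Basis. (n x \<bullet> n' x b + n' x b \<bullet> n x) * \<sigma>' (n x \<bullet> n x) * (n x \<bullet> b))"
      using divergence_scaleR[OF C1_onD(1)[OF s x] C1_onD(1)[OF n x]] unfolding e .
    also have "(\<Sum>b\<in>Basis. (n x \<bullet> n' x b + n' x b \<bullet> n x) * \<sigma>' (n x \<bullet> n x) * (n x \<bullet> b))
       = 2 * \<sigma>' (n x \<bullet> n x) * (\<Sum>b\<in>Basis. (n x \<bullet> b) * (n x \<bullet> n' x b))"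
      unfolding sum_distrib_left by (rule sum.cong) (auto simp: inner_commute)
    also have "\<sigma> (n x \<bullet> n x) = inverse (norm (n x))" by (simp add: \<sigma>_def norm_eq_sqrt_inner)
    also have "\<sigma>' (n x \<bullet> n x) = - inverse (2 * norm (n x) ^ 3)" by (simp add: \<sigma>'_def norm_eq_sqrt_inner)
    also have "divergence n x = (\<Sum>b\<in>Basis. n' x b \<bullet> b)" by (rule divergence_eq[OF C1_onD(1)[OF n x]])
    finally have *: "divergence (\<lambda>x. n x /\<^sub>R norm (n x)) x = inverse (norm (n x)) * (\<Sum>b\<in>Basis. n' x b \<bullet> b)
       + 2 * - inverse (2 * norm (n x) ^ 3) * (\<Sum>b\<in>Basis. (n x \<bullet> b) * (n x \<bullet> n' x b))" .
    have p: "norm (n x) > 0" using nz[OF x] by simp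
    have ni: "n x \<bullet> n x = norm (n x) ^ 2" by (rule power2_norm_eq_inner[symmetric])
    show ?thesis unfolding * curvature_num_def ni using p
      by (simp add: field_simps power3_eq_cube power2_eq_square)
  qed
  from 1 obtain N' where "C1_on W (\<lambda>x. n x /\<^sub>R norm (n x)) N'" by blast
  then show thesis by (rule that) (rule 2)
qed

lemma lebesgue_integral_ae_sublevel:
  fixes D :: "'a::euclidean_space \<Rightarrow> real"
  assumes A: "A \<in> sets lebesgue" and U: "open U" and \<phi>: "continuous_on U \<phi>"
    and ae: "negligible (U \<inter> ((A - {x. \<phi> x < 0}) \<union> ({x. \<phi> x < (0::real)} - A)))"
    and D: "continuous_on UNIV D" and z: "\<And>x. x \<notin> U \<Longrightarrow> D x = 0"
  shows "set_lebesgue_integral lebesgue A D = (\<integral>x. indicator {x\<in>U. \<phi> x < 0} x * D x \<partial>lborel)"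
proof -
  let ?B = "{x\<in>U. \<phi> x < 0}"
  have "open ?B"
    using continuous_open_preimage[OF \<phi> U, of "{..<0}"] by (simp add: vimage_def Int_def conj_commute)
  then have B: "?B \<in> sets borel" by simp
  have Dm: "D \<in> borel_measurable borel" using D by (rule borel_measurable_continuous_onI)
  have m1: "(\<lambda>x. indicator ?B x * D x) \<in> borel_measurable lborel"
    using B Dm by (auto intro!: borel_measurable_times)
  have DL: "D \<in> borel_measurable lebesgue"
    using Dm by (simp add: measurable_completion)
  have "set_lebesgue_integral lebesgue A D = (\<integral>x. indicator ?B x * D x \<partial>lebesgue)"
    unfolding set_lebesgue_integral_def
  proof (rule integral_cong_AE)
    show "(\<lambda>x. indicator A x *\<^sub>R D x) \<in> borel_measurable lebesgue"
      using A DL by (auto intro!: borel_measurable_times)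
    show "(\<lambda>x. indicator ?B x * D x) \<in> borel_measurable lebesgue"
      using m1 by (simp add: measurable_completion)
    have "AE x in lebesgue. x \<notin> U \<inter> ((A - {x. \<phi> x < 0}) \<union> ({x. \<phi> x < 0} - A))"
      using ae by (intro AE_not_in) (simp add: negligible_iff_null_sets)
    then show "AE x in lebesgue. indicator A x *\<^sub>R D x = indicator ?B x * D x"
      by (rule AE_mp) (intro AE_I2, use z in \<open>auto simp: indicator_def\<close>)
  qed
  also have "\<dots> = (\<integral>x. indicator ?B x * D x \<partial>lborel)"
    by (rule integral_completion[OF m1])
  finally show ?thesis .
qed

text \<open>Leaves room between the support of a test field and the sphere for a cutoff function.\<close>

lemma compact_subset_ball_shrink:
  fixes p :: "'a::metric_space"
  assumes "compact K" "K \<subseteq> ball p \<rho>" "R < \<rho>"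
  obtains r where "R < r" "r < \<rho>" "K \<subseteq> cball p r"
proof (cases "K = {}")
  case True
  then show ?thesis using that[of "(R + \<rho>) / 2"] assms(3) by auto
next
  case False
  have "continuous_on K (dist p)" by (intro continuous_intros)
  then obtain x where x: "x \<in> K" "\<And>y. y \<in> K \<Longrightarrow> dist p y \<le> dist p x"
    using continuous_attains_sup[OF assms(1) False] by blast
  then have "dist p x < \<rho>" using assms(2) by auto
  moreover have "K \<subseteq> cball p (max ((R + \<rho>) / 2) (dist p x))"
    using x(2) by (auto simp: le_max_iff_disj)
  ultimately show ?thesis using that[of "max ((R + \<rho>) / 2) (dist p x)"] assms(3)
    by (simp add: less_max_iff_disj)
qed

lemma zero_in_test_fields: "(\<lambda>_. 0) \<in> test_fields U"
proof -
  have "Ck_on 1 UNIV (\<lambda>_. 0 :: 'a)" by (rule C1_on_imp_Ck_on[OF C1_on_const])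
  then show ?thesis unfolding test_fields_def by (auto intro!: exI[of _ "{}"])
qed

lemma perimeter_nonneg: "0 \<le> perimeter E U"
proof -
  have "divergence (\<lambda>_. 0 :: 'a) = (\<lambda>_. 0)"
    using divergence_eq[OF has_derivative_const[of "0::'a"]] by auto
  then have "ereal (set_lebesgue_integral lebesgue E (divergence (\<lambda>_. 0))) = 0"
    by (simp add: set_lebesgue_integral_def)
  then show ?thesis unfolding perimeter_def using SUP_upper[OF zero_in_test_fields] by metis
qed

text \<open>A calibration argument. Here \<open>E\<close> is \<open>{g < 0}\<close> in the ball, the competitor is \<open>{h < 0}\<close>, and
\<open>N = n / |n|\<close> is the unit normal of the competitor. For a test field \<open>Y\<close>, the field \<open>\<zeta> N - Y\<close>
points outward along the boundary of \<open>{h < 0}\<close> because \<open>|Y| \<le> 1\<close>, so the integral of \<open>div Y\<close> over the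
competitor is at most that of \<open>div (\<zeta> N)\<close>. Passing from \<open>{h < 0}\<close> to \<open>{g < 0}\<close> increases the latter by
the integral of the sign condition, which is positive on \<open>Q\<close>. As \<open>\<zeta> N\<close> is a test field, the
perimeter of the competitor is strictly smaller than that of \<open>E\<close>, which is absurd.\<close>

lemma no_calibrated_competitor:
  fixes E :: "'a::euclidean_space set" and g h :: "'a \<Rightarrow> real"
  assumes E: "perimeter_minimizing E" and R: "0 < R" "R < \<rho>"
    and g: "continuous_on (ball p \<rho>) g"
    and h: "C1_on (ball p \<rho>) h (\<lambda>x v. n x \<bullet> v)" and n: "C1_on (ball p \<rho>) n n'"
    and nz: "\<And>x. x \<in> ball p \<rho> \<Longrightarrow> n x \<noteq> 0"
    and gh: "\<And>x. x \<notin> ball p R \<Longrightarrow> g x = h x"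
    and ae: "negligible (ball p \<rho> \<inter> ((E - {x. g x < 0}) \<union> ({x. g x < 0} - E)))"
    and sign: "\<And>x. x \<in> ball p R \<Longrightarrow>
       (indicator {x. g x < 0} x - indicator {x. h x < 0} x) * divergence (\<lambda>x. n x /\<^sub>R norm (n x)) x \<ge> (0::real)"
    and Q: "open Q" "Q \<noteq> {}" "Q \<subseteq> ball p R" "\<And>x. x \<in> Q \<Longrightarrow>
       (indicator {x. g x < 0} x - indicator {x. h x < 0} x) * divergence (\<lambda>x. n x /\<^sub>R norm (n x)) x > (0::real)"
  shows False
proof -
  let ?U = "ball p \<rho>"
  define N where "N = (\<lambda>x. n x /\<^sub>R norm (n x))"
  define F where "F = (E - cball p R) \<union> {x \<in> cball p R. h x < 0}"
  have Em: "E \<in> sets lebesgue" using E by (simp add: perimeter_minimizing_def)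
  have hc: "continuous_on ?U h" by (rule C1_on_continuous[OF h])
  have ch: "continuous_on (cball p R) h" by (rule continuous_on_subset[OF hc]) (use R in auto)
  have openg: "open {x\<in>?U. g x < 0}" and openh: "open {x\<in>?U. h x < 0}"
    using continuous_open_preimage[OF g open_ball, of "{..<0}"] continuous_open_preimage[OF hc open_ball, of "{..<0}"]
    by (simp_all add: vimage_def Int_def conj_commute)
  have Fm: "F \<in> sets lebesgue"
  proof -
    have "{x \<in> cball p R. h x < 0} = cball p R \<inter> {x\<in>?U. h x < 0}" using R by auto
    moreover have "\<dots> \<in> sets borel" using openh by (intro sets.Int) auto
    ultimately have "{x \<in> cball p R. h x < 0} \<in> sets lebesgue" by simp
    moreover have "E - cball p R \<in> sets lebesgue" using Em by auto
    ultimately show ?thesis unfolding F_def by (rule sets.Un[rotated])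
  qed
  have fin: "perimeter E ?U < \<infinity>" and min: "perimeter E ?U \<le> perimeter F ?U"
  proof -
    have "cball p R \<subseteq> ?U" using R by auto
    moreover have "(E - F) \<union> (F - E) \<subseteq> cball p R" by (auto simp: F_def)
    ultimately show "perimeter E ?U < \<infinity>" "perimeter E ?U \<le> perimeter F ?U"
      using E Fm unfolding perimeter_minimizing_def
      by (meson open_ball bounded_ball compact_cball)+
  qed
  have aeF: "negligible (?U \<inter> ((F - {x. h x < 0}) \<union> ({x. h x < 0} - F)))"
  proof (rule negligible_subset[OF ae], rule subsetI)
    fix x assume x: "x \<in> ?U \<inter> ((F - {x. h x < 0}) \<union> ({x. h x < 0} - F))"
    show "x \<in> ?U \<inter> ((E - {x. g x < 0}) \<union> ({x. g x < 0} - E))"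
    proof (cases "x \<in> cball p R")
      case False
      then have "g x = h x" using gh[of x] by simp
      then show ?thesis using x False by (simp add: F_def)
    qed (use x in \<open>simp add: F_def\<close>)
  qed
  obtain N' where N': "C1_on ?U N N'"
    using C1_on_normalize[OF n nz] unfolding N_def by metis
  have N1: "norm (N x) = 1" if "x \<in> ?U" for x using nz[OF that] by (simp add: N_def)
  have nN: "n x \<bullet> N x = norm (n x)" for x
    by (cases "n x = 0") (simp_all add: N_def power2_norm_eq_inner[symmetric] power2_eq_square)
  \<comment> \<open>the density of the amount by which the perimeter drops\<close>
  define d where "d = (\<lambda>x. indicator (ball p R) x * ((indicator {x\<in>?U. g x < 0} x - indicator {x\<in>?U. h x < 0} x) * divergence N x) :: real)"
  have d0: "d x \<ge> 0" for x
  proof (cases "x \<in> ball p R")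
    case True
    then show ?thesis using sign[OF True] R by (simp add: d_def N_def indicator_def)
  qed (simp add: d_def)
  have dQ: "d x > 0" if "x \<in> Q" for x
  proof -
    have "x \<in> ball p R" using that Q(3) by blast
    then show ?thesis using Q(4)[OF that] R by (simp add: d_def N_def indicator_def)
  qed
  have divN: "continuous_on ?U (divergence N)" by (rule C1_on_continuous_divergence[OF N'])
  have d_int: "integrable lborel d"
  proof -
    have "compact (cball p R)" by simp
    moreover have "continuous_on (cball p R) (divergence N)"
      by (rule continuous_on_subset[OF divN]) (use R in auto)
    ultimately have i: "integrable lborel (\<lambda>x. indicator (cball p R) x *\<^sub>R divergence N x)"
      by (rule borel_integrable_compact)
    have m: "(\<lambda>x. indicator (ball p R) x * (indicator {x\<in>?U. g x < 0} x - indicator {x\<in>?U. h x < 0} x) :: real) \<in> borel_measurable lborel"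
      using openg openh by (intro borel_measurable_times borel_measurable_diff borel_measurable_indicator) auto
    have "integrable lborel (\<lambda>x. (indicator (ball p R) x * (indicator {x\<in>?U. g x < 0} x - indicator {x\<in>?U. h x < 0} x)) *
         (indicator (cball p R) x *\<^sub>R divergence N x))"
      by (rule Bochner_Integration.integrable_bound[OF i])
        (use borel_measurable_times[OF m borel_measurable_integrable[OF i]] in \<open>simp, simp add: indicator_def\<close>)
    moreover have "(\<lambda>x. (indicator (ball p R) x * (indicator {x\<in>?U. g x < 0} x - indicator {x\<in>?U. h x < 0} x)) *
         (indicator (cball p R) x *\<^sub>R divergence N x)) = d"
      by (rule ext) (auto simp: d_def indicator_def)
    ultimately show ?thesis by simp
  qed
  define \<delta> where "\<delta> = (\<integral>x. d x \<partial>lborel)"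
  have "\<delta> > 0"
  proof (rule ccontr)
    assume "\<not> \<delta> > 0"
    moreover have "0 \<le> \<delta>"
      unfolding \<delta>_def by (rule Bochner_Integration.integral_nonneg) (rule d0)
    ultimately have "\<delta> = 0" by simp
    then have "AE x in lborel. d x = 0"
      using integral_nonneg_eq_0_iff_AE[OF d_int AE_I2[OF d0]] by (simp add: \<delta>_def)
    then have "AE x in lborel. x \<notin> Q" by (rule AE_mp) (intro AE_I2 impI, use dQ in force)
    then have "Q \<in> null_sets lborel" using AE_iff_null_sets[of Q lborel] Q(1) by simp
    then have "negligible Q" by (simp add: negligible_iff_null_sets null_sets_completionI)
    then show False using open_not_negligible[OF Q(1,2)] by blast
  qed
  have main: "set_lebesgue_integral lebesgue F (divergence Y) + \<delta> \<le> perimeter E ?U"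
    if Y: "Y \<in> test_fields ?U" for Y
  proof -
    obtain K where Y1: "Ck_on 1 UNIV Y" and Yn: "\<And>x. norm (Y x) \<le> 1" and K: "compact K" "K \<subseteq> ?U"
      and Y0: "\<And>x. x \<notin> K \<Longrightarrow> Y x = 0"
      using Y unfolding test_fields_def by auto
    have Yc: "C1_on UNIV Y (\<lambda>x. frechet_derivative Y (at x))" using Y1 by (simp add: C1_on_iff_Ck_on)
    obtain r where r: "R < r" "r < \<rho>" "K \<subseteq> cball p r"
      using compact_subset_ball_shrink[OF K R(2)] by blast
    obtain \<zeta> \<zeta>' where \<zeta>: "C1_on UNIV \<zeta> \<zeta>'" "\<And>x. 0 \<le> \<zeta> x \<and> \<zeta> x \<le> (1::real)"
      "\<And>x. dist p x \<le> r \<Longrightarrow> \<zeta> x = 1" "\<And>x. dist p x \<ge> (r + \<rho>) / 2 \<Longrightarrow> \<zeta> x = 0"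
      using radial_cutoff_exists[of r "(r + \<rho>) / 2" p] R r by auto
    let ?K = "cball p ((r + \<rho>) / 2)"
    have K': "?K \<subseteq> ?U" "K \<subseteq> ?K" "cball p r \<subseteq> ?K" using r by auto
    define Z where "Z = (\<lambda>x. if x \<in> ?U then \<zeta> x *\<^sub>R N x else 0)"
    have Z0: "Z x = 0" if "x \<notin> ?K" for x using that \<zeta>(4)[of x] by (auto simp: Z_def)
    have \<zeta>N: "C1_on ?U (\<lambda>x. \<zeta> x *\<^sub>R N x) (\<lambda>x v. \<zeta> x *\<^sub>R N' x v + \<zeta>' x v *\<^sub>R N x)"
      by (rule C1_on_scaleR[OF C1_on_subset[OF \<zeta>(1)] N']) simp
    have "\<exists>Z'. C1_on UNIV Z Z'"
      unfolding Z_def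
      by (rule exI, rule C1_on_extend_by_zero[OF \<zeta>N open_ball closed_cball K'(1)]) (use \<zeta>(4) in auto)
    then obtain Z' where Z': "C1_on UNIV Z Z'" by blast
    have Zt: "Z \<in> test_fields ?U"
    proof -
      have "norm (Z x) \<le> 1" for x using \<zeta>(2)[of x] N1[of x] by (auto simp: Z_def)
      moreover have "compact ?K" by simp
      ultimately show ?thesis unfolding test_fields_def using C1_on_imp_Ck_on[OF Z'] Z0 K'(1) by blast
    qed
    have divZ: "continuous_on UNIV (divergence Z)" "continuous_on UNIV (divergence Y)"
      by (rule C1_on_continuous_divergence[OF Z'], rule C1_on_continuous_divergence[OF Yc])
    have div0: "divergence X x = 0" if "closed C" "x \<notin> C" "\<And>y. y \<notin> C \<Longrightarrow> X y = 0" for X :: "'a \<Rightarrow> 'a" and x C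
    proof -
      have "divergence X x = divergence (\<lambda>_. 0) x"
        by (rule divergence_cong[of "- C"]) (use that in auto)
      then show ?thesis using divergence_eq[OF has_derivative_const[of "0::'a" "at x"]] by simp
    qed
    have dZ0: "divergence Z x = 0" if "x \<notin> ?K" for x
      by (rule div0[of ?K]) (use that Z0 in auto)
    have dY0: "divergence Y x = 0" if "x \<notin> K" for x
      by (rule div0[of K]) (use that Y0 K compact_imp_closed in auto)
    have iF: "set_lebesgue_integral lebesgue F (divergence Y) = (\<integral>x. indicator {x\<in>?U. h x < 0} x * divergence Y x \<partial>lborel)"
      by (rule lebesgue_integral_ae_sublevel[OF Fm open_ball hc aeF divZ(2)]) (use dY0 K(2) in blast)
    have iE: "set_lebesgue_integral lebesgue E (divergence Z) = (\<integral>x. indicator {x\<in>?U. g x < 0} x * divergence Z x \<partial>lborel)"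
      by (rule lebesgue_integral_ae_sublevel[OF Em open_ball g ae divZ(1)]) (use dZ0 K'(1) in blast)
    have ind_int: "integrable lborel (\<lambda>x. indicator A x * f x)"
      if "open A" "continuous_on UNIV f" "compact C" "\<And>x. x \<notin> C \<Longrightarrow> f x = 0" for A C and f :: "'a \<Rightarrow> real"
    proof -
      have i: "integrable lborel f" by (rule integrable_continuous_compact_support[OF that(2-4)])
      show ?thesis
        by (rule Bochner_Integration.integrable_bound[OF i])
          (use that(1) borel_measurable_integrable[OF i] in
            \<open>simp add: borel_measurable_times borel_measurable_indicator, simp add: indicator_def\<close>)
    qed
    have ints: "integrable lborel (\<lambda>x. indicator {x\<in>?U. h x < 0} x * divergence Y x)"
      "integrable lborel (\<lambda>x. indicator {x\<in>?U. h x < 0} x * divergence Z x)"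
      "integrable lborel (\<lambda>x. indicator {x\<in>?U. g x < 0} x * divergence Z x)"
      by (rule ind_int[OF openh divZ(2) K(1) dY0], assumption)
        (rule ind_int[OF openh divZ(1) compact_cball dZ0], assumption,
          rule ind_int[OF openg divZ(1) compact_cball dZ0], assumption)
    have V: "C1_on ?U (\<lambda>x. Z x - Y x) (\<lambda>x v. Z' x v - frechet_derivative Y (at x) v)"
      by (rule C1_on_diff[OF C1_on_subset[OF Z'] C1_on_subset[OF Yc]]) auto
    have "0 \<le> (\<integral>x. indicator {x\<in>?U. h x < 0} x * divergence (\<lambda>x. Z x - Y x) x \<partial>lborel)"
    proof (rule integral_divergence_sublevel_nonneg[OF h V open_ball _ K'(1)])
      show "compact ?K" by simp
      show "Z x - Y x = 0" if "x \<in> ?U - ?K" for x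
      proof -
        have "x \<notin> ?K" using that by blast
        moreover have "x \<notin> K" using calculation K'(2) by blast
        ultimately show ?thesis using Z0 Y0 by simp
      qed
      show "n x \<bullet> (Z x - Y x) \<ge> 0" if x: "x \<in> ?U" for x
      proof -
        have "n x \<bullet> Z x = \<zeta> x * norm (n x)" using x nN[of x] by (simp add: Z_def)
        moreover have "n x \<bullet> Y x \<le> \<zeta> x * norm (n x)"
        proof (cases "x \<in> K")
          case True
          then have "\<zeta> x = 1" using \<zeta>(3)[of x] r by auto
          moreover have "n x \<bullet> Y x \<le> norm (n x) * norm (Y x)" by (rule norm_cauchy_schwarz)
          moreover have "\<dots> \<le> norm (n x) * 1" by (rule mult_left_mono[OF Yn]) simp
          ultimately show ?thesis by simp
        qed (use \<zeta>(2)[of x] Y0 in auto)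
        ultimately show ?thesis by (simp add: inner_diff_right)
      qed
    qed
    moreover have "divergence (\<lambda>x. Z x - Y x) x = divergence Z x - divergence Y x" for x
      using divergence_eq[OF has_derivative_diff[OF C1_onD(1)[OF Z'] C1_onD(1)[OF Yc]]]
        divergence_eq[OF C1_onD(1)[OF Z']] divergence_eq[OF C1_onD(1)[OF Yc]]
      by (simp add: inner_diff_left sum_subtractf)
    ultimately have 1: "(\<integral>x. indicator {x\<in>?U. h x < 0} x * divergence Y x \<partial>lborel)
        \<le> (\<integral>x. indicator {x\<in>?U. h x < 0} x * divergence Z x \<partial>lborel)"
      using ints by (simp add: right_diff_distrib)
    have "indicator {x\<in>?U. g x < 0} x * divergence Z x - indicator {x\<in>?U. h x < 0} x * divergence Z x = d x" for x
    proof (cases "x \<in> ball p R")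
      case True
      have "divergence Z x = divergence N x"
        by (rule divergence_cong[of "ball p R"]) (use True \<zeta>(3) r R in \<open>auto simp: Z_def\<close>)
      then show ?thesis using True by (simp add: d_def left_diff_distrib)
    qed (use gh[of x] in \<open>auto simp: d_def indicator_def\<close>)
    then have "(\<integral>x. indicator {x\<in>?U. g x < 0} x * divergence Z x \<partial>lborel)
        - (\<integral>x. indicator {x\<in>?U. h x < 0} x * divergence Z x \<partial>lborel) = \<delta>"
      using Bochner_Integration.integral_diff[OF ints(3,2)] by (simp add: \<delta>_def)
    with 1 have "set_lebesgue_integral lebesgue F (divergence Y) + \<delta> \<le> set_lebesgue_integral lebesgue E (divergence Z)"
      unfolding iF iE by linarith
    moreover have "ereal (set_lebesgue_integral lebesgue E (divergence Z)) \<le> perimeter E ?U"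
      unfolding perimeter_def by (rule SUP_upper[OF Zt])
    ultimately show ?thesis by (meson ereal_less_eq(3) order_trans)
  qed
  obtain P where P: "perimeter E ?U = ereal P"
    using fin perimeter_nonneg[of E ?U] by (cases "perimeter E ?U") auto
  have "perimeter F ?U \<le> ereal (P - \<delta>)"
    unfolding perimeter_def using main P by (intro SUP_least) (simp add: algebra_simps)
  with min P have "ereal P \<le> ereal (P - \<delta>)" by (metis order_trans)
  with \<open>\<delta> > 0\<close> show False by simp
qed

text \<open>The cube makes the gradient of the bump itself \<open>C^1\<close>, so that the perturbed defining function has
a continuous Hessian.\<close>

lemma C1_on_bump:
  fixes p :: "'a::euclidean_space" and R :: real
  defines "q \<equiv> \<lambda>x. R\<^sup>2 - (x - p) \<bullet> (x - p)"
  shows "C1_on UNIV (\<lambda>x. (max 0 (q x))^3) (\<lambda>x h. (- 6 * (max 0 (q x))\<^sup>2) *\<^sub>R (x - p) \<bullet> h)"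
    "C1_on UNIV (\<lambda>x. (- 6 * (max 0 (q x))\<^sup>2) *\<^sub>R (x - p))
       (\<lambda>x h. (- 6 * (max 0 (q x))\<^sup>2) *\<^sub>R h + (24 * max 0 (q x) * ((x - p) \<bullet> h)) *\<^sub>R (x - p))"
proof -
  have q: "C1_on UNIV q (\<lambda>x h. - (2 * ((x - p) \<bullet> h)))"
    unfolding q_def by (rule C1_on_radial_quadratic)
  have c: "continuous_on UNIV (\<lambda>t::real. 3 * (max 0 t)\<^sup>2)" "continuous_on UNIV (\<lambda>t::real. 2 * max 0 t)"
    by (intro continuous_intros)+
  have "C1_on UNIV (\<lambda>x. (max 0 (q x))^3) (\<lambda>x h. - (2 * ((x - p) \<bullet> h)) * (3 * (max 0 (q x))\<^sup>2))"
    using C1_on_real_compose[where T=UNIV and \<sigma>="\<lambda>t. (max 0 t)^3" and \<sigma>'="\<lambda>t. 3 * (max 0 t)\<^sup>2",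
      OF q _ DERIV_pos_part_power3 c(1)] by simp
  moreover have "(\<lambda>x h. - (2 * ((x - p) \<bullet> h)) * (3 * (max 0 (q x))\<^sup>2)) = (\<lambda>x h. (- 6 * (max 0 (q x))\<^sup>2) *\<^sub>R (x - p) \<bullet> h)"
    by (intro ext) simp
  ultimately show "C1_on UNIV (\<lambda>x. (max 0 (q x))^3) (\<lambda>x h. (- 6 * (max 0 (q x))\<^sup>2) *\<^sub>R (x - p) \<bullet> h)"
    by simp
  have m: "C1_on UNIV (\<lambda>x. (max 0 (q x))\<^sup>2) (\<lambda>x h. - (2 * ((x - p) \<bullet> h)) * (2 * max 0 (q x)))"
    using C1_on_real_compose[where T=UNIV and \<sigma>="\<lambda>t. (max 0 t)\<^sup>2" and \<sigma>'="\<lambda>t. 2 * max 0 t",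
      OF q _ DERIV_pos_part_power2 c(2)] by simp
  have i: "C1_on UNIV (\<lambda>x. x - p) (\<lambda>x h. h)"
    using C1_on_diff[of UNIV "\<lambda>x. x" "\<lambda>x h. h", OF _ C1_on_const[of UNIV p]]
    by (simp add: C1_on_def has_derivative_ident)
  from C1_on_scaleR[OF C1_on_mult[OF C1_on_const[of UNIV "- 6 :: real"] m] i]
  have "C1_on UNIV (\<lambda>x. (- 6 * (max 0 (q x))\<^sup>2) *\<^sub>R (x - p)) (\<lambda>x h. (- 6 * (max 0 (q x))\<^sup>2) *\<^sub>R h
     + (- 6 * (- (2 * ((x - p) \<bullet> h)) * (2 * max 0 (q x))) + 0 * (max 0 (q x))\<^sup>2) *\<^sub>R (x - p))" .
  moreover have "(\<lambda>x h. (- 6 * (max 0 (q x))\<^sup>2) *\<^sub>R h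
     + (- 6 * (- (2 * ((x - p) \<bullet> h)) * (2 * max 0 (q x))) + 0 * (max 0 (q x))\<^sup>2) *\<^sub>R (x - p))
    = (\<lambda>x h. (- 6 * (max 0 (q x))\<^sup>2) *\<^sub>R h + (24 * max 0 (q x) * ((x - p) \<bullet> h)) *\<^sub>R (x - p))"
    by (intro ext arg_cong2[where f="(+)"] refl arg_cong2[where f="scaleR"]) simp
  ultimately show "C1_on UNIV (\<lambda>x. (- 6 * (max 0 (q x))\<^sup>2) *\<^sub>R (x - p))
       (\<lambda>x h. (- 6 * (max 0 (q x))\<^sup>2) *\<^sub>R h + (24 * max 0 (q x) * ((x - p) \<bullet> h)) *\<^sub>R (x - p))" by simp
qed

text \<open>If the curvature had sign \<open>s\<close> at \<open>p\<close>, adding \<open>s\<close> times a small bump to \<open>g\<close> would shrink the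
perimeter: the perturbation moves the boundary in the direction of its mean curvature vector.\<close>

theorem perimeter_minimizing_stationary:
  fixes E :: "'a::euclidean_space set" and g :: "'a \<Rightarrow> real"
  assumes E: "perimeter_minimizing E" and W: "open W" "p \<in> W"
    and g: "C1_on W g (\<lambda>x v. n x \<bullet> v)" and n: "C1_on W n n'"
    and gp: "g p = 0" and np: "n p \<noteq> 0"
    and ae: "negligible (W \<inter> ((E - {x. g x < 0}) \<union> ({x. g x < 0} - E)))"
  shows "curvature_num n n' p = 0"
proof (rule ccontr)
  assume nz: "curvature_num n n' p \<noteq> 0"
  define s where "s = sgn (curvature_num n n' p)"
  have s: "s = 1 \<or> s = - 1" using nz by (auto simp: s_def sgn_if)
  \<comment> \<open>the parameter \<open>R\<close> is both the radius and the amplitude of the bump, so that the perturbed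
    normal and Hessian depend continuously on \<open>(R, x)\<close> and return to those of \<open>g\<close> at \<open>R = 0\<close>\<close>
  define q where "q = (\<lambda>R x. R\<^sup>2 - (x - p) \<bullet> (x - p))"
  define \<nu> where "\<nu> = (\<lambda>R x. n x + (s * R) *\<^sub>R ((- 6 * (max 0 (q R x))\<^sup>2) *\<^sub>R (x - p)))"
  define \<nu>' where "\<nu>' = (\<lambda>R x h. n' x h + (s * R) *\<^sub>R
     ((- 6 * (max 0 (q R x))\<^sup>2) *\<^sub>R h + (24 * max 0 (q R x) * ((x - p) \<bullet> h)) *\<^sub>R (x - p)))"
  define h where "h = (\<lambda>R x. g x + s * R * (max 0 (q R x))^3)"
  have C1h: "C1_on W (h R) (\<lambda>x v. \<nu> R x \<bullet> v)" and C1\<nu>: "C1_on W (\<nu> R) (\<nu>' R)" for R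
  proof -
    have "C1_on W (\<lambda>x. s * R * (max 0 (q R x))^3)
       (\<lambda>x h. s * R * ((- 6 * (max 0 (q R x))\<^sup>2) *\<^sub>R (x - p) \<bullet> h) + 0 * (max 0 (q R x))^3)"
      unfolding q_def by (rule C1_on_mult[OF C1_on_const C1_on_subset[OF C1_on_bump(1)]]) simp
    from C1_on_add[OF g this] show "C1_on W (h R) (\<lambda>x v. \<nu> R x \<bullet> v)"
      unfolding h_def \<nu>_def by (simp only: inner_add_left inner_scaleR_left mult_zero_left add_0_right)
    have "C1_on W (\<lambda>x. (s * R) *\<^sub>R ((- 6 * (max 0 (q R x))\<^sup>2) *\<^sub>R (x - p)))
       (\<lambda>x h. (s * R) *\<^sub>R ((- 6 * (max 0 (q R x))\<^sup>2) *\<^sub>R h + (24 * max 0 (q R x) * ((x - p) \<bullet> h)) *\<^sub>R (x - p))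
         + 0 *\<^sub>R ((- 6 * (max 0 (q R x))\<^sup>2) *\<^sub>R (x - p)))"
      unfolding q_def by (rule C1_on_scaleR[OF C1_on_const C1_on_subset[OF C1_on_bump(2)]]) simp
    from C1_on_add[OF n this] show "C1_on W (\<nu> R) (\<nu>' R)"
      unfolding \<nu>_def \<nu>'_def by simp
  qed
  let ?Z = "UNIV \<times> W :: (real \<times> 'a) set"
  have oZ: "open ?Z" using W by (intro open_Times) auto
  have cn: "continuous_on ?Z (\<lambda>z. n (snd z))"
    by (rule continuous_on_compose2[OF C1_on_continuous[OF n]]) (auto intro!: continuous_intros)
  have cn': "continuous_on ?Z (\<lambda>z. n' (snd z) b)" for b
    by (rule continuous_on_compose2[OF C1_onD(2)[OF n]]) (auto intro!: continuous_intros)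
  have c\<nu>: "continuous_on ?Z (\<lambda>z. \<nu> (fst z) (snd z))"
    unfolding \<nu>_def q_def by (intro continuous_intros cn)
  have c\<nu>': "continuous_on ?Z (\<lambda>z. \<nu>' (fst z) (snd z) b)" for b
    unfolding \<nu>'_def q_def by (intro continuous_intros cn')
  have cP: "continuous_on ?Z (\<lambda>z. s * curvature_num (\<nu> (fst z)) (\<nu>' (fst z)) (snd z))"
    unfolding curvature_num_def by (intro continuous_intros c\<nu> c\<nu>')
  have cQ: "continuous_on ?Z (\<lambda>z. \<nu> (fst z) (snd z) \<bullet> \<nu> (fst z) (snd z))"
    by (intro continuous_intros c\<nu>)
  define Z where "Z = {z \<in> ?Z. s * curvature_num (\<nu> (fst z)) (\<nu>' (fst z)) (snd z) > 0 \<and>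
      \<nu> (fst z) (snd z) \<bullet> \<nu> (fst z) (snd z) > 0}"
  have "open Z"
  proof -
    have "Z = (?Z \<inter> (\<lambda>z. s * curvature_num (\<nu> (fst z)) (\<nu>' (fst z)) (snd z)) -` {0<..})
        \<inter> (?Z \<inter> (\<lambda>z. \<nu> (fst z) (snd z) \<bullet> \<nu> (fst z) (snd z)) -` {0<..})"
      by (auto simp: Z_def)
    then show ?thesis
      using continuous_open_preimage[OF cP oZ, of "{0<..}"] continuous_open_preimage[OF cQ oZ, of "{0<..}"] by auto
  qed
  moreover have "(0, p) \<in> Z"
  proof -
    have "\<nu> 0 = n" "\<nu>' 0 = n'" by (auto simp: \<nu>_def \<nu>'_def fun_eq_iff)
    then show ?thesis using W np nz by (auto simp: Z_def s_def sgn_if)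
  qed
  ultimately obtain \<epsilon> where \<epsilon>: "\<epsilon> > 0" "ball (0, p) \<epsilon> \<subseteq> Z" by (meson open_contains_ball)
  define \<rho> where "\<rho> = \<epsilon> / 2"
  define R where "R = \<rho> / 2"
  have R: "0 < R" "R < \<rho>" using \<epsilon> by (auto simp: R_def \<rho>_def)
  have inZ: "(R, x) \<in> Z" if "x \<in> ball p \<rho>" for x
  proof -
    have "dist (0, p) (R, x) \<le> dist 0 R + dist p x"
      unfolding dist_Pair_Pair by (rule sqrt_sum_squares_le_sum) auto
    also have "\<dots> < \<epsilon>" using that R by (auto simp: \<rho>_def)
    finally show ?thesis using \<epsilon> by auto
  qed
  have sub: "ball p \<rho> \<subseteq> W" using inZ by (auto simp: Z_def)
  have \<nu>0: "\<nu> R x \<noteq> 0" if "x \<in> ball p \<rho>" for x using inZ[OF that] by (auto simp: Z_def)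
  have div: "s * divergence (\<lambda>x. \<nu> R x /\<^sub>R norm (\<nu> R x)) x > 0" if x: "x \<in> ball p \<rho>" for x
  proof -
    obtain N' where "\<And>x. x \<in> ball p \<rho> \<Longrightarrow>
      divergence (\<lambda>x. \<nu> R x /\<^sub>R norm (\<nu> R x)) x = curvature_num (\<nu> R) (\<nu>' R) x / norm (\<nu> R x) ^ 3"
      using C1_on_normalize[OF C1_on_subset[OF C1\<nu> sub] \<nu>0] by metis
    then show ?thesis using inZ[OF x] \<nu>0[OF x] x by (auto simp: Z_def)
  qed
  have out: "(max 0 (q R x))^3 = 0" if "x \<notin> ball p R" for x
  proof -
    have "(dist p x)\<^sup>2 \<ge> R\<^sup>2" using that R by (simp add: power_mono)
    moreover have "(x - p) \<bullet> (x - p) = (dist p x)\<^sup>2"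
      by (simp add: dist_norm power2_norm_eq_inner inner_diff_left inner_diff_right inner_commute)
    ultimately show ?thesis by (simp add: q_def)
  qed
  have gc: "continuous_on W g" by (rule C1_on_continuous[OF g])
  have hc: "continuous_on W (h R)" by (rule C1_on_continuous[OF C1h])
  \<comment> \<open>along the normal through \<open>p\<close> the bump reverses the sign of \<open>g\<close>, which makes \<open>Q\<close> nonempty\<close>
  define Q where "Q = {x \<in> ball p R. s * g x < 0 \<and> s * h R x > 0}"
  have gh: "s * (h R x - g x) \<ge> 0" for x
  proof -
    have "s * (h R x - g x) = (s * s) * (R * (max 0 (q R x))^3)" by (simp add: h_def)
    then show ?thesis using s R by auto
  qed
  have Qo: "open Q"
  proof -
    have "ball p R \<subseteq> W" using sub R by auto
    then have "continuous_on (ball p R) (\<lambda>x. s * g x)" "continuous_on (ball p R) (\<lambda>x. s * h R x)"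
      by (intro continuous_intros continuous_on_subset[OF gc] continuous_on_subset[OF hc]; simp)+
    from continuous_open_preimage[OF this(1) open_ball, of "{..<0}"]
      continuous_open_preimage[OF this(2) open_ball, of "{0<..}"]
    have "open ((ball p R \<inter> (\<lambda>x. s * g x) -` {..<0}) \<inter> (ball p R \<inter> (\<lambda>x. s * h R x) -` {0<..}))" by auto
    moreover have "(ball p R \<inter> (\<lambda>x. s * g x) -` {..<0}) \<inter> (ball p R \<inter> (\<lambda>x. s * h R x) -` {0<..}) = Q"
      by (auto simp: Q_def)
    ultimately show ?thesis by simp
  qed
  have Qne: "Q \<noteq> {}"
  proof -
    have "((\<lambda>t. g (p + t *\<^sub>R n p)) has_derivative (\<lambda>t. n p \<bullet> (t *\<^sub>R n p))) (at 0)"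
      using has_derivative_compose[OF has_derivative_line[of p "n p" 0 UNIV], of g "\<lambda>v. n p \<bullet> v"]
        C1_onD(1)[OF g W(2)] by simp
    then have D: "((\<lambda>t. s * g (p + t *\<^sub>R n p)) has_real_derivative s * (n p \<bullet> n p)) (at 0)"
    proof -
      assume "((\<lambda>t. g (p + t *\<^sub>R n p)) has_derivative (\<lambda>t. n p \<bullet> (t *\<^sub>R n p))) (at 0)"
      from has_derivative_mult_right[OF this, of s]
      have "((\<lambda>t. s * g (p + t *\<^sub>R n p)) has_derivative (\<lambda>t. s * (n p \<bullet> (t *\<^sub>R n p)))) (at 0)" .
      moreover have "(\<lambda>t. s * (n p \<bullet> (t *\<^sub>R n p))) = (*) (s * (n p \<bullet> n p))" by (auto simp: fun_eq_iff)
      ultimately show ?thesis unfolding has_field_derivative_def by simp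
    qed
    have "\<forall>\<^sub>F t in at 0. p + t *\<^sub>R n p \<in> ball p R \<and> s * h R (p + t *\<^sub>R n p) > 0"
    proof -
      have "continuous (at p) (h R)" using hc W by (simp add: continuous_on_eq_continuous_at)
      then have "isCont (\<lambda>x. s * h R x) p" by (intro continuous_intros)
      moreover have "s * h R p > 0" using s R gp by (auto simp: h_def q_def)
      ultimately have "\<forall>\<^sub>F x in nhds p. s * h R x > 0"
        using order_tendstoD(1)[of "\<lambda>x. s * h R x" "s * h R p" "nhds p" 0]
          tendsto_at_iff_tendsto_nhds[of "\<lambda>x. s * h R x" p] by (simp add: isCont_def)
      moreover have "\<forall>\<^sub>F x in nhds p. x \<in> ball p R" using R by (intro eventually_nhds_in_open) auto
      ultimately have "\<forall>\<^sub>F x in nhds p. x \<in> ball p R \<and> s * h R x > 0" by eventually_elim auto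
      moreover have "((\<lambda>t. p + t *\<^sub>R n p) \<longlongrightarrow> p) (at 0)" by (auto intro!: tendsto_eq_intros)
      ultimately show ?thesis by (rule eventually_compose_filterlim)
    qed
    then obtain e where e: "e > 0" "\<And>t. t \<noteq> 0 \<Longrightarrow> \<bar>t\<bar> < e \<Longrightarrow> p + t *\<^sub>R n p \<in> ball p R \<and> s * h R (p + t *\<^sub>R n p) > 0"
      unfolding eventually_at by (auto simp: dist_norm)
    have "\<exists>t. \<bar>t\<bar> < e \<and> t \<noteq> 0 \<and> s * g (p + t *\<^sub>R n p) < 0"
    proof (cases "s = 1")
      case True
      then have "s * (n p \<bullet> n p) > 0" using np by simp
      from DERIV_pos_inc_left[OF D this] obtain d where d: "d > 0"
        "\<And>k. k > 0 \<Longrightarrow> k < d \<Longrightarrow> s * g (p + (0 - k) *\<^sub>R n p) < s * g (p + 0 *\<^sub>R n p)" by auto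
      have "s * g (p + (0 - min d e / 2) *\<^sub>R n p) < s * g (p + 0 *\<^sub>R n p)" using d e by (intro d(2)) auto
      then show ?thesis using gp d e by (intro exI[of _ "0 - min d e / 2"]) auto
    next
      case False
      then have "s * (n p \<bullet> n p) < 0" using np s by simp
      from DERIV_neg_dec_right[OF D this] obtain d where d: "d > 0"
        "\<And>k. k > 0 \<Longrightarrow> k < d \<Longrightarrow> s * g (p + 0 *\<^sub>R n p) > s * g (p + (0 + k) *\<^sub>R n p)" by auto
      have "s * g (p + 0 *\<^sub>R n p) > s * g (p + (0 + min d e / 2) *\<^sub>R n p)" using d e by (intro d(2)) auto
      then show ?thesis using gp d e by (intro exI[of _ "0 + min d e / 2"]) auto
    qed
    then obtain t where "\<bar>t\<bar> < e" "t \<noteq> 0" "s * g (p + t *\<^sub>R n p) < 0" by blast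
    with e(2)[of t] have "p + t *\<^sub>R n p \<in> Q" by (simp add: Q_def)
    then show ?thesis by blast
  qed
  have ind: "(indicator {x. g x < 0} x - indicator {x. h R x < 0} x :: real)
     = (if s * g x < 0 \<and> s * h R x > 0 \<or> s = 1 \<and> g x < 0 \<and> h R x = 0 \<or> s = - 1 \<and> g x = 0 \<and> h R x < 0
        \<or> s = -1 \<and> g x > 0 \<and> h R x < 0 then s else 0)" for x
    using s gh[of x] by (auto simp: indicator_def split: if_splits)
  show False
  proof (rule no_calibrated_competitor[OF E R, where g=g and h="h R" and n="\<nu> R" and n'="\<nu>' R" and p=p and Q=Q])
    show "continuous_on (ball p \<rho>) g" by (rule continuous_on_subset[OF gc sub])
    show "C1_on (ball p \<rho>) (h R) (\<lambda>x v. \<nu> R x \<bullet> v)" by (rule C1_on_subset[OF C1h sub])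
    show "C1_on (ball p \<rho>) (\<nu> R) (\<nu>' R)" by (rule C1_on_subset[OF C1\<nu> sub])
    show "\<nu> R x \<noteq> 0" if "x \<in> ball p \<rho>" for x by (rule \<nu>0[OF that])
    show "g x = h R x" if "x \<notin> ball p R" for x using out[OF that] by (simp add: h_def)
    show "negligible (ball p \<rho> \<inter> ((E - {x. g x < 0}) \<union> ({x. g x < 0} - E)))"
      by (rule negligible_subset[OF ae]) (use sub in auto)
    show "(indicator {x. g x < 0} x - indicator {x. h R x < 0} x) *
        divergence (\<lambda>x. \<nu> R x /\<^sub>R norm (\<nu> R x)) x \<ge> (0::real)" if "x \<in> ball p R" for x
      using div[of x] that R unfolding ind by auto
    show "(indicator {x. g x < 0} x - indicator {x. h R x < 0} x) *
        divergence (\<lambda>x. \<nu> R x /\<^sub>R norm (\<nu> R x)) x > (0::real)" if "x \<in> Q" for x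
      using div[of x] that R unfolding ind by (auto simp: Q_def)
  qed (use Qo Qne in \<open>auto simp: Q_def\<close>)
qed

section \<open>Area minimizing hypersurfaces lie on one side locally\<close>

lemma negligible_iff_emeasure: "S \<in> sets lebesgue \<Longrightarrow> negligible S \<longleftrightarrow> emeasure lebesgue S = 0"
  by (auto simp: negligible_iff_null_sets null_sets_def)

lemma boundary_support_iff:
  assumes "E \<in> sets lebesgue"
  shows "p \<in> boundary_support E \<longleftrightarrow> (\<forall>r>0. \<not> negligible (E \<inter> ball p r) \<and> \<not> negligible (ball p r - E))"
proof -
  have "E \<inter> ball p r \<in> sets lebesgue" "ball p r - E \<in> sets lebesgue" for r
    using assms by auto
  then show ?thesis
    unfolding boundary_support_def by (auto simp: negligible_iff_emeasure zero_less_iff_neq_zero)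
qed

lemma closed_boundary_support:
  assumes E: "E \<in> sets lebesgue" shows "closed (boundary_support E)"
proof -
  have "\<exists>e>0. ball p e \<subseteq> - boundary_support E" if pS: "p \<in> - boundary_support E" for p
  proof -
    obtain r where r: "r > 0" "negligible (E \<inter> ball p r) \<or> negligible (ball p r - E)"
      using pS unfolding Compl_iff boundary_support_iff[OF E] by blast
    have "x \<notin> boundary_support E" if "x \<in> ball p (r / 2)" for x
    proof -
      have "ball x (r / 2) \<subseteq> ball p r"
        using that by (intro subsetI) (auto simp: dist_commute intro: dist_triangle_half_r)
      then have "negligible (E \<inter> ball x (r / 2)) \<or> negligible (ball x (r / 2) - E)"
        using r(2) by (meson Int_mono Diff_mono order_refl negligible_subset)
      moreover have "r / 2 > 0" using r(1) by simp
      ultimately show ?thesis unfolding boundary_support_iff[OF E] by blast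
    qed
    moreover have "r / 2 > 0" using r(1) by simp
    ultimately show ?thesis by blast
  qed
  then have "open (- boundary_support E)" by (simp add: open_contains_ball)
  then show ?thesis by (simp add: closed_def)
qed

text \<open>The points with a neighbourhood almost outside \<open>E\<close> and those with a neighbourhood almost inside \<open>E\<close>
form two disjoint open sets, which cover the complement of the boundary support.\<close>

lemma connected_avoiding_boundary_support:
  fixes E C :: "'a::euclidean_space set"
  assumes E: "E \<in> sets lebesgue" and C: "connected C" and avoid: "C \<inter> boundary_support E = {}"
  shows "negligible (C \<inter> E) \<or> negligible (C - E)"
proof -
  define A where "A = (\<Union>{ball x r | x r. r > 0 \<and> negligible (E \<inter> ball x r)})"
  define B where "B = (\<Union>{ball x r | x r. r > 0 \<and> negligible (ball x r - E)})"
  have "A \<inter> B = {}"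
  proof (rule ccontr)
    assume "A \<inter> B \<noteq> {}"
    then obtain x r y s z where z: "z \<in> ball x r" "z \<in> ball y s" "negligible (E \<inter> ball x r)" "negligible (ball y s - E)"
      unfolding A_def B_def by blast
    have "negligible ((E \<inter> ball x r) \<union> (ball y s - E))" using z by simp
    then have "negligible (ball x r \<inter> ball y s)" by (rule negligible_subset) auto
    moreover have "open (ball x r \<inter> ball y s)" "ball x r \<inter> ball y s \<noteq> {}" using z by auto
    ultimately show False using open_not_negligible by blast
  qed
  moreover have "C \<subseteq> A \<union> B"
  proof
    fix x assume "x \<in> C"
    then have "x \<notin> boundary_support E" using avoid by blast
    then obtain r where "r > 0" "negligible (E \<inter> ball x r) \<or> negligible (ball x r - E)"
      by (auto simp: boundary_support_iff[OF E])
    moreover from this have "x \<in> ball x r" by simp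
    ultimately show "x \<in> A \<union> B" unfolding A_def B_def by blast
  qed
  moreover have "open A" "open B" unfolding A_def B_def by auto
  ultimately have "A \<inter> C = {} \<or> B \<inter> C = {}" using connectedD[OF C] by blast
  then have "C \<subseteq> A \<or> C \<subseteq> B" using \<open>C \<subseteq> A \<union> B\<close> by blast
  then show ?thesis
  proof
    assume "C \<subseteq> A"
    have "negligible (C \<inter> E)"
    proof (subst locally_negligible_alt, rule ballI)
      fix x assume x: "x \<in> C \<inter> E"
      then obtain y r where "x \<in> ball y r" "negligible (E \<inter> ball y r)" using \<open>C \<subseteq> A\<close> unfolding A_def by blast
      moreover from this have "negligible ((C \<inter> E) \<inter> ball y r)" by (auto elim: negligible_subset)
      ultimately show "\<exists>U. openin (top_of_set (C \<inter> E)) U \<and> x \<in> U \<and> negligible U"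
        using x by (intro exI[of _ "(C \<inter> E) \<inter> ball y r"]) auto
    qed
    then show ?thesis ..
  next
    assume "C \<subseteq> B"
    have "negligible (C - E)"
    proof (subst locally_negligible_alt, rule ballI)
      fix x assume x: "x \<in> C - E"
      then obtain y r where "x \<in> ball y r" "negligible (ball y r - E)" using \<open>C \<subseteq> B\<close> unfolding B_def by blast
      moreover from this have "negligible ((C - E) \<inter> ball y r)" by (auto elim: negligible_subset)
      ultimately show "\<exists>U. openin (top_of_set (C - E)) U \<and> x \<in> U \<and> negligible U"
        using x by (intro exI[of _ "(C - E) \<inter> ball y r"]) auto
    qed
    then show ?thesis ..
  qed
qed

text \<open>Stacked along the direction \<open>e\<close> in which the defining function increases, so that sublevel sets
are unions of segments hanging from one connected base.\<close>

definition cylinder :: "'a::euclidean_space \<Rightarrow> real \<Rightarrow> 'a \<Rightarrow> real \<Rightarrow> 'a set" where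
  "cylinder p r e a = (\<Union>t\<in>{-a..a}. (\<lambda>x. x + t *\<^sub>R e) ` ball p r)"

lemma open_cylinder: "open (cylinder p r e a)"
proof -
  have "open ((\<lambda>x. x + t *\<^sub>R e) ` ball p r)" for t
    using open_translation[OF open_ball, of "t *\<^sub>R e" p r] by (simp add: add.commute)
  then show ?thesis unfolding cylinder_def by auto
qed

text \<open>Every point of the sublevel set is joined to the bottom translate of the ball by a segment in
direction \<open>- e\<close>, along which \<open>g\<close> decreases.\<close>

lemma connected_sublevel_cylinder:
  assumes r: "0 < r" and a: "0 < a"
    and mono: "\<And>x s t. x \<in> ball p r \<Longrightarrow> - a \<le> s \<Longrightarrow> s < t \<Longrightarrow> t \<le> a \<Longrightarrow> g (x + s *\<^sub>R e) < (g (x + t *\<^sub>R e) :: real)"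
    and neg: "\<And>x. x \<in> ball p r \<Longrightarrow> g (x - a *\<^sub>R e) < 0"
  shows "connected {y \<in> cylinder p r e a. g y < 0}"
proof -
  define L where "L = (\<lambda>z. (\<lambda>s. fst z + s *\<^sub>R e) ` {-a..snd z} \<union> (\<lambda>x. x - a *\<^sub>R e) ` ball p r)"
  define I where "I = {z. fst z \<in> ball p r \<and> - a \<le> snd z \<and> snd z \<le> a \<and> g (fst z + snd z *\<^sub>R e) < 0}"
  have "connected (\<Union>(L ` I))"
  proof (rule connected_Union)
    fix T assume "T \<in> L ` I"
    then obtain z where z: "z \<in> I" "T = L z" by blast
    have "connected ((\<lambda>s. fst z + s *\<^sub>R e) ` {-a..snd z})" "connected ((\<lambda>x. x - a *\<^sub>R e) ` ball p r)"
      by (intro connected_continuous_image continuous_intros connected_Icc connected_ball)+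
    moreover have "fst z + (-a) *\<^sub>R e \<in> (\<lambda>s. fst z + s *\<^sub>R e) ` {-a..snd z}"
      by (rule image_eqI[of _ _ "-a"]) (use z in \<open>auto simp: I_def\<close>)
    moreover have "fst z + (-a) *\<^sub>R e \<in> (\<lambda>x. x - a *\<^sub>R e) ` ball p r" using z by (auto simp: I_def)
    ultimately show "connected T" unfolding z(2) L_def by (intro connected_Un) blast+
  next
    have "p - a *\<^sub>R e \<in> T" if "T \<in> L ` I" for T using that r by (auto simp: L_def)
    then show "\<Inter> (L ` I) \<noteq> {}" by blast
  qed
  also have "\<Union>(L ` I) = {y \<in> cylinder p r e a. g y < 0}"
  proof (intro equalityI subsetI)
    fix y assume "y \<in> \<Union>(L ` I)"
    then obtain z where z: "z \<in> I" "y \<in> L z" by blast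
    then consider s where "s \<in> {-a..snd z}" "y = fst z + s *\<^sub>R e" | x where "x \<in> ball p r" "y = x + (-a) *\<^sub>R e"
      unfolding L_def by auto
    then show "y \<in> {y \<in> cylinder p r e a. g y < 0}"
    proof cases
      case 1
      have "g y < 0"
      proof (cases "s = snd z")
        case False
        then have "g y < g (fst z + snd z *\<^sub>R e)" unfolding 1(2) using z(1) 1(1) by (intro mono) (auto simp: I_def)
        then show ?thesis using z(1) by (simp add: I_def)
      qed (use z 1 in \<open>simp add: I_def\<close>)
      have "s \<in> {-a..a}" using 1 z(1) by (auto simp: I_def)
      moreover have "fst z \<in> ball p r" using z(1) by (simp add: I_def)
      ultimately have "y \<in> cylinder p r e a" unfolding cylinder_def 1(2) by blast
      with \<open>g y < 0\<close> show ?thesis by simp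
    next
      case 2
      have "- a \<in> {-a..a}" using a by simp
      then have "y \<in> cylinder p r e a" unfolding cylinder_def 2(2) using 2(1) by blast
      then show ?thesis using neg[OF 2(1)] 2(2) by simp
    qed
  next
    fix y assume "y \<in> {y \<in> cylinder p r e a. g y < 0}"
    then obtain x t where x: "x \<in> ball p r" "t \<in> {-a..a}" "y = x + t *\<^sub>R e" "g y < 0"
      unfolding cylinder_def by blast
    then have "(x, t) \<in> I" by (auto simp: I_def)
    moreover have "y \<in> L (x, t)" using x by (auto simp: L_def)
    ultimately show "y \<in> \<Union>(L ` I)" by blast
  qed
  finally show ?thesis .
qed

lemma connected_sides_exist:
  fixes g :: "'a::euclidean_space \<Rightarrow> real"
  assumes W: "open W" "p \<in> W" and g: "C1_on W g (\<lambda>x v. n x \<bullet> v)" and n: "continuous_on W n"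
    and gp: "g p = 0" and np: "n p \<noteq> 0"
  obtains V where "open V" "p \<in> V" "V \<subseteq> W" "connected {x\<in>V. g x < 0}" "connected {x\<in>V. g x > 0}"
proof -
  define e where "e = n p"
  have "continuous_on W (\<lambda>x. n x \<bullet> e)" by (intro continuous_intros n)
  then have "open (W \<inter> (\<lambda>x. n x \<bullet> e) -` {0<..})" by (rule continuous_open_preimage[OF _ W(1)]) simp
  moreover have "p \<in> W \<inter> (\<lambda>x. n x \<bullet> e) -` {0<..}" using W np by (simp add: e_def)
  ultimately obtain d where d: "d > 0" "ball p d \<subseteq> W \<inter> (\<lambda>x. n x \<bullet> e) -` {0<..}" by (meson open_contains_ball)
  have e0: "norm e > 0" using np by (simp add: e_def)
  define a where "a = d / (2 * norm e)"
  have a: "a > 0" "a * norm e = d / 2" using d e0 by (auto simp: a_def)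
  have inb: "x + t *\<^sub>R e \<in> ball p d" if "x \<in> ball p (d/2)" "\<bar>t\<bar> \<le> a" for x t
  proof -
    have "dist p (x + t *\<^sub>R e) \<le> dist p x + norm (t *\<^sub>R e)"
      using norm_triangle_ineq4[of "p - x" "t *\<^sub>R e"] by (simp add: dist_norm algebra_simps)
    moreover have "norm (t *\<^sub>R e) \<le> a * norm e" using that(2) by (simp add: mult_right_mono)
    ultimately show ?thesis using that(1) a(2) by simp
  qed
  have mono: "g (x + s *\<^sub>R e) < g (x + t *\<^sub>R e)" if "x \<in> ball p (d/2)" "- a \<le> s" "s < t" "t \<le> a" for x s t
  proof (rule DERIV_pos_imp_increasing[OF that(3), of "\<lambda>u. g (x + u *\<^sub>R e)"])
    fix u assume "s \<le> u" "u \<le> t"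
    then have u: "x + u *\<^sub>R e \<in> ball p d" using that by (intro inb) auto
    then have uW: "x + u *\<^sub>R e \<in> W" "n (x + u *\<^sub>R e) \<bullet> e > 0" using d by auto
    have "((\<lambda>u. g (x + u *\<^sub>R e)) has_derivative (\<lambda>h. n (x + u *\<^sub>R e) \<bullet> (h *\<^sub>R e))) (at u)"
      by (rule has_derivative_compose[OF has_derivative_line C1_onD(1)[OF g uW(1)]])
    moreover have "(\<lambda>h. n (x + u *\<^sub>R e) \<bullet> (h *\<^sub>R e)) = (*) (n (x + u *\<^sub>R e) \<bullet> e)" by auto
    ultimately have "((\<lambda>u. g (x + u *\<^sub>R e)) has_real_derivative n (x + u *\<^sub>R e) \<bullet> e) (at u)"
      by (simp add: has_field_derivative_def)
    then show "\<exists>y. ((\<lambda>u. g (x + u *\<^sub>R e)) has_real_derivative y) (at u) \<and> y > 0" using uW(2) by blast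
  qed
  have gc: "continuous_on W g" by (rule C1_on_continuous[OF g])
  have pb: "p \<in> ball p (d/2)" using d by simp
  have gm: "g (p - a *\<^sub>R e) < 0" and gpp: "g (p + a *\<^sub>R e) > 0"
    using mono[OF pb, of "-a" 0] mono[OF pb, of 0 a] a gp by auto
  have "open (W \<inter> g -` {..<0})" "open (W \<inter> g -` {0<..})"
    by (rule continuous_open_preimage[OF gc W(1)], simp)+
  moreover have "p - a *\<^sub>R e \<in> W \<inter> g -` {..<0}" "p + a *\<^sub>R e \<in> W \<inter> g -` {0<..}"
  proof -
    have "p + (-a) *\<^sub>R e \<in> ball p d" "p + a *\<^sub>R e \<in> ball p d" by (intro inb[OF pb], use a in simp)+
    then have "p + (-a) *\<^sub>R e \<in> W" "p + a *\<^sub>R e \<in> W" using d(2) by blast+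
    then show "p - a *\<^sub>R e \<in> W \<inter> g -` {..<0}" "p + a *\<^sub>R e \<in> W \<inter> g -` {0<..}" using gm gpp by auto
  qed
  ultimately obtain r1 r2 where r12: "r1 > 0" "ball (p - a *\<^sub>R e) r1 \<subseteq> W \<inter> g -` {..<0}"
      "r2 > 0" "ball (p + a *\<^sub>R e) r2 \<subseteq> W \<inter> g -` {0<..}"
    by (meson open_contains_ball)
  define r where "r = min (d/2) (min r1 r2)"
  have r: "r > 0" "r \<le> d/2" "r \<le> r1" "r \<le> r2" using d r12 by (auto simp: r_def)
  have neg: "g (x - a *\<^sub>R e) < 0" and pos: "g (x + a *\<^sub>R e) > 0" if "x \<in> ball p r" for x
  proof -
    have "x - a *\<^sub>R e \<in> ball (p - a *\<^sub>R e) r1" "x + a *\<^sub>R e \<in> ball (p + a *\<^sub>R e) r2"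
      using that r by (auto simp: dist_norm)
    then show "g (x - a *\<^sub>R e) < 0" "g (x + a *\<^sub>R e) > 0" using r12(2,4) by blast+
  qed
  have xb: "x \<in> ball p (d/2)" if "x \<in> ball p r" for x using that r by auto
  have cneg: "cylinder p r (- e) a = cylinder p r e a"
  proof -
    have sub: "cylinder p r (- v) a \<subseteq> cylinder p r v a" for v :: 'a
    proof
      fix y assume "y \<in> cylinder p r (- v) a"
      then obtain x t where x: "x \<in> ball p r" "t \<in> {-a..a}" "y = x + t *\<^sub>R (- v)"
        unfolding cylinder_def by blast
      then have "y = x + (- t) *\<^sub>R v" "- t \<in> {-a..a}" by auto
      then show "y \<in> cylinder p r v a" using x(1) unfolding cylinder_def by blast
    qed
    show ?thesis using sub[of e] sub[of "- e"] by simp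
  qed
  have 1: "connected {y \<in> cylinder p r e a. g y < 0}"
    by (rule connected_sublevel_cylinder[OF r(1) a(1)]) (use mono xb neg in auto)
  have "connected {y \<in> cylinder p r (- e) a. - g y < 0}"
  proof (rule connected_sublevel_cylinder[OF r(1) a(1)])
    fix x s t assume "x \<in> ball p r" "- a \<le> s" "s < t" "t \<le> a"
    then show "- g (x + s *\<^sub>R - e) < - g (x + t *\<^sub>R - e)" using mono[OF xb, of x "-t" "-s"] by simp
  qed (use pos in auto)
  then have 2: "connected {y \<in> cylinder p r e a. g y > 0}" by (simp add: cneg)
  have 3: "p \<in> cylinder p r e a"
  proof -
    have "p \<in> (\<lambda>x. x + 0 *\<^sub>R e) ` ball p r" using r by simp
    moreover have "0 \<in> {-a..a}" using a by simp
    ultimately show ?thesis unfolding cylinder_def by blast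
  qed
  have 4: "cylinder p r e a \<subseteq> W"
    unfolding cylinder_def using inb[OF xb] d by fastforce
  show thesis by (rule that[OF open_cylinder 3 4 1 2])
qed

text \<open>On each side of the hypersurface \<open>E\<close> contains almost everything or almost nothing. If both sides agreed, a
neighbourhood of \<open>p\<close> would lie almost inside or almost outside \<open>E\<close>, because the hypersurface is a
null set; that contradicts \<open>p\<close> being in the boundary support.\<close>

lemma locally_one_side:
  fixes E :: "'a::euclidean_space set" and g :: "'a \<Rightarrow> real"
  assumes E: "E \<in> sets lebesgue" and null: "negligible (boundary_support E)" and p: "p \<in> boundary_support E"
    and W: "open W" "p \<in> W" and g: "C1_on W g (\<lambda>x v. n x \<bullet> v)" and n: "continuous_on W n" and np: "n p \<noteq> 0"
    and S: "boundary_support E \<inter> W = {x \<in> W. g x = 0}"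
  obtains V where "open V" "p \<in> V" "V \<subseteq> W"
    "negligible (V \<inter> ((E - {x. g x < 0}) \<union> ({x. g x < 0} - E))) \<or>
     negligible (V \<inter> ((E - {x. g x > 0}) \<union> ({x. g x > 0} - E)))"
proof -
  have gp: "g p = 0" using S p W by blast
  obtain V where V: "open V" "p \<in> V" "V \<subseteq> W" "connected {x\<in>V. g x < 0}" "connected {x\<in>V. g x > 0}"
    using connected_sides_exist[OF W g n gp np] by blast
  obtain r where r: "r > 0" "ball p r \<subseteq> V" using V by (meson open_contains_ball)
  let ?m = "{x\<in>V. g x < 0}" and ?p = "{x\<in>V. g x > 0}" and ?S = "boundary_support E"
  have Z: "x \<in> ?S" if "x \<in> V" "g x = 0" for x using S V(3) that by blast
  have nz: "g x = 0" if "x \<in> V" "x \<in> ?S" for x using S V(3) that by blast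
  have m: "negligible (?m \<inter> E) \<or> negligible (?m - E)"
    by (rule connected_avoiding_boundary_support[OF E V(4)]) (use nz in force)
  have pp: "negligible (?p \<inter> E) \<or> negligible (?p - E)"
    by (rule connected_avoiding_boundary_support[OF E V(5)]) (use nz in force)
  have ne: "\<not> negligible (E \<inter> ball p r)" "\<not> negligible (ball p r - E)"
    using p r by (auto simp: boundary_support_iff[OF E])
  have "\<not> (negligible (?m \<inter> E) \<and> negligible (?p \<inter> E))"
  proof
    assume "negligible (?m \<inter> E) \<and> negligible (?p \<inter> E)"
    then have "negligible ((?m \<inter> E) \<union> (?p \<inter> E) \<union> ?S)" using null by simp
    then have "negligible (E \<inter> ball p r)" by (rule negligible_subset) (use r Z in force)
    then show False using ne by blast
  qed
  moreover have "\<not> (negligible (?m - E) \<and> negligible (?p - E))"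
  proof
    assume "negligible (?m - E) \<and> negligible (?p - E)"
    then have "negligible ((?m - E) \<union> (?p - E) \<union> ?S)" using null by simp
    then have "negligible (ball p r - E)" by (rule negligible_subset) (use r Z in force)
    then show False using ne by blast
  qed
  ultimately consider "negligible (?m \<inter> E)" "negligible (?p - E)" | "negligible (?m - E)" "negligible (?p \<inter> E)"
    using m pp by blast
  then show thesis
  proof cases
    case 1
    then have "negligible ((?m \<inter> E) \<union> (?p - E) \<union> ?S)" using null by simp
    then have "negligible (V \<inter> ((E - {x. g x > 0}) \<union> ({x. g x > 0} - E)))"
      by (rule negligible_subset) (use Z in force)
    then show ?thesis using that[OF V(1-3)] by blast
  next
    case 2
    then have "negligible ((?m - E) \<union> (?p \<inter> E) \<union> ?S)" using null by simp
    then have "negligible (V \<inter> ((E - {x. g x < 0}) \<union> ({x. g x < 0} - E)))"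
      by (rule negligible_subset) (use Z in force)
    then show ?thesis using that[OF V(1-3)] by blast
  qed
qed

text \<open>Depending on the side on which \<open>E\<close> lies, the previous result applies to \<open>g\<close> or to \<open>- g\<close>; the
curvature numerator is odd in \<open>n\<close>.\<close>

theorem area_minimizing_stationary:
  fixes S :: "'a::euclidean_space set" and g :: "'a \<Rightarrow> real"
  assumes S: "area_minimizing S" and null: "negligible S" and p: "p \<in> S"
    and W: "open W" "p \<in> W" and g: "C1_on W g (\<lambda>x v. n x \<bullet> v)" and n: "C1_on W n n'" and np: "n p \<noteq> 0"
    and SW: "S \<inter> W = {x \<in> W. g x = 0}"
  shows "curvature_num n n' p = 0"
proof -
  obtain E where E: "perimeter_minimizing E" "S = boundary_support E"
    using S unfolding area_minimizing_def by blast
  have Em: "E \<in> sets lebesgue" using E by (simp add: perimeter_minimizing_def)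
  have gp: "g p = 0" using SW p W by blast
  obtain V where V: "open V" "p \<in> V" "V \<subseteq> W" and side:
    "negligible (V \<inter> ((E - {x. g x < 0}) \<union> ({x. g x < 0} - E))) \<or>
     negligible (V \<inter> ((E - {x. g x > 0}) \<union> ({x. g x > 0} - E)))"
    using locally_one_side[OF Em _ _ W g C1_on_continuous[OF n] np] null p SW unfolding E(2) by blast
  note gV = C1_on_subset[OF g V(3)] and nV = C1_on_subset[OF n V(3)]
  from side show ?thesis
  proof
    assume "negligible (V \<inter> ((E - {x. g x < 0}) \<union> ({x. g x < 0} - E)))"
    then show ?thesis by (rule perimeter_minimizing_stationary[OF E(1) V(1,2) gV nV gp np])
  next
    assume s: "negligible (V \<inter> ((E - {x. g x > 0}) \<union> ({x. g x > 0} - E)))"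
    have g': "C1_on V (\<lambda>x. - g x) (\<lambda>x v. (- n x) \<bullet> v)"
      using C1_on_diff[OF C1_on_const[of V "0::real"] gV] by simp
    have n': "C1_on V (\<lambda>x. - n x) (\<lambda>x h. - n' x h)"
      using C1_on_diff[OF C1_on_const[of V "0::'a"] nV] by simp
    have "curvature_num (\<lambda>x. - n x) (\<lambda>x h. - n' x h) p = 0"
      by (rule perimeter_minimizing_stationary[OF E(1) V(1,2) g' n']) (use gp np s in auto)
    then show ?thesis by (simp add: curvature_num_def sum_negf)
  qed
qed

text \<open>The dilations of a bounded piece by factors close to \<open>1\<close> would be infinitely many disjoint sets of
comparable measure in a bounded region.\<close>

lemma negligible_if_dilations_disjoint:
  fixes S :: "'a::euclidean_space set"
  assumes S: "closed S" "0 \<notin> S"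
    and disj: "\<And>c x. c > 0 \<Longrightarrow> x \<in> S \<Longrightarrow> c *\<^sub>R x \<in> S \<Longrightarrow> c = 1"
  shows "negligible S"
proof (rule starlike_negligible[OF S(1), of 0])
  fix c x assume "0 + c *\<^sub>R x \<in> S" "0 \<le> c" "0 + x \<in> S"
  then show "c = 1" using S(2) disj[of c x] by (cases "c = 0") auto
qed

section \<open>Reduction to the profile curve\<close>

definition e5 :: "real^5" where "e5 = axis 1 1"
definition e3 :: "real^3" where "e3 = axis 1 1"

lemma unit_axes [simp]: "e5 \<bullet> e5 = 1" "e3 \<bullet> e3 = 1" "norm e5 = 1" "norm e3 = 1"
  by (simp_all add: e5_def e3_def inner_axis_axis norm_eq_sqrt_inner)

text \<open>The retraction of the whole space along the orbits of \<open>O(5) \<times> O(3)\<close> onto a quarter plane. Composing a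
defining function with it yields an invariant defining function of the same hypersurface, whose
gradient has the form \<open>(a x, b y)\<close>.\<close>

definition fold8 :: "R8 \<Rightarrow> R8" where
  "fold8 z = (norm (fst z) *\<^sub>R e5, norm (snd z) *\<^sub>R e3)"

definition slice8 :: "real \<times> real \<Rightarrow> R8" where
  "slice8 z = (fst z *\<^sub>R e5, snd z *\<^sub>R e3)"

lemma linear_slice8_decompose:
  fixes L :: "R8 \<Rightarrow> real"
  assumes "linear L" shows "L (a *\<^sub>R e5, b *\<^sub>R e3) = a * L (e5, 0) + b * L (0, e3)"
proof -
  have "(a *\<^sub>R e5, b *\<^sub>R e3) = a *\<^sub>R (e5, 0) + b *\<^sub>R (0, e3)" by simp
  then show ?thesis by (simp only: linear_add[OF assms] linear_scale[OF assms] real_scaleR_def)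
qed

lemma O_invariant_iff:
  assumes S: "O5_O3_invariant S" and n: "norm x = norm x'" "norm y = norm y'"
  shows "(x, y) \<in> S \<longleftrightarrow> (x', y') \<in> S"
proof -
  have *: "(x', y') \<in> S" if xy: "(x, y) \<in> S" "norm x = norm x'" "norm y = norm y'" for x x' y y'
  proof -
    obtain A where A: "orthogonal_transformation A" "A x = x'"
      using orthogonal_transformation_exists[OF xy(2)] by blast
    obtain B where B: "orthogonal_transformation B" "B y = y'"
      using orthogonal_transformation_exists[OF xy(3)] by blast
    have "map_prod A B (x, y) \<in> map_prod A B ` S" using xy(1) by blast
    then show ?thesis using S A B unfolding O5_O3_invariant_def by auto
  qed
  show ?thesis using *[of x y x' y'] *[of x' y' x y] n by auto
qed

lemma O_invariant_fold8: "O5_O3_invariant S \<Longrightarrow> fold8 z \<in> S \<longleftrightarrow> z \<in> S"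
  using O_invariant_iff[of S "norm (fst z) *\<^sub>R e5" "fst z" "norm (snd z) *\<^sub>R e3" "snd z"]
  by (simp add: fold8_def)

lemma has_derivative_fold8:
  assumes "fst z \<noteq> 0" "snd z \<noteq> 0"
  shows "(fold8 has_derivative (\<lambda>h. ((fst z \<bullet> fst h / norm (fst z)) *\<^sub>R e5,
     (snd z \<bullet> snd h / norm (snd z)) *\<^sub>R e3))) (at z)"
proof -
  have 1: "((\<lambda>z::R8. norm (fst z)) has_derivative (\<lambda>h. fst h \<bullet> sgn (fst z))) (at z)"
    by (rule has_derivative_compose[OF has_derivative_fst[OF has_derivative_ident] has_derivative_norm[OF assms(1)]])
  have 2: "((\<lambda>z::R8. norm (snd z)) has_derivative (\<lambda>h. snd h \<bullet> sgn (snd z))) (at z)"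
    by (rule has_derivative_compose[OF has_derivative_snd[OF has_derivative_ident] has_derivative_norm[OF assms(2)]])
  have e: "(\<lambda>h. ((fst z \<bullet> fst h / norm (fst z)) *\<^sub>R e5, (snd z \<bullet> snd h / norm (snd z)) *\<^sub>R e3))
     = (\<lambda>h. ((fst h \<bullet> sgn (fst z)) *\<^sub>R e5, (snd h \<bullet> sgn (snd z)) *\<^sub>R e3))"
    by (simp add: sgn_div_norm inner_commute divide_inverse mult.commute)
  show ?thesis unfolding fold8_def[abs_def] e
    by (intro has_derivative_Pair has_derivative_scaleR_left 1 2)
qed

lemma C1_on_inverse_norm:
  "C1_on {z. fst z \<noteq> 0} (\<lambda>z::'a::euclidean_space \<times> 'b::euclidean_space. inverse (norm (fst z)))
     (\<lambda>z h. - (fst z \<bullet> fst h) / norm (fst z) ^ 3)"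
  "C1_on {z. snd z \<noteq> 0} (\<lambda>z::'a \<times> 'b. inverse (norm (snd z)))
     (\<lambda>z h. - (snd z \<bullet> snd h) / norm (snd z) ^ 3)"
proof -
  have d: "((\<lambda>x::'c. inverse (norm x)) has_derivative (\<lambda>h. - (x \<bullet> h) / norm x ^ 3)) (at x)"
    if "x \<noteq> 0" for x :: "'c::euclidean_space"
  proof -
    have "((\<lambda>x. inverse (norm x)) has_derivative (\<lambda>h. - (inverse (norm x) * (h \<bullet> sgn x) * inverse (norm x)))) (at x)"
      using that by (intro Deriv.has_derivative_inverse has_derivative_norm) auto
    moreover have "(\<lambda>h. - (inverse (norm x) * (h \<bullet> sgn x) * inverse (norm x))) = (\<lambda>h. - (x \<bullet> h) / norm x ^ 3)"
      by (simp add: sgn_div_norm inner_commute divide_inverse power3_eq_cube mult.commute mult.left_commute)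
    ultimately show ?thesis by simp
  qed
  show "C1_on {z. fst z \<noteq> 0} (\<lambda>z::'a \<times> 'b. inverse (norm (fst z))) (\<lambda>z h. - (fst z \<bullet> fst h) / norm (fst z) ^ 3)"
    by (rule C1_onI, rule has_derivative_compose[OF has_derivative_fst[OF has_derivative_ident] d])
      (auto intro!: continuous_intros)
  show "C1_on {z. snd z \<noteq> 0} (\<lambda>z::'a \<times> 'b. inverse (norm (snd z))) (\<lambda>z h. - (snd z \<bullet> snd h) / norm (snd z) ^ 3)"
    by (rule C1_onI, rule has_derivative_compose[OF has_derivative_snd[OF has_derivative_ident] d])
      (auto intro!: continuous_intros)
qed

lemma C1_on_compose_fold8:
  fixes G :: "R8 \<Rightarrow> real"
  assumes G: "C1_on W G G'"
  shows "C1_on {z. fst z \<noteq> 0 \<and> snd z \<noteq> 0 \<and> fold8 z \<in> W} (\<lambda>z. G (fold8 z))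
    (\<lambda>z h. (fst z \<bullet> fst h / norm (fst z)) * G' (fold8 z) (e5, 0) + (snd z \<bullet> snd h / norm (snd z)) * G' (fold8 z) (0, e3))"
proof (rule C1_onI)
  fix z assume z: "z \<in> {z. fst z \<noteq> 0 \<and> snd z \<noteq> 0 \<and> fold8 z \<in> W}"
  then have d: "(G has_derivative G' (fold8 z)) (at (fold8 z))" using C1_onD(1)[OF G] by blast
  have l: "linear (G' (fold8 z))" using d by (rule has_derivative_linear)
  have "((\<lambda>z. G (fold8 z)) has_derivative (\<lambda>h. G' (fold8 z) ((fst z \<bullet> fst h / norm (fst z)) *\<^sub>R e5,
     (snd z \<bullet> snd h / norm (snd z)) *\<^sub>R e3))) (at z)"
    by (rule has_derivative_compose[OF has_derivative_fold8 d]) (use z in auto)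
  then show "((\<lambda>z. G (fold8 z)) has_derivative (\<lambda>h. (fst z \<bullet> fst h / norm (fst z)) * G' (fold8 z) (e5, 0)
      + (snd z \<bullet> snd h / norm (snd z)) * G' (fold8 z) (0, e3))) (at z)"
    by (simp only: linear_slice8_decompose[OF l])
next
  fix h
  have f: "continuous_on {z. fst z \<noteq> 0 \<and> snd z \<noteq> 0 \<and> fold8 z \<in> W} (\<lambda>z. G' (fold8 z) v)" for v
    by (rule continuous_on_compose2[OF C1_onD(2)[OF G]]) (auto simp: fold8_def[abs_def] intro!: continuous_intros)
  show "continuous_on {z. fst z \<noteq> 0 \<and> snd z \<noteq> 0 \<and> fold8 z \<in> W} (\<lambda>z. (fst z \<bullet> fst h / norm (fst z)) * G' (fold8 z) (e5, 0)
      + (snd z \<bullet> snd h / norm (snd z)) * G' (fold8 z) (0, e3))"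
    by (intro continuous_intros f) auto
qed

text \<open>Near each of its points in the open quarter plane the curve is the zero set of a \<open>C\<^sup>2\<close> function with
gradient \<open>(G1, G2)\<close>, and it satisfies the equation for the profile of a minimal hypersurface
with symmetric factors of dimensions \<open>k + 1\<close> and \<open>l + 1\<close>: the curvature of the curve
plus the contributions \<open>k G1 / s\<close> and \<open>l G2 / t\<close> of the two spheres vanishes. The equation has been
multiplied by \<open>G1\<^sup>2 + G2\<^sup>2\<close> to clear denominators.\<close>

definition stationary_profile :: "real \<Rightarrow> real \<Rightarrow> (real \<times> real) set \<Rightarrow> bool" where
  "stationary_profile k l \<Sigma> \<longleftrightarrow> (\<forall>z\<in>\<Sigma>. fst z > 0 \<and> snd z > 0 \<longrightarrow>
    (\<exists>V G G1 G2 G1' G2'. open V \<and> z \<in> V \<and> V \<subseteq> {z. fst z > 0 \<and> snd z > 0} \<and>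
      C1_on V G (\<lambda>z h. G1 z * fst h + G2 z * snd h) \<and> C1_on V G1 G1' \<and> C1_on V G2 G2' \<and>
      (\<forall>z\<in>V. (G1 z)\<^sup>2 + (G2 z)\<^sup>2 > 0) \<and> \<Sigma> \<inter> V = {z \<in> V. G z = 0} \<and>
      (\<forall>z\<in>V. G z = 0 \<longrightarrow>
        (G1' z (1, 0) + k * G1 z / fst z + G2' z (0, 1) + l * G2 z / snd z) * ((G1 z)\<^sup>2 + (G2 z)\<^sup>2)
        = (G1 z)\<^sup>2 * G1' z (1, 0) + G1 z * G2 z * (G1' z (0, 1) + G2' z (1, 0)) + (G2 z)\<^sup>2 * G2' z (0, 1))))"

text \<open>The coefficients \<open>5\<close> and \<open>3\<close> are the traces of the identity on the two factors. Only the \<open>e5\<close> and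
\<open>e3\<close> components of the gradients of the two scalar coefficients enter.\<close>

lemma curvature_num_doubly_radial:
  fixes a b :: "R8 \<Rightarrow> real"
  assumes a': "\<And>h. a' h = a1 * (e5 \<bullet> fst h) + a2 * (e3 \<bullet> snd h)"
    and b': "\<And>h. b' h = b1 * (e5 \<bullet> fst h) + b2 * (e3 \<bullet> snd h)"
    and n: "n z = (\<alpha> *\<^sub>R fst z, \<beta> *\<^sub>R snd z)"
    and n': "\<And>h. n' z h = (\<alpha> *\<^sub>R fst h + a' h *\<^sub>R fst z, \<beta> *\<^sub>R snd h + b' h *\<^sub>R snd z)"
    and z: "z = (s *\<^sub>R e5, t *\<^sub>R e3)"
  shows "curvature_num n n' z = (a1 * s + 5 * \<alpha> + b2 * t + 3 * \<beta>) * ((\<alpha> * s)\<^sup>2 + (\<beta> * t)\<^sup>2)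
     - (\<alpha> * s * (\<alpha> * (\<alpha> * s) + (a1 * (\<alpha> * s) + a2 * (\<beta> * t)) * s) + \<beta> * t * (\<beta> * (\<beta> * t) + (b1 * (\<alpha> * s) + b2 * (\<beta> * t)) * t))"
proof -
  have sumB: "(\<Sum>c\<in>(Basis :: R8 set). f c) = (\<Sum>i\<in>Basis. f (i, 0)) + (\<Sum>j\<in>Basis. f (0, j))" for f :: "R8 \<Rightarrow> real"
  proof -
    have "(\<lambda>u. (u, 0)) ` Basis \<inter> (\<lambda>v. (0, v)) ` Basis = ({} :: R8 set)" by (auto simp: nonzero_Basis)
    then show ?thesis
      unfolding Basis_prod_def by (subst sum.union_disjoint) (simp_all add: sum.reindex inj_on_def)
  qed
  have zf: "fst z = s *\<^sub>R e5" "snd z = t *\<^sub>R e3" by (simp_all add: z)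
  have nz: "n z = ((\<alpha> * s) *\<^sub>R e5, (\<beta> * t) *\<^sub>R e3)" by (simp add: n zf)
  have "(\<Sum>c\<in>Basis. n' z c \<bullet> c) = (\<Sum>c\<in>(Basis :: R8 set). \<alpha> * (fst c \<bullet> fst c) + \<beta> * (snd c \<bullet> snd c)
      + (((a1 * s) *\<^sub>R e5, (a2 * s) *\<^sub>R e3) \<bullet> c) * ((e5, 0) \<bullet> c)
      + (((b1 * t) *\<^sub>R e5, (b2 * t) *\<^sub>R e3) \<bullet> c) * ((0, e3) \<bullet> c))"
    by (rule sum.cong) (auto simp: n' a' b' zf inner_prod_def inner_add_left algebra_simps)
  also have "\<dots> = \<alpha> * (\<Sum>c\<in>(Basis :: R8 set). fst c \<bullet> fst c) + \<beta> * (\<Sum>c\<in>(Basis :: R8 set). snd c \<bullet> snd c)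
      + ((a1 * s) *\<^sub>R e5, (a2 * s) *\<^sub>R e3) \<bullet> (e5, 0) + ((b1 * t) *\<^sub>R e5, (b2 * t) *\<^sub>R e3) \<bullet> (0, e3)"
    by (simp only: sum.distrib sum_inner_product sum_distrib_left)
  also have "(\<Sum>c\<in>(Basis :: R8 set). fst c \<bullet> fst c) = 5"
    by (simp add: sumB inner_same_Basis)
  also have "(\<Sum>c\<in>(Basis :: R8 set). snd c \<bullet> snd c) = 3"
    by (simp add: sumB inner_same_Basis)
  finally have 1: "(\<Sum>c\<in>Basis. n' z c \<bullet> c) = a1 * s + 5 * \<alpha> + b2 * t + 3 * \<beta>" by simp
  have "(\<Sum>c\<in>Basis. (n z \<bullet> c) * (n z \<bullet> n' z c)) = (\<Sum>c\<in>(Basis :: R8 set). (n z \<bullet> c) *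
     (((\<alpha> * (\<alpha> * s) + (\<alpha> * s) * s * a1 + (\<beta> * t) * t * b1) *\<^sub>R e5,
      (\<beta> * (\<beta> * t) + (\<alpha> * s) * s * a2 + (\<beta> * t) * t * b2) *\<^sub>R e3) \<bullet> c))"
    by (rule sum.cong) (auto simp: nz n' a' b' zf inner_prod_def inner_add_right algebra_simps)
  also have "\<dots> = n z \<bullet> ((\<alpha> * (\<alpha> * s) + (\<alpha> * s) * s * a1 + (\<beta> * t) * t * b1) *\<^sub>R e5,
      (\<beta> * (\<beta> * t) + (\<alpha> * s) * s * a2 + (\<beta> * t) * t * b2) *\<^sub>R e3)"
    by (rule sum_inner_product)
  finally have 2: "(\<Sum>c\<in>Basis. (n z \<bullet> c) * (n z \<bullet> n' z c)) =
     \<alpha> * s * (\<alpha> * (\<alpha> * s) + (\<alpha> * s) * s * a1 + (\<beta> * t) * t * b1) + \<beta> * t * (\<beta> * (\<beta> * t) + (\<alpha> * s) * s * a2 + (\<beta> * t) * t * b2)"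
    by (simp add: nz)
  have 3: "n z \<bullet> n z = (\<alpha> * s)\<^sup>2 + (\<beta> * t)\<^sup>2" by (simp add: nz power2_eq_square)
  show ?thesis unfolding curvature_num_def 1 2 3 by (simp add: algebra_simps)
qed

lemma norm_circle:
  fixes e z :: "'a::real_inner"
  assumes "norm e = 1" "norm z = 1" "z \<bullet> e = 0"
  shows "norm (cos \<theta> *\<^sub>R e + sin \<theta> *\<^sub>R z) = 1"
proof -
  have "(norm (cos \<theta> *\<^sub>R e + sin \<theta> *\<^sub>R z))\<^sup>2 = (cos \<theta>)\<^sup>2 * (norm e)\<^sup>2 + (sin \<theta>)\<^sup>2 * (norm z)\<^sup>2 + 2 * cos \<theta> * sin \<theta> * (z \<bullet> e)"
    unfolding power2_norm_eq_inner
    by (simp add: inner_add_left inner_add_right inner_commute power2_eq_square)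
  then have "(norm (cos \<theta> *\<^sub>R e + sin \<theta> *\<^sub>R z))\<^sup>2 = 1" using assms by simp
  then show ?thesis by (metis abs_norm_cancel power2_eq_1_iff abs_1 abs_minus_cancel)
qed

lemma has_derivative_circle:
  fixes e z :: "'a::real_normed_vector"
  shows "((\<lambda>\<theta>. s *\<^sub>R (cos \<theta> *\<^sub>R e + sin \<theta> *\<^sub>R z)) has_derivative (\<lambda>h. h *\<^sub>R (s *\<^sub>R z))) (at (0::real))"
proof -
  have "(cos has_derivative (\<lambda>h. 0)) (at (0::real))" "(sin has_derivative (\<lambda>h. h)) (at (0::real))"
  proof -
    have "(*) 0 = (\<lambda>h::real. 0)" "(*) 1 = (\<lambda>h::real. h)" by auto
    then show "(cos has_derivative (\<lambda>h. 0)) (at (0::real))" "(sin has_derivative (\<lambda>h. h)) (at (0::real))"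
      using DERIV_cos[of "0::real"] DERIV_sin[of "0::real"] by (simp_all add: has_field_derivative_def)
  qed
  from has_derivative_scaleR_right[OF has_derivative_add[OF has_derivative_scaleR_left[OF this(1), of e]
    has_derivative_scaleR_left[OF this(2), of z]], of s]
  show ?thesis by (simp add: mult.commute)
qed

text \<open>Rotating the base point within its orbit gives curves in \<open>S\<close> whose tangents span the complement
of the slice, so the differential of \<open>g\<close> vanishes there and must be nonzero on the slice itself.\<close>

lemma invariant_gradient_in_slice:
  fixes g :: "R8 \<Rightarrow> real"
  assumes inv: "O5_O3_invariant S" and W: "open W" "(s *\<^sub>R e5, t *\<^sub>R e3) \<in> W"
    and SW: "S \<inter> W = {q \<in> W. g q = 0}" and p: "(s *\<^sub>R e5, t *\<^sub>R e3) \<in> S" and st: "s > 0" "t > 0"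
    and g: "(g has_derivative D) (at (s *\<^sub>R e5, t *\<^sub>R e3))" and D: "D \<noteq> (\<lambda>_. 0)"
  shows "D (e5, 0) \<noteq> 0 \<or> D (0, e3) \<noteq> 0"
proof (rule ccontr)
  assume "\<not> ?thesis"
  then have D0: "D (e5, 0) = 0" "D (0, e3) = 0" by auto
  have l: "linear D" using g by (rule has_derivative_linear)
  let ?p = "(s *\<^sub>R e5, t *\<^sub>R e3) :: R8"
  \<comment> \<open>curves through the base point that stay in its orbit\<close>
  have curve: "D c' = 0" if c: "(c has_derivative (\<lambda>h. h *\<^sub>R c')) (at (0::real))" and c0: "c 0 = ?p"
    and cn: "\<And>\<theta>. norm (fst (c \<theta>)) = s \<and> norm (snd (c \<theta>)) = t" for c c'
  proof -
    have "c \<theta> \<in> S" for \<theta>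
      using O_invariant_iff[OF inv, of "fst (c \<theta>)" "s *\<^sub>R e5" "snd (c \<theta>)" "t *\<^sub>R e3"] cn[of \<theta>] p st by simp
    have "isCont c 0" using c by (rule has_derivative_continuous)
    then have "(c \<longlongrightarrow> ?p) (nhds 0)"
      using c0 tendsto_at_iff_tendsto_nhds[of c 0] by (simp add: isCont_def)
    then have "\<forall>\<^sub>F \<theta> in nhds 0. c \<theta> \<in> W" using W by (rule topological_tendstoD)
    then have ev: "\<forall>\<^sub>F \<theta> in nhds 0. g (c \<theta>) = 0"
      by eventually_elim (use \<open>\<And>\<theta>. c \<theta> \<in> S\<close> SW in blast)
    have "((\<lambda>\<theta>. g (c \<theta>)) has_derivative (\<lambda>h. D (h *\<^sub>R c'))) (at 0)"
      by (rule has_derivative_compose[OF c]) (use g c0 in simp)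
    moreover have "((\<lambda>\<theta>. g (c \<theta>)) has_derivative (\<lambda>_. 0)) (at 0)"
    proof -
      obtain T where T: "open T" "0 \<in> T" "\<And>\<theta>. \<theta> \<in> T \<Longrightarrow> g (c \<theta>) = 0"
        using ev unfolding eventually_nhds by blast
      show ?thesis
        by (rule has_derivative_transform_within_open[where f="\<lambda>_. 0", OF has_derivative_const T(1,2)])
          (simp add: T(3))
    qed
    ultimately have "(\<lambda>h. D (h *\<^sub>R c')) = (\<lambda>_. 0)" by (rule has_derivative_unique)
    from fun_cong[OF this, of 1] show "D c' = 0" by simp
  qed
  have unit5: "D (z, 0) = 0" if z: "z \<bullet> e5 = 0" "norm z = 1" for z
  proof -
    let ?c = "\<lambda>\<theta>. (s *\<^sub>R (cos \<theta> *\<^sub>R e5 + sin \<theta> *\<^sub>R z), t *\<^sub>R e3) :: R8"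
    have "D (s *\<^sub>R z, 0) = 0"
    proof (rule curve)
      show "(?c has_derivative (\<lambda>h. h *\<^sub>R (s *\<^sub>R z, 0))) (at 0)"
        using has_derivative_Pair[OF has_derivative_circle[of s e5 z] has_derivative_const[of "t *\<^sub>R e3"]] by simp
      show "norm (fst (?c \<theta>)) = s \<and> norm (snd (?c \<theta>)) = t" for \<theta>
      proof -
        have "norm (cos \<theta> *\<^sub>R e5 + sin \<theta> *\<^sub>R z) = 1" by (rule norm_circle) (use z in auto)
        then show ?thesis using st by simp
      qed
    qed simp
    moreover have "D (s *\<^sub>R z, 0) = s * D (z, 0)" using linear_scale[OF l, of s "(z, 0)"] by simp
    ultimately show ?thesis using st by simp
  qed
  have unit3: "D (0, z) = 0" if z: "z \<bullet> e3 = 0" "norm z = 1" for z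
  proof -
    let ?c = "\<lambda>\<theta>. (s *\<^sub>R e5, t *\<^sub>R (cos \<theta> *\<^sub>R e3 + sin \<theta> *\<^sub>R z)) :: R8"
    have "D (0, t *\<^sub>R z) = 0"
    proof (rule curve)
      show "(?c has_derivative (\<lambda>h. h *\<^sub>R (0, t *\<^sub>R z))) (at 0)"
        using has_derivative_Pair[OF has_derivative_const[of "s *\<^sub>R e5"] has_derivative_circle[of t e3 z]] by simp
      show "norm (fst (?c \<theta>)) = s \<and> norm (snd (?c \<theta>)) = t" for \<theta>
      proof -
        have "norm (cos \<theta> *\<^sub>R e3 + sin \<theta> *\<^sub>R z) = 1" by (rule norm_circle) (use z in auto)
        then show ?thesis using st by simp
      qed
    qed simp
    moreover have "D (0, t *\<^sub>R z) = t * D (0, z)" using linear_scale[OF l, of t "(0, z)"] by simp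
    ultimately show ?thesis using st by simp
  qed
  have perp5: "D (z, 0) = 0" if "z \<bullet> e5 = 0" for z
  proof (cases "z = 0")
    case False
    have "D (z /\<^sub>R norm z, 0) = 0" by (rule unit5) (use that False in auto)
    moreover have "D (z, 0) = norm z * D (z /\<^sub>R norm z, 0)"
      using linear_scale[OF l, of "norm z" "(z /\<^sub>R norm z, 0)"] False by simp
    ultimately show ?thesis by simp
  qed (use linear_0[OF l] in \<open>simp add: zero_prod_def\<close>)
  have perp3: "D (0, z) = 0" if "z \<bullet> e3 = 0" for z
  proof (cases "z = 0")
    case False
    have "D (0, z /\<^sub>R norm z) = 0" by (rule unit3) (use that False in auto)
    moreover have "D (0, z) = norm z * D (0, z /\<^sub>R norm z)"
      using linear_scale[OF l, of "norm z" "(0, z /\<^sub>R norm z)"] False by simp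
    ultimately show ?thesis by simp
  qed (use linear_0[OF l] in \<open>simp add: zero_prod_def\<close>)
  have "D h = 0" for h
  proof -
    obtain x y where h: "h = (x, y)" by (cases h)
    have "h = ((x \<bullet> e5) *\<^sub>R e5, (y \<bullet> e3) *\<^sub>R e3) + ((x - (x \<bullet> e5) *\<^sub>R e5, 0) + (0, y - (y \<bullet> e3) *\<^sub>R e3))"
      by (simp add: h)
    then have "D h = D ((x \<bullet> e5) *\<^sub>R e5, (y \<bullet> e3) *\<^sub>R e3) + (D (x - (x \<bullet> e5) *\<^sub>R e5, 0) + D (0, y - (y \<bullet> e3) *\<^sub>R e3))"
      by (metis linear_add[OF l])
    moreover have "D ((x \<bullet> e5) *\<^sub>R e5, (y \<bullet> e3) *\<^sub>R e3) = 0"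
      using D0 by (simp add: linear_slice8_decompose[OF l])
    moreover have "D (x - (x \<bullet> e5) *\<^sub>R e5, 0) = 0" by (rule perp5) (simp add: inner_diff_left)
    moreover have "D (0, y - (y \<bullet> e3) *\<^sub>R e3) = 0" by (rule perp3) (simp add: inner_diff_left)
    ultimately show ?thesis by simp
  qed
  then show False using D by blast
qed

lemma C1_on_compose_slice8:
  fixes G :: "R8 \<Rightarrow> real"
  assumes G: "C1_on W G G'"
  shows "C1_on {z. slice8 z \<in> W} (\<lambda>z. G (slice8 z))
    (\<lambda>z h. G' (slice8 z) (e5, 0) * fst h + G' (slice8 z) (0, e3) * snd h)"
proof (rule C1_onI)
  fix z assume z: "z \<in> {z. slice8 z \<in> W}"
  then have d: "(G has_derivative G' (slice8 z)) (at (slice8 z))" using C1_onD(1)[OF G] by blast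
  have l: "linear (G' (slice8 z))" using d by (rule has_derivative_linear)
  have "(slice8 has_derivative (\<lambda>h. (fst h *\<^sub>R e5, snd h *\<^sub>R e3))) (at z)"
    unfolding slice8_def[abs_def]
    by (intro has_derivative_Pair has_derivative_scaleR_left has_derivative_fst has_derivative_snd has_derivative_ident)
  from has_derivative_compose[OF this d]
  show "((\<lambda>z. G (slice8 z)) has_derivative (\<lambda>h. G' (slice8 z) (e5, 0) * fst h + G' (slice8 z) (0, e3) * snd h)) (at z)"
    by (simp only: linear_slice8_decompose[OF l] mult.commute)
next
  fix h
  have f: "continuous_on {z. slice8 z \<in> W} (\<lambda>z. G' (slice8 z) v)" for v
    by (rule continuous_on_compose2[OF C1_onD(2)[OF G]]) (auto simp: slice8_def[abs_def] intro!: continuous_intros)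
  show "continuous_on {z. slice8 z \<in> W} (\<lambda>z. G' (slice8 z) (e5, 0) * fst h + G' (slice8 z) (0, e3) * snd h)"
    by (intro continuous_intros f)
qed

text \<open>Stationarity is applied to the invariant function \<open>g \<circ> fold8\<close>, whose gradient at \<open>(x, y)\<close> is
\<open>(G1 x / |x|, G2 y / |y|)\<close>. Of the traces \<open>5\<close> and \<open>3\<close> one unit each is cancelled by the derivative of
the factors \<open>1 / |x|\<close> and \<open>1 / |y|\<close>, which leaves the dimensions \<open>4\<close> and \<open>2\<close> of the spheres.\<close>

lemma doubly_radial_curvature_eq:
  fixes g :: "R8 \<Rightarrow> real"
  assumes S: "area_minimizing S" "O5_O3_invariant S" "negligible S"
    and W: "open W" and SW: "S \<inter> W = {q \<in> W. g q = 0}"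
    and g: "C1_on W g g'" and g1: "C1_on W (\<lambda>x. g' x (e5, 0)) D1" and g2: "C1_on W (\<lambda>x. g' x (0, e3)) D2"
    and p: "p = (s *\<^sub>R e5, t *\<^sub>R e3)" "p \<in> W" "g p = 0" and st: "s > 0" "t > 0"
    and nz: "g' p (e5, 0) \<noteq> 0 \<or> g' p (0, e3) \<noteq> 0"
  defines "G1 \<equiv> g' p (e5, 0)" and "G2 \<equiv> g' p (0, e3)"
  shows "(D1 p (e5, 0) + 4 * G1 / s + D2 p (0, e3) + 2 * G2 / t) * (G1\<^sup>2 + G2\<^sup>2)
        = G1\<^sup>2 * D1 p (e5, 0) + G1 * G2 * (D1 p (0, e3) + D2 p (e5, 0)) + G2\<^sup>2 * D2 p (0, e3)"
proof -
  let ?V = "{z. fst z \<noteq> 0 \<and> snd z \<noteq> 0 \<and> fold8 z \<in> W}"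
  have fp: "fold8 p = p" using st by (simp add: p(1) fold8_def)
  have zf: "fst p = s *\<^sub>R e5" "snd p = t *\<^sub>R e3" by (simp_all add: p)
  have e0: "e5 \<noteq> 0" "e3 \<noteq> 0" using unit_axes by force+
  have pV: "p \<in> ?V" using fp p(2) st e0 by (simp add: zf)
  have Vo: "open ?V"
  proof -
    have "open {z::R8. fst z \<noteq> 0}" "open {z::R8. snd z \<noteq> 0}"
      by (intro open_Collect_neq continuous_intros)+
    moreover have "open (fold8 -` W)"
      by (rule open_vimage[OF W]) (auto simp: fold8_def[abs_def] intro!: continuous_intros)
    ultimately have "open ({z. fst z \<noteq> 0} \<inter> {z. snd z \<noteq> 0} \<inter> fold8 -` W)" by (intro open_Int)
    moreover have "?V = {z. fst z \<noteq> 0} \<inter> {z. snd z \<noteq> 0} \<inter> fold8 -` W" by auto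
    ultimately show ?thesis by simp
  qed
  define \<alpha> where "\<alpha> = (\<lambda>z. g' (fold8 z) (e5, 0) * inverse (norm (fst z)))"
  define \<beta> where "\<beta> = (\<lambda>z. g' (fold8 z) (0, e3) * inverse (norm (snd z)))"
  define n where "n = (\<lambda>z. (\<alpha> z *\<^sub>R fst z, \<beta> z *\<^sub>R snd z))"
  define c1 where "c1 = (\<lambda>(z::R8) (h::R8). fst z \<bullet> fst h / norm (fst z))"
  define c2 where "c2 = (\<lambda>(z::R8) (h::R8). snd z \<bullet> snd h / norm (snd z))"
  define \<alpha>' where "\<alpha>' = (\<lambda>z h. g' (fold8 z) (e5, 0) * (- (fst z \<bullet> fst h) / norm (fst z) ^ 3)
    + (c1 z h * D1 (fold8 z) (e5, 0) + c2 z h * D1 (fold8 z) (0, e3)) * inverse (norm (fst z)))"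
  define \<beta>' where "\<beta>' = (\<lambda>z h. g' (fold8 z) (0, e3) * (- (snd z \<bullet> snd h) / norm (snd z) ^ 3)
    + (c1 z h * D2 (fold8 z) (e5, 0) + c2 z h * D2 (fold8 z) (0, e3)) * inverse (norm (snd z)))"
  have g': "C1_on ?V (\<lambda>z. g (fold8 z)) (\<lambda>z h. n z \<bullet> h)"
  proof -
    have e: "c1 z h * g' (fold8 z) (e5, 0) + c2 z h * g' (fold8 z) (0, e3) = n z \<bullet> h" for z h
      by (simp add: n_def inner_prod_def c1_def c2_def \<alpha>_def \<beta>_def divide_inverse mult.commute mult.left_commute)
    show ?thesis using C1_on_compose_fold8[OF g]
      by (simp only: e[unfolded c1_def c2_def])
  qed
  have \<alpha>: "C1_on ?V \<alpha> \<alpha>'"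
    unfolding \<alpha>_def \<alpha>'_def c1_def c2_def
    by (rule C1_on_mult[OF C1_on_compose_fold8[OF g1] C1_on_subset[OF C1_on_inverse_norm(1)]]) auto
  have \<beta>: "C1_on ?V \<beta> \<beta>'"
    unfolding \<beta>_def \<beta>'_def c1_def c2_def
    by (rule C1_on_mult[OF C1_on_compose_fold8[OF g2] C1_on_subset[OF C1_on_inverse_norm(2)]]) auto
  define n' where "n' = (\<lambda>z h. (\<alpha> z *\<^sub>R fst h + \<alpha>' z h *\<^sub>R fst z, \<beta> z *\<^sub>R snd h + \<beta>' z h *\<^sub>R snd z))"
  have n: "C1_on ?V n n'"
  proof (rule C1_onI)
    show "(n has_derivative n' z) (at z)" if "z \<in> ?V" for z
      unfolding n_def n'_def
      by (intro has_derivative_Pair has_derivative_scaleR C1_onD(1)[OF \<alpha> that] C1_onD(1)[OF \<beta> that]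
        has_derivative_fst has_derivative_snd has_derivative_ident)
    show "continuous_on ?V (\<lambda>z. n' z h)" for h
      unfolding n'_def by (intro continuous_intros C1_on_continuous[OF \<alpha>] C1_on_continuous[OF \<beta>] C1_onD(2)[OF \<alpha>] C1_onD(2)[OF \<beta>])
  qed
  have ap: "\<alpha> p = G1 / s" "\<beta> p = G2 / t"
    using st by (simp_all add: \<alpha>_def \<beta>_def fp zf G1_def G2_def divide_inverse)
  have np: "n p \<noteq> 0" using nz st e0 by (auto simp: n_def ap zf G1_def G2_def zero_prod_def)
  have pS: "p \<in> S" using SW p by blast
  have SV: "S \<inter> ?V = {z \<in> ?V. g (fold8 z) = 0}"
    using SW O_invariant_fold8[OF S(2)] by blast
  have "curvature_num n n' p = 0"
    by (rule area_minimizing_stationary[OF S(1,3) pS Vo pV g' n np SV])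
  moreover have "curvature_num n n' p = ((D1 p (e5, 0) / s - G1 / s\<^sup>2) * s + 5 * (G1 / s) + (D2 p (0, e3) / t - G2 / t\<^sup>2) * t + 3 * (G2 / t))
     * ((G1 / s * s)\<^sup>2 + (G2 / t * t)\<^sup>2)
     - (G1 / s * s * (G1 / s * (G1 / s * s) + ((D1 p (e5, 0) / s - G1 / s\<^sup>2) * (G1 / s * s) + (D1 p (0, e3) / s) * (G2 / t * t)) * s)
       + G2 / t * t * (G2 / t * (G2 / t * t) + ((D2 p (e5, 0) / t) * (G1 / s * s) + (D2 p (0, e3) / t - G2 / t\<^sup>2) * (G2 / t * t)) * t))"
  proof (rule curvature_num_doubly_radial[where a'="\<alpha>' p" and b'="\<beta>' p"])
    show "\<alpha>' p h = (D1 p (e5, 0) / s - G1 / s\<^sup>2) * (e5 \<bullet> fst h) + D1 p (0, e3) / s * (e3 \<bullet> snd h)" for h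
      using st by (simp add: \<alpha>'_def c1_def c2_def fp zf G1_def field_simps power2_eq_square power3_eq_cube)
    show "\<beta>' p h = (D2 p (e5, 0) / t) * (e5 \<bullet> fst h) + (D2 p (0, e3) / t - G2 / t\<^sup>2) * (e3 \<bullet> snd h)" for h
      using st by (simp add: \<beta>'_def c1_def c2_def fp zf G2_def field_simps power2_eq_square power3_eq_cube)
    show "n p = ((G1 / s) *\<^sub>R fst p, (G2 / t) *\<^sub>R snd p)" by (simp add: n_def ap)
    show "n' p h = ((G1 / s) *\<^sub>R fst h + \<alpha>' p h *\<^sub>R fst p, (G2 / t) *\<^sub>R snd h + \<beta>' p h *\<^sub>R snd p)" for h
      by (simp add: n'_def ap)
  qed (rule p(1))
  ultimately have C: "0 = ((D1 p (e5, 0) / s - G1 / s\<^sup>2) * s + 5 * (G1 / s) + (D2 p (0, e3) / t - G2 / t\<^sup>2) * t + 3 * (G2 / t))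
     * ((G1 / s * s)\<^sup>2 + (G2 / t * t)\<^sup>2)
     - (G1 / s * s * (G1 / s * (G1 / s * s) + ((D1 p (e5, 0) / s - G1 / s\<^sup>2) * (G1 / s * s) + (D1 p (0, e3) / s) * (G2 / t * t)) * s)
       + G2 / t * t * (G2 / t * (G2 / t * t) + ((D2 p (e5, 0) / t) * (G1 / s * s) + (D2 p (0, e3) / t - G2 / t\<^sup>2) * (G2 / t * t)) * t))"
    by (rule trans[OF sym])
  \<comment> \<open>atomic names for the quotients keep the final identity polynomial\<close>
  obtain a b where ab: "G1 / s = a" "G2 / t = b" by blast
  have c: "G1 / s * s = G1" "G2 / t * t = G2" "(d / s - G1 / s\<^sup>2) * s = d - G1 / s" "(d / t - G2 / t\<^sup>2) * t = d - G2 / t"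
    "((d / s - G1 / s\<^sup>2) * G1 + c / s * G2) * s = (d - G1 / s) * G1 + c * G2"
    "((c / t) * G1 + (d / t - G2 / t\<^sup>2) * G2) * t = c * G1 + (d - G2 / t) * G2" for d c
    using st by (simp_all add: field_simps power2_eq_square)
  have "0 = ((D1 p (e5, 0) - a) + 5 * a + (D2 p (0, e3) - b) + 3 * b) * (G1\<^sup>2 + G2\<^sup>2)
     - (G1 * (a * G1 + ((D1 p (e5, 0) - a) * G1 + D1 p (0, e3) * G2)) + G2 * (b * G2 + (D2 p (e5, 0) * G1 + (D2 p (0, e3) - b) * G2)))"
    using C unfolding c unfolding ab .
  moreover have "4 * G1 / s = 4 * a" "2 * G2 / t = 2 * b" by (simp_all add: ab[symmetric])
  ultimately show ?thesis by (simp add: algebra_simps power2_eq_square)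
qed

definition profile :: "R8 set \<Rightarrow> (real \<times> real) set" where
  "profile S = {z. slice8 z \<in> S}"

theorem stationary_profile_of_invariant_minimizer:
  assumes S: "area_minimizing S" "O5_O3_invariant S" "negligible S" "smooth_hypersurface S"
  shows "stationary_profile 4 2 (profile S)"
  unfolding stationary_profile_def
proof (intro ballI impI)
  fix z assume z: "z \<in> profile S" "fst z > 0 \<and> snd z > 0"
  then have zS: "slice8 z \<in> S" by (simp add: profile_def)
  obtain W and g :: "R8 \<Rightarrow> real" where "open W \<and> slice8 z \<in> W \<and> smooth_on W g \<and>
        (\<forall>q\<in>W. frechet_derivative g (at q) \<noteq> (\<lambda>_. 0)) \<and> S \<inter> W = {q \<in> W. g q = 0}"
    using bspec[OF S(4)[unfolded smooth_hypersurface_def] zS] by (elim exE)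
  then have W: "open W" "slice8 z \<in> W" and sm: "smooth_on W g"
    and reg: "\<And>q. q \<in> W \<Longrightarrow> frechet_derivative g (at q) \<noteq> (\<lambda>_. 0)" and SW: "S \<inter> W = {q \<in> W. g q = 0}"
    by simp_all
  define g' where "g' = (\<lambda>x. frechet_derivative g (at x))"
  have C2: "Ck_on (Suc 1) W g" using sm unfolding smooth_on_def by blast
  then have diff: "\<forall>x\<in>W. g differentiable (at x)" and Ck1: "\<And>h. Ck_on 1 W (\<lambda>x. g' x h)"
    unfolding Ck_on.simps g'_def by blast+
  define D1 where "D1 = (\<lambda>x. frechet_derivative (\<lambda>x. g' x (e5, 0)) (at x))"
  define D2 where "D2 = (\<lambda>x. frechet_derivative (\<lambda>x. g' x (0, e3)) (at x))"
  have g1: "C1_on W (\<lambda>x. g' x (e5, 0)) D1" and g2: "C1_on W (\<lambda>x. g' x (0, e3)) D2"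
    unfolding D1_def D2_def C1_on_iff_Ck_on by (rule Ck1)+
  have g: "C1_on W g g'"
  proof (rule C1_onI)
    show "(g has_derivative g' x) (at x)" if "x \<in> W" for x
      using diff that unfolding g'_def by (simp add: frechet_derivative_works)
    show "continuous_on W (\<lambda>x. g' x h)" for h
      using C1_on_continuous[of W "\<lambda>x. g' x h"] Ck1[of h] by (metis C1_on_iff_Ck_on)
  qed
  define V where "V = {z. fst z > 0} \<inter> {z. snd z > 0} \<inter> {z. slice8 z \<in> W} \<inter>
     {z. slice8 z \<in> W \<and> (g' (slice8 z) (e5, 0))\<^sup>2 + (g' (slice8 z) (0, e3))\<^sup>2 > 0}"
  have VW: "V \<subseteq> {z. slice8 z \<in> W}" by (auto simp: V_def)
  have sW: "open {z. slice8 z \<in> W}"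
  proof -
    have "continuous_on UNIV slice8" unfolding slice8_def[abs_def] by (intro continuous_intros)
    from open_vimage[OF W(1) this] show ?thesis by (simp add: vimage_def)
  qed
  have "open V"
  proof -
    have "continuous_on {z. slice8 z \<in> W} (\<lambda>z. (g' (slice8 z) (e5, 0))\<^sup>2 + (g' (slice8 z) (0, e3))\<^sup>2)"
      by (intro continuous_intros C1_on_continuous[OF C1_on_compose_slice8[OF g1]] C1_on_continuous[OF C1_on_compose_slice8[OF g2]])
    from continuous_open_preimage[OF this sW, of "{0<..}"]
    have "open {z. slice8 z \<in> W \<and> (g' (slice8 z) (e5, 0))\<^sup>2 + (g' (slice8 z) (0, e3))\<^sup>2 > 0}"
      by (simp add: vimage_def Int_def)
    moreover have "open {z::real \<times> real. fst z > 0}" "open {z::real \<times> real. snd z > 0}"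
      by (intro open_Collect_less continuous_intros)+
    ultimately show ?thesis unfolding V_def using sW by (intro open_Int)
  qed
  have pz: "(fst z *\<^sub>R e5, snd z *\<^sub>R e3) = slice8 z" by (simp add: slice8_def)
  have "g' (slice8 z) (e5, 0) \<noteq> 0 \<or> g' (slice8 z) (0, e3) \<noteq> 0"
    by (rule invariant_gradient_in_slice[OF S(2) W(1) _ SW, where s="fst z" and t="snd z"])
      (use z zS W reg C1_onD(1)[OF g] in \<open>auto simp: pz g'_def\<close>)
  then have zV: "z \<in> V" using z W by (auto simp: V_def sum_power2_gt_zero_iff)
  show "\<exists>V G G1 G2 G1' G2'. open V \<and> z \<in> V \<and> V \<subseteq> {z. fst z > 0 \<and> snd z > 0} \<and>
      C1_on V G (\<lambda>z h. G1 z * fst h + G2 z * snd h) \<and> C1_on V G1 G1' \<and> C1_on V G2 G2' \<and>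
      (\<forall>z\<in>V. (G1 z)\<^sup>2 + (G2 z)\<^sup>2 > 0) \<and> profile S \<inter> V = {z \<in> V. G z = 0} \<and>
      (\<forall>z\<in>V. G z = 0 \<longrightarrow>
        (G1' z (1, 0) + 4 * G1 z / fst z + G2' z (0, 1) + 2 * G2 z / snd z) * ((G1 z)\<^sup>2 + (G2 z)\<^sup>2)
        = (G1 z)\<^sup>2 * G1' z (1, 0) + G1 z * G2 z * (G1' z (0, 1) + G2' z (1, 0)) + (G2 z)\<^sup>2 * G2' z (0, 1))"
  proof (rule exI[of _ V], rule exI[of _ "\<lambda>z. g (slice8 z)"], rule exI[of _ "\<lambda>z. g' (slice8 z) (e5, 0)"],
      rule exI[of _ "\<lambda>z. g' (slice8 z) (0, e3)"],
      rule exI[of _ "\<lambda>z h. D1 (slice8 z) (e5, 0) * fst h + D1 (slice8 z) (0, e3) * snd h"],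
      rule exI[of _ "\<lambda>z h. D2 (slice8 z) (e5, 0) * fst h + D2 (slice8 z) (0, e3) * snd h"],
      intro conjI ballI impI)
    show "C1_on V (\<lambda>z. g (slice8 z)) (\<lambda>z h. g' (slice8 z) (e5, 0) * fst h + g' (slice8 z) (0, e3) * snd h)"
      by (rule C1_on_subset[OF C1_on_compose_slice8[OF g] VW])
    show "C1_on V (\<lambda>z. g' (slice8 z) (e5, 0)) (\<lambda>z h. D1 (slice8 z) (e5, 0) * fst h + D1 (slice8 z) (0, e3) * snd h)"
      by (rule C1_on_subset[OF C1_on_compose_slice8[OF g1] VW])
    show "C1_on V (\<lambda>z. g' (slice8 z) (0, e3)) (\<lambda>z h. D2 (slice8 z) (e5, 0) * fst h + D2 (slice8 z) (0, e3) * snd h)"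
      by (rule C1_on_subset[OF C1_on_compose_slice8[OF g2] VW])
    show "profile S \<inter> V = {z \<in> V. g (slice8 z) = 0}" using SW VW by (auto simp: profile_def)
    fix w assume w: "w \<in> V" "g (slice8 w) = 0"
    have "g' (slice8 w) (e5, 0) \<noteq> 0 \<or> g' (slice8 w) (0, e3) \<noteq> 0"
      using w by (auto simp: V_def)
    from doubly_radial_curvature_eq[OF S(1-3) W(1) SW g g1 g2 _ _ w(2) _ _ this, of "fst w" "snd w"]
    show "(D1 (slice8 w) (e5, 0) * fst (1, 0) + D1 (slice8 w) (0, e3) * snd (1, 0) + 4 * g' (slice8 w) (e5, 0) / fst w
       + (D2 (slice8 w) (e5, 0) * fst (0, 1) + D2 (slice8 w) (0, e3) * snd (0, 1)) + 2 * g' (slice8 w) (0, e3) / snd w) *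
       ((g' (slice8 w) (e5, 0))\<^sup>2 + (g' (slice8 w) (0, e3))\<^sup>2)
      = (g' (slice8 w) (e5, 0))\<^sup>2 * (D1 (slice8 w) (e5, 0) * fst (1, 0) + D1 (slice8 w) (0, e3) * snd (1, 0))
       + g' (slice8 w) (e5, 0) * g' (slice8 w) (0, e3) * (D1 (slice8 w) (e5, 0) * fst (0, 1) + D1 (slice8 w) (0, e3) * snd (0, 1)
         + (D2 (slice8 w) (e5, 0) * fst (1, 0) + D2 (slice8 w) (0, e3) * snd (1, 0)))
       + (g' (slice8 w) (0, e3))\<^sup>2 * (D2 (slice8 w) (e5, 0) * fst (0, 1) + D2 (slice8 w) (0, e3) * snd (0, 1))"
      using w by (simp add: V_def slice8_def)
  qed (use \<open>open V\<close> zV in \<open>auto simp: V_def\<close>)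
qed

section \<open>The profile in logarithmic polar coordinates\<close>

definition polar :: "real \<times> real \<Rightarrow> real \<times> real" where
  "polar z = (exp (fst z) * cos (snd z), exp (fst z) * sin (snd z))"

lemma has_derivative_polar:
  "(polar has_derivative (\<lambda>h. (fst (polar z) * fst h - snd (polar z) * snd h, snd (polar z) * fst h + fst (polar z) * snd h))) (at z)"
proof -
  have 1: "((\<lambda>z::real\<times>real. exp (fst z)) has_derivative (\<lambda>h. fst h * exp (fst z))) (at z)"
    using has_derivative_compose[OF has_derivative_fst[OF has_derivative_ident] DERIV_exp[THEN has_field_derivative_imp_has_derivative]]
    by (simp add: mult.commute)
  have 2: "((\<lambda>z::real\<times>real. cos (snd z)) has_derivative (\<lambda>h. snd h * - sin (snd z))) (at z)"
    using has_derivative_compose[OF has_derivative_snd[OF has_derivative_ident] DERIV_cos[THEN has_field_derivative_imp_has_derivative]]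
    by (simp add: mult.commute)
  have 3: "((\<lambda>z::real\<times>real. sin (snd z)) has_derivative (\<lambda>h. snd h * cos (snd z))) (at z)"
    using has_derivative_compose[OF has_derivative_snd[OF has_derivative_ident] DERIV_sin[THEN has_field_derivative_imp_has_derivative]]
    by (simp add: mult.commute)
  have "(polar has_derivative (\<lambda>h. (exp (fst z) * (snd h * - sin (snd z)) + fst h * exp (fst z) * cos (snd z),
      exp (fst z) * (snd h * cos (snd z)) + fst h * exp (fst z) * sin (snd z)))) (at z)"
    unfolding polar_def[abs_def] by (intro has_derivative_Pair has_derivative_mult 1 2 3)
  then show ?thesis by (simp add: polar_def algebra_simps)
qed

lemma linear_pair_decompose:
  fixes L :: "real \<times> real \<Rightarrow> real"
  assumes "linear L" shows "L (a, b) = a * L (1, 0) + b * L (0, 1)"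
proof -
  have "(a, b) = a *\<^sub>R (1, 0) + b *\<^sub>R (0, 1)" by simp
  then show ?thesis by (simp only: linear_add[OF assms] linear_scale[OF assms] real_scaleR_def)
qed

lemma continuous_on_polar: "continuous_on S polar"
  unfolding polar_def[abs_def] by (intro continuous_intros)

lemma C1_on_compose_polar:
  fixes G :: "real \<times> real \<Rightarrow> real"
  assumes G: "C1_on W G G'" and V: "\<And>z. z \<in> V \<Longrightarrow> polar z \<in> W"
  shows "C1_on V (\<lambda>z. G (polar z)) (\<lambda>z h. (fst (polar z) * fst h - snd (polar z) * snd h) * G' (polar z) (1, 0)
     + (snd (polar z) * fst h + fst (polar z) * snd h) * G' (polar z) (0, 1))"
proof (rule C1_onI)
  fix z assume z: "z \<in> V"
  have d: "(G has_derivative G' (polar z)) (at (polar z))" using C1_onD(1)[OF G V[OF z]] .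
  have l: "linear (G' (polar z))" using d by (rule has_derivative_linear)
  show "((\<lambda>z. G (polar z)) has_derivative (\<lambda>h. (fst (polar z) * fst h - snd (polar z) * snd h) * G' (polar z) (1, 0)
     + (snd (polar z) * fst h + fst (polar z) * snd h) * G' (polar z) (0, 1))) (at z)"
  proof -
    have "(\<lambda>h. G' (polar z) (fst (polar z) * fst h - snd (polar z) * snd h, snd (polar z) * fst h + fst (polar z) * snd h))
      = (\<lambda>h. (fst (polar z) * fst h - snd (polar z) * snd h) * G' (polar z) (1, 0)
     + (snd (polar z) * fst h + fst (polar z) * snd h) * G' (polar z) (0, 1))"
      by (rule ext) (rule linear_pair_decompose[OF l])
    then show ?thesis using has_derivative_compose[OF has_derivative_polar d] by simp
  qed
next
  fix h
  have f: "continuous_on V (\<lambda>z. G' (polar z) v)" for v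
    by (rule continuous_on_compose2[OF C1_onD(2)[OF G] continuous_on_polar]) (use V in auto)
  show "continuous_on V (\<lambda>z. (fst (polar z) * fst h - snd (polar z) * snd h) * G' (polar z) (1, 0)
     + (snd (polar z) * fst h + fst (polar z) * snd h) * G' (polar z) (0, 1))"
    by (intro continuous_intros f continuous_on_polar)
qed

text \<open>\<open>K\<close> is a \<open>C\<^sup>2\<close> defining function of the curve in the coordinates \<open>(w, \<theta>)\<close>, with partial derivatives
\<open>P = dK/dw\<close> and \<open>Q = dK/d\<theta>\<close>. Dilations act by translation of \<open>w\<close>, so the equation has no explicit
\<open>w\<close>.\<close>

definition polar_chart ::
  "real \<Rightarrow> real \<Rightarrow> (real \<times> real) set \<Rightarrow> (real \<times> real) set \<Rightarrow> (real \<times> real \<Rightarrow> real) \<Rightarrow>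
    (real \<times> real \<Rightarrow> real) \<Rightarrow> (real \<times> real \<Rightarrow> real) \<Rightarrow>
    (real \<times> real \<Rightarrow> real \<times> real \<Rightarrow> real) \<Rightarrow> (real \<times> real \<Rightarrow> real \<times> real \<Rightarrow> real) \<Rightarrow> bool" where
  "polar_chart k l \<Sigma> V K P Q P' Q' \<longleftrightarrow> open V \<and>
    C1_on V K (\<lambda>z h. P z * fst h + Q z * snd h) \<and> C1_on V P P' \<and> C1_on V Q Q' \<and>
    (\<forall>z\<in>V. P z \<noteq> 0 \<or> Q z \<noteq> 0) \<and> (\<forall>z\<in>V. polar z \<in> \<Sigma> \<longleftrightarrow> K z = 0) \<and>
    (\<forall>z\<in>V. K z = 0 \<longrightarrow> P z * Q z * (P' z (0, 1) + Q' z (1, 0)) - (P z)\<^sup>2 * Q' z (0, 1) - (Q z)\<^sup>2 * P' z (1, 0)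
       = ((k + l + 1) * P z + (l * cot (snd z) - k * tan (snd z)) * Q z) * ((P z)\<^sup>2 + (Q z)\<^sup>2))"

text \<open>The change of variables at one point, with \<open>(s, t)\<close> the point, \<open>(a, b)\<close> the gradient and \<open>a11, ..., a22\<close> the
Hessian in Cartesian coordinates. The coordinates are
conformal with factor \<open>s\<^sup>2 + t\<^sup>2\<close>, so the curvature of the curve only acquires the extra term
\<open>P (P\<^sup>2 + Q\<^sup>2)\<close>; this raises \<open>k + l\<close> to \<open>k + l + 1\<close>.\<close>

lemma polar_curvature_identity:
  fixes s t :: real
  assumes st: "s > 0" "t > 0"
    and eq: "(a11 + k * a / s + a22 + l * b / t) * (a\<^sup>2 + b\<^sup>2) = a\<^sup>2 * a11 + a * b * (a12 + a21) + b\<^sup>2 * a22"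
  defines "P \<equiv> s * a + t * b" and "Q \<equiv> - t * a + s * b"
    and "Pw \<equiv> s * a + t * b + s * (s * a11 + t * a12) + t * (s * a21 + t * a22)"
    and "Pt \<equiv> - t * a + s * b + s * (- t * a11 + s * a12) + t * (- t * a21 + s * a22)"
    and "Qw \<equiv> - t * a + s * b - t * (s * a11 + t * a12) + s * (s * a21 + t * a22)"
    and "Qt \<equiv> - s * a - t * b - t * (- t * a11 + s * a12) + s * (- t * a21 + s * a22)"
  shows "P * Q * (Pt + Qw) - P\<^sup>2 * Qt - Q\<^sup>2 * Pw = ((k + l + 1) * P + (l * (s / t) - k * (t / s)) * Q) * (P\<^sup>2 + Q\<^sup>2)"
proof -
  define c where "c = b\<^sup>2 * a11 + a\<^sup>2 * a22 - a * b * (a12 + a21)"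
  have c: "c = - (k * a / s + l * b / t) * (a\<^sup>2 + b\<^sup>2)"
    using eq unfolding c_def by (simp add: algebra_simps power2_eq_square)
  have 1: "P * Q * (Pt + Qw) - P\<^sup>2 * Qt - Q\<^sup>2 * Pw = P * (P\<^sup>2 + Q\<^sup>2) - (s\<^sup>2 + t\<^sup>2)\<^sup>2 * c"
    unfolding P_def Q_def Pw_def Pt_def Qw_def Qt_def c_def by algebra
  have 2: "P\<^sup>2 + Q\<^sup>2 = (s\<^sup>2 + t\<^sup>2) * (a\<^sup>2 + b\<^sup>2)"
    unfolding P_def Q_def by algebra
  have 3: "(s\<^sup>2 + t\<^sup>2) * (k * a / s + l * b / t) = (k + l) * P + (l * (s / t) - k * (t / s)) * Q"
    using st unfolding P_def Q_def by (simp add: field_simps power2_eq_square)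
  have "(s\<^sup>2 + t\<^sup>2)\<^sup>2 * c = - ((s\<^sup>2 + t\<^sup>2) * (k * a / s + l * b / t)) * (P\<^sup>2 + Q\<^sup>2)"
  proof -
    have "u\<^sup>2 * (- x * y) = - (u * x) * (u * y)" for u x y :: real by (simp add: power2_eq_square)
    then show ?thesis unfolding c 2 .
  qed
  then show ?thesis unfolding 1 3 by (simp add: algebra_simps)
qed

lemma polar_chart_exists:
  assumes st: "stationary_profile k l \<Sigma>" and z: "polar z \<in> \<Sigma>" "0 < snd z" "snd z < pi / 2"
  obtains V K P Q P' Q' where "polar_chart k l \<Sigma> V K P Q P' Q'" "z \<in> V"
proof -
  have pos: "fst (polar z) > 0" "snd (polar z) > 0"
    using z by (auto simp: polar_def intro!: mult_pos_pos cos_gt_zero sin_gt_zero)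
  then obtain W G G1 G2 G1' G2' where W: "open W" "polar z \<in> W" "W \<subseteq> {z. fst z > 0 \<and> snd z > 0}"
    and G: "C1_on W G (\<lambda>z h. G1 z * fst h + G2 z * snd h)" and G1: "C1_on W G1 G1'" and G2: "C1_on W G2 G2'"
    and nz: "\<forall>z\<in>W. (G1 z)\<^sup>2 + (G2 z)\<^sup>2 > 0" and \<Sigma>: "\<Sigma> \<inter> W = {z \<in> W. G z = 0}"
    and eq: "\<forall>z\<in>W. G z = 0 \<longrightarrow>
        (G1' z (1, 0) + k * G1 z / fst z + G2' z (0, 1) + l * G2 z / snd z) * ((G1 z)\<^sup>2 + (G2 z)\<^sup>2)
        = (G1 z)\<^sup>2 * G1' z (1, 0) + G1 z * G2 z * (G1' z (0, 1) + G2' z (1, 0)) + (G2 z)\<^sup>2 * G2' z (0, 1)"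
    using bspec[OF st[unfolded stationary_profile_def] z(1)] by (elim impE exE conjE) auto
  define V where "V = polar -` W"
  have Vo: "open V" unfolding V_def by (rule open_vimage[OF W(1) continuous_on_polar])
  have zV: "z \<in> V" using W by (simp add: V_def)
  have VW: "polar z \<in> W" if "z \<in> V" for z using that by (simp add: V_def)
  define P where "P = (\<lambda>z. fst (polar z) * G1 (polar z) + snd (polar z) * G2 (polar z))"
  define Q where "Q = (\<lambda>z. - snd (polar z) * G1 (polar z) + fst (polar z) * G2 (polar z))"
  have C1f: "C1_on V (\<lambda>z. fst (polar z)) (\<lambda>z h. fst (polar z) * fst h - snd (polar z) * snd h)"
    and C1s: "C1_on V (\<lambda>z. snd (polar z)) (\<lambda>z h. snd (polar z) * fst h + fst (polar z) * snd h)"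
    using has_derivative_fst[OF has_derivative_polar] has_derivative_snd[OF has_derivative_polar]
    by (auto intro!: C1_onI continuous_intros continuous_on_polar)
  have C1s': "C1_on V (\<lambda>z. - snd (polar z)) (\<lambda>z h. 0 - (snd (polar z) * fst h + fst (polar z) * snd h))"
    using C1_on_diff[OF C1_on_const[of V "0::real"] C1s] by simp
  let ?G1' = "\<lambda>z h. (fst (polar z) * fst h - snd (polar z) * snd h) * G1' (polar z) (1, 0)
     + (snd (polar z) * fst h + fst (polar z) * snd h) * G1' (polar z) (0, 1)"
  let ?G2' = "\<lambda>z h. (fst (polar z) * fst h - snd (polar z) * snd h) * G2' (polar z) (1, 0)
     + (snd (polar z) * fst h + fst (polar z) * snd h) * G2' (polar z) (0, 1)"
  define P' where "P' = (\<lambda>z h. (fst (polar z) * ?G1' z h + (fst (polar z) * fst h - snd (polar z) * snd h) * G1 (polar z))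
     + (snd (polar z) * ?G2' z h + (snd (polar z) * fst h + fst (polar z) * snd h) * G2 (polar z)))"
  define Q' where "Q' = (\<lambda>z h. (- snd (polar z) * ?G1' z h + (0 - (snd (polar z) * fst h + fst (polar z) * snd h)) * G1 (polar z))
     + (fst (polar z) * ?G2' z h + (fst (polar z) * fst h - snd (polar z) * snd h) * G2 (polar z)))"
  have PP: "C1_on V P P'"
    unfolding P_def P'_def by (intro C1_on_add C1_on_mult C1f C1s C1_on_compose_polar[OF G1 VW] C1_on_compose_polar[OF G2 VW])
  have QQ: "C1_on V Q Q'"
    unfolding Q_def Q'_def by (intro C1_on_add C1_on_mult C1f C1s' C1_on_compose_polar[OF G1 VW] C1_on_compose_polar[OF G2 VW])
  have KK: "C1_on V (\<lambda>z. G (polar z)) (\<lambda>z h. P z * fst h + Q z * snd h)"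
  proof -
    have e: "P z * fst h + Q z * snd h = (fst (polar z) * fst h - snd (polar z) * snd h) * (G1 (polar z) * fst (1::real, 0::real) + G2 (polar z) * snd (1::real, 0::real))
      + (snd (polar z) * fst h + fst (polar z) * snd h) * (G1 (polar z) * fst (0::real, 1::real) + G2 (polar z) * snd (0::real, 1::real))" for z h
      by (simp add: P_def Q_def algebra_simps)
    show ?thesis unfolding e by (rule C1_on_compose_polar[OF G VW])
  qed
  have "polar_chart k l \<Sigma> V (\<lambda>z. G (polar z)) P Q P' Q'"
    unfolding polar_chart_def
  proof (intro conjI ballI impI Vo KK PP QQ)
    fix z assume z: "z \<in> V"
    have ps: "fst (polar z) > 0" "snd (polar z) > 0" using VW[OF z] W by auto
    show "polar z \<in> \<Sigma> \<longleftrightarrow> G (polar z) = 0" using \<Sigma> VW[OF z] by blast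
    have "(P z)\<^sup>2 + (Q z)\<^sup>2 = ((fst (polar z))\<^sup>2 + (snd (polar z))\<^sup>2) * ((G1 (polar z))\<^sup>2 + (G2 (polar z))\<^sup>2)"
      unfolding P_def Q_def by algebra
    moreover have "(fst (polar z))\<^sup>2 + (snd (polar z))\<^sup>2 > 0" using ps by (intro add_pos_pos) auto
    moreover have "(G1 (polar z))\<^sup>2 + (G2 (polar z))\<^sup>2 > 0" using nz VW[OF z] by blast
    ultimately have "(P z)\<^sup>2 + (Q z)\<^sup>2 > 0" by simp
    then show "P z \<noteq> 0 \<or> Q z \<noteq> 0" by (auto simp: sum_power2_gt_zero_iff)
    assume "G (polar z) = 0"
    with eq VW[OF z] have E: "(G1' (polar z) (1, 0) + k * G1 (polar z) / fst (polar z) + G2' (polar z) (0, 1) + l * G2 (polar z) / snd (polar z)) *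
        ((G1 (polar z))\<^sup>2 + (G2 (polar z))\<^sup>2) = (G1 (polar z))\<^sup>2 * G1' (polar z) (1, 0) +
        G1 (polar z) * G2 (polar z) * (G1' (polar z) (0, 1) + G2' (polar z) (1, 0)) + (G2 (polar z))\<^sup>2 * G2' (polar z) (0, 1)"
      by blast
    have ct: "fst (polar z) / snd (polar z) = cot (snd z)" "snd (polar z) / fst (polar z) = tan (snd z)"
      by (simp_all add: polar_def cot_def tan_def)
    show "P z * Q z * (P' z (0, 1) + Q' z (1, 0)) - (P z)\<^sup>2 * Q' z (0, 1) - (Q z)\<^sup>2 * P' z (1, 0)
       = ((k + l + 1) * P z + (l * cot (snd z) - k * tan (snd z)) * Q z) * ((P z)\<^sup>2 + (Q z)\<^sup>2)"
      using polar_curvature_identity[OF ps E] unfolding ct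
      by (simp add: P_def Q_def P'_def Q'_def algebra_simps)
  qed
  then show thesis using that zV by blast
qed

section \<open>The profile is a graph over the angle\<close>

text \<open>The differentiability half of the implicit function theorem: continuity of the solution is given,
and the first-order expansion of \<open>K\<close> first bounds \<open>f\<close> by a Lipschitz estimate at \<open>b\<close>.\<close>

lemma implicit_derivative:
  fixes K :: "real \<times> real \<Rightarrow> real" and f :: "real \<Rightarrow> real"
  assumes K: "(K has_derivative (\<lambda>h. P * fst h + Q * snd h)) (at (f b, b))" and P: "P \<noteq> 0"
    and f: "isCont f b" and zero: "\<forall>\<^sub>F x in at b. K (f x, x) = 0" and z0: "K (f b, b) = 0"
  shows "(f has_real_derivative - Q / P) (at b)"
proof -
  have step: "\<forall>\<^sub>F x in at b. \<bar>P * (f x - f b) + Q * (x - b)\<bar> \<le> e * (\<bar>f x - f b\<bar> + \<bar>x - b\<bar>)" if e: "e > 0" for e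
  proof -
    obtain d where d: "d > 0" "\<And>y. norm (y - (f b, b)) < d \<Longrightarrow>
        norm (K y - K (f b, b) - (P * fst (y - (f b, b)) + Q * snd (y - (f b, b)))) \<le> e * norm (y - (f b, b))"
      using K e unfolding has_derivative_at_alt by blast
    have "((\<lambda>x. (f x, x)) \<longlongrightarrow> (f b, b)) (at b)"
      using f by (intro tendsto_Pair) (auto simp: isCont_def)
    then have "\<forall>\<^sub>F x in at b. dist (f x, x) (f b, b) < d" using d(1) by (rule tendstoD)
    with zero show ?thesis
    proof eventually_elim
      case (elim x)
      have "norm ((f x, x) - (f b, b)) < d" using elim(2) by (simp add: dist_norm)
      from d(2)[OF this] have "\<bar>P * (f x - f b) + Q * (x - b)\<bar> \<le> e * norm (f x - f b, x - b)"
        using elim(1) z0 by simp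
      also have "\<dots> \<le> e * (\<bar>f x - f b\<bar> + \<bar>x - b\<bar>)"
        using e norm_Pair_le[of "f x - f b" "x - b"] by simp
      finally show ?case .
    qed
  qed
  define C where "C = 2 * (\<bar>Q\<bar> + \<bar>P\<bar>) / \<bar>P\<bar>"
  have lip: "\<forall>\<^sub>F x in at b. \<bar>f x - f b\<bar> \<le> C * \<bar>x - b\<bar>"
  proof -
    have "\<bar>P\<bar> / 2 > 0" using P by simp
    from step[OF this] show ?thesis
    proof eventually_elim
      case (elim x)
      have "\<bar>P\<bar> * \<bar>f x - f b\<bar> - \<bar>Q\<bar> * \<bar>x - b\<bar> \<le> \<bar>P * (f x - f b) + Q * (x - b)\<bar>"
        using abs_triangle_ineq2[of "P * (f x - f b)" "- (Q * (x - b))"] by (simp add: abs_mult)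
      moreover have "\<bar>P * (f x - f b) + Q * (x - b)\<bar> \<le> \<bar>P\<bar> * \<bar>f x - f b\<bar> / 2 + \<bar>P\<bar> * \<bar>x - b\<bar> / 2"
        using elim by (simp add: distrib_left)
      moreover have "0 \<le> \<bar>P\<bar> * \<bar>x - b\<bar>" by simp
      moreover have "2 * (\<bar>Q\<bar> + \<bar>P\<bar>) * \<bar>x - b\<bar> = 2 * (\<bar>Q\<bar> * \<bar>x - b\<bar>) + 2 * (\<bar>P\<bar> * \<bar>x - b\<bar>)"
        by (simp add: algebra_simps)
      ultimately have "\<bar>P\<bar> * \<bar>f x - f b\<bar> \<le> 2 * (\<bar>Q\<bar> + \<bar>P\<bar>) * \<bar>x - b\<bar>" by linarith
      then show ?case using P by (simp add: C_def field_simps)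
    qed
  qed
  have "((\<lambda>x. (f x - f b) / (x - b)) \<longlongrightarrow> - Q / P) (at b)"
  proof (rule tendstoI)
    fix e :: real assume e: "e > 0"
    define e' where "e' = e * \<bar>P\<bar> / (2 * (\<bar>C\<bar> + 1))"
    have e': "e' > 0" using e P by (simp add: e'_def)
    have "\<forall>\<^sub>F x in at b. x \<noteq> b" by (simp add: eventually_at_filter)
    with step[OF e'] lip show "\<forall>\<^sub>F x in at b. dist ((f x - f b) / (x - b)) (- Q / P) < e"
    proof eventually_elim
      case (elim x)
      let ?q = "(f x - f b) / (x - b)"
      have xb: "\<bar>x - b\<bar> > 0" using elim by simp
      have "\<bar>P * (f x - f b) + Q * (x - b)\<bar> \<le> e' * (\<bar>C\<bar> * \<bar>x - b\<bar> + \<bar>x - b\<bar>)"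
      proof -
        have "\<bar>f x - f b\<bar> \<le> \<bar>C\<bar> * \<bar>x - b\<bar>"
          using elim(2) by (meson abs_ge_self abs_ge_zero mult_right_mono order_trans)
        then have "e' * (\<bar>f x - f b\<bar> + \<bar>x - b\<bar>) \<le> e' * (\<bar>C\<bar> * \<bar>x - b\<bar> + \<bar>x - b\<bar>)" using e' by simp
        then show ?thesis using elim(1) by linarith
      qed
      also have "\<dots> = (e * \<bar>P\<bar> / 2) * \<bar>x - b\<bar>"
      proof -
        have "e' * (\<bar>C\<bar> + 1) = e * \<bar>P\<bar> / 2" unfolding e'_def by (simp add: field_simps)
        moreover have "e' * (\<bar>C\<bar> * \<bar>x - b\<bar> + \<bar>x - b\<bar>) = (e' * (\<bar>C\<bar> + 1)) * \<bar>x - b\<bar>" by (simp add: algebra_simps)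
        ultimately show ?thesis by metis
      qed
      finally have 1: "\<bar>P * (f x - f b) + Q * (x - b)\<bar> \<le> (e * \<bar>P\<bar> / 2) * \<bar>x - b\<bar>" .
      have "P * (f x - f b) + Q * (x - b) = P * (?q - - Q / P) * (x - b)"
        using P xb by (simp add: field_simps)
      with 1 have "\<bar>P\<bar> * \<bar>?q - - Q / P\<bar> * \<bar>x - b\<bar> \<le> (e * \<bar>P\<bar> / 2) * \<bar>x - b\<bar>" by (simp add: abs_mult)
      then have "\<bar>P\<bar> * \<bar>?q - - Q / P\<bar> \<le> e * \<bar>P\<bar> / 2" using xb by (simp only: mult_le_cancel_right_pos)
      then have "\<bar>?q - - Q / P\<bar> \<le> e / 2" using P by (simp add: field_simps)
      then show ?case using e by (simp add: dist_real_def)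
    qed
  qed
  then show ?thesis by (simp add: has_field_derivative_iff)
qed

lemma eventually_slice:
  fixes V :: "(real \<times> real) set"
  assumes "open V" "(a, b) \<in> V"
  shows "\<forall>\<^sub>F x in nhds a. (x, b) \<in> V" "\<forall>\<^sub>F y in nhds b. (a, y) \<in> V"
proof -
  have "((\<lambda>x. (x, b)) \<longlongrightarrow> (a, b)) (nhds a)" "((\<lambda>y. (a, y)) \<longlongrightarrow> (a, b)) (nhds b)"
    by (intro tendsto_Pair tendsto_const filterlim_ident)+
  then show "\<forall>\<^sub>F x in nhds a. (x, b) \<in> V" "\<forall>\<^sub>F y in nhds b. (a, y) \<in> V"
    using assms topological_tendstoD by blast+
qed

lemma eventually_sign:
  fixes K :: "real \<times> real \<Rightarrow> real"
  assumes "open V" "C1_on V K K'" "(a, b) \<in> V" "K (a, b) > (0::real)"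
  shows "\<forall>\<^sub>F y in nhds b. (a, y) \<in> V \<and> K (a, y) > 0"
proof -
  have "open (V \<inter> K -` {0<..})"
    by (rule continuous_open_preimage[OF C1_on_continuous[OF assms(2)] assms(1)]) simp
  moreover have "(a, b) \<in> V \<inter> K -` {0<..}" using assms by simp
  ultimately have "\<forall>\<^sub>F y in nhds b. (a, y) \<in> V \<inter> K -` {0<..}" by (rule eventually_slice(2))
  then show ?thesis by eventually_elim simp
qed

lemma zero_between:
  fixes K :: "real \<times> real \<Rightarrow> real"
  assumes V: "open V" and box: "{a..c} \<times> {y} \<subseteq> V" and K: "C1_on V K K'" and ac: "a \<le> c"
    and sign: "K (a, y) * K (c, y) < (0::real)"
  shows "\<exists>x. a < x \<and> x < c \<and> K (x, y) = 0"
proof -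
  have cont: "continuous_on {a..c} (\<lambda>x. K (x, y))"
    by (rule continuous_on_compose2[OF C1_on_continuous[OF K]]) (use box in \<open>auto intro!: continuous_intros\<close>)
  from sign consider "K (a, y) < 0" "K (c, y) > 0" | "K (a, y) > 0" "K (c, y) < 0"
    by (auto simp: mult_less_0_iff)
  then obtain x where x: "a \<le> x" "x \<le> c" "K (x, y) = 0"
  proof cases
    case 1
    then show ?thesis using IVT'[of "\<lambda>x. K (x, y)" a 0 c] ac cont that by auto
  next
    case 2
    then show ?thesis using IVT2'[of "\<lambda>x. K (x, y)" c 0 a] ac cont that by auto
  qed
  moreover have "x \<noteq> a" "x \<noteq> c" using x(3) sign by auto
  ultimately show ?thesis by (intro exI[of _ x]) auto
qed

text \<open>If \<open>K\<close> has a strict maximum \<open>0\<close> in the first variable and increases in the second, then slightly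
above \<open>b\<close> it is positive in the middle and negative on both sides.\<close>

lemma strict_local_extremum_two_zeros:
  fixes K :: "real \<times> real \<Rightarrow> real"
  assumes V: "open V" "(a, b) \<in> V" and K: "C1_on V K K'" and K0: "K (a, b) = (0::real)"
    and dy: "((\<lambda>y. K (a, y)) has_real_derivative Q) (at b)" "Q > 0"
    and neg: "\<And>e. e > 0 \<Longrightarrow> \<exists>h. 0 < h \<and> h < e \<and> K (a + h, b) < 0 \<and> K (a - h, b) < 0"
    and \<epsilon>: "\<epsilon> > 0"
  shows "\<exists>y x1 x2. b < y \<and> y < b + \<epsilon> \<and> x1 \<noteq> x2 \<and> (x1, y) \<in> V \<and> (x2, y) \<in> V \<and> K (x1, y) = 0 \<and> K (x2, y) = 0"
proof -
  obtain A B where AB: "open A" "open B" "(a, b) \<in> A \<times> B" "A \<times> B \<subseteq> V" using V by (rule open_prod_elim)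
  obtain e where e: "e > 0" "\<And>x. \<bar>x - a\<bar> < e \<Longrightarrow> x \<in> A"
    using AB by (auto simp: open_real)
  obtain h where h: "0 < h" "h < e" "K (a + h, b) < 0" "K (a - h, b) < 0" using neg[OF e(1)] by blast
  have nK: "C1_on V (\<lambda>z. - K z) (\<lambda>z v. 0 - K' z v)" using C1_on_diff[OF C1_on_const[of V "0::real"] K] by simp
  have inV: "(a + h, b) \<in> V" "(a - h, b) \<in> V" using e h AB by auto
  have e1: "\<forall>\<^sub>F y in nhds b. K (a + h, y) < 0" "\<forall>\<^sub>F y in nhds b. K (a - h, y) < 0"
  proof -
    have "- K (a + h, b) > 0" "- K (a - h, b) > 0" using h by simp_all
    from eventually_sign[OF V(1) nK inV(1) this(1)] eventually_sign[OF V(1) nK inV(2) this(2)]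
    show "\<forall>\<^sub>F y in nhds b. K (a + h, y) < 0" "\<forall>\<^sub>F y in nhds b. K (a - h, y) < 0"
      by (eventually_elim, simp)+
  qed
  have e2: "\<forall>\<^sub>F y in nhds b. y \<in> B" using AB by (intro eventually_nhds_in_open) auto
  obtain d where d: "d > 0" "\<And>u. u > 0 \<Longrightarrow> u < d \<Longrightarrow> K (a, b + u) > K (a, b)"
    using DERIV_pos_inc_right[OF dy] by blast
  have e3: "\<forall>\<^sub>F y in at_right b. K (a, y) > 0"
    unfolding eventually_at_right_field
  proof (intro exI[of _ "b + d"] conjI allI impI)
    fix y assume "b < y" "y < b + d"
    then show "0 < K (a, y)" using d(2)[of "y - b"] K0 by simp
  qed (use d in simp)
  have e4: "\<forall>\<^sub>F y in at_right b. y < b + \<epsilon>" "\<forall>\<^sub>F y in at_right b. y > b"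
    using \<epsilon> by (auto intro: eventually_at_right_less eventually_at_rightI[of b "b + \<epsilon>"])
  have "at_right b \<le> nhds b" by (simp add: at_within_le_nhds)
  then have "\<forall>\<^sub>F y in at_right b. K (a + h, y) < 0 \<and> K (a - h, y) < 0 \<and> y \<in> B"
    using e1 e2 by (intro eventually_conj) (rule filter_leD; assumption)+
  with e3 e4 have "\<forall>\<^sub>F y in at_right b. K (a + h, y) < 0 \<and> K (a - h, y) < 0 \<and> y \<in> B \<and> K (a, y) > 0 \<and> y < b + \<epsilon> \<and> y > b"
    by eventually_elim auto
  then obtain y where y: "K (a + h, y) < 0" "K (a - h, y) < 0" "y \<in> B" "K (a, y) > 0" "y < b + \<epsilon>" "y > b"
    using eventually_happens'[OF trivial_limit_at_right_real] by blast
  have "x \<in> A" if "x \<in> {a - h..a + h}" for x using that h by (intro e(2)) auto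
  then have box: "{a - h..a} \<times> {y} \<subseteq> V" "{a..a + h} \<times> {y} \<subseteq> V" using AB(4) y h(1) by auto
  obtain x1 where x1: "a - h < x1" "x1 < a" "K (x1, y) = 0"
    using zero_between[OF V(1) box(1) K] h y by (auto simp: mult_neg_pos)
  obtain x2 where x2: "a < x2" "x2 < a + h" "K (x2, y) = 0"
    using zero_between[OF V(1) box(2) K] h y by (auto simp: mult_pos_neg)
  show ?thesis
    using x1 x2 y box by (intro exI[of _ y] exI[of _ x1] exI[of _ x2]) auto
qed

text \<open>The condition \<open>M_pos\<close> says that the sector lies strictly on one side of the cone, where the slope
\<open>tan \<theta> = sqrt (l / k)\<close> is attained.\<close>

locale polar_graph =
  fixes k l :: real and \<Sigma> :: "(real \<times> real) set" and \<theta>0 :: real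
  assumes stat: "stationary_profile k l \<Sigma>" and \<theta>0: "0 < \<theta>0" "\<theta>0 < pi / 2"
    and M_pos: "\<And>\<theta>. 0 < \<theta> \<Longrightarrow> \<theta> < \<theta>0 \<Longrightarrow> l * cot \<theta> - k * tan \<theta> > 0"
    and unique: "\<And>\<theta>. 0 < \<theta> \<Longrightarrow> \<theta> < \<theta>0 \<Longrightarrow> \<exists>!w. polar (w, \<theta>) \<in> \<Sigma>"
begin

definition w :: "real \<Rightarrow> real" where "w \<theta> = (THE w. polar (w, \<theta>) \<in> \<Sigma>)"

lemma polar_w: "0 < \<theta> \<Longrightarrow> \<theta> < \<theta>0 \<Longrightarrow> polar (w \<theta>, \<theta>) \<in> \<Sigma>"
  unfolding w_def by (rule theI') (rule unique)

lemma w_unique: "0 < \<theta> \<Longrightarrow> \<theta> < \<theta>0 \<Longrightarrow> polar (v, \<theta>) \<in> \<Sigma> \<Longrightarrow> v = w \<theta>"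
  using unique polar_w by blast

definition M :: "real \<Rightarrow> real" where "M \<theta> = l * cot \<theta> - k * tan \<theta>"

lemma chart:
  assumes "0 < \<theta>" "\<theta> < \<theta>0"
  obtains V K P Q P' Q' where "polar_chart k l \<Sigma> V K P Q P' Q'" "(w \<theta>, \<theta>) \<in> V"
proof (rule polar_chart_exists[OF stat, of "(w \<theta>, \<theta>)"])
  show "polar (w \<theta>, \<theta>) \<in> \<Sigma>" by (rule polar_w[OF assms])
qed (use assms \<theta>0 that in auto)

lemma chart_partials:
  assumes ch: "polar_chart k l \<Sigma> V K P Q P' Q'" and z: "(a, b) \<in> V"
  shows "((\<lambda>x. K (x, b)) has_real_derivative P (a, b)) (at a)"
    "((\<lambda>y. K (a, y)) has_real_derivative Q (a, b)) (at b)"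
    "((\<lambda>x. P (x, b)) has_real_derivative P' (a, b) (1, 0)) (at a)"
proof -
  have dx: "((\<lambda>x. (x, b)) has_derivative (\<lambda>h. (h, 0))) (at a)" and dy: "((\<lambda>y. (a, y)) has_derivative (\<lambda>h. (0, h))) (at b)"
    by (intro has_derivative_Pair has_derivative_ident has_derivative_const)+
  have K: "(K has_derivative (\<lambda>h. P (a, b) * fst h + Q (a, b) * snd h)) (at (a, b))"
    and PP: "(P has_derivative P' (a, b)) (at (a, b))"
  proof -
    have "C1_on V K (\<lambda>z h. P z * fst h + Q z * snd h)" "C1_on V P P'"
      using ch unfolding polar_chart_def by simp_all
    from C1_onD(1)[OF this(1) z] C1_onD(1)[OF this(2) z]
    show "(K has_derivative (\<lambda>h. P (a, b) * fst h + Q (a, b) * snd h)) (at (a, b))"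
      "(P has_derivative P' (a, b)) (at (a, b))" .
  qed
  have l: "linear (P' (a, b))" using PP by (rule has_derivative_linear)
  show "((\<lambda>x. K (x, b)) has_real_derivative P (a, b)) (at a)"
    using has_derivative_compose[OF dx K] by (simp add: has_field_derivative_def)
  show "((\<lambda>y. K (a, y)) has_real_derivative Q (a, b)) (at b)"
    using has_derivative_compose[OF dy K] by (simp add: has_field_derivative_def)
  have "(\<lambda>h. P' (a, b) (h, 0)) = (*) (P' (a, b) (1, 0))"
  proof
    show "P' (a, b) (h, 0) = P' (a, b) (1, 0) * h" for h
      using linear_pair_decompose[OF l, of h 0] by (simp add: mult.commute)
  qed
  then show "((\<lambda>x. P (x, b)) has_real_derivative P' (a, b) (1, 0)) (at a)"
    using has_derivative_compose[OF dx PP] by (simp add: has_field_derivative_def)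
qed

text \<open>At a radial tangency the curvature equation gives \<open>dP/dw = - M Q\<close>, so along the ray \<open>K\<close> (with the
sign of \<open>Q\<close>) has a strict maximum with value \<open>0\<close>. Then the rays with slightly larger angle meet the
curve twice.\<close>

lemma no_radial_tangency:
  assumes ch: "polar_chart k l \<Sigma> V K P Q P' Q'" and \<theta>: "0 < \<theta>" "\<theta> < \<theta>0" and z: "(w \<theta>, \<theta>) \<in> V"
  shows "P (w \<theta>, \<theta>) \<noteq> 0"
proof
  assume P0: "P (w \<theta>, \<theta>) = 0"
  let ?z = "(w \<theta>, \<theta>)"
  have V: "open V" and K: "C1_on V K (\<lambda>z h. P z * fst h + Q z * snd h)" and PQ: "\<And>z. z \<in> V \<Longrightarrow> P z \<noteq> 0 \<or> Q z \<noteq> 0"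
    and KS: "\<And>z. z \<in> V \<Longrightarrow> polar z \<in> \<Sigma> \<longleftrightarrow> K z = 0"
    and eq: "\<And>z. z \<in> V \<Longrightarrow> K z = 0 \<Longrightarrow> P z * Q z * (P' z (0, 1) + Q' z (1, 0)) - (P z)\<^sup>2 * Q' z (0, 1) - (Q z)\<^sup>2 * P' z (1, 0)
       = ((k + l + 1) * P z + (l * cot (snd z) - k * tan (snd z)) * Q z) * ((P z)\<^sup>2 + (Q z)\<^sup>2)"
    using ch unfolding polar_chart_def by auto
  have K0: "K ?z = 0" using KS[OF z] polar_w[OF \<theta>] by blast
  have Q0: "Q ?z \<noteq> 0" using PQ[OF z] P0 by blast
  define \<sigma> where "\<sigma> = sgn (Q ?z)"
  have \<sigma>: "\<sigma> * Q ?z = \<bar>Q ?z\<bar>" "\<sigma> = 1 \<or> \<sigma> = -1" using Q0 by (auto simp: \<sigma>_def sgn_if)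
  have Pw: "P' ?z (1, 0) = - M \<theta> * Q ?z"
  proof -
    have "(Q ?z)\<^sup>2 * P' ?z (1, 0) = (Q ?z)\<^sup>2 * (- M \<theta> * Q ?z)"
      using eq[OF z K0] P0 by (simp add: M_def power2_eq_square algebra_simps)
    then show ?thesis using Q0 by (simp only: mult_cancel_left power_eq_0_iff) simp
  qed
  have MQ: "\<sigma> * P' ?z (1, 0) < 0"
  proof -
    have "\<sigma> * P' ?z (1, 0) = - (M \<theta> * \<bar>Q ?z\<bar>)" unfolding Pw \<sigma>(1)[symmetric] by simp
    moreover have "M \<theta> > 0" unfolding M_def by (rule M_pos[OF \<theta>])
    ultimately show ?thesis using Q0 by simp
  qed
  have \<sigma>K: "C1_on V (\<lambda>z. \<sigma> * K z) (\<lambda>z v. \<sigma> * (P z * fst v + Q z * snd v) + 0 * K z)"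
    by (rule C1_on_mult[OF C1_on_const K])
  have dy: "((\<lambda>y. \<sigma> * K (w \<theta>, y)) has_real_derivative \<sigma> * Q ?z) (at \<theta>)"
    by (rule DERIV_cmult[OF chart_partials(2)[OF ch z]])
  have dPx: "((\<lambda>x. \<sigma> * P (x, \<theta>)) has_real_derivative \<sigma> * P' ?z (1, 0)) (at (w \<theta>))"
    by (rule DERIV_cmult[OF chart_partials(3)[OF ch z]])
  have neg: "\<exists>h. 0 < h \<and> h < e \<and> \<sigma> * K (w \<theta> + h, \<theta>) < 0 \<and> \<sigma> * K (w \<theta> - h, \<theta>) < 0" if e: "e > 0" for e
  proof -
    obtain A B where AB: "open A" "open B" "?z \<in> A \<times> B" "A \<times> B \<subseteq> V" using V z by (rule open_prod_elim)
    obtain r where r: "r > 0" "\<And>x. \<bar>x - w \<theta>\<bar> < r \<Longrightarrow> x \<in> A" using AB by (auto simp: open_real)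
    have inV: "(x, \<theta>) \<in> V" if "\<bar>x - w \<theta>\<bar> < r" for x using r(2)[OF that] AB by auto
    obtain d1 where d1: "d1 > 0" "\<And>h. h > 0 \<Longrightarrow> h < d1 \<Longrightarrow> \<sigma> * P (w \<theta> + h, \<theta>) < \<sigma> * P ?z"
      using DERIV_neg_dec_right[OF dPx MQ] by blast
    obtain d2 where d2: "d2 > 0" "\<And>h. h > 0 \<Longrightarrow> h < d2 \<Longrightarrow> \<sigma> * P (w \<theta> - h, \<theta>) > \<sigma> * P ?z"
      using DERIV_neg_dec_left[OF dPx MQ] by blast
    define h where "h = Min {e, r, d1, d2} / 2"
    have h: "0 < h" "h < e" "h < r" "h < d1" "h < d2" using e r(1) d1(1) d2(1) by (auto simp: h_def)
    have dK: "((\<lambda>x. \<sigma> * K (x, \<theta>)) has_real_derivative \<sigma> * P (x, \<theta>)) (at x)" if "\<bar>x - w \<theta>\<bar> < r" for x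
      by (rule DERIV_cmult[OF chart_partials(1)[OF ch inV[OF that]]])
    have ct: "continuous_on {w \<theta> - h..w \<theta> + h} (\<lambda>x. \<sigma> * K (x, \<theta>))"
      by (rule DERIV_continuous_on[where D="\<lambda>x. \<sigma> * P (x, \<theta>)"])
         (rule has_field_derivative_at_within, rule dK, use h in auto)
    have "\<sigma> * K (w \<theta> + h, \<theta>) < \<sigma> * K (w \<theta>, \<theta>)"
    proof (rule DERIV_neg_imp_decreasing_open[of "w \<theta>" "w \<theta> + h"])
      fix x assume "w \<theta> < x" "x < w \<theta> + h"
      then show "\<exists>y. ((\<lambda>x. \<sigma> * K (x, \<theta>)) has_real_derivative y) (at x) \<and> y < 0"
        using dK[of x] d1(2)[of "x - w \<theta>"] h P0 by (intro exI[of _ "\<sigma> * P (x, \<theta>)"]) auto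
    qed (use h continuous_on_subset[OF ct] in auto)
    moreover have "\<sigma> * K (w \<theta> - h, \<theta>) < \<sigma> * K (w \<theta>, \<theta>)"
    proof (rule DERIV_pos_imp_increasing_open[of "w \<theta> - h" "w \<theta>"])
      fix x assume "w \<theta> - h < x" "x < w \<theta>"
      then show "\<exists>y. ((\<lambda>x. \<sigma> * K (x, \<theta>)) has_real_derivative y) (at x) \<and> y > 0"
        using dK[of x] d2(2)[of "w \<theta> - x"] h P0 by (intro exI[of _ "\<sigma> * P (x, \<theta>)"]) auto
    qed (use h continuous_on_subset[OF ct] in auto)
    ultimately show ?thesis using h K0 by (intro exI[of _ h]) auto
  qed
  have "\<sigma> * K ?z = 0" "\<sigma> * Q ?z > 0" "\<theta>0 - \<theta> > 0" using K0 Q0 \<sigma>(1) \<theta> by auto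
  from strict_local_extremum_two_zeros[OF V z \<sigma>K this(1) dy this(2) neg this(3)]
  obtain y x1 x2 where y: "\<theta> < y" "y < \<theta>0" "x1 \<noteq> x2" "(x1, y) \<in> V" "(x2, y) \<in> V" "\<sigma> * K (x1, y) = 0" "\<sigma> * K (x2, y) = 0"
    by auto
  then have "polar (x1, y) \<in> \<Sigma>" "polar (x2, y) \<in> \<Sigma>" using KS \<sigma>(2) by auto
  then show False using w_unique[of y x1] w_unique[of y x2] y \<theta> by auto
qed

text \<open>\<open>K\<close> changes sign along the ray at \<open>w \<theta>\<close>, hence also along nearby rays, which traps the unique zero.\<close>

lemma isCont_w:
  assumes \<theta>: "0 < \<theta>" "\<theta> < \<theta>0"
  shows "isCont w \<theta>"
proof -
  obtain V K P Q P' Q' where ch: "polar_chart k l \<Sigma> V K P Q P' Q'" and z: "(w \<theta>, \<theta>) \<in> V"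
    using chart[OF \<theta>] by blast
  let ?z = "(w \<theta>, \<theta>)"
  have V: "open V" and K: "C1_on V K (\<lambda>z h. P z * fst h + Q z * snd h)"
    and KS: "\<And>z. z \<in> V \<Longrightarrow> polar z \<in> \<Sigma> \<longleftrightarrow> K z = 0"
    using ch unfolding polar_chart_def by auto
  have P0: "P ?z \<noteq> 0" by (rule no_radial_tangency[OF ch \<theta> z])
  have K0: "K ?z = 0" using KS[OF z] polar_w[OF \<theta>] by blast
  define \<sigma> where "\<sigma> = sgn (P ?z)"
  have \<sigma>: "\<sigma> * P ?z > 0" "\<sigma> = 1 \<or> \<sigma> = -1" using P0 by (auto simp: \<sigma>_def sgn_if)
  have dx: "((\<lambda>x. \<sigma> * K (x, \<theta>)) has_real_derivative \<sigma> * P ?z) (at (w \<theta>))"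
    by (rule DERIV_cmult[OF chart_partials(1)[OF ch z]])
  have \<sigma>K: "C1_on V (\<lambda>z. \<sigma> * K z) (\<lambda>z v. \<sigma> * (P z * fst v + Q z * snd v) + 0 * K z)"
    by (rule C1_on_mult[OF C1_on_const K])
  have n\<sigma>K: "C1_on V (\<lambda>z. - (\<sigma> * K z)) (\<lambda>z v. 0 - (\<sigma> * (P z * fst v + Q z * snd v) + 0 * K z))"
    using C1_on_diff[OF C1_on_const[of V "0::real"] \<sigma>K] by simp
  obtain A B where AB: "open A" "open B" "?z \<in> A \<times> B" "A \<times> B \<subseteq> V" using V z by (rule open_prod_elim)
  obtain r where r: "r > 0" "\<And>x. \<bar>x - w \<theta>\<bar> < r \<Longrightarrow> x \<in> A" using AB by (auto simp: open_real)
  have "\<forall>\<^sub>F y in nhds \<theta>. \<bar>w y - w \<theta>\<bar> < e" if e: "e > 0" for e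
  proof -
    obtain d1 where d1: "d1 > 0" "\<And>h. h > 0 \<Longrightarrow> h < d1 \<Longrightarrow> \<sigma> * K (w \<theta> + h, \<theta>) > \<sigma> * K ?z"
      using DERIV_pos_inc_right[OF dx \<sigma>(1)] by blast
    obtain d2 where d2: "d2 > 0" "\<And>h. h > 0 \<Longrightarrow> h < d2 \<Longrightarrow> \<sigma> * K (w \<theta> - h, \<theta>) < \<sigma> * K ?z"
      using DERIV_pos_inc_left[OF dx \<sigma>(1)] by blast
    define h where "h = Min {e, r, d1, d2} / 2"
    have h: "0 < h" "h < e" "h < r" "h < d1" "h < d2" using e r(1) d1(1) d2(1) by (auto simp: h_def)
    have inV: "(w \<theta> + h, \<theta>) \<in> V" "(w \<theta> - h, \<theta>) \<in> V" using r(2) AB h by auto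
    have "\<sigma> * K (w \<theta> + h, \<theta>) > 0" "- (\<sigma> * K (w \<theta> - h, \<theta>)) > 0" using d1(2)[of h] d2(2)[of h] h K0 by auto
    from eventually_sign[OF V \<sigma>K inV(1) this(1)] eventually_sign[OF V n\<sigma>K inV(2) this(2)]
    have "\<forall>\<^sub>F y in nhds \<theta>. \<sigma> * K (w \<theta> + h, y) > 0" "\<forall>\<^sub>F y in nhds \<theta>. - (\<sigma> * K (w \<theta> - h, y)) > 0"
      by (eventually_elim, simp)+
    moreover have "\<forall>\<^sub>F y in nhds \<theta>. y \<in> B" "\<forall>\<^sub>F y in nhds \<theta>. y \<in> {0<..<\<theta>0}"
      by (rule eventually_nhds_in_open, use AB \<theta> in simp, use AB \<theta> in simp)+
    ultimately show ?thesis
    proof eventually_elim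
      case (elim y)
      have "x \<in> A" if "x \<in> {w \<theta> - h..w \<theta> + h}" for x using that h by (intro r(2)) auto
      then have box: "{w \<theta> - h..w \<theta> + h} \<times> {y} \<subseteq> V" using AB(4) elim by auto
      have neg: "(\<sigma> * K (w \<theta> - h, y)) * (\<sigma> * K (w \<theta> + h, y)) < 0" by (rule mult_neg_pos) (use elim in auto)
      then obtain x where x: "w \<theta> - h < x" "x < w \<theta> + h" "\<sigma> * K (x, y) = 0"
        using zero_between[OF V box \<sigma>K _ neg] h by auto
      have "(x, y) \<in> V" using box x by auto
      then have "polar (x, y) \<in> \<Sigma>" using KS x(3) \<sigma>(2) by auto
      then have "x = w y" using w_unique[of y x] elim by auto
      then show ?case using x h by auto
    qed
  qed
  then have "(w \<longlongrightarrow> w \<theta>) (nhds \<theta>)" by (intro tendstoI) (simp add: dist_real_def)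
  then show ?thesis by (simp add: isCont_def tendsto_at_iff_tendsto_nhds)
qed

lemma DERIV_w_chart:
  assumes ch: "polar_chart k l \<Sigma> V K P Q P' Q'" and \<theta>: "0 < \<theta>" "\<theta> < \<theta>0" and z: "(w \<theta>, \<theta>) \<in> V"
  shows "(w has_real_derivative - Q (w \<theta>, \<theta>) / P (w \<theta>, \<theta>)) (at \<theta>)"
proof (rule implicit_derivative)
  have V: "open V" and K: "C1_on V K (\<lambda>z h. P z * fst h + Q z * snd h)"
    and KS: "\<And>z. z \<in> V \<Longrightarrow> polar z \<in> \<Sigma> \<longleftrightarrow> K z = 0"
    using ch unfolding polar_chart_def by auto
  show "(K has_derivative (\<lambda>h. P (w \<theta>, \<theta>) * fst h + Q (w \<theta>, \<theta>) * snd h)) (at (w \<theta>, \<theta>))"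
    by (rule C1_onD(1)[OF K z])
  show "P (w \<theta>, \<theta>) \<noteq> 0" by (rule no_radial_tangency[OF ch \<theta> z])
  show c: "isCont w \<theta>" by (rule isCont_w[OF \<theta>])
  show "K (w \<theta>, \<theta>) = 0" using KS[OF z] polar_w[OF \<theta>] by blast
  have "((\<lambda>x. (w x, x)) \<longlongrightarrow> (w \<theta>, \<theta>)) (at \<theta>)"
    using c by (intro tendsto_Pair) (auto simp: isCont_def)
  then have "\<forall>\<^sub>F x in at \<theta>. (w x, x) \<in> V" using V z by (rule topological_tendstoD)
  moreover have "\<forall>\<^sub>F x in at \<theta>. x \<in> {0<..<\<theta>0}" using \<theta> by (intro eventually_at_in_open') auto
  ultimately show "\<forall>\<^sub>F x in at \<theta>. K (w x, x) = 0"
    by eventually_elim (use KS polar_w in auto)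
qed

definition \<alpha> :: "real \<Rightarrow> real" where "\<alpha> \<theta> = arctan (deriv w \<theta>)"

lemma alpha_bounds: "- (pi / 2) < \<alpha> \<theta>" "\<alpha> \<theta> < pi / 2"
  unfolding \<alpha>_def by (rule arctan_lbound, rule arctan_ubound)

lemma DERIV_w:
  assumes "0 < \<theta>" "\<theta> < \<theta>0"
  shows "(w has_real_derivative tan (\<alpha> \<theta>)) (at \<theta>)"
proof -
  obtain V K P Q P' Q' where "polar_chart k l \<Sigma> V K P Q P' Q'" "(w \<theta>, \<theta>) \<in> V"
    using chart[OF assms] by blast
  from DERIV_w_chart[OF this(1) assms this(2)] show ?thesis
    by (simp add: \<alpha>_def tan_arctan DERIV_imp_deriv)
qed

text \<open>In terms of the angle \<open>\<alpha>\<close> between the curve and the direction of increasing \<open>\<theta>\<close> the curvature equation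
is linear in \<open>tan \<alpha>\<close>: divide the chart form of the equation by \<open>P (P\<^sup>2 + Q\<^sup>2)\<close> and use
\<open>tan \<alpha> = - Q / P\<close>.\<close>

lemma DERIV_alpha:
  assumes \<theta>: "0 < \<theta>" "\<theta> < \<theta>0"
  shows "(\<alpha> has_real_derivative (k + l + 1) - M \<theta> * tan (\<alpha> \<theta>)) (at \<theta>)"
proof -
  obtain V K P Q P' Q' where ch: "polar_chart k l \<Sigma> V K P Q P' Q'" and z: "(w \<theta>, \<theta>) \<in> V"
    using chart[OF \<theta>] by blast
  let ?z = "(w \<theta>, \<theta>)"
  have V: "open V" and PP: "C1_on V P P'" and QQ: "C1_on V Q Q'"
    and KS: "\<And>z. z \<in> V \<Longrightarrow> polar z \<in> \<Sigma> \<longleftrightarrow> K z = 0"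
    and eq: "\<And>z. z \<in> V \<Longrightarrow> K z = 0 \<Longrightarrow> P z * Q z * (P' z (0, 1) + Q' z (1, 0)) - (P z)\<^sup>2 * Q' z (0, 1) - (Q z)\<^sup>2 * P' z (1, 0)
       = ((k + l + 1) * P z + (l * cot (snd z) - k * tan (snd z)) * Q z) * ((P z)\<^sup>2 + (Q z)\<^sup>2)"
    using ch unfolding polar_chart_def by auto
  have P0: "P ?z \<noteq> 0" by (rule no_radial_tangency[OF ch \<theta> z])
  have K0: "K ?z = 0" using KS[OF z] polar_w[OF \<theta>] by blast
  define p q where "p = P ?z" and "q = Q ?z"
  have dw: "(w has_real_derivative - q / p) (at \<theta>)" unfolding p_def q_def by (rule DERIV_w_chart[OF ch \<theta> z])
  have tan\<alpha>: "tan (\<alpha> \<theta>) = - q / p" using DERIV_imp_deriv[OF dw] by (simp add: \<alpha>_def tan_arctan)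
  have curve: "((\<lambda>x. (w x, x)) has_derivative (\<lambda>h. (- q / p * h, h))) (at \<theta>)"
    by (intro has_derivative_Pair has_derivative_ident dw[unfolded has_field_derivative_def])
  have along: "((\<lambda>x. F (w x, x)) has_real_derivative F' ?z (1, 0) * (- q / p) + F' ?z (0, 1)) (at \<theta>)"
    if F: "C1_on V F F'" for F F'
  proof -
    have d: "(F has_derivative F' ?z) (at ?z)" by (rule C1_onD(1)[OF F z])
    have l: "linear (F' ?z)" using d by (rule has_derivative_linear)
    have "(\<lambda>h. F' ?z (- q / p * h, h)) = (*) (F' ?z (1, 0) * (- q / p) + F' ?z (0, 1))"
    proof
      show "F' ?z (- q / p * h, h) = (F' ?z (1, 0) * (- q / p) + F' ?z (0, 1)) * h" for h
        using linear_pair_decompose[OF l, of "- q / p * h" h] by (simp add: algebra_simps)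
    qed
    then show ?thesis using has_derivative_compose[OF curve d] by (simp add: has_field_derivative_def)
  qed
  have "((\<lambda>x. (w x, x)) \<longlongrightarrow> ?z) (at \<theta>)"
    using isCont_w[OF \<theta>] by (intro tendsto_Pair) (auto simp: isCont_def)
  then have "\<forall>\<^sub>F x in at \<theta>. (w x, x) \<in> V" using V z by (rule topological_tendstoD)
  moreover have "\<forall>\<^sub>F x in at \<theta>. x \<in> {0<..<\<theta>0}" using \<theta> by (intro eventually_at_in_open') auto
  ultimately have "\<forall>\<^sub>F x in at \<theta>. \<alpha> x = arctan (- Q (w x, x) / P (w x, x))"
  proof eventually_elim
    case (elim x)
    have "deriv w x = - Q (w x, x) / P (w x, x)"
      by (rule DERIV_imp_deriv[OF DERIV_w_chart[OF ch]]) (use elim in auto)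
    then show ?case by (simp only: \<alpha>_def)
  qed
  then have ev: "\<forall>\<^sub>F x in nhds \<theta>. \<alpha> x = arctan (- Q (w x, x) / P (w x, x))"
    unfolding eventually_nhds_conv_at using DERIV_imp_deriv[OF dw] by (simp add: \<alpha>_def p_def q_def)
  define Pt Qt where "Pt = P' ?z (1, 0) * (- q / p) + P' ?z (0, 1)" and "Qt = Q' ?z (1, 0) * (- q / p) + Q' ?z (0, 1)"
  have "((\<lambda>x. - Q (w x, x) / P (w x, x)) has_real_derivative (- Qt * p - - q * Pt) / (p * p)) (at \<theta>)"
    unfolding Pt_def Qt_def p_def q_def
    by (intro DERIV_divide DERIV_minus along[OF PP, unfolded p_def q_def] along[OF QQ, unfolded p_def q_def] P0)
  from DERIV_chain2[OF DERIV_arctan this]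
  have "((\<lambda>x. arctan (- Q (w x, x) / P (w x, x))) has_real_derivative
      inverse (1 + (- q / p)\<^sup>2) * ((- Qt * p - - q * Pt) / (p * p))) (at \<theta>)"
    by (simp add: p_def q_def)
  then have d: "(\<alpha> has_real_derivative inverse (1 + (- q / p)\<^sup>2) * ((- Qt * p - - q * Pt) / (p * p))) (at \<theta>)"
    using DERIV_cong_ev[OF refl ev refl] by simp
  have p0: "p \<noteq> 0" using P0 by (simp add: p_def)
  have E: "p * q * (P' ?z (0, 1) + Q' ?z (1, 0)) - p\<^sup>2 * Q' ?z (0, 1) - q\<^sup>2 * P' ?z (1, 0)
       = ((k + l + 1) * p + M \<theta> * q) * (p\<^sup>2 + q\<^sup>2)"
    using eq[OF z K0] by (simp add: M_def p_def q_def)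
  have pq: "p\<^sup>2 + q\<^sup>2 > 0" using p0 by (simp add: sum_power2_gt_zero_iff)
  have "(- Qt * p - - q * Pt) * p = ((k + l + 1) * p + M \<theta> * q) * (p\<^sup>2 + q\<^sup>2)"
    unfolding E[symmetric] Pt_def Qt_def using p0 by (simp add: field_simps power2_eq_square)
  then have "- Qt * p - - q * Pt = ((k + l + 1) * p + M \<theta> * q) * (p\<^sup>2 + q\<^sup>2) / p"
    using p0 by (simp add: field_simps)
  then have "inverse (1 + (- q / p)\<^sup>2) * ((- Qt * p - - q * Pt) / (p * p)) = (k + l + 1) - M \<theta> * tan (\<alpha> \<theta>)"
    unfolding tan\<alpha>
  proof -
    assume *: "- Qt * p - - q * Pt = ((k + l + 1) * p + M \<theta> * q) * (p\<^sup>2 + q\<^sup>2) / p"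
    have 1: "inverse (1 + (- q / p)\<^sup>2) = p\<^sup>2 / (p\<^sup>2 + q\<^sup>2)" using p0 pq by (simp add: field_simps)
    have "p\<^sup>2 / (p\<^sup>2 + q\<^sup>2) * (((k + l + 1) * p + M \<theta> * q) * (p\<^sup>2 + q\<^sup>2) / p / (p * p)) = ((k + l + 1) * p + M \<theta> * q) / p"
      using p0 pq by (simp add: power2_eq_square)
    also have "\<dots> = (k + l + 1) - M \<theta> * (- q / p)" using p0 by (simp add: field_simps)
    finally show "inverse (1 + (- q / p)\<^sup>2) * ((- Qt * p - - q * Pt) / (p * p)) = k + l + 1 - M \<theta> * (- q / p)"
      unfolding * 1 .
  qed
  then show ?thesis using d by simp
qed

end

section \<open>The angle equation and comparison with barriers\<close>

lemma nonneg_derivative_mono: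
  fixes F :: "real \<Rightarrow> real"
  assumes d: "\<And>x. a < x \<Longrightarrow> x < b \<Longrightarrow> (F has_real_derivative F' x) (at x)"
    and n: "\<And>x. a < x \<Longrightarrow> x < b \<Longrightarrow> F' x \<ge> 0"
    and xy: "a < x" "x \<le> y" "y < b"
  shows "F x \<le> F y"
proof (rule DERIV_nonneg_imp_nondecreasing[OF xy(2)])
  fix z assume "x \<le> z" "z \<le> y"
  then show "\<exists>y. (F has_real_derivative y) (at z) \<and> y \<ge> 0" using d[of z] n[of z] xy by auto
qed

lemma tendsto_left_mono_le:
  fixes F :: "real \<Rightarrow> real"
  assumes mono: "\<And>x y. a < x \<Longrightarrow> x \<le> y \<Longrightarrow> y < b \<Longrightarrow> F x \<le> F y"
    and lim: "(F \<longlongrightarrow> L) (at_left b)" and x: "a < x" "x < b"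
  shows "F x \<le> L"
proof (rule tendsto_lowerbound[OF lim])
  show "\<forall>\<^sub>F y in at_left b. F x \<le> F y"
    unfolding eventually_at_left_field using mono x by (intro exI[of _ x]) auto
qed simp

text \<open>Both \<open>F - \<kappa>\<close> and \<open>- (F + \<kappa>)\<close> are nondecreasing, and \<open>\<kappa>\<close> tends to \<open>0\<close>.\<close>

lemma derivative_dominated_converges:
  fixes F \<kappa> :: "real \<Rightarrow> real"
  assumes ab: "a < b"
    and F: "\<And>x. a < x \<Longrightarrow> x < b \<Longrightarrow> (F has_real_derivative F' x) (at x)"
    and \<kappa>: "\<And>x. a < x \<Longrightarrow> x < b \<Longrightarrow> (\<kappa> has_real_derivative \<kappa>' x) (at x)"
    and dom: "\<And>x. a < x \<Longrightarrow> x < b \<Longrightarrow> \<bar>F' x\<bar> \<le> - \<kappa>' x"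
    and \<kappa>0: "(\<kappa> \<longlongrightarrow> 0) (at_left b)"
  obtains L where "(F \<longlongrightarrow> L) (at_left b)" "\<And>x. a < x \<Longrightarrow> x < b \<Longrightarrow> \<bar>F x - L\<bar> \<le> \<kappa> x"
proof -
  have up: "F x - \<kappa> x \<le> F y - \<kappa> y" if "a < x" "x \<le> y" "y < b" for x y
  proof (rule nonneg_derivative_mono[where a=a and b=b and F="\<lambda>x. F x - \<kappa> x" and F'="\<lambda>x. F' x - \<kappa>' x"])
    show "((\<lambda>x. F x - \<kappa> x) has_real_derivative F' z - \<kappa>' z) (at z)" if "a < z" "z < b" for z
      by (intro DERIV_diff F \<kappa> that)
    show "F' z - \<kappa>' z \<ge> 0" if "a < z" "z < b" for z using dom[OF that] by linarith
  qed (use that in auto)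
  have dn: "- (F x + \<kappa> x) \<le> - (F y + \<kappa> y)" if "a < x" "x \<le> y" "y < b" for x y
  proof (rule nonneg_derivative_mono[where a=a and b=b and F="\<lambda>x. - (F x + \<kappa> x)" and F'="\<lambda>x. - (F' x + \<kappa>' x)"])
    show "((\<lambda>x. - (F x + \<kappa> x)) has_real_derivative - (F' z + \<kappa>' z)) (at z)" if "a < z" "z < b" for z
      by (intro DERIV_minus DERIV_add F \<kappa> that)
    show "- (F' z + \<kappa>' z) \<ge> 0" if "a < z" "z < b" for z using dom[OF that] by linarith
  qed (use that in auto)
  have k\<kappa>: "- \<kappa> x \<le> - \<kappa> y" if "a < x" "x \<le> y" "y < b" for x y
  proof (rule nonneg_derivative_mono[where a=a and b=b and F="\<lambda>x. - \<kappa> x" and F'="\<lambda>x. - \<kappa>' x"])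
    show "((\<lambda>x. - \<kappa> x) has_real_derivative - \<kappa>' z) (at z)" if "a < z" "z < b" for z
      by (intro DERIV_minus \<kappa> that)
    show "- \<kappa>' z \<ge> 0" if "a < z" "z < b" for z using dom[OF that] by linarith
  qed (use that in auto)
  have nk: "- \<kappa> x \<le> - 0" if "a < x" "x < b" for x
    by (rule tendsto_left_mono_le[where a=a and b=b and F="\<lambda>x. - \<kappa> x", OF k\<kappa> tendsto_minus[OF \<kappa>0] that])
  define c where "c = (a + b) / 2"
  have c: "a < c" "c < b" using ab by (auto simp: c_def)
  define U where "U = (\<lambda>x. F x - \<kappa> x)"
  have bdd: "U x \<le> F c + \<kappa> c" if "a < x" "x < b" for x
  proof (cases "x \<le> c")
    case True
    then show ?thesis using up[of x c] nk[of c] c that by (simp add: U_def)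
  next
    case False
    then show ?thesis using dn[of c x] nk[of x] c that by (simp add: U_def)
  qed
  define L where "L = Sup (U ` {a<..<b})"
  have bA: "bdd_above (U ` {a<..<b})" using bdd by (intro bdd_aboveI2) auto
  have "(U \<longlongrightarrow> L) (at_left b)"
  proof (rule increasing_tendsto)
    show "\<forall>\<^sub>F x in at_left b. U x \<le> L"
      unfolding eventually_at_left_field L_def using ab bA
      by (intro exI[of _ a]) (auto intro!: cSup_upper)
    fix x assume "x < L"
    moreover have "U ` {a<..<b} \<noteq> {}" using ab by simp
    ultimately obtain y where y: "a < y" "y < b" "x < U y"
      unfolding L_def less_cSup_iff[OF \<open>U ` {a<..<b} \<noteq> {}\<close> bA] by auto
    have "x < U z" if "y < z" "z < b" for z
      using up[of y z] y that by (simp add: U_def)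
    then show "\<forall>\<^sub>F z in at_left b. x < U z"
      unfolding eventually_at_left_field using y(2) by blast
  qed
  from tendsto_add[OF this \<kappa>0] have lim: "(F \<longlongrightarrow> L) (at_left b)" by (simp add: U_def)
  moreover have "\<bar>F x - L\<bar> \<le> \<kappa> x" if x: "a < x" "x < b" for x
  proof -
    have "F x - \<kappa> x \<le> L - 0"
      by (rule tendsto_left_mono_le[where a=a and b=b and F="\<lambda>x. F x - \<kappa> x", OF up tendsto_diff[OF lim \<kappa>0] x])
    moreover have "- (F x + \<kappa> x) \<le> - (L + 0)"
      by (rule tendsto_left_mono_le[where a=a and b=b and F="\<lambda>x. - (F x + \<kappa> x)", OF dn tendsto_minus[OF tendsto_add[OF lim \<kappa>0]] x])
    ultimately show ?thesis by linarith
  qed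
  ultimately show thesis using that by blast
qed

lemma arctan_lower_cubic:
  assumes "s \<ge> 0" shows "s - s ^ 3 / 3 \<le> arctan (s::real)" "arctan s \<le> s"
proof -
  have "arctan 0 - 0 + 0 ^ 3 / 3 \<le> arctan s - s + s ^ 3 / 3"
  proof (rule DERIV_nonneg_imp_nondecreasing[OF assms, where f="\<lambda>s. arctan s - s + s ^ 3 / 3"])
    fix x :: real assume "0 \<le> x"
    have "1 + x\<^sup>2 > 0" by (simp add: add_pos_nonneg)
    then have "((\<lambda>s. arctan s - s + s ^ 3 / 3) has_real_derivative x ^ 4 / (1 + x\<^sup>2)) (at x)"
      by (auto intro!: derivative_eq_intros simp: field_simps power2_eq_square power4_eq_xxxx)
    then show "\<exists>y. ((\<lambda>s. arctan s - s + s ^ 3 / 3) has_real_derivative y) (at x) \<and> 0 \<le> y"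
      by (intro exI[of _ "x ^ 4 / (1 + x\<^sup>2)"]) auto
  qed
  then show "s - s ^ 3 / 3 \<le> arctan s" by simp
  have "0 - arctan 0 \<le> s - arctan s"
  proof (rule DERIV_nonneg_imp_nondecreasing[OF assms, where f="\<lambda>s. s - arctan s"])
    fix x :: real
    have "1 + x\<^sup>2 > 0" by (simp add: add_pos_nonneg)
    then have "((\<lambda>s. s - arctan s) has_real_derivative x\<^sup>2 / (1 + x\<^sup>2)) (at x)"
      by (auto intro!: derivative_eq_intros simp: field_simps)
    then show "\<exists>y. ((\<lambda>s. s - arctan s) has_real_derivative y) (at x) \<and> 0 \<le> y"
      by (intro exI[of _ "x\<^sup>2 / (1 + x\<^sup>2)"]) auto
  qed
  then show "arctan s \<le> s" by simp
qed

text \<open>The assumption \<open>tan\<theta>0\<close> says that the ray at angle \<open>\<theta>0\<close> lies on the cone \<open>k |y|\<^sup>2 = l |x|\<^sup>2\<close>, on which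
\<open>M\<close> vanishes.\<close>

locale cone_ode =
  fixes k l \<theta>0 :: real and w \<alpha> :: "real \<Rightarrow> real"
  assumes kl: "k > 0" "l > 0" "k + l = 6" and \<theta>0: "0 < \<theta>0" "\<theta>0 < pi / 2" and tan\<theta>0: "k * (tan \<theta>0)\<^sup>2 = l"
    and \<alpha>_bd: "\<And>\<theta>. 0 < \<theta> \<Longrightarrow> \<theta> < \<theta>0 \<Longrightarrow> \<bar>\<alpha> \<theta>\<bar> < pi / 2"
    and dw: "\<And>\<theta>. 0 < \<theta> \<Longrightarrow> \<theta> < \<theta>0 \<Longrightarrow> (w has_real_derivative tan (\<alpha> \<theta>)) (at \<theta>)"
    and d\<alpha>: "\<And>\<theta>. 0 < \<theta> \<Longrightarrow> \<theta> < \<theta>0 \<Longrightarrow> (\<alpha> has_real_derivative 7 - (l * cot \<theta> - k * tan \<theta>) * tan (\<alpha> \<theta>)) (at \<theta>)"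
begin

definition M :: "real \<Rightarrow> real" where "M \<theta> = l * cot \<theta> - k * tan \<theta>"

text \<open>The volume, up to a constant, of the orbit over the unit vector in direction \<open>\<theta>\<close>; an integrating factor,
\<open>m' = M m\<close>.\<close>

definition m :: "real \<Rightarrow> real" where "m \<theta> = cos \<theta> powr k * sin \<theta> powr l"

abbreviation "t0 \<equiv> tan \<theta>0"

lemma t0_pos: "t0 > 0" using \<theta>0 by (simp add: tan_gt_zero)

lemma sin_cos_pos: "0 < \<theta> \<Longrightarrow> \<theta> \<le> \<theta>0 \<Longrightarrow> sin \<theta> > 0 \<and> cos \<theta> > 0"
  using \<theta>0 by (auto intro!: sin_gt_zero cos_gt_zero_pi)

lemma m_pos: "0 < \<theta> \<Longrightarrow> \<theta> \<le> \<theta>0 \<Longrightarrow> m \<theta> > 0"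
  using sin_cos_pos[of \<theta>] by (simp add: m_def)

lemma DERIV_m:
  assumes "0 < \<theta>" "\<theta> \<le> \<theta>0" shows "(m has_real_derivative m \<theta> * M \<theta>) (at \<theta>)"
proof -
  have p: "sin \<theta> > 0" "cos \<theta> > 0" using sin_cos_pos[OF assms] by auto
  have "((\<lambda>\<theta>. cos \<theta> powr k) has_real_derivative k * cos \<theta> powr (k - 1) * - sin \<theta>) (at \<theta>)"
    using DERIV_powr[OF DERIV_cos p(2) DERIV_const[of k]] p by (simp add: powr_diff field_simps)
  moreover have "((\<lambda>\<theta>. sin \<theta> powr l) has_real_derivative l * sin \<theta> powr (l - 1) * cos \<theta>) (at \<theta>)"
    using DERIV_powr[OF DERIV_sin p(1) DERIV_const[of l]] p by (simp add: powr_diff field_simps)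
  ultimately have "(m has_real_derivative k * cos \<theta> powr (k - 1) * - sin \<theta> * sin \<theta> powr l
      + l * sin \<theta> powr (l - 1) * cos \<theta> * cos \<theta> powr k) (at \<theta>)"
    unfolding m_def[abs_def] by (rule DERIV_mult)
  moreover have "k * cos \<theta> powr (k - 1) * - sin \<theta> * sin \<theta> powr l
      + l * sin \<theta> powr (l - 1) * cos \<theta> * cos \<theta> powr k = m \<theta> * M \<theta>"
    using p by (simp add: m_def M_def powr_diff tan_def cot_def field_simps)
  ultimately show ?thesis by simp
qed

text \<open>Written in terms of the distance \<open>s = tan (\<theta>0 - \<theta>)\<close> from the cone. The first factor \<open>s\<close> is the zero of
\<open>M\<close> on the cone, and the denominator vanishes on the axis.\<close>

lemma M_formula:
  assumes "0 < \<theta>" "\<theta> < \<theta>0"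
  defines "s \<equiv> tan (\<theta>0 - \<theta>)"
  shows "0 < s" "s < t0" "M \<theta> = 6 * s * (2 * t0 + (t0\<^sup>2 - 1) * s) / ((t0 - s) * (1 + t0 * s))"
    "tan \<theta> = (t0 - s) / (1 + t0 * s)"
proof -
  have t: "tan \<theta> > 0" using assms \<theta>0 by (intro tan_gt_zero) auto
  show s: "0 < s" using assms \<theta>0 by (auto simp: s_def intro!: tan_gt_zero)
  show s2: "s < t0" unfolding s_def using assms \<theta>0 by (intro tan_monotone) auto
  have "\<theta> = \<theta>0 - (\<theta>0 - \<theta>)" by simp
  moreover have "tan (\<theta>0 - (\<theta>0 - \<theta>)) = (t0 - s) / (1 + t0 * s)"
    unfolding s_def using assms \<theta>0 by (intro tan_diff) (auto intro!: less_imp_neq[symmetric] cos_gt_zero_pi)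
  ultimately show tt: "tan \<theta> = (t0 - s) / (1 + t0 * s)" by simp
  have d: "t0 - s > 0" "1 + t0 * s > 0" using s s2 t0_pos by (auto intro: add_pos_pos)
  have l: "l = k * t0\<^sup>2" using tan\<theta>0 by simp
  have k6: "k * (1 + t0\<^sup>2) = 6" using kl(3) unfolding l by (simp add: algebra_simps)
  have "M \<theta> = l * ((1 + t0 * s) / (t0 - s)) - k * ((t0 - s) / (1 + t0 * s))"
    unfolding M_def by (simp add: cot_altdef tt)
  also have "\<dots> = k * (t0\<^sup>2 * ((1 + t0 * s) / (t0 - s)) - (t0 - s) / (1 + t0 * s))"
    unfolding l by (simp only: right_diff_distrib mult.assoc)
  also have "t0\<^sup>2 * ((1 + t0 * s) / (t0 - s)) - (t0 - s) / (1 + t0 * s)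
      = (t0\<^sup>2 * (1 + t0 * s)\<^sup>2 - (t0 - s)\<^sup>2) / ((t0 - s) * (1 + t0 * s))"
    using d by (simp add: field_simps power2_eq_square)
  also have "t0\<^sup>2 * (1 + t0 * s)\<^sup>2 - (t0 - s)\<^sup>2 = (1 + t0\<^sup>2) * (s * (2 * t0 + (t0\<^sup>2 - 1) * s))"
    by algebra
  also have "k * ((1 + t0\<^sup>2) * (s * (2 * t0 + (t0\<^sup>2 - 1) * s)) / ((t0 - s) * (1 + t0 * s)))
     = (k * (1 + t0\<^sup>2)) * (s * (2 * t0 + (t0\<^sup>2 - 1) * s)) / ((t0 - s) * (1 + t0 * s))" by simp
  finally show "M \<theta> = 6 * s * (2 * t0 + (t0\<^sup>2 - 1) * s) / ((t0 - s) * (1 + t0 * s))"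
    unfolding k6 by simp
qed

lemma M_pos:
  assumes "0 < \<theta>" "\<theta> < \<theta>0" shows "M \<theta> > 0"
proof -
  note F = M_formula[OF assms]
  have "2 * t0 + (t0\<^sup>2 - 1) * tan (\<theta>0 - \<theta>) > 0"
  proof -
    have "(t0\<^sup>2 - 1) * tan (\<theta>0 - \<theta>) \<ge> - tan (\<theta>0 - \<theta>)"
      using F(1) by (simp add: left_diff_distrib)
    then show ?thesis using F t0_pos by linarith
  qed
  moreover have "1 + t0 * tan (\<theta>0 - \<theta>) > 0" using F t0_pos by (simp add: add_pos_pos)
  ultimately show ?thesis unfolding F(3) using F(1,2) by (intro divide_pos_pos mult_pos_pos) simp_all
qed

lemma m_le: assumes "0 < \<theta>" "\<theta> \<le> \<theta>0" shows "m \<theta> \<le> m \<theta>0"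
proof (rule DERIV_nonneg_imp_nondecreasing[OF assms(2)])
  fix x assume x: "\<theta> \<le> x" "x \<le> \<theta>0"
  have "M x \<ge> 0"
  proof (cases "x = \<theta>0")
    case True
    have "l * cot \<theta>0 = k * tan \<theta>0"
      using t0_pos tan\<theta>0 by (simp add: cot_altdef field_simps power2_eq_square)
    then show ?thesis by (simp add: M_def True)
  next
    case False
    then show ?thesis using M_pos[of x] x assms by simp
  qed
  then show "\<exists>y. (m has_real_derivative y) (at x) \<and> y \<ge> 0"
    using DERIV_m[of x] m_pos[of x] x assms by (intro exI[of _ "m x * M x"]) (auto intro!: mult_nonneg_nonneg)
qed

lemma m_tendsto_0: "(m \<longlongrightarrow> 0) (at_right 0)"
proof -
  have "((\<lambda>\<theta>. sin \<theta> powr l) \<longlongrightarrow> 0 powr l) (at_right 0)"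
  proof (rule tendsto_powr')
    have "((\<lambda>\<theta>::real. sin \<theta>) \<longlongrightarrow> sin 0) (at_right 0)" by (intro tendsto_intros)
    then show "((\<lambda>\<theta>::real. sin \<theta>) \<longlongrightarrow> 0) (at_right 0)" by simp
    have "\<forall>\<^sub>F x in at_right 0. 0 \<le> sin (x::real)"
      unfolding eventually_at_right_field by (intro exI[of _ pi]) (auto intro!: sin_ge_zero)
    then show "(0::real) \<noteq> 0 \<or> 0 < l \<and> (\<forall>\<^sub>F x in at_right 0. 0 \<le> sin (x::real))" using kl by simp
  qed auto
  moreover have "((\<lambda>\<theta>. cos \<theta> powr k) \<longlongrightarrow> cos 0 powr k) (at_right 0)"
    by (intro tendsto_intros) auto
  ultimately have "((\<lambda>\<theta>. cos \<theta> powr k * sin \<theta> powr l) \<longlongrightarrow> cos 0 powr k * 0 powr l) (at_right 0)"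
    by (intro tendsto_mult)
  then show ?thesis unfolding m_def[abs_def] by simp
qed

text \<open>Up to the factor \<open>exp (7 w)\<close>, the flux of the dilation field across the orbit over \<open>\<theta>\<close>, whose growth is
\<open>7\<close> times the area. So \<open>M\<close>, which is singular at the axis, drops out of its derivative, and its
limit at the axis serves as the boundary condition.\<close>

definition j :: "real \<Rightarrow> real" where "j \<theta> = m \<theta> * sin (\<alpha> \<theta>)"

lemma cos_alpha_pos: "0 < \<theta> \<Longrightarrow> \<theta> < \<theta>0 \<Longrightarrow> cos (\<alpha> \<theta>) > 0"
  using \<alpha>_bd[of \<theta>] by (intro cos_gt_zero_pi) auto

lemma DERIV_j:
  assumes "0 < \<theta>" "\<theta> < \<theta>0" shows "(j has_real_derivative 7 * m \<theta> * cos (\<alpha> \<theta>)) (at \<theta>)"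
proof -
  have "((\<lambda>\<theta>. sin (\<alpha> \<theta>)) has_real_derivative cos (\<alpha> \<theta>) * (7 - M \<theta> * tan (\<alpha> \<theta>))) (at \<theta>)"
    unfolding M_def by (rule DERIV_fun_sin[OF d\<alpha>[OF assms]])
  from DERIV_mult[OF DERIV_m this, of] assms
  have "(j has_real_derivative m \<theta> * M \<theta> * sin (\<alpha> \<theta>) + cos (\<alpha> \<theta>) * (7 - M \<theta> * tan (\<alpha> \<theta>)) * m \<theta>) (at \<theta>)"
    unfolding j_def[abs_def] by simp
  moreover have "m \<theta> * M \<theta> * sin (\<alpha> \<theta>) + cos (\<alpha> \<theta>) * (7 - M \<theta> * tan (\<alpha> \<theta>)) * m \<theta> = 7 * m \<theta> * cos (\<alpha> \<theta>)"
    using cos_alpha_pos[OF assms] by (simp add: tan_def field_simps)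
  ultimately show ?thesis by simp
qed

lemma j_strict_mono:
  assumes "0 < x" "x < y" "y < \<theta>0" shows "j x < j y"
proof (rule DERIV_pos_imp_increasing[OF assms(2)])
  fix z assume "x \<le> z" "z \<le> y"
  then have z: "0 < z" "z < \<theta>0" using assms by auto
  then show "\<exists>u. (j has_real_derivative u) (at z) \<and> 0 < u"
    using DERIV_j[OF z] cos_alpha_pos[OF z] m_pos[of z] by (intro exI[of _ "7 * m z * cos (\<alpha> z)"]) auto
qed

lemma j_tendsto_0: "(j \<longlongrightarrow> 0) (at_right 0)"
proof (rule Lim_null_comparison[OF _ m_tendsto_0])
  show "\<forall>\<^sub>F x in at_right 0. norm (j x) \<le> m x"
    unfolding eventually_at_right_field
  proof (intro exI[of _ \<theta>0] conjI allI impI \<theta>0)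
    fix y assume "0 < y" "y < \<theta>0"
    then show "norm (j y) \<le> m y"
      using m_pos[of y] abs_sin_le_one[of "\<alpha> y"] by (simp add: j_def abs_mult)
  qed
qed

text \<open>\<open>j\<close> increases from its limit \<open>0\<close> at the axis; hence \<open>w\<close> is increasing in \<open>\<theta>\<close>.\<close>

lemma j_pos: assumes "0 < \<theta>" "\<theta> < \<theta>0" shows "j \<theta> > 0"
proof -
  have "0 \<le> j (\<theta> / 2)"
  proof (rule tendsto_upperbound[OF j_tendsto_0])
    show "\<forall>\<^sub>F x in at_right 0. j x \<le> j (\<theta> / 2)"
      unfolding eventually_at_right_field
      by (intro exI[of _ "\<theta> / 2"]) (use assms j_strict_mono[of _ "\<theta> / 2"] in \<open>auto intro: less_imp_le\<close>)
  qed simp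
  also have "\<dots> < j \<theta>" using assms by (intro j_strict_mono) auto
  finally show ?thesis .
qed

lemma sin_alpha_pos: "0 < \<theta> \<Longrightarrow> \<theta> < \<theta>0 \<Longrightarrow> sin (\<alpha> \<theta>) > 0"
  using j_pos[of \<theta>] m_pos[of \<theta>] by (simp add: j_def zero_less_mult_iff)

text \<open>The cotangent of \<open>\<alpha>\<close>, the slope \<open>d\<theta>/dw\<close>; it is small near the cone, where the curve becomes radial.\<close>

definition T :: "real \<Rightarrow> real" where "T \<theta> = cos (\<alpha> \<theta>) / sin (\<alpha> \<theta>)"

lemma T_pos: "0 < \<theta> \<Longrightarrow> \<theta> < \<theta>0 \<Longrightarrow> T \<theta> > 0"
  using sin_alpha_pos cos_alpha_pos by (simp add: T_def)

lemma DERIV_w_T: "0 < \<theta> \<Longrightarrow> \<theta> < \<theta>0 \<Longrightarrow> (w has_real_derivative 1 / T \<theta>) (at \<theta>)"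
  using dw[of \<theta>] by (simp add: T_def tan_def)

lemma DERIV_T:
  assumes "0 < \<theta>" "\<theta> < \<theta>0"
  shows "(T has_real_derivative - (1 + (T \<theta>)\<^sup>2) * (7 - M \<theta> / T \<theta>)) (at \<theta>)"
proof -
  have s: "sin (\<alpha> \<theta>) > 0" "cos (\<alpha> \<theta>) > 0" using sin_alpha_pos cos_alpha_pos assms by auto
  let ?a = "7 - M \<theta> * tan (\<alpha> \<theta>)"
  have "((\<lambda>\<theta>. cos (\<alpha> \<theta>) / sin (\<alpha> \<theta>)) has_real_derivative
      ((- sin (\<alpha> \<theta>) * ?a) * sin (\<alpha> \<theta>) - cos (\<alpha> \<theta>) * (cos (\<alpha> \<theta>) * ?a)) / (sin (\<alpha> \<theta>) * sin (\<alpha> \<theta>))) (at \<theta>)"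
    unfolding M_def using s by (intro DERIV_divide DERIV_fun_sin DERIV_fun_cos d\<alpha>[OF assms]) auto
  moreover have "((- sin (\<alpha> \<theta>) * ?a) * sin (\<alpha> \<theta>) - cos (\<alpha> \<theta>) * (cos (\<alpha> \<theta>) * ?a)) / (sin (\<alpha> \<theta>) * sin (\<alpha> \<theta>))
     = - (1 + (T \<theta>)\<^sup>2) * ?a"
  proof -
    have "((- S * a) * S - C * (C * a)) / (S * S) = - (1 + (C / S)\<^sup>2) * a" if "S \<noteq> 0" for S C a :: real
      using that by (simp add: field_simps power2_eq_square)
    from this[of "sin (\<alpha> \<theta>)" ?a "cos (\<alpha> \<theta>)"] show ?thesis using s unfolding T_def by simp
  qed
  moreover have "M \<theta> * tan (\<alpha> \<theta>) = M \<theta> / T \<theta>" by (simp add: T_def tan_def)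
  ultimately show ?thesis unfolding T_def[abs_def] by simp
qed

lemma j_eq_m_over_sqrt: "0 < \<theta> \<Longrightarrow> \<theta> < \<theta>0 \<Longrightarrow> j \<theta> = m \<theta> / sqrt (1 + (T \<theta>)\<^sup>2)"
proof -
  assume a: "0 < \<theta>" "\<theta> < \<theta>0"
  have s: "sin (\<alpha> \<theta>) > 0" using sin_alpha_pos a by auto
  have "1 + (T \<theta>)\<^sup>2 = (1 / sin (\<alpha> \<theta>))\<^sup>2"
    using s by (simp add: T_def power_divide field_simps)
  then have "sqrt (1 + (T \<theta>)\<^sup>2) = 1 / sin (\<alpha> \<theta>)" using s by simp
  then show ?thesis by (simp add: j_def)
qed

text \<open>\<open>J = m / sqrt (1 + B\<^sup>2)\<close> is the quantity that \<open>j\<close> would be if \<open>B\<close> were the solution, and it depends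
monotonically on \<open>B\<close>. The inequality for \<open>B\<close> makes \<open>\<sigma> (j - J)\<close> nondecreasing wherever it is
negative, but it tends to \<open>0\<close> at the axis, so it is never negative. The sign \<open>\<sigma>\<close> selects upper or
lower barriers.\<close>

lemma comparison:
  fixes B B' :: "real \<Rightarrow> real" and \<sigma> :: real
  assumes \<sigma>: "\<sigma> = 1 \<or> \<sigma> = -1"
    and B: "\<And>\<theta>. 0 < \<theta> \<Longrightarrow> \<theta> < \<theta>0 \<Longrightarrow> B \<theta> > 0"
    and dB: "\<And>\<theta>. 0 < \<theta> \<Longrightarrow> \<theta> < \<theta>0 \<Longrightarrow> (B has_real_derivative - B' \<theta>) (at \<theta>)"
    and ineq: "\<And>\<theta>. 0 < \<theta> \<Longrightarrow> \<theta> < \<theta>0 \<Longrightarrow> \<sigma> * B' \<theta> \<le> \<sigma> * ((1 + (B \<theta>)\<^sup>2) * (7 - M \<theta> / B \<theta>))"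
    and \<theta>: "0 < \<theta>" "\<theta> < \<theta>0"
  shows "\<sigma> * T \<theta> \<le> \<sigma> * B \<theta>"
proof -
  define J where "J = (\<lambda>\<theta>. m \<theta> / sqrt (1 + (B \<theta>)\<^sup>2))"
  have p1: "1 + x\<^sup>2 > 0" for x :: real by (simp add: add_pos_nonneg)
  have JT: "\<sigma> * (j x - J x) < 0 \<longleftrightarrow> \<sigma> * T x > \<sigma> * B x" if x: "0 < x" "x < \<theta>0" for x
  proof -
    have *: "m x / sqrt (1 + u\<^sup>2) < m x / sqrt (1 + v\<^sup>2) \<longleftrightarrow> v < u" if "u > 0" "v > 0" for u v
    proof -
      have "(c / a < c / b) = (b < a)" if "c > 0" "a > 0" "b > 0" for a b c :: real
        using that by (simp add: field_simps)
      then have "m x / sqrt (1 + u\<^sup>2) < m x / sqrt (1 + v\<^sup>2) \<longleftrightarrow> sqrt (1 + v\<^sup>2) < sqrt (1 + u\<^sup>2)"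
        using m_pos[of x] x p1[of u] p1[of v] by simp
      also have "\<dots> \<longleftrightarrow> v\<^sup>2 < u\<^sup>2" by simp
      also have "\<dots> \<longleftrightarrow> v < u" using that by (auto intro: power2_less_imp_less power_strict_mono)
      finally show ?thesis .
    qed
    show ?thesis using \<sigma> *[OF T_pos[OF x] B[OF x]] *[OF B[OF x] T_pos[OF x]]
      by (auto simp: j_eq_m_over_sqrt[OF x] J_def)
  qed
  have dJ: "(J has_real_derivative m x / sqrt (1 + (B x)\<^sup>2) * (M x + B x * B' x / (1 + (B x)\<^sup>2))) (at x)"
    if x: "0 < x" "x < \<theta>0" for x
  proof -
    have dq: "((\<lambda>x. sqrt (1 + (B x)\<^sup>2)) has_real_derivative (2 * B x * - B' x) * (inverse (sqrt (1 + (B x)\<^sup>2)) / 2)) (at x)"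
    proof -
      have d1: "((\<lambda>x. 1 + (B x)\<^sup>2) has_real_derivative 2 * B x * - B' x) (at x)"
        by (auto intro!: derivative_eq_intros dB[OF x])
      show ?thesis
        using DERIV_chain2[where f=sqrt and g="\<lambda>x. 1 + (B x)\<^sup>2", OF DERIV_real_sqrt[OF p1] d1] by (simp add: mult.commute)
    qed
    have "(J has_real_derivative (m x * M x * sqrt (1 + (B x)\<^sup>2) - m x * ((2 * B x * - B' x) * (inverse (sqrt (1 + (B x)\<^sup>2)) / 2)))
      / (sqrt (1 + (B x)\<^sup>2) * sqrt (1 + (B x)\<^sup>2))) (at x)"
      unfolding J_def using x p1[of "B x"] by (intro DERIV_divide DERIV_m dq) auto
    moreover have "(m x * M x * sqrt (1 + (B x)\<^sup>2) - m x * ((2 * B x * - B' x) * (inverse (sqrt (1 + (B x)\<^sup>2)) / 2)))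
      / (sqrt (1 + (B x)\<^sup>2) * sqrt (1 + (B x)\<^sup>2)) = m x / sqrt (1 + (B x)\<^sup>2) * (M x + B x * B' x / (1 + (B x)\<^sup>2))"
    proof -
      define q where "q = sqrt (1 + (B x)\<^sup>2)"
      have q: "q > 0" "1 + (B x)\<^sup>2 = q * q" using p1[of "B x"] by (auto simp: q_def)
      show ?thesis unfolding q_def[symmetric] unfolding q(2) using q(1) by (simp add: field_simps)
    qed
    ultimately show ?thesis by simp
  qed
  show ?thesis
  proof (rule ccontr)
    assume "\<not> ?thesis"
    then have neg: "\<sigma> * (j \<theta> - J \<theta>) < 0" using JT[OF \<theta>] by simp
    define D where "D = (\<lambda>x. \<sigma> * (j x - J x))"
    have dD: "(D has_real_derivative \<sigma> * (7 * m x * cos (\<alpha> x) - m x / sqrt (1 + (B x)\<^sup>2) * (M x + B x * B' x / (1 + (B x)\<^sup>2)))) (at x)"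
      if "0 < x" "x < \<theta>0" for x
      unfolding D_def by (intro DERIV_cmult DERIV_diff DERIV_j dJ that)
    have D': "\<sigma> * (7 * m x * cos (\<alpha> x) - m x / sqrt (1 + (B x)\<^sup>2) * (M x + B x * B' x / (1 + (B x)\<^sup>2))) \<ge> 0"
      if x: "0 < x" "x < \<theta>0" and Dx: "D x < 0" for x
    proof -
      have s: "sin (\<alpha> x) > 0" using sin_alpha_pos x by auto
      have jm: "sin (\<alpha> x) = 1 / sqrt (1 + (T x)\<^sup>2)"
      proof -
        have "m x * sin (\<alpha> x) = m x * (1 / sqrt (1 + (T x)\<^sup>2))" using j_eq_m_over_sqrt[OF x] by (simp add: j_def)
        then show ?thesis using m_pos[of x] x by (simp only: mult_cancel_left) simp
      qed
      have "cos (\<alpha> x) = T x * sin (\<alpha> x)" using s by (simp add: T_def)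
      then have cT: "cos (\<alpha> x) = T x / sqrt (1 + (T x)\<^sup>2)" by (simp add: jm)
      have mono: "u / sqrt (1 + u\<^sup>2) \<le> v / sqrt (1 + v\<^sup>2)" if uv: "0 < u" "u \<le> v" for u v :: real
      proof -
        have "(u * sqrt (1 + v\<^sup>2))\<^sup>2 \<le> (v * sqrt (1 + u\<^sup>2))\<^sup>2"
          using uv p1[of u] p1[of v] by (simp add: power_mult_distrib algebra_simps power_mono)
        then have "u * sqrt (1 + v\<^sup>2) \<le> v * sqrt (1 + u\<^sup>2)"
          by (rule power2_le_imp_le) (use uv p1[of u] in auto)
        then show ?thesis using p1[of u] p1[of v] by (simp add: field_simps)
      qed
      have 1: "\<sigma> * cos (\<alpha> x) \<ge> \<sigma> * (B x / sqrt (1 + (B x)\<^sup>2))"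
      proof -
        have "\<sigma> * T x > \<sigma> * B x" using JT[OF x] Dx by (simp add: D_def)
        then show ?thesis unfolding cT using \<sigma> mono[of "B x" "T x"] mono[of "T x" "B x"] B[OF x] T_pos[OF x] by auto
      qed
      have 2: "\<sigma> * (M x + B x * B' x / (1 + (B x)\<^sup>2)) \<le> \<sigma> * (7 * B x)"
      proof -
        have "\<sigma> * B' x * (B x / (1 + (B x)\<^sup>2)) \<le> \<sigma> * ((1 + (B x)\<^sup>2) * (7 - M x / B x)) * (B x / (1 + (B x)\<^sup>2))"
          using B[OF x] p1[of "B x"] by (intro mult_right_mono ineq[OF x]) auto
        also have "\<dots> = \<sigma> * (7 * B x - M x)"
        proof -
          have "\<sigma> * (u * (7 - c / b)) * (b / u) = \<sigma> * (7 * b - c)" if "u > 0" "b > 0" for u b c :: real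
            using that by (simp add: field_simps)
          then show ?thesis using B[OF x] p1[of "B x"] by blast
        qed
        finally show ?thesis by (simp add: algebra_simps)
      qed
      have "\<sigma> * (m x / sqrt (1 + (B x)\<^sup>2) * (M x + B x * B' x / (1 + (B x)\<^sup>2)))
         = m x / sqrt (1 + (B x)\<^sup>2) * (\<sigma> * (M x + B x * B' x / (1 + (B x)\<^sup>2)))" by simp
      also have "\<dots> \<le> m x / sqrt (1 + (B x)\<^sup>2) * (\<sigma> * (7 * B x))"
        using m_pos[of x] x p1[of "B x"] by (intro mult_left_mono 2) auto
      also have "\<dots> = 7 * m x * (\<sigma> * (B x / sqrt (1 + (B x)\<^sup>2)))" by simp
      also have "\<dots> \<le> 7 * m x * (\<sigma> * cos (\<alpha> x))" using m_pos[of x] x by (intro mult_left_mono 1) auto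
      finally show ?thesis by (simp add: right_diff_distrib mult.left_commute)
    qed
    \<comment> \<open>look at the last point before \<open>\<theta>\<close> where \<open>D\<close> is above the smaller of \<open>D x\<close> and \<open>D \<theta> / 2\<close>; from there on
      \<open>D\<close> is negative, hence nondecreasing\<close>
    have Dn: "D x \<le> D \<theta>" if x: "0 < x" "x \<le> \<theta>" for x
    proof (rule ccontr)
      assume "\<not> D x \<le> D \<theta>"
      then have gt: "D x > D \<theta>" by simp
      have cD: "continuous_on {x..\<theta>} D"
        by (rule DERIV_continuous_on) (rule has_field_derivative_at_within, rule dD, use x \<theta> in auto)
      have c: "D \<theta> < min (D x) (D \<theta> / 2)" using gt neg by (simp add: D_def)
      define A where "A = {y \<in> {x..\<theta>}. D y \<ge> min (D x) (D \<theta> / 2)}"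
      have "closed A"
      proof -
        have "A = {x..\<theta>} \<inter> D -` {min (D x) (D \<theta> / 2)..}" by (auto simp: A_def)
        then show ?thesis using continuous_closed_preimage[OF cD closed_atLeastAtMost closed_atLeast] by simp
      qed
      moreover have "x \<in> A" "bdd_above A" using x by (auto simp: A_def intro: bdd_aboveI[of _ \<theta>])
      ultimately have SA: "Sup A \<in> A" using closed_contains_Sup by blast
      define y where "y = Sup A"
      have y: "x \<le> y" "y \<le> \<theta>" "D y \<ge> min (D x) (D \<theta> / 2)" using SA by (auto simp: A_def y_def)
      have "y \<noteq> \<theta>" using y(3) c by auto
      then have yt: "y < \<theta>" using y by simp
      have below: "D z < 0" if z: "y < z" "z \<le> \<theta>" for z
      proof -
        have "z \<notin> A" using z cSup_upper[OF _ \<open>bdd_above A\<close>, of z] by (auto simp: y_def)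
        then have "D z < min (D x) (D \<theta> / 2)" using z y by (auto simp: A_def)
        then show ?thesis using neg by (simp add: D_def min_less_iff_disj)
      qed
      have "D y \<le> D \<theta>"
      proof (rule DERIV_nonneg_imp_increasing_open[of y \<theta> D])
        fix z assume "y < z" "z < \<theta>"
        then show "\<exists>u. (D has_real_derivative u) (at z) \<and> 0 \<le> u"
          using dD[of z] D'[of z] below[of z] x y \<theta> by (intro exI) auto
      qed (use yt y continuous_on_subset[OF cD] in auto)
      then show False using y(3) c by linarith
    qed
    have "(J \<longlongrightarrow> 0) (at_right 0)"
    proof (rule Lim_null_comparison[OF _ m_tendsto_0])
      show "\<forall>\<^sub>F x in at_right 0. norm (J x) \<le> m x"
        unfolding eventually_at_right_field
      proof (intro exI[of _ \<theta>0] conjI allI impI \<theta>0)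
        fix y assume "0 < y" "y < \<theta>0"
        then have "m y > 0" by (simp add: m_pos)
        moreover have "sqrt (1 + (B y)\<^sup>2) \<ge> 1" by simp
        ultimately have "m y / sqrt (1 + (B y)\<^sup>2) \<le> m y / 1" using p1[of "B y"] by (intro divide_left_mono) auto
        moreover have "m y / sqrt (1 + (B y)\<^sup>2) \<ge> 0" using \<open>m y > 0\<close> p1[of "B y"] by simp
        ultimately show "norm (J y) \<le> m y" unfolding J_def by simp
      qed
    qed
    then have "(D \<longlongrightarrow> \<sigma> * (0 - 0)) (at_right 0)" unfolding D_def by (intro tendsto_intros j_tendsto_0)
    then have "\<sigma> * (0 - 0) \<le> D \<theta>"
    proof (rule tendsto_upperbound)
      show "\<forall>\<^sub>F x in at_right 0. D x \<le> D \<theta>"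
        unfolding eventually_at_right_field using Dn \<theta> by (intro exI[of _ \<theta>]) auto
    qed simp
    then show False using neg by (simp add: D_def)
  qed
qed

end

section \<open>Asymptotics at the cone\<close>

text \<open>The part of the curve far from the origin is the normal graph of \<open>r f(r)\<close> over the cone: the point
over radius \<open>r\<close> lies at angle \<open>\<theta>0 - arctan (f r)\<close> and at distance \<open>r sqrt (1 + f(r)\<^sup>2)\<close>.\<close>

locale cone_graph = cone_ode +
  fixes f :: "real \<Rightarrow> real" and R1 :: real
  assumes f_cont: "continuous_on {R1<..} f"
    and f_lim: "((\<lambda>r. f r * r ^ 3) \<longlongrightarrow> 1) at_top"
    and graph: "\<And>r. r > R1 \<Longrightarrow> f r > 0 \<Longrightarrow> arctan (f r) < \<theta>0 \<Longrightarrow> w (\<theta>0 - arctan (f r)) = ln (r * sqrt (1 + (f r)\<^sup>2))"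
begin

lemma f_eventually: "\<forall>\<^sub>F r in at_top. r > 1 \<and> r > R1 \<and> 1 / (2 * r ^ 3) \<le> f r \<and> f r \<le> 2 / r ^ 3 \<and> f r < e" if "e > 0" for e
proof -
  have "\<forall>\<^sub>F r in at_top. f r * r ^ 3 > 1 / 2" "\<forall>\<^sub>F r in at_top. f r * r ^ 3 < 2"
    using order_tendstoD(1)[OF f_lim, of "1/2"] order_tendstoD(2)[OF f_lim, of 2] by simp_all
  moreover have "\<forall>\<^sub>F r::real in at_top. 2 / r ^ 3 < e"
  proof -
    have "((\<lambda>r::real. 2 / r ^ 3) \<longlongrightarrow> 0) at_top"
      by (intro real_tendsto_divide_at_top[OF tendsto_const] filterlim_pow_at_top filterlim_ident) auto
    then show ?thesis using that by (rule order_tendstoD(2))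
  qed
  moreover have "\<forall>\<^sub>F r::real in at_top. r > 1" "\<forall>\<^sub>F r::real in at_top. r > R1" by (rule eventually_gt_at_top)+
  ultimately show ?thesis
  proof eventually_elim
    case (elim r)
    have "r ^ 3 > 0" using elim by simp
    then have "1 / (2 * r ^ 3) \<le> f r" "f r \<le> 2 / r ^ 3" using elim by (auto simp: field_simps)
    then show ?case using elim by auto
  qed
qed

lemma f_tendsto_0: "(f \<longlongrightarrow> 0) at_top"
proof (rule tendstoI)
  fix e :: real assume "e > 0"
  from f_eventually[OF this] show "\<forall>\<^sub>F r in at_top. dist (f r) 0 < e"
  proof eventually_elim
    case (elim r)
    have "1 / (2 * r ^ 3) > 0" using elim by simp
    then show ?case using elim by (simp add: dist_real_def)
  qed
qed

text \<open>As \<open>f\<close> is continuous and tends to \<open>0\<close>, its values fill an interval \<open>(0, y0)\<close>, so all angles close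
to \<open>\<theta>0\<close> are covered by the graph.\<close>

lemma graph_radius_exists:
  "\<forall>\<^sub>F \<theta> in at_left \<theta>0. \<exists>r. r > 1 \<and> r > R1 \<and> 1 / (2 * r ^ 3) \<le> f r \<and> f r \<le> 2 / r ^ 3 \<and> f r \<le> 1 \<and>
     f r = tan (\<theta>0 - \<theta>) \<and> exp (w \<theta>) = r * sqrt (1 + (f r)\<^sup>2)"
proof -
  have "min 1 t0 > 0" using t0_pos by simp
  from f_eventually[OF this] obtain R where R: "\<And>r. r \<ge> R \<Longrightarrow> r > 1 \<and> r > R1 \<and> 1 / (2 * r ^ 3) \<le> f r \<and> f r \<le> 2 / r ^ 3 \<and> f r < min 1 t0"
    unfolding eventually_at_top_linorder by blast
  have fpos: "f r > 0" if "r \<ge> R" for r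
  proof -
    have "1 / (2 * r ^ 3) > 0" using R[OF that] by simp
    then show ?thesis using R[OF that] by linarith
  qed
  define y0 where "y0 = f R"
  have y0: "y0 > 0" "y0 < t0" using fpos[of R] R[of R] by (auto simp: y0_def)
  have key: "\<exists>r\<ge>R. f r = y" if y: "0 < y" "y < y0" for y
  proof -
    have "\<forall>\<^sub>F r in at_top. f r < y" using order_tendstoD(2)[OF f_tendsto_0 y(1)] .
    then obtain R' where R': "R' \<ge> R" "f R' < y"
      unfolding eventually_at_top_linorder by (meson linorder_le_cases order_refl)
    have "continuous_on {R..R'} f" by (rule continuous_on_subset[OF f_cont]) (use R[of R] in auto)
    from IVT2'[of f R' y R, OF _ _ R'(1) this] R' y
    show ?thesis by (auto simp: y0_def)
  qed
  define \<theta>1 where "\<theta>1 = \<theta>0 - arctan y0"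
  have "\<theta>1 < \<theta>0" using y0 by (simp add: \<theta>1_def zero_less_arctan_iff)
  moreover have "\<exists>r. r > 1 \<and> r > R1 \<and> 1 / (2 * r ^ 3) \<le> f r \<and> f r \<le> 2 / r ^ 3 \<and> f r \<le> 1 \<and>
     f r = tan (\<theta>0 - \<theta>) \<and> exp (w \<theta>) = r * sqrt (1 + (f r)\<^sup>2)" if \<theta>: "\<theta>1 < \<theta>" "\<theta> < \<theta>0" for \<theta>
  proof -
    have d: "0 < \<theta>0 - \<theta>" "\<theta>0 - \<theta> < arctan y0" using \<theta> by (auto simp: \<theta>1_def)
    have d2: "\<theta>0 - \<theta> < pi / 2" using d(2) arctan_ubound[of y0] by linarith
    have "tan (\<theta>0 - \<theta>) < tan (arctan y0)" using d arctan_ubound[of y0] by (intro tan_monotone) auto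
    then have "tan (\<theta>0 - \<theta>) < y0" by (simp add: tan_arctan)
    moreover have "0 < tan (\<theta>0 - \<theta>)" using d d2 by (intro tan_gt_zero)
    ultimately obtain r where r: "r \<ge> R" "f r = tan (\<theta>0 - \<theta>)" using key by blast
    have a: "arctan (f r) = \<theta>0 - \<theta>" unfolding r(2) using d d2 by (intro arctan_tan) auto
    have "arctan (f r) < arctan t0" using R[OF r(1)] by (simp add: arctan_less_iff)
    moreover have "arctan t0 = \<theta>0" using \<theta>0 by (intro arctan_tan) auto
    ultimately have "w (\<theta>0 - arctan (f r)) = ln (r * sqrt (1 + (f r)\<^sup>2))"
      using R[OF r(1)] fpos[OF r(1)] by (intro graph) auto
    then have "w \<theta> = ln (r * sqrt (1 + (f r)\<^sup>2))" by (simp add: a)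
    moreover have "r * sqrt (1 + (f r)\<^sup>2) > 0" using R[OF r(1)] by (intro mult_pos_pos) (auto intro: add_pos_nonneg)
    ultimately have "exp (w \<theta>) = r * sqrt (1 + (f r)\<^sup>2)" by simp
    then show ?thesis using R[OF r(1)] r(2) by (intro exI[of _ r]) auto
  qed
  ultimately show ?thesis unfolding eventually_at_left_field by blast
qed

lemma eventually_near: "\<forall>\<^sub>F \<theta> in at_left \<theta>0. 0 < \<theta> \<and> \<theta> < \<theta>0"
  unfolding eventually_at_left_field using \<theta>0 by (intro exI[of _ 0]) auto

lemma delta_tendsto: "((\<lambda>\<theta>. \<theta>0 - \<theta>) \<longlongrightarrow> 0) (at_left \<theta>0)" "((\<lambda>\<theta>. tan (\<theta>0 - \<theta>)) \<longlongrightarrow> 0) (at_left \<theta>0)"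
proof -
  show 1: "((\<lambda>\<theta>. \<theta>0 - \<theta>) \<longlongrightarrow> 0) (at_left \<theta>0)" by (auto intro!: tendsto_eq_intros)
  have "((\<lambda>\<theta>. tan (\<theta>0 - \<theta>)) \<longlongrightarrow> tan 0) (at_left \<theta>0)" by (rule tendsto_tan[OF 1]) simp
  then show "((\<lambda>\<theta>. tan (\<theta>0 - \<theta>)) \<longlongrightarrow> 0) (at_left \<theta>0)" by simp
qed

lemma exp_w_bounds:
  "\<forall>\<^sub>F \<theta> in at_left \<theta>0. exp (- 3 * w \<theta>) \<le> 2 * tan (\<theta>0 - \<theta>) \<and> \<theta>0 - \<theta> \<le> 8 * exp (- 3 * w \<theta>)"
  using graph_radius_exists eventually_near
proof eventually_elim
  case (elim \<theta>)
  then obtain r where r: "r > 1" "1 / (2 * r ^ 3) \<le> f r" "f r \<le> 2 / r ^ 3" "f r \<le> 1"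
    "f r = tan (\<theta>0 - \<theta>)" "exp (w \<theta>) = r * sqrt (1 + (f r)\<^sup>2)" by blast
  define q where "q = sqrt (1 + (f r)\<^sup>2)"
  have f0: "f r > 0" using r(1,2) by (smt (verit) divide_pos_pos mult_pos_pos zero_less_power)
  have q: "1 \<le> q" "q \<le> sqrt 2" using r(4) f0 by (auto simp: q_def power_le_one)
  have q3: "1 \<le> q ^ 3" "q ^ 3 \<le> 4"
  proof -
    show "1 \<le> q ^ 3" using q by (simp add: one_le_power)
    have "q ^ 3 \<le> sqrt 2 ^ 3" using q by (intro power_mono) auto
    also have "\<dots> = 2 * sqrt 2" by (simp add: power3_eq_cube)
    also have "\<dots> \<le> 4" using real_sqrt_le_mono[of 2 4] by simp
    finally show "q ^ 3 \<le> 4" .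
  qed
  have e: "exp (- 3 * w \<theta>) = 1 / (r ^ 3 * q ^ 3)"
  proof -
    have "exp (- 3 * w \<theta>) = 1 / exp (w \<theta>) ^ 3" by (simp add: exp_minus exp_of_nat_mult[symmetric] inverse_eq_divide)
    then show ?thesis by (simp add: r(6) q_def power_mult_distrib)
  qed
  have r3: "r ^ 3 > 0" using r(1) by simp
  have "1 / (r ^ 3 * q ^ 3) \<le> 1 / (r ^ 3 * 1)" using r3 q3 q by (intro divide_left_mono mult_left_mono mult_pos_pos) auto
  also have "\<dots> \<le> 2 * f r" using r(2) by simp
  finally have 1: "exp (- 3 * w \<theta>) \<le> 2 * tan (\<theta>0 - \<theta>)" unfolding e r(5) .
  have d: "0 < \<theta>0 - \<theta>" "\<theta>0 - \<theta> < pi / 2" using elim \<theta>0 by auto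
  have "\<theta>0 - \<theta> = arctan (f r)" unfolding r(5) using d by (intro arctan_tan[symmetric]) auto
  also have "\<dots> \<le> f r" using f0 by (intro arctan_lower_cubic) auto
  also have "\<dots> \<le> 2 / r ^ 3" by (rule r(3))
  also have "\<dots> \<le> 8 * exp (- 3 * w \<theta>)"
  proof -
    have "2 * q ^ 3 \<le> 8" using q3 by simp
    then have "2 * q ^ 3 / (r ^ 3 * q ^ 3) \<le> 8 / (r ^ 3 * q ^ 3)" using r3 q3 q by (intro divide_right_mono mult_nonneg_nonneg) auto
    moreover have "2 * q ^ 3 / (r ^ 3 * q ^ 3) = 2 / r ^ 3" using q by simp
    ultimately show ?thesis unfolding e by simp
  qed
  finally show ?case using 1 by blast
qed

lemma exp_w_tendsto_0: "((\<lambda>\<theta>. exp (- 3 * w \<theta>)) \<longlongrightarrow> 0) (at_left \<theta>0)"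
proof (rule tendsto_sandwich[of "\<lambda>_. 0" _ _ "\<lambda>\<theta>. 2 * tan (\<theta>0 - \<theta>)"])
  show "\<forall>\<^sub>F \<theta> in at_left \<theta>0. exp (- 3 * w \<theta>) \<le> 2 * tan (\<theta>0 - \<theta>)"
    using exp_w_bounds by eventually_elim auto
  show "((\<lambda>\<theta>. 2 * tan (\<theta>0 - \<theta>)) \<longlongrightarrow> 0) (at_left \<theta>0)"
    using tendsto_mult_left[OF delta_tendsto(2), of 2] by simp
qed auto

lemma w_at_top: "filterlim w at_top (at_left \<theta>0)"
proof -
  have "filterlim (\<lambda>\<theta>. inverse (exp (- 3 * w \<theta>))) at_top (at_left \<theta>0)"
    by (rule filterlim_inverse_at_top[OF exp_w_tendsto_0]) simp
  then have "filterlim (\<lambda>\<theta>. exp (3 * w \<theta>)) at_top (at_left \<theta>0)"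
    by (simp add: exp_minus)
  then have "filterlim (\<lambda>\<theta>. ln (exp (3 * w \<theta>))) at_top (at_left \<theta>0)"
    by (rule filterlim_compose[OF ln_at_top])
  then have 3: "filterlim (\<lambda>\<theta>. 3 * w \<theta>) at_top (at_left \<theta>0)" by simp
  have "filterlim (\<lambda>\<theta>. (1/3) * (3 * w \<theta>)) at_top (at_left \<theta>0)"
    by (rule filterlim_tendsto_pos_mult_at_top[OF tendsto_const _ 3]) simp
  moreover have "(\<lambda>\<theta>. (1/3) * (3 * w \<theta>)) = w" by auto
  ultimately show ?thesis by (simp only:)
qed

text \<open>The normalization \<open>f(r) r\<^sup>3 \<rightarrow> 1\<close> of the scale, expressed along the curve.\<close>

lemma exp3w_delta_tendsto_1: "((\<lambda>\<theta>. exp (3 * w \<theta>) * (\<theta>0 - \<theta>)) \<longlongrightarrow> 1) (at_left \<theta>0)"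
proof -
  define H where "H = (\<lambda>r. (f r * r ^ 3) * sqrt (1 + (f r)\<^sup>2) ^ 3 * (if f r = 0 then 1 else arctan (f r) / f r))"
  have "(H \<longlongrightarrow> 1 * sqrt (1 + 0\<^sup>2) ^ 3 * 1) at_top"
  proof -
    have "((\<lambda>x. if x = 0 then 1 else arctan x / x) \<longlongrightarrow> 1) (nhds (0::real))"
    proof -
      have "((\<lambda>x. arctan x / x) \<longlongrightarrow> 1) (at (0::real))"
        using DERIV_arctan[of 0] by (simp add: DERIV_def)
      then have "((\<lambda>x. if x = 0 then 1 else arctan x / x) \<longlongrightarrow> 1) (at (0::real))"
        by (rule Lim_transform_eventually) (simp add: eventually_at_filter)
      then show ?thesis using tendsto_at_iff_tendsto_nhds[of "\<lambda>x. if x = 0 then 1 else arctan x / x" "0::real"] by simp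
    qed
    from filterlim_compose[OF this f_tendsto_0]
    have "((\<lambda>r. if f r = 0 then 1 else arctan (f r) / f r) \<longlongrightarrow> 1) at_top" .
    then show ?thesis unfolding H_def by (intro tendsto_mult f_lim tendsto_power tendsto_real_sqrt tendsto_add tendsto_const f_tendsto_0)
  qed
  then have H: "(H \<longlongrightarrow> 1) at_top" by simp
  show ?thesis
  proof (rule tendstoI)
    fix e :: real assume "e > 0"
    with H have "\<forall>\<^sub>F r in at_top. dist (H r) 1 < e" by (rule tendstoD)
    then obtain R where R: "\<And>r. r \<ge> R \<Longrightarrow> dist (H r) 1 < e" unfolding eventually_at_top_linorder by blast
    have "\<forall>\<^sub>F \<theta> in at_left \<theta>0. tan (\<theta>0 - \<theta>) < 1 / (2 * (max R 1) ^ 3)"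
      by (rule order_tendstoD(2)[OF delta_tendsto(2)]) (simp add: less_max_iff_disj)
    then show "\<forall>\<^sub>F \<theta> in at_left \<theta>0. dist (exp (3 * w \<theta>) * (\<theta>0 - \<theta>)) 1 < e"
      using graph_radius_exists eventually_near
    proof eventually_elim
      case (elim \<theta>)
      then obtain r where r: "r > 1" "1 / (2 * r ^ 3) \<le> f r" "f r = tan (\<theta>0 - \<theta>)" "exp (w \<theta>) = r * sqrt (1 + (f r)\<^sup>2)" by blast
      have f0: "f r > 0" using r(1,2) by (smt (verit) divide_pos_pos mult_pos_pos zero_less_power)
      have "r \<ge> R"
      proof (rule ccontr)
        assume "\<not> r \<ge> R"
        then have "r ^ 3 \<le> (max R 1) ^ 3" using r(1) by (intro power_mono) auto
        then have "1 / (2 * (max R 1) ^ 3) \<le> 1 / (2 * r ^ 3)"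
          using r(1) by (intro divide_left_mono) (auto simp: less_max_iff_disj)
        then show False using r(2,3) elim(1) by linarith
      qed
      have d: "0 < \<theta>0 - \<theta>" "\<theta>0 - \<theta> < pi / 2" using elim \<theta>0 by auto
      have "\<theta>0 - \<theta> = arctan (f r)" unfolding r(3) using d by (intro arctan_tan[symmetric]) auto
      moreover have "exp (3 * w \<theta>) = exp (w \<theta>) ^ 3" by (simp add: exp_of_nat_mult[symmetric])
      ultimately have "exp (3 * w \<theta>) * (\<theta>0 - \<theta>) = H r"
        using f0 by (simp add: H_def r(4) power_mult_distrib)
      then show ?case using R[OF \<open>r \<ge> R\<close>] by simp
    qed
  qed
qed

lemma m_continuous: "(m \<longlongrightarrow> m \<theta>0) (at_left \<theta>0)"
  using DERIV_isCont[OF DERIV_m[of \<theta>0]] \<theta>0 by (auto simp: isCont_def intro: filterlim_mono at_le)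

lemma j_le: "0 < \<theta> \<Longrightarrow> \<theta> < \<theta>0 \<Longrightarrow> j \<theta> < m \<theta>0"
proof -
  assume a: "0 < \<theta>" "\<theta> < \<theta>0"
  have "sin (\<alpha> \<theta>) < 1"
  proof -
    have "(sin (\<alpha> \<theta>))\<^sup>2 + (cos (\<alpha> \<theta>))\<^sup>2 = 1" "(cos (\<alpha> \<theta>))\<^sup>2 > 0" using cos_alpha_pos[OF a] by auto
    then have "(sin (\<alpha> \<theta>))\<^sup>2 < 1" by linarith
    then show ?thesis using power2_less_imp_less[of "sin (\<alpha> \<theta>)" 1] by simp
  qed
  then have "j \<theta> < m \<theta>" using m_pos[of \<theta>] a by (simp add: j_def)
  also have "\<dots> \<le> m \<theta>0" using a by (intro m_le) auto
  finally show ?thesis .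
qed

lemma m_cos: "0 < \<theta> \<Longrightarrow> \<theta> < \<theta>0 \<Longrightarrow> m \<theta> * cos (\<alpha> \<theta>) = sqrt ((m \<theta>)\<^sup>2 - (j \<theta>)\<^sup>2)"
proof -
  assume a: "0 < \<theta>" "\<theta> < \<theta>0"
  have "(m \<theta>)\<^sup>2 - (j \<theta>)\<^sup>2 = (m \<theta>)\<^sup>2 * (1 - (sin (\<alpha> \<theta>))\<^sup>2)"
    by (simp add: j_def power_mult_distrib algebra_simps)
  also have "1 - (sin (\<alpha> \<theta>))\<^sup>2 = (cos (\<alpha> \<theta>))\<^sup>2" using sin_cos_squared_add[of "\<alpha> \<theta>"] by linarith
  also have "(m \<theta>)\<^sup>2 * (cos (\<alpha> \<theta>))\<^sup>2 = (m \<theta> * cos (\<alpha> \<theta>))\<^sup>2" by (simp add: power_mult_distrib)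
  finally show ?thesis using m_pos[of \<theta>] cos_alpha_pos[OF a] a by simp
qed

text \<open>If \<open>j\<close> stayed below some \<open>x < m \<theta>0\<close>, then \<open>tan \<alpha>\<close> would stay bounded near the cone, and so would
\<open>w\<close>; but \<open>w\<close> is unbounded.\<close>

lemma j_tendsto: "(j \<longlongrightarrow> m \<theta>0) (at_left \<theta>0)"
proof (rule increasing_tendsto)
  show "\<forall>\<^sub>F \<theta> in at_left \<theta>0. j \<theta> \<le> m \<theta>0"
    using eventually_near by eventually_elim (auto intro: less_imp_le j_le)
  fix x assume x: "x < m \<theta>0"
  have m0: "m \<theta>0 > 0" using m_pos[of \<theta>0] \<theta>0 by simp
  have "\<exists>\<theta>. 0 < \<theta> \<and> \<theta> < \<theta>0 \<and> x < j \<theta>"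
  proof (rule ccontr)
    assume "\<not> ?thesis"
    then have jx: "j \<theta> \<le> x" if "0 < \<theta>" "\<theta> < \<theta>0" for \<theta> using that not_less by blast
    have x0: "x > 0" using jx[of "\<theta>0 / 2"] j_pos[of "\<theta>0 / 2"] \<theta>0 by auto
    define y where "y = (x + m \<theta>0) / 2"
    have y: "x < y" "y < m \<theta>0" using x by (auto simp: y_def)
    have "\<forall>\<^sub>F \<theta> in at_left \<theta>0. y < m \<theta>" using order_tendstoD(1)[OF m_continuous y(2)] .
    then obtain c where c: "c < \<theta>0" "\<And>\<theta>. c < \<theta> \<Longrightarrow> \<theta> < \<theta>0 \<Longrightarrow> y < m \<theta>"
      unfolding eventually_at_left_field by blast
    define c1 where "c1 = (max c 0 + \<theta>0) / 2"
    have c1: "0 < c1" "c < c1" "c1 < \<theta>0" using c \<theta>0 by (auto simp: c1_def max_def)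
    define \<tau> where "\<tau> = x / sqrt (y\<^sup>2 - x\<^sup>2)"
    have yx: "y\<^sup>2 - x\<^sup>2 > 0" using y x0 by (simp add: power_strict_mono)
    have tle: "1 / T \<theta> \<le> \<tau>" if "c1 \<le> \<theta>" "\<theta> < \<theta>0" for \<theta>
    proof -
      have a: "0 < \<theta>" "\<theta> < \<theta>0" using that c1 by auto
      have mp: "m \<theta> > 0" using m_pos[of \<theta>] a by simp
      have "1 / T \<theta> = j \<theta> / (m \<theta> * cos (\<alpha> \<theta>))" using mp by (simp add: T_def j_def)
      also have "\<dots> = j \<theta> / sqrt ((m \<theta>)\<^sup>2 - (j \<theta>)\<^sup>2)" by (simp add: m_cos[OF a])
      also have "\<dots> \<le> x / sqrt (y\<^sup>2 - x\<^sup>2)"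
      proof (rule frac_le)
        have "y\<^sup>2 \<le> (m \<theta>)\<^sup>2" using c(2)[of \<theta>] that c1 y x0 by (intro power_mono) auto
        moreover have "(j \<theta>)\<^sup>2 \<le> x\<^sup>2" using jx[OF a] j_pos[OF a] by (intro power_mono) auto
        ultimately show "sqrt (y\<^sup>2 - x\<^sup>2) \<le> sqrt ((m \<theta>)\<^sup>2 - (j \<theta>)\<^sup>2)" by simp
      qed (use jx[OF a] yx x0 in auto)
      finally show ?thesis by (simp add: \<tau>_def)
    qed
    have bd: "w \<theta> \<le> w c1 + \<tau> * (\<theta>0 - c1)" if th: "c1 \<le> \<theta>" "\<theta> < \<theta>0" for \<theta>
    proof -
      have "\<tau> * c1 - w c1 \<le> \<tau> * \<theta> - w \<theta>"
      proof (rule DERIV_nonneg_imp_nondecreasing[OF th(1), where f="\<lambda>\<theta>. \<tau> * \<theta> - w \<theta>"])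
        fix z assume z: "c1 \<le> z" "z \<le> \<theta>"
        then have "((\<lambda>\<theta>. \<tau> * \<theta> - w \<theta>) has_real_derivative \<tau> * 1 - 1 / T z) (at z)"
          using c1 th by (intro DERIV_diff DERIV_cmult DERIV_ident DERIV_w_T) auto
        then show "\<exists>u. ((\<lambda>\<theta>. \<tau> * \<theta> - w \<theta>) has_real_derivative u) (at z) \<and> 0 \<le> u"
          using tle[of z] z th by (intro exI[of _ "\<tau> * 1 - 1 / T z"]) auto
      qed
      moreover have "\<tau> \<ge> 0" using x0 yx by (simp add: \<tau>_def)
      then have "\<tau> * \<theta> \<le> \<tau> * \<theta>0" using th by (intro mult_left_mono) auto
      ultimately show ?thesis by (simp add: right_diff_distrib)
    qed
    have "\<forall>\<^sub>F \<theta> in at_left \<theta>0. w \<theta> > w c1 + \<tau> * (\<theta>0 - c1)"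
      using w_at_top by (simp add: filterlim_at_top_dense)
    moreover have "\<forall>\<^sub>F \<theta> in at_left \<theta>0. c1 \<le> \<theta> \<and> \<theta> < \<theta>0"
      unfolding eventually_at_left_field using c1 by (intro exI[of _ c1]) auto
    ultimately have "\<forall>\<^sub>F \<theta> in at_left \<theta>0. False"
      by eventually_elim (use bd in force)
    then show False by simp
  qed
  then obtain \<theta> where \<theta>: "0 < \<theta>" "\<theta> < \<theta>0" "x < j \<theta>" by blast
  show "\<forall>\<^sub>F z in at_left \<theta>0. x < j z"
    unfolding eventually_at_left_field
  proof (intro exI[of _ \<theta>] conjI allI impI \<theta>(2))
    fix z assume "\<theta> < z" "z < \<theta>0"
    then show "x < j z" using j_strict_mono[of \<theta> z] \<theta> by auto
  qed
qed

text \<open>The quantity \<open>S = sqrt (m \<theta>0 - j)\<close> vanishes at the cone and has bounded derivative there, because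
\<open>m cos \<alpha> = sqrt (m\<^sup>2 - j\<^sup>2)\<close> is at most a multiple of \<open>S\<close>. So \<open>S\<close>, and with it
\<open>T = m cos \<alpha> / j\<close>, is at most linear in \<open>\<theta>0 - \<theta>\<close>.\<close>

lemma T_le_linear: "\<forall>\<^sub>F \<theta> in at_left \<theta>0. T \<theta> \<le> 14 * (\<theta>0 - \<theta>)"
proof -
  let ?m0 = "m \<theta>0"
  have m0: "?m0 > 0" using m_pos[of \<theta>0] \<theta>0 by simp
  define S where "S = (\<lambda>\<theta>. sqrt (?m0 - j \<theta>))"
  define c where "c = sqrt (2 * ?m0)"
  have mc: "m \<theta> * cos (\<alpha> \<theta>) \<le> c * S \<theta>" if a: "0 < \<theta>" "\<theta> < \<theta>0" for \<theta>
  proof -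
    have "(m \<theta>)\<^sup>2 \<le> ?m0\<^sup>2" using m_le[of \<theta>] m_pos[of \<theta>] a by (intro power_mono) auto
    moreover have "?m0\<^sup>2 - (j \<theta>)\<^sup>2 = (?m0 + j \<theta>) * (?m0 - j \<theta>)" by (simp add: power2_eq_square algebra_simps)
    moreover have "(?m0 + j \<theta>) * (?m0 - j \<theta>) \<le> (2 * ?m0) * (?m0 - j \<theta>)"
      using j_le[OF a] by (intro mult_right_mono) auto
    ultimately have "(m \<theta>)\<^sup>2 - (j \<theta>)\<^sup>2 \<le> (2 * ?m0) * (?m0 - j \<theta>)" by linarith
    then show ?thesis unfolding m_cos[OF a] c_def S_def real_sqrt_mult[symmetric] by (rule real_sqrt_le_mono)
  qed
  have dS: "(S has_real_derivative - (7 * m \<theta> * cos (\<alpha> \<theta>)) * (inverse (S \<theta>) / 2)) (at \<theta>)" if a: "0 < \<theta>" "\<theta> < \<theta>0" for \<theta>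
  proof -
    have d: "((\<lambda>\<theta>. ?m0 - j \<theta>) has_real_derivative 0 - 7 * m \<theta> * cos (\<alpha> \<theta>)) (at \<theta>)"
      by (intro DERIV_diff DERIV_const DERIV_j a)
    have p: "?m0 - j \<theta> > 0" using j_le[OF a] by simp
    from DERIV_chain2[where f=sqrt and g="\<lambda>\<theta>. ?m0 - j \<theta>", OF DERIV_real_sqrt[OF p] d]
    show ?thesis unfolding S_def by (simp add: mult.commute)
  qed
  have Sp: "S \<theta> > 0" if "0 < \<theta>" "\<theta> < \<theta>0" for \<theta> using j_le[OF that] by (simp add: S_def)
  have S0: "(S \<longlongrightarrow> sqrt (?m0 - ?m0)) (at_left \<theta>0)"
    unfolding S_def by (intro tendsto_intros j_tendsto)
  have Sb: "S \<theta> \<le> (7 / 2 * c) * (\<theta>0 - \<theta>)" if a: "0 < \<theta>" "\<theta> < \<theta>0" for \<theta>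
  proof -
    define F where "F = (\<lambda>\<theta>. S \<theta> - (7 / 2 * c) * (\<theta>0 - \<theta>))"
    have "F \<theta> \<le> sqrt (?m0 - ?m0) - (7 / 2 * c) * 0"
    proof (rule tendsto_left_mono_le[where a=0 and b=\<theta>0 and F=F])
      show "(F \<longlongrightarrow> sqrt (?m0 - ?m0) - (7 / 2 * c) * 0) (at_left \<theta>0)"
        unfolding F_def by (intro tendsto_diff S0 tendsto_mult tendsto_const delta_tendsto(1))
      fix x y assume xy: "0 < x" "x \<le> y" "y < \<theta>0"
      show "F x \<le> F y"
      proof (rule nonneg_derivative_mono[where a=0 and b=\<theta>0 and F=F
            and F'="\<lambda>\<theta>. - (7 * m \<theta> * cos (\<alpha> \<theta>)) * (inverse (S \<theta>) / 2) - (7 / 2 * c) * (0 - 1)"])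
        show "(F has_real_derivative - (7 * m z * cos (\<alpha> z)) * (inverse (S z) / 2) - (7 / 2 * c) * (0 - 1)) (at z)"
          if "0 < z" "z < \<theta>0" for z
          unfolding F_def by (intro DERIV_diff dS that DERIV_cmult DERIV_const DERIV_ident)
        show "- (7 * m z * cos (\<alpha> z)) * (inverse (S z) / 2) - (7 / 2 * c) * (0 - 1) \<ge> 0" if z: "0 < z" "z < \<theta>0" for z
        proof -
          have "m z * cos (\<alpha> z) * inverse (S z) \<le> c" using mc[OF z] Sp[OF z] by (simp add: field_simps)
          then show ?thesis by (simp add: mult.commute mult.left_commute)
        qed
      qed (use xy in auto)
    qed (use a in auto)
    then show ?thesis by (simp add: F_def)
  qed
  have "\<forall>\<^sub>F \<theta> in at_left \<theta>0. ?m0 / 2 < j \<theta>" using order_tendstoD(1)[OF j_tendsto, of "?m0 / 2"] m0 by simp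
  then show ?thesis using eventually_near
  proof eventually_elim
    case (elim \<theta>)
    then have a: "0 < \<theta>" "\<theta> < \<theta>0" by auto
    have mp: "m \<theta> > 0" using m_pos[of \<theta>] a by simp
    have jp: "j \<theta> > 0" by (rule j_pos[OF a])
    have "T \<theta> = m \<theta> * cos (\<alpha> \<theta>) / j \<theta>" using mp by (simp add: T_def j_def)
    also have "\<dots> \<le> c * S \<theta> / j \<theta>" using mc[OF a] jp by (intro divide_right_mono) auto
    also have "\<dots> \<le> c * ((7 / 2 * c) * (\<theta>0 - \<theta>)) / j \<theta>"
      using Sb[OF a] jp m0 by (intro divide_right_mono mult_left_mono) (auto simp: c_def)
    also have "c * ((7 / 2 * c) * (\<theta>0 - \<theta>)) = 7 * ?m0 * (\<theta>0 - \<theta>)"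
    proof -
      have "c * c = 2 * ?m0" using m0 by (simp add: c_def)
      then have "(c * c) * (7 / 2 * (\<theta>0 - \<theta>)) = 7 * ?m0 * (\<theta>0 - \<theta>)" by simp
      then show ?thesis by (simp only: mult.assoc mult.left_commute)
    qed
    also have "7 * ?m0 * (\<theta>0 - \<theta>) / j \<theta> \<le> 14 * (\<theta>0 - \<theta>)"
    proof -
      have "7 * ?m0 * (\<theta>0 - \<theta>) \<le> (14 * j \<theta>) * (\<theta>0 - \<theta>)" using elim a by (intro mult_right_mono) auto
      then have "7 * ?m0 * (\<theta>0 - \<theta>) / j \<theta> \<le> (14 * j \<theta>) * (\<theta>0 - \<theta>) / j \<theta>"
        using jp by (intro divide_right_mono) auto
      then show ?thesis using jp by simp
    qed
    finally show ?case .
  qed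
qed

text \<open>The quadratic remainder of the equation for \<open>T\<close>, after its linear part \<open>12 \<delta> - 7 T\<close> has been removed.\<close>

definition X :: "real \<Rightarrow> real" where "X \<theta> = 12 * (\<theta>0 - \<theta>) - M \<theta> + (T \<theta>)\<^sup>2 * (7 * T \<theta> - M \<theta>)"

text \<open>On the cone \<open>M\<close> vanishes with derivative \<open>-12\<close>, and \<open>T\<close> is at most linear in the distance.\<close>

lemma X_quadratic: "\<exists>C>0. \<forall>\<^sub>F \<theta> in at_left \<theta>0. \<bar>X \<theta>\<bar> \<le> C * (\<theta>0 - \<theta>)\<^sup>2"
proof -
  define K where "K = 12 * (1 + 2 * t0\<^sup>2) / t0"
  have K: "K > 0" using t0_pos by (simp add: K_def add_pos_nonneg)
  define C where "C = 16 + 4 * K + 196 * (98 + 24 + 4 * K)"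
  have "\<forall>\<^sub>F \<theta> in at_left \<theta>0. tan (\<theta>0 - \<theta>) < min 1 (t0 / 2)"
    by (rule order_tendstoD(2)[OF delta_tendsto(2)]) (use t0_pos in auto)
  then have "\<forall>\<^sub>F \<theta> in at_left \<theta>0. \<bar>X \<theta>\<bar> \<le> C * (\<theta>0 - \<theta>)\<^sup>2"
    using T_le_linear eventually_near
  proof eventually_elim
    case (elim \<theta>)
    then have a: "0 < \<theta>" "\<theta> < \<theta>0" by auto
    define s where "s = tan (\<theta>0 - \<theta>)"
    define d where "d = \<theta>0 - \<theta>"
    note MF = M_formula[OF a, folded s_def]
    have s1: "s < 1" "s < t0 / 2" using elim by (auto simp: s_def)
    have "d < pi / 2" using a \<theta>0 by (simp add: d_def)
    then have ds: "d = arctan s" unfolding s_def d_def using a by (intro arctan_tan[symmetric]) auto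
    have d1: "d \<le> s" "s - s ^ 3 / 3 \<le> d" unfolding ds using arctan_lower_cubic[of s] MF(1) by auto
    have s3: "s ^ 3 \<le> s\<^sup>2" "s\<^sup>2 \<le> s" using MF(1) s1 by (auto simp: power3_eq_cube power2_eq_square mult_left_le)
    have sd: "s \<le> 2 * d" using d1(2) s3 MF(1) by linarith
    have d0: "0 < d" "d \<le> 1" using a d1 s1 by (auto simp: d_def)
    have ss: "s\<^sup>2 \<le> 4 * d\<^sup>2" using power_mono[OF sd, of 2] MF(1) by (simp add: power_mult_distrib)
    have 1: "\<bar>12 * d - 12 * s\<bar> \<le> 16 * d\<^sup>2" using d1 s3 ss by simp
    have den: "(t0 - s) * (1 + t0 * s) \<ge> t0 / 2"
    proof -
      have "t0 / 2 * 1 \<le> (t0 - s) * (1 + t0 * s)" using s1 t0_pos MF(1) by (intro mult_mono) auto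
      then show ?thesis by simp
    qed
    have "M \<theta> - 12 * s = 6 * s\<^sup>2 * ((1 - t0\<^sup>2) + 2 * t0 * s) / ((t0 - s) * (1 + t0 * s))"
    proof -
      have nz: "(t0 - s) * (1 + t0 * s) \<noteq> 0" using den t0_pos by auto
      have "6 * s * (2 * t0 + (t0\<^sup>2 - 1) * s) - 12 * s * ((t0 - s) * (1 + t0 * s)) = 6 * s\<^sup>2 * ((1 - t0\<^sup>2) + 2 * t0 * s)"
        by algebra
      moreover have "N / e - c = (N - c * e) / e" if "e \<noteq> 0" for N e c :: real
        using that by (simp add: field_simps)
      ultimately show ?thesis unfolding MF(3) using nz by metis
    qed
    then have "\<bar>M \<theta> - 12 * s\<bar> = 6 * s\<^sup>2 * \<bar>(1 - t0\<^sup>2) + 2 * t0 * s\<bar> / ((t0 - s) * (1 + t0 * s))"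
    proof -
      have dp: "(t0 - s) * (1 + t0 * s) > 0" using den t0_pos by linarith
      assume "M \<theta> - 12 * s = 6 * s\<^sup>2 * ((1 - t0\<^sup>2) + 2 * t0 * s) / ((t0 - s) * (1 + t0 * s))"
      then show ?thesis by (simp only: abs_divide abs_of_pos[OF dp]) (simp add: abs_mult)
    qed
    also have "\<dots> \<le> 6 * s\<^sup>2 * (1 + 2 * t0\<^sup>2) / (t0 / 2)"
    proof (rule frac_le)
      have "t0 * s \<le> t0 * (t0 / 2)" using s1 t0_pos by (intro mult_left_mono) auto
      then have "2 * t0 * s \<le> t0\<^sup>2" by (simp add: power2_eq_square)
      moreover have "0 \<le> t0 * s" using MF(1) t0_pos by simp
      ultimately have "\<bar>(1 - t0\<^sup>2) + 2 * t0 * s\<bar> \<le> 1 + 2 * t0\<^sup>2"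
        using zero_le_power2[of t0] unfolding abs_le_iff by linarith
      then show "6 * s\<^sup>2 * \<bar>(1 - t0\<^sup>2) + 2 * t0 * s\<bar> \<le> 6 * s\<^sup>2 * (1 + 2 * t0\<^sup>2)"
        by (intro mult_left_mono) auto
    qed (use den t0_pos in auto)
    also have "\<dots> = K * s\<^sup>2" using t0_pos by (simp add: K_def field_simps)
    finally have M1: "\<bar>M \<theta> - 12 * s\<bar> \<le> K * s\<^sup>2" .
    also have "\<dots> \<le> K * (4 * d\<^sup>2)" using ss K by (intro mult_left_mono) auto
    finally have 2: "\<bar>M \<theta> - 12 * s\<bar> \<le> 4 * K * d\<^sup>2" by simp
    have dd: "d\<^sup>2 \<le> 1" using d0 by (simp add: power_le_one)
    have Tp: "0 < T \<theta>" "T \<theta> \<le> 14 * d" using T_pos[OF a] elim by (auto simp: d_def)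
    have "\<bar>7 * T \<theta> - M \<theta>\<bar> \<le> 98 + 24 + 4 * K"
    proof -
      have "4 * K * d\<^sup>2 \<le> 4 * K" using dd K by (simp add: mult_left_le)
      then have "\<bar>M \<theta> - 12 * s\<bar> \<le> 4 * K" using 2 by linarith
      then show ?thesis using Tp d0 s1 MF(1) by linarith
    qed
    moreover have "(T \<theta>)\<^sup>2 \<le> 196 * d\<^sup>2" using power_mono[OF Tp(2), of 2] Tp by (simp add: power_mult_distrib)
    ultimately have "(T \<theta>)\<^sup>2 * \<bar>7 * T \<theta> - M \<theta>\<bar> \<le> (196 * d\<^sup>2) * (98 + 24 + 4 * K)"
      by (intro mult_mono) auto
    then have 3: "\<bar>(T \<theta>)\<^sup>2 * (7 * T \<theta> - M \<theta>)\<bar> \<le> 196 * (98 + 24 + 4 * K) * d\<^sup>2" by (simp add: abs_mult mult.commute mult.left_commute)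
    have "X \<theta> = (12 * d - 12 * s) - (M \<theta> - 12 * s) + (T \<theta>)\<^sup>2 * (7 * T \<theta> - M \<theta>)" by (simp add: X_def d_def)
    then have "\<bar>X \<theta>\<bar> \<le> 16 * d\<^sup>2 + 4 * K * d\<^sup>2 + 196 * (98 + 24 + 4 * K) * d\<^sup>2" using 1 2 3 by linarith
    then show ?case by (simp add: C_def d_def algebra_simps)
  qed
  moreover have "C > 0" using K by (simp add: C_def add_pos_pos)
  ultimately show ?thesis by blast
qed

text \<open>\<open>3\<close> and \<open>4\<close> are the roots of \<open>x\<^sup>2 - 7 x + 12\<close>, the characteristic polynomial of the linearized system,
up to sign; each of the two combinations is an eigenfunction of the linear part.\<close>

lemma DERIV_mode:
  assumes a: "0 < \<theta>" "\<theta> < \<theta>0" and mu: "\<mu> = 3 \<and> \<nu> = 4 \<or> \<mu> = 4 \<and> \<nu> = 3"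
  shows "((\<lambda>\<theta>. exp (\<mu> * w \<theta>) * (\<nu> * (\<theta>0 - \<theta>) - T \<theta>)) has_real_derivative (1 / T \<theta>) * exp (\<mu> * w \<theta>) * X \<theta>) (at \<theta>)"
proof -
  have Tp: "T \<theta> > 0" by (rule T_pos[OF a])
  have e: "((\<lambda>\<theta>. exp (\<mu> * w \<theta>)) has_real_derivative exp (\<mu> * w \<theta>) * (\<mu> * (1 / T \<theta>))) (at \<theta>)"
    by (rule DERIV_fun_exp[OF DERIV_cmult[OF DERIV_w_T[OF a]]])
  have d: "((\<lambda>\<theta>. \<nu> * (\<theta>0 - \<theta>) - T \<theta>) has_real_derivative \<nu> * (0 - 1) - - (1 + (T \<theta>)\<^sup>2) * (7 - M \<theta> / T \<theta>)) (at \<theta>)"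
    by (intro DERIV_diff DERIV_cmult DERIV_const DERIV_ident DERIV_T a)
  have "exp (\<mu> * w \<theta>) * (\<mu> * (1 / T \<theta>)) * (\<nu> * (\<theta>0 - \<theta>) - T \<theta>) +
     (\<nu> * (0 - 1) - - (1 + (T \<theta>)\<^sup>2) * (7 - M \<theta> / T \<theta>)) * exp (\<mu> * w \<theta>) = (1 / T \<theta>) * exp (\<mu> * w \<theta>) * X \<theta>"
  proof -
    have "\<mu> * (\<nu> * (\<theta>0 - \<theta>) - T \<theta>) + T \<theta> * (\<nu> * (0 - 1) - - (1 + (T \<theta>)\<^sup>2) * (7 - M \<theta> / T \<theta>)) = X \<theta>"
      using mu Tp by (auto simp: X_def field_simps power2_eq_square)
    then have "(1 / T \<theta>) * exp (\<mu> * w \<theta>) * X \<theta> = (1 / T \<theta>) * exp (\<mu> * w \<theta>) *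
        (\<mu> * (\<nu> * (\<theta>0 - \<theta>) - T \<theta>) + T \<theta> * (\<nu> * (0 - 1) - - (1 + (T \<theta>)\<^sup>2) * (7 - M \<theta> / T \<theta>)))" by simp
    moreover have "(1 / t) * E * (p + t * q) = E * (1 / t) * p + q * E" if "t > 0" for t E p q :: real
      using that by (simp add: field_simps)
    ultimately show ?thesis using Tp by simp
  qed
  with DERIV_mult[OF e d] show ?thesis by simp
qed

lemma mode_expansion:
  obtains a b C \<theta>1 where "\<theta>1 < \<theta>0" "0 \<le> \<theta>1"
    "\<And>\<theta>. \<theta>1 < \<theta> \<Longrightarrow> \<theta> < \<theta>0 \<Longrightarrow> \<bar>exp (3 * w \<theta>) * (4 * (\<theta>0 - \<theta>) - T \<theta>) - a\<bar> \<le> C * exp (- 3 * w \<theta>)"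
    "\<And>\<theta>. \<theta>1 < \<theta> \<Longrightarrow> \<theta> < \<theta>0 \<Longrightarrow> \<bar>exp (4 * w \<theta>) * (3 * (\<theta>0 - \<theta>) - T \<theta>) + b\<bar> \<le> C * exp (- 2 * w \<theta>)"
    "((\<lambda>\<theta>. exp (4 * w \<theta>) * (T \<theta> - 3 * (\<theta>0 - \<theta>))) \<longlongrightarrow> b) (at_left \<theta>0)"
proof -
  obtain C where C: "C > 0" "\<forall>\<^sub>F \<theta> in at_left \<theta>0. \<bar>X \<theta>\<bar> \<le> C * (\<theta>0 - \<theta>)\<^sup>2" using X_quadratic by blast
  have "\<forall>\<^sub>F \<theta> in at_left \<theta>0. 0 < \<theta> \<and> \<bar>X \<theta>\<bar> \<le> 64 * C * exp (- 6 * w \<theta>)"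
    using C(2) exp_w_bounds eventually_near
  proof eventually_elim
    case (elim \<theta>)
    have "(\<theta>0 - \<theta>)\<^sup>2 \<le> (8 * exp (- 3 * w \<theta>))\<^sup>2" using elim by (intro power_mono) auto
    also have "\<dots> = 64 * exp (- 6 * w \<theta>)" by (simp add: power_mult_distrib exp_double[symmetric])
    finally have "C * (\<theta>0 - \<theta>)\<^sup>2 \<le> C * (64 * exp (- 6 * w \<theta>))" using C(1) by (intro mult_left_mono) auto
    then show ?case using elim by simp
  qed
  then obtain c where c: "c < \<theta>0" "\<And>\<theta>. c < \<theta> \<Longrightarrow> \<theta> < \<theta>0 \<Longrightarrow> 0 < \<theta> \<and> \<bar>X \<theta>\<bar> \<le> 64 * C * exp (- 6 * w \<theta>)"
    unfolding eventually_at_left_field by blast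
  define \<theta>1 where "\<theta>1 = max c 0"
  have \<theta>1: "\<theta>1 < \<theta>0" "0 \<le> \<theta>1" using c \<theta>0 by (auto simp: \<theta>1_def)
  \<comment> \<open>the remainder decays like \<open>exp (-6 w)\<close>, so the mode with rate \<open>\<mu>\<close> converges with rate \<open>6 - \<mu>\<close>\<close>
  have mode: "\<exists>L. ((\<lambda>\<theta>. exp (\<mu> * w \<theta>) * (\<nu> * (\<theta>0 - \<theta>) - T \<theta>)) \<longlongrightarrow> L) (at_left \<theta>0) \<and>
      (\<forall>\<theta>. \<theta>1 < \<theta> \<longrightarrow> \<theta> < \<theta>0 \<longrightarrow> \<bar>exp (\<mu> * w \<theta>) * (\<nu> * (\<theta>0 - \<theta>) - T \<theta>) - L\<bar> \<le> (64 * C / \<gamma>) * exp (- \<gamma> * w \<theta>))"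
    if mu: "\<mu> = 3 \<and> \<nu> = 4 \<or> \<mu> = 4 \<and> \<nu> = 3" and lam: "\<gamma> = 6 - \<mu>" for \<mu> \<nu> \<gamma>
  proof -
    have lp: "\<gamma> > 0" using mu lam by auto
    have dF: "((\<lambda>\<theta>. exp (\<mu> * w \<theta>) * (\<nu> * (\<theta>0 - \<theta>) - T \<theta>)) has_real_derivative (1 / T x) * exp (\<mu> * w x) * X x) (at x)"
      if "\<theta>1 < x" "x < \<theta>0" for x by (rule DERIV_mode) (use that \<theta>1 mu in auto)
    have dk: "((\<lambda>\<theta>. (64 * C / \<gamma>) * exp (- \<gamma> * w \<theta>)) has_real_derivative (64 * C / \<gamma>) * (exp (- \<gamma> * w x) * (- \<gamma> * (1 / T x)))) (at x)"
      if "\<theta>1 < x" "x < \<theta>0" for x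
      by (intro DERIV_cmult DERIV_fun_exp DERIV_w_T) (use that \<theta>1 in auto)
    have dom: "\<bar>(1 / T x) * exp (\<mu> * w x) * X x\<bar> \<le> - ((64 * C / \<gamma>) * (exp (- \<gamma> * w x) * (- \<gamma> * (1 / T x))))"
      if x: "\<theta>1 < x" "x < \<theta>0" for x
    proof -
      have Tp: "T x > 0" using T_pos[of x] x \<theta>1 by auto
      have "\<bar>X x\<bar> \<le> 64 * C * exp (- 6 * w x)" using c(2)[of x] x by (simp add: \<theta>1_def)
      then have "(1 / T x) * exp (\<mu> * w x) * \<bar>X x\<bar> \<le> (1 / T x) * exp (\<mu> * w x) * (64 * C * exp (- 6 * w x))"
        using Tp by (intro mult_left_mono) auto
      also have "\<dots> = 64 * C * (1 / T x) * (exp (\<mu> * w x) * exp (- 6 * w x))" by simp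
      also have "exp (\<mu> * w x) * exp (- 6 * w x) = exp (- \<gamma> * w x)" by (simp add: lam exp_add[symmetric] algebra_simps)
      finally show ?thesis using Tp lp by (simp add: abs_mult)
    qed
    have k0: "((\<lambda>\<theta>. (64 * C / \<gamma>) * exp (- \<gamma> * w \<theta>)) \<longlongrightarrow> 0) (at_left \<theta>0)"
    proof -
      have "filterlim (\<lambda>\<theta>. - \<gamma> * w \<theta>) at_bot (at_left \<theta>0)"
        using lp by (intro filterlim_tendsto_neg_mult_at_bot[OF tendsto_const _ w_at_top]) auto
      then have "((\<lambda>\<theta>. exp (- \<gamma> * w \<theta>)) \<longlongrightarrow> 0) (at_left \<theta>0)" by (rule filterlim_compose[OF exp_at_bot])
      from tendsto_mult_left[OF this, of "64 * C / \<gamma>"] show ?thesis by simp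
    qed
    show ?thesis
      by (rule derivative_dominated_converges[where F="\<lambda>\<theta>. exp (\<mu> * w \<theta>) * (\<nu> * (\<theta>0 - \<theta>) - T \<theta>)"
            and \<kappa>="\<lambda>\<theta>. (64 * C / \<gamma>) * exp (- \<gamma> * w \<theta>)", OF \<theta>1(1) dF dk dom k0]) blast+
  qed
  obtain a where a: "\<And>\<theta>. \<theta>1 < \<theta> \<Longrightarrow> \<theta> < \<theta>0 \<Longrightarrow> \<bar>exp (3 * w \<theta>) * (4 * (\<theta>0 - \<theta>) - T \<theta>) - a\<bar> \<le> (64 * C / 3) * exp (- 3 * w \<theta>)"
    using mode[of 3 4 3] by auto
  obtain L where L: "((\<lambda>\<theta>. exp (4 * w \<theta>) * (3 * (\<theta>0 - \<theta>) - T \<theta>)) \<longlongrightarrow> L) (at_left \<theta>0)"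
    "\<And>\<theta>. \<theta>1 < \<theta> \<Longrightarrow> \<theta> < \<theta>0 \<Longrightarrow> \<bar>exp (4 * w \<theta>) * (3 * (\<theta>0 - \<theta>) - T \<theta>) - L\<bar> \<le> (64 * C / 2) * exp (- 2 * w \<theta>)"
    using mode[of 4 3 2] by auto
  show thesis
  proof (rule that[OF \<theta>1, of a "32 * C" "- L"])
    show "\<bar>exp (3 * w \<theta>) * (4 * (\<theta>0 - \<theta>) - T \<theta>) - a\<bar> \<le> 32 * C * exp (- 3 * w \<theta>)" if "\<theta>1 < \<theta>" "\<theta> < \<theta>0" for \<theta>
    proof -
      have "(64 * C / 3) * exp (- 3 * w \<theta>) \<le> 32 * C * exp (- 3 * w \<theta>)" using C(1) by (intro mult_right_mono) auto
      then show ?thesis using a[OF that] by linarith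
    qed
    show "\<bar>exp (4 * w \<theta>) * (3 * (\<theta>0 - \<theta>) - T \<theta>) + - L\<bar> \<le> 32 * C * exp (- 2 * w \<theta>)" if "\<theta>1 < \<theta>" "\<theta> < \<theta>0" for \<theta>
      using L(2)[OF that] by simp
    have "((\<lambda>\<theta>. - (exp (4 * w \<theta>) * (3 * (\<theta>0 - \<theta>) - T \<theta>))) \<longlongrightarrow> - L) (at_left \<theta>0)"
      by (rule tendsto_minus[OF L(1)])
    then show "((\<lambda>\<theta>. exp (4 * w \<theta>) * (T \<theta> - 3 * (\<theta>0 - \<theta>))) \<longlongrightarrow> - L) (at_left \<theta>0)"
      by (simp add: algebra_simps)
  qed
qed

text \<open>Solving the two modes for \<open>\<delta> = \<theta>0 - \<theta>\<close> gives \<open>\<delta> = exp (-3 w) + b exp (-4 w) + O(exp (-6 w))\<close>.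
The replacement of \<open>\<delta>\<close> by \<open>f = tan \<delta>\<close> and of \<open>exp w\<close> by \<open>r = exp w / sqrt (1 + f\<^sup>2)\<close> costs
relative errors of order \<open>f\<^sup>2\<close>, which are \<open>O(r^(-6))\<close> as well.\<close>

lemma expansion:
  obtains b where "(\<lambda>r. f r - r powr (-3) - b * r powr (-4)) \<in> O[at_top](\<lambda>r. r powr (-6))"
    "((\<lambda>\<theta>. exp (4 * w \<theta>) * (T \<theta> - 3 * (\<theta>0 - \<theta>))) \<longlongrightarrow> b) (at_left \<theta>0)"
proof (rule mode_expansion)
  fix a b C \<theta>1
  assume \<theta>1: "\<theta>1 < \<theta>0" "0 \<le> \<theta>1"
    and a: "\<And>\<theta>. \<theta>1 < \<theta> \<Longrightarrow> \<theta> < \<theta>0 \<Longrightarrow> \<bar>exp (3 * w \<theta>) * (4 * (\<theta>0 - \<theta>) - T \<theta>) - a\<bar> \<le> C * exp (- 3 * w \<theta>)"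
    and b: "\<And>\<theta>. \<theta>1 < \<theta> \<Longrightarrow> \<theta> < \<theta>0 \<Longrightarrow> \<bar>exp (4 * w \<theta>) * (3 * (\<theta>0 - \<theta>) - T \<theta>) + b\<bar> \<le> C * exp (- 2 * w \<theta>)"
    and lim: "((\<lambda>\<theta>. exp (4 * w \<theta>) * (T \<theta> - 3 * (\<theta>0 - \<theta>))) \<longlongrightarrow> b) (at_left \<theta>0)"
  have near: "\<forall>\<^sub>F \<theta> in at_left \<theta>0. \<theta>1 < \<theta> \<and> \<theta> < \<theta>0"
    unfolding eventually_at_left_field using \<theta>1 by blast
  have C0: "C \<ge> 0"
  proof -
    have "0 \<le> C * exp (- 3 * w ((\<theta>1 + \<theta>0) / 2))"
      using a[of "(\<theta>1 + \<theta>0) / 2"] \<theta>1 by (intro order_trans[OF abs_ge_zero]) auto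
    then show ?thesis by (simp add: zero_le_mult_iff)
  qed
  have emw: "((\<lambda>\<theta>. exp (- w \<theta>)) \<longlongrightarrow> 0) (at_left \<theta>0)"
    by (rule filterlim_compose[OF exp_at_bot]) (use w_at_top in \<open>simp add: filterlim_uminus_at_top\<close>)
  \<comment> \<open>the fast mode does not contribute to the limit that the normalization of the scale prescribes\<close>
  have a1: "a = 1"
  proof -
    have "((\<lambda>\<theta>. exp (3 * w \<theta>) * (4 * (\<theta>0 - \<theta>) - T \<theta>) - a) \<longlongrightarrow> 0) (at_left \<theta>0)"
    proof (rule Lim_null_comparison)
      show "\<forall>\<^sub>F \<theta> in at_left \<theta>0. norm (exp (3 * w \<theta>) * (4 * (\<theta>0 - \<theta>) - T \<theta>) - a) \<le> C * exp (- 3 * w \<theta>)"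
        using near by eventually_elim (use a in auto)
      show "((\<lambda>\<theta>. C * exp (- 3 * w \<theta>)) \<longlongrightarrow> 0) (at_left \<theta>0)"
        using tendsto_mult_left[OF exp_w_tendsto_0, of C] by simp
    qed
    from tendsto_add[OF this tendsto_const[of a]]
    have 1: "((\<lambda>\<theta>. exp (3 * w \<theta>) * (4 * (\<theta>0 - \<theta>) - T \<theta>)) \<longlongrightarrow> a) (at_left \<theta>0)" by simp
    have 2: "((\<lambda>\<theta>. exp (- w \<theta>) * (exp (4 * w \<theta>) * (T \<theta> - 3 * (\<theta>0 - \<theta>)))) \<longlongrightarrow> 0 * b) (at_left \<theta>0)"
      by (rule tendsto_mult[OF emw lim])
    have "exp (- w \<theta>) * (exp (4 * w \<theta>) * (T \<theta> - 3 * (\<theta>0 - \<theta>))) = exp (3 * w \<theta>) * (T \<theta> - 3 * (\<theta>0 - \<theta>))" for \<theta>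
      by (simp only: mult.assoc[symmetric] exp_add[symmetric]) simp
    with 2 have "((\<lambda>\<theta>. exp (3 * w \<theta>) * (T \<theta> - 3 * (\<theta>0 - \<theta>))) \<longlongrightarrow> 0) (at_left \<theta>0)"
      by (simp only: mult_zero_left)
    from tendsto_add[OF 1 this] have "((\<lambda>\<theta>. exp (3 * w \<theta>) * (\<theta>0 - \<theta>)) \<longlongrightarrow> a) (at_left \<theta>0)"
      by (simp add: algebra_simps)
    then show ?thesis using tendsto_unique[OF _ _ exp3w_delta_tendsto_1] by auto
  qed
  have main: "\<bar>(\<theta>0 - \<theta>) - exp (- 3 * w \<theta>) - b * exp (- 4 * w \<theta>)\<bar> \<le> 2 * C * exp (- 6 * w \<theta>)"
    if \<theta>: "\<theta>1 < \<theta>" "\<theta> < \<theta>0" for \<theta>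
  proof -
    define u where "u = exp (3 * w \<theta>) * (4 * (\<theta>0 - \<theta>) - T \<theta>) - 1"
    define v where "v = exp (4 * w \<theta>) * (3 * (\<theta>0 - \<theta>) - T \<theta>) + b"
    have inv: "exp (- 3 * w \<theta>) * exp (3 * w \<theta>) = 1" "exp (- 4 * w \<theta>) * exp (4 * w \<theta>) = 1"
      by (simp_all add: exp_add[symmetric])
    have "(\<theta>0 - \<theta>) - exp (- 3 * w \<theta>) - b * exp (- 4 * w \<theta>) = exp (- 3 * w \<theta>) * u - exp (- 4 * w \<theta>) * v"
    proof -
      have "exp (- 3 * w \<theta>) * u = (4 * (\<theta>0 - \<theta>) - T \<theta>) - exp (- 3 * w \<theta>)"
      proof -
        have "E * (F * x - 1) = x - E" if "E * F = 1" for E F x :: real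
          using that by (simp add: right_diff_distrib mult.assoc[symmetric])
        then show ?thesis unfolding u_def using inv(1) by blast
      qed
      moreover have "exp (- 4 * w \<theta>) * v = (3 * (\<theta>0 - \<theta>) - T \<theta>) + b * exp (- 4 * w \<theta>)"
      proof -
        have "E * (F * x + b) = x + b * E" if "E * F = 1" for E F x :: real
          using that by (simp add: distrib_left mult.assoc[symmetric])
        then show ?thesis unfolding v_def using inv(2) by blast
      qed
      ultimately show ?thesis by (simp only:) simp
    qed
    also have "\<bar>\<dots>\<bar> \<le> exp (- 3 * w \<theta>) * \<bar>u\<bar> + exp (- 4 * w \<theta>) * \<bar>v\<bar>"
      by (rule order_trans[OF abs_triangle_ineq4]) (simp add: abs_mult)
    also have "\<dots> \<le> exp (- 3 * w \<theta>) * (C * exp (- 3 * w \<theta>)) + exp (- 4 * w \<theta>) * (C * exp (- 2 * w \<theta>))"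
      using a[OF \<theta>] b[OF \<theta>] unfolding a1 u_def v_def by (intro add_mono mult_left_mono) auto
    also have "\<dots> = 2 * C * exp (- 6 * w \<theta>)"
    proof -
      have "exp (- 3 * w \<theta>) * exp (- 3 * w \<theta>) = exp (- 6 * w \<theta>)" "exp (- 4 * w \<theta>) * exp (- 2 * w \<theta>) = exp (- 6 * w \<theta>)"
        by (simp_all add: exp_add[symmetric])
      then show ?thesis by (simp only: mult.left_commute[of _ C])
    qed
    finally show ?thesis .
  qed
  have tpos: "0 < min 1 (tan (\<theta>0 - \<theta>1))" using \<theta>1 \<theta>0 by (auto intro!: tan_gt_zero)
  have "\<forall>\<^sub>F r in at_top. norm (f r - r powr (-3) - b * r powr (-4)) \<le> (3 + 2 * C + 12 + 12 * \<bar>b\<bar>) * norm (r powr (-6))"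
    using f_eventually[OF tpos]
  proof eventually_elim
    case (elim r)
    then have r: "r > 1" "r > R1" "1 / (2 * r ^ 3) \<le> f r" "f r \<le> 2 / r ^ 3" "f r < 1" "f r < tan (\<theta>0 - \<theta>1)" by auto
    have f0: "f r > 0" using r(1,3) by (smt (verit) divide_pos_pos mult_pos_pos zero_less_power)
    define d where "d = arctan (f r)"
    define q where "q = sqrt (1 + (f r)\<^sup>2)"
    have d: "0 < d" "d < \<theta>0 - \<theta>1"
    proof -
      show "0 < d" using f0 by (simp add: d_def zero_less_arctan_iff)
      have "arctan (f r) < arctan (tan (\<theta>0 - \<theta>1))" using r(6) by (simp add: arctan_less_iff)
      also have "\<dots> = \<theta>0 - \<theta>1" using \<theta>1 \<theta>0 by (intro arctan_tan) auto
      finally show "d < \<theta>0 - \<theta>1" by (simp add: d_def)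
    qed
    have q1: "q \<ge> 1" by (simp add: q_def)
    have W: "w (\<theta>0 - d) = ln (r * q)" unfolding d_def q_def
      by (rule graph) (use r f0 d \<theta>1 in \<open>auto simp: d_def\<close>)
    have rq: "r * q > 0" using r(1) q1 by simp
    have ew: "exp (- 3 * w (\<theta>0 - d)) = 1 / (r * q) ^ 3" "exp (- 4 * w (\<theta>0 - d)) = 1 / (r * q) ^ 4"
      "exp (- 6 * w (\<theta>0 - d)) = 1 / (r * q) ^ 6"
    proof -
      have "exp (- real n * w (\<theta>0 - d)) = 1 / (r * q) ^ n" for n
      proof -
        have "exp (- real n * w (\<theta>0 - d)) = inverse (exp (w (\<theta>0 - d)) ^ n)"
          by (simp add: exp_minus exp_of_nat_mult)
        then show ?thesis using rq by (simp add: W inverse_eq_divide)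
      qed
      from this[of 3] this[of 4] this[of 6] show "exp (- 3 * w (\<theta>0 - d)) = 1 / (r * q) ^ 3" "exp (- 4 * w (\<theta>0 - d)) = 1 / (r * q) ^ 4"
      "exp (- 6 * w (\<theta>0 - d)) = 1 / (r * q) ^ 6" by simp_all
    qed
    have r0: "r > 0" "r ^ n \<ge> 1" for n using r(1) by (auto intro: one_le_power)
    have fsq: "(f r)\<^sup>2 \<le> 4 / r ^ 6"
    proof -
      have "(f r)\<^sup>2 \<le> (2 / r ^ 3)\<^sup>2" using r(4) f0 by (intro power_mono) auto
      then show ?thesis by (simp add: power_divide power_mult[symmetric])
    qed
    have 1: "\<bar>f r - d\<bar> \<le> 3 / r ^ 6"
    proof -
      have "\<bar>f r - d\<bar> \<le> (f r) ^ 3 / 3" using arctan_lower_cubic[of "f r"] f0 by (simp add: d_def)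
      moreover have "(f r) ^ 3 \<le> (f r)\<^sup>2"
        using f0 r(5) by (simp add: power3_eq_cube power2_eq_square mult_left_le)
      moreover have "4 / r ^ 6 \<le> 9 / r ^ 6" using r0(1) by (intro divide_right_mono) auto
      moreover have "3 * (3 / r ^ 6) = 9 / r ^ 6" by simp
      ultimately show ?thesis using fsq by linarith
    qed
    have 2: "\<bar>d - 1 / (r * q) ^ 3 - b * (1 / (r * q) ^ 4)\<bar> \<le> 2 * C / r ^ 6"
    proof -
      have "\<bar>d - 1 / (r * q) ^ 3 - b * (1 / (r * q) ^ 4)\<bar> \<le> 2 * C * (1 / (r * q) ^ 6)"
        using main[of "\<theta>0 - d"] d \<theta>1 unfolding ew by simp
      also have "\<dots> \<le> 2 * C * (1 / r ^ 6)"
      proof -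
        have "r ^ 6 * 1 \<le> r ^ 6 * q ^ 6" using r0 q1 by (intro mult_left_mono one_le_power) auto
        then have "1 / (r * q) ^ 6 \<le> 1 / r ^ 6" using r0 q1 by (simp add: power_mult_distrib divide_left_mono)
        then show ?thesis using C0 by (intro mult_left_mono) auto
      qed
      finally show ?thesis by simp
    qed
    have qn: "\<bar>1 / (r * q) ^ n - 1 / r ^ n\<bar> \<le> 12 / r ^ 6" if n: "n \<le> 4" for n
    proof -
      have qn1: "1 \<le> q ^ n" "q ^ n \<le> q ^ 4" using q1 n by (auto intro: one_le_power power_increasing)
      have "q ^ 4 = (1 + (f r)\<^sup>2)\<^sup>2"
      proof -
        have "q ^ 4 = (q\<^sup>2)\<^sup>2" by (simp add: power_mult[symmetric])
        then show ?thesis by (simp add: q_def add_nonneg_nonneg)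
      qed
      also have "\<dots> \<le> 1 + 3 * (f r)\<^sup>2"
      proof -
        have "(f r)\<^sup>2 * (f r)\<^sup>2 \<le> (f r)\<^sup>2 * 1" using f0 r(5) by (intro mult_left_mono) (auto simp: power_le_one)
        then show ?thesis by (simp add: power2_eq_square algebra_simps)
      qed
      finally have q4: "q ^ n - 1 \<le> 12 / r ^ 6" using fsq qn1 by linarith
      have "1 / r ^ n - 1 / (r * q) ^ n = (q ^ n - 1) / (r ^ n * q ^ n)"
        using r0 qn1 q1 by (simp add: power_mult_distrib field_simps)
      also have "\<dots> \<le> (q ^ n - 1) / 1"
      proof -
        have "1 * 1 \<le> r ^ n * q ^ n" using r0 qn1 by (intro mult_mono) auto
        then show ?thesis using qn1 by (intro divide_left_mono) auto
      qed
      finally have "1 / r ^ n - 1 / (r * q) ^ n \<le> 12 / r ^ 6" using q4 by simp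
      moreover have "0 \<le> (q ^ n - 1) / (r ^ n * q ^ n)" using r0 qn1 q1 by (intro divide_nonneg_nonneg) auto
      moreover have "1 / r ^ n - 1 / (r * q) ^ n \<ge> 0"
        unfolding \<open>1 / r ^ n - 1 / (r * q) ^ n = (q ^ n - 1) / (r ^ n * q ^ n)\<close> by fact
      moreover have "\<bar>x - y\<bar> \<le> c" if "0 \<le> y - x" "y - x \<le> c" for x y c :: real using that by linarith
      ultimately show ?thesis by blast
    qed
    have pw: "r powr (-3) = 1 / r ^ 3" "r powr (-4) = 1 / r ^ 4" "r powr (-6) = 1 / r ^ 6"
      using r0(1) by (simp_all add: powr_minus inverse_eq_divide)
    have "\<bar>b * (1 / (r * q) ^ 4 - 1 / r ^ 4)\<bar> \<le> \<bar>b\<bar> * (12 / r ^ 6)"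
      unfolding abs_mult using qn[of 4] by (intro mult_left_mono) auto
    then have 3: "\<bar>b * (1 / (r * q) ^ 4) - b * (1 / r ^ 4)\<bar> \<le> 12 * \<bar>b\<bar> / r ^ 6" by (simp add: right_diff_distrib mult.commute)
    have 4: "\<bar>1 / (r * q) ^ 3 - 1 / r ^ 3\<bar> \<le> 12 / r ^ 6" by (rule qn) simp
    have "\<bar>f r - 1 / r ^ 3 - b * (1 / r ^ 4)\<bar> \<le> 3 / r ^ 6 + 2 * C / r ^ 6 + 12 * \<bar>b\<bar> / r ^ 6 + 12 / r ^ 6"
      using 1 2 3 4 by linarith
    also have "\<dots> = (3 + 2 * C + 12 + 12 * \<bar>b\<bar>) * (1 / r ^ 6)" by (simp add: add_divide_distrib algebra_simps)
    finally show ?case unfolding pw by simp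
  qed
  then have "(\<lambda>r. f r - r powr (-3) - b * r powr (-4)) \<in> O[at_top](\<lambda>r. r powr (-6))"
    by (rule bigoI)
  with lim show thesis using that by blast
qed

lemma exp4w_cube_root_tendsto:
  "((\<lambda>\<theta>. exp (4 * w \<theta>) * root 3 (3 * tan (\<theta>0 - \<theta>) / sqrt 2) ^ 4) \<longlongrightarrow> root 3 (3 / sqrt 2) ^ 4) (at_left \<theta>0)"
proof -
  have t: "((\<lambda>\<theta>. tan (\<theta>0 - \<theta>) / (\<theta>0 - \<theta>)) \<longlongrightarrow> 1) (at_left \<theta>0)"
  proof -
    have "((\<lambda>x. tan x / x) \<longlongrightarrow> 1) (at (0::real))"
      using DERIV_tan[of 0] by (simp add: DERIV_def)
    moreover have "filterlim (\<lambda>\<theta>. \<theta>0 - \<theta>) (at 0) (at_left \<theta>0)"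
      unfolding filterlim_at using delta_tendsto(1) eventually_near by (auto elim!: eventually_mono)
    ultimately show ?thesis by (rule filterlim_compose)
  qed
  have "((\<lambda>\<theta>. root 3 (3 / sqrt 2 * ((exp (3 * w \<theta>) * (\<theta>0 - \<theta>)) * (tan (\<theta>0 - \<theta>) / (\<theta>0 - \<theta>)))) ^ 4) \<longlongrightarrow> root 3 (3 / sqrt 2 * (1 * 1)) ^ 4) (at_left \<theta>0)"
    by (intro tendsto_power tendsto_real_root tendsto_mult tendsto_const exp3w_delta_tendsto_1 t)
  then have "((\<lambda>\<theta>. root 3 (3 / sqrt 2 * ((exp (3 * w \<theta>) * (\<theta>0 - \<theta>)) * (tan (\<theta>0 - \<theta>) / (\<theta>0 - \<theta>)))) ^ 4) \<longlongrightarrow> root 3 (3 / sqrt 2) ^ 4) (at_left \<theta>0)"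
    by simp
  then show ?thesis
  proof (rule Lim_transform_eventually)
    show "\<forall>\<^sub>F \<theta> in at_left \<theta>0. root 3 (3 / sqrt 2 * ((exp (3 * w \<theta>) * (\<theta>0 - \<theta>)) * (tan (\<theta>0 - \<theta>) / (\<theta>0 - \<theta>)))) ^ 4
        = exp (4 * w \<theta>) * root 3 (3 * tan (\<theta>0 - \<theta>) / sqrt 2) ^ 4"
      using eventually_near
    proof eventually_elim
      case (elim \<theta>)
      have "3 / sqrt 2 * ((exp (3 * w \<theta>) * d) * (t / d)) = exp (w \<theta>) ^ 3 * (3 * t / sqrt 2)" if "d > 0" for d t :: real
        using that by (simp add: exp_of_nat_mult[symmetric])
      from this[of "\<theta>0 - \<theta>" "tan (\<theta>0 - \<theta>)"]
      have e: "3 / sqrt 2 * ((exp (3 * w \<theta>) * (\<theta>0 - \<theta>)) * (tan (\<theta>0 - \<theta>) / (\<theta>0 - \<theta>))) = exp (w \<theta>) ^ 3 * (3 * tan (\<theta>0 - \<theta>) / sqrt 2)"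
        using elim by simp
      have k: "root 3 (E ^ 3 * y) = E * root 3 y" if "E > 0" for E y :: real
        using that by (simp add: real_root_mult real_root_power_cancel)
      then have "root 3 (3 / sqrt 2 * ((exp (3 * w \<theta>) * (\<theta>0 - \<theta>)) * (tan (\<theta>0 - \<theta>) / (\<theta>0 - \<theta>))))
        = exp (w \<theta>) * root 3 (3 * tan (\<theta>0 - \<theta>) / sqrt 2)"
        unfolding e using k[OF exp_gt_zero] by (simp only:)
      moreover have "exp (w \<theta>) ^ 4 = exp (4 * w \<theta>)" by (simp add: exp_of_nat_mult[symmetric])
      ultimately show ?case by (simp only: power_mult_distrib)
    qed
  qed
qed

text \<open>If \<open>B\<close> has the expansion \<open>3 tan \<delta> + sqrt 2 z^4 K\<close> with \<open>z = root 3 (3 tan \<delta> / sqrt 2)\<close>, then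
\<open>exp (4 w) (B - 3 \<delta>)\<close> tends to \<open>sqrt 2 K (3 / sqrt 2)^(4/3)\<close>, because \<open>exp w z\<close> tends to \<open>(3 / sqrt 2)^(1/3)\<close>.
Comparing with \<open>T\<close> transfers the bound to \<open>b\<close>.\<close>

lemma barrier_bound:
  fixes \<phi> :: "real \<Rightarrow> real" and K b \<sigma> :: real
  assumes \<sigma>: "\<sigma> = 1 \<or> \<sigma> = -1"
    and b: "((\<lambda>\<theta>. exp (4 * w \<theta>) * (T \<theta> - 3 * (\<theta>0 - \<theta>))) \<longlongrightarrow> b) (at_left \<theta>0)"
    and cmp: "\<forall>\<^sub>F \<theta> in at_left \<theta>0. \<sigma> * T \<theta> \<le> \<sigma> * B \<theta>"
    and B: "\<forall>\<^sub>F \<theta> in at_left \<theta>0. B \<theta> = 3 * tan (\<theta>0 - \<theta>) + sqrt 2 * (root 3 (3 * tan (\<theta>0 - \<theta>) / sqrt 2)) ^ 4 * \<phi> (root 3 (3 * tan (\<theta>0 - \<theta>) / sqrt 2))"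
    and \<phi>: "(\<phi> \<longlongrightarrow> K) (nhds 0)"
  shows "\<sigma> * b \<le> \<sigma> * (sqrt 2 * K * root 3 (3 / sqrt 2) ^ 4)"
proof -
  let ?z = "\<lambda>\<theta>. root 3 (3 * tan (\<theta>0 - \<theta>) / sqrt 2)"
  have z0: "(?z \<longlongrightarrow> root 3 (3 * 0 / sqrt 2)) (at_left \<theta>0)"
    by (intro tendsto_real_root tendsto_divide tendsto_mult tendsto_const delta_tendsto(2)) simp
  have phi: "((\<lambda>\<theta>. \<phi> (?z \<theta>)) \<longlongrightarrow> K) (at_left \<theta>0)"
    by (rule filterlim_compose[OF \<phi>]) (use z0 in simp)
  have td: "((\<lambda>\<theta>. exp (4 * w \<theta>) * (3 * (tan (\<theta>0 - \<theta>) - (\<theta>0 - \<theta>)))) \<longlongrightarrow> 0) (at_left \<theta>0)"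
  proof (rule Lim_null_comparison)
    have "\<forall>\<^sub>F \<theta> in at_left \<theta>0. tan (\<theta>0 - \<theta>) < 1"
      by (rule order_tendstoD(2)[OF delta_tendsto(2)]) simp
    then show "\<forall>\<^sub>F \<theta> in at_left \<theta>0. norm (exp (4 * w \<theta>) * (3 * (tan (\<theta>0 - \<theta>) - (\<theta>0 - \<theta>)))) \<le> 4096 * exp (- 3 * w \<theta>) * exp (- 2 * w \<theta>)"
      using exp_w_bounds eventually_near
    proof eventually_elim
      case (elim \<theta>)
      define s where "s = tan (\<theta>0 - \<theta>)"
      have d: "0 < \<theta>0 - \<theta>" "\<theta>0 - \<theta> < pi / 2" using elim \<theta>0 by auto
      have s: "0 < s" "s < 1" using d elim by (auto simp: s_def intro: tan_gt_zero)
      have ds: "\<theta>0 - \<theta> = arctan s" unfolding s_def using d by (intro arctan_tan[symmetric]) auto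
      have c: "s - s ^ 3 / 3 \<le> \<theta>0 - \<theta>" "\<theta>0 - \<theta> \<le> s" unfolding ds using arctan_lower_cubic[of s] s by auto
      have "s ^ 3 \<le> s" using s by (simp add: power3_eq_cube mult_le_one mult_left_le)
      have s2: "s \<le> 2 * (\<theta>0 - \<theta>)"
      proof -
        have "s ^ 3 / 3 \<le> s / 3" using \<open>s ^ 3 \<le> s\<close> by (rule divide_right_mono) simp
        then have "s - s / 3 \<le> \<theta>0 - \<theta>" using c(1) by linarith
        moreover have "x \<le> 2 * y" if "x - x / 3 \<le> y" "0 < y" for x y :: real using that by (simp add: field_simps)
        ultimately show ?thesis using d(1) by blast
      qed
      also have "\<dots> \<le> 16 * exp (- 3 * w \<theta>)" using elim by simp
      finally have "s ^ 3 \<le> (16 * exp (- 3 * w \<theta>)) ^ 3" using s by (intro power_mono) auto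
      also have "\<dots> = 4096 * (exp (- 3 * w \<theta>)) ^ 3" by (simp add: power_mult_distrib)
      finally have s3: "s ^ 3 \<le> 4096 * (exp (- 3 * w \<theta>)) ^ 3" .
      have "norm (exp (4 * w \<theta>) * (3 * (s - (\<theta>0 - \<theta>)))) = exp (4 * w \<theta>) * (3 * (s - (\<theta>0 - \<theta>)))" using c by simp
      also have "\<dots> \<le> exp (4 * w \<theta>) * (4096 * (exp (- 3 * w \<theta>)) ^ 3)" using c s3 by (intro mult_left_mono) auto
      also have "\<dots> = 4096 * (exp (4 * w \<theta>) * (exp (- 3 * w \<theta>)) ^ 3)" by simp
      also have "exp (4 * w \<theta>) * (exp (- 3 * w \<theta>)) ^ 3 = exp (- 3 * w \<theta>) * exp (- 2 * w \<theta>)"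
        by (simp add: exp_of_nat_mult[symmetric] exp_add[symmetric])
      finally show ?case by (simp add: s_def)
    qed
    have emw: "((\<lambda>\<theta>. exp (- 2 * w \<theta>)) \<longlongrightarrow> 0) (at_left \<theta>0)"
    proof -
      have "filterlim (\<lambda>\<theta>. - 2 * w \<theta>) at_bot (at_left \<theta>0)"
        by (intro filterlim_tendsto_neg_mult_at_bot[OF tendsto_const _ w_at_top]) auto
      then show ?thesis by (rule filterlim_compose[OF exp_at_bot])
    qed
    show "((\<lambda>\<theta>. 4096 * exp (- 3 * w \<theta>) * exp (- 2 * w \<theta>)) \<longlongrightarrow> 0) (at_left \<theta>0)"
      using tendsto_mult[OF tendsto_mult_left[OF exp_w_tendsto_0, of 4096] emw] by simp
  qed
  have "((\<lambda>\<theta>. exp (4 * w \<theta>) * (3 * (tan (\<theta>0 - \<theta>) - (\<theta>0 - \<theta>))) + sqrt 2 * \<phi> (?z \<theta>) * (exp (4 * w \<theta>) * ?z \<theta> ^ 4))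
     \<longlongrightarrow> 0 + sqrt 2 * K * root 3 (3 / sqrt 2) ^ 4) (at_left \<theta>0)"
    by (intro tendsto_add td tendsto_mult tendsto_const phi exp4w_cube_root_tendsto)
  then have "((\<lambda>\<theta>. exp (4 * w \<theta>) * (B \<theta> - 3 * (\<theta>0 - \<theta>))) \<longlongrightarrow> 0 + sqrt 2 * K * root 3 (3 / sqrt 2) ^ 4) (at_left \<theta>0)"
  proof (rule Lim_transform_eventually)
    show "\<forall>\<^sub>F \<theta> in at_left \<theta>0. exp (4 * w \<theta>) * (3 * (tan (\<theta>0 - \<theta>) - (\<theta>0 - \<theta>))) + sqrt 2 * \<phi> (?z \<theta>) * (exp (4 * w \<theta>) * ?z \<theta> ^ 4)
       = exp (4 * w \<theta>) * (B \<theta> - 3 * (\<theta>0 - \<theta>))"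
      using B
    proof eventually_elim
      case (elim \<theta>)
      show ?case unfolding elim by (simp add: algebra_simps)
    qed
  qed
  then have "((\<lambda>\<theta>. \<sigma> * (exp (4 * w \<theta>) * (B \<theta> - 3 * (\<theta>0 - \<theta>)))) \<longlongrightarrow> \<sigma> * (0 + sqrt 2 * K * root 3 (3 / sqrt 2) ^ 4)) (at_left \<theta>0)"
    by (rule tendsto_mult_left)
  moreover have "((\<lambda>\<theta>. \<sigma> * (exp (4 * w \<theta>) * (T \<theta> - 3 * (\<theta>0 - \<theta>)))) \<longlongrightarrow> \<sigma> * b) (at_left \<theta>0)"
    by (rule tendsto_mult_left[OF b])
  ultimately have "\<sigma> * b \<le> \<sigma> * (0 + sqrt 2 * K * root 3 (3 / sqrt 2) ^ 4)"
  proof (rule tendsto_le[rotated])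
    show "\<forall>\<^sub>F \<theta> in at_left \<theta>0. \<sigma> * (exp (4 * w \<theta>) * (T \<theta> - 3 * (\<theta>0 - \<theta>))) \<le> \<sigma> * (exp (4 * w \<theta>) * (B \<theta> - 3 * (\<theta>0 - \<theta>)))"
      using cmp
    proof eventually_elim
      case (elim \<theta>)
      have "exp (4 * w \<theta>) * (\<sigma> * T \<theta> - \<sigma> * (3 * (\<theta>0 - \<theta>))) \<le> exp (4 * w \<theta>) * (\<sigma> * B \<theta> - \<sigma> * (3 * (\<theta>0 - \<theta>)))"
        using elim by (intro mult_left_mono) auto
      then show ?case by (simp add: algebra_simps)
    qed
  qed simp
  then show ?thesis by simp
qed

end

section \<open>Sign certificates for polynomials\<close>

fun horner :: "real list \<Rightarrow> real \<Rightarrow> real" where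
  "horner [] x = 0"
| "horner (c # cs) x = c + x * horner cs x"

fun padd :: "real list \<Rightarrow> real list \<Rightarrow> real list" where
  "padd [] ds = ds"
| "padd cs [] = cs"
| "padd (c # cs) (d # ds) = (c + d) # padd cs ds"

text \<open>Coefficients of \<open>c + (a + x) q(x)\<close> for a list of coefficients of \<open>q\<close>.\<close>

fun pstep :: "real \<Rightarrow> real \<Rightarrow> real list \<Rightarrow> real list" where
  "pstep a c [] = [c]"
| "pstep a c (d # ds) = (c + a * d) # pstep a d ds"

fun pshift :: "real \<Rightarrow> real list \<Rightarrow> real list" where
  "pshift a [] = []"
| "pshift a (c # cs) = pstep a c (pshift a cs)"

text \<open>A lower bound on \<open>[0, w]\<close>, obtained by running Horner's scheme with \<open>x\<close> replaced by \<open>0\<close> or \<open>w\<close>,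
whichever is worse.\<close>

fun plower :: "real \<Rightarrow> real list \<Rightarrow> real" where
  "plower w [] = 0"
| "plower w (c # cs) = c + min 0 (w * plower w cs)"

lemma horner_padd: "horner (padd cs ds) x = horner cs x + horner ds x"
  by (induction cs ds rule: padd.induct) (auto simp: algebra_simps)

lemma horner_map_mult: "horner (map ((*) a) cs) x = a * horner cs x"
  by (induction cs) (auto simp: algebra_simps)

lemma horner_pstep: "horner (pstep a c cs) x = c + (a + x) * horner cs x"
  by (induction cs arbitrary: c) (simp_all add: algebra_simps)

lemma horner_pshift: "horner (pshift a cs) x = horner cs (a + x)"
  by (induction cs) (simp_all add: horner_pstep)

lemma plower_le_horner: "0 \<le> x \<Longrightarrow> x \<le> w \<Longrightarrow> plower w cs \<le> horner cs x"
proof (induction cs)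
  case (Cons c cs)
  have "min 0 (w * plower w cs) \<le> x * horner cs x"
  proof (cases "plower w cs \<ge> 0")
    case True
    then have "0 \<le> x * horner cs x" using Cons by (intro mult_nonneg_nonneg) auto
    then show ?thesis by simp
  next
    case False
    then have "w * plower w cs \<le> x * plower w cs" using Cons.prems by (intro mult_right_mono_neg) auto
    also have "\<dots> \<le> x * horner cs x" using Cons by (intro mult_left_mono) auto
    finally show ?thesis by simp
  qed
  then show ?case by simp
qed simp

text \<open>Taylor expansion at the left end point followed by the Horner bound; on short intervals this is sharp
enough, and it is evaluated by rational arithmetic alone.\<close>

lemma horner_nonneg_on_interval:
  assumes "plower (b - a) (pshift a cs) \<ge> 0" "a \<le> x" "x \<le> b"
  shows "horner cs x \<ge> 0"
  using plower_le_horner[of "x - a" "b - a" "pshift a cs"] assms by (simp add: horner_pshift)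

lemma horner_pos_on_interval:
  assumes "plower (b - a) (pshift a cs) > 0" "a \<le> x" "x \<le> b"
  shows "horner cs x > 0"
  using plower_le_horner[of "x - a" "b - a" "pshift a cs"] assms by (simp add: horner_pshift)

fun pmul :: "real list \<Rightarrow> real list \<Rightarrow> real list" where
  "pmul [] ds = []"
| "pmul (c # cs) ds = padd (map ((*) c) ds) (0 # pmul cs ds)"

fun pdiff :: "real list \<Rightarrow> real list" where
  "pdiff [] = []"
| "pdiff (c # cs) = padd cs (0 # pdiff cs)"

lemma horner_pmul: "horner (pmul cs ds) x = horner cs x * horner ds x"
  by (induction cs) (auto simp: horner_padd horner_map_mult algebra_simps)

lemma DERIV_horner: "(horner cs has_real_derivative horner (pdiff cs) x) (at x)"
proof (induction cs)
  case (Cons c cs)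
  have "((\<lambda>x. c + x * horner cs x) has_real_derivative 0 + (1 * horner cs x + horner (pdiff cs) x * x)) (at x)"
    by (intro DERIV_add DERIV_const DERIV_mult DERIV_ident Cons)
  moreover have "horner (c # cs) = (\<lambda>x. c + x * horner cs x)" by auto
  ultimately show ?case by (simp add: horner_padd mult.commute)
next
  case Nil
  have "horner [] = (\<lambda>_. 0)" by auto
  then show ?case by simp
qed

text \<open>The difference of the two sides of the barrier inequality for \<open>B = sqrt 2 z\<^sup>3 h(z) / E(z)\<close>, multiplied by
the common positive denominator; the next lemma gives it in closed form. The sign \<open>\<tau>\<close> is \<open>1\<close> in
the sector of \<open>U_plus\<close> and \<open>-1\<close> in that of \<open>U_minus\<close>.\<close>

definition barrier_poly :: "real list \<Rightarrow> real \<Rightarrow> real list" where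
  "barrier_poly h \<tau> =
    (let E = [1, 0, 0, - \<tau> / 3, 0, 0, - 2 / 9];
         N = padd (pmul (padd (map ((*) 3) h) (0 # pdiff h)) E) (pmul h [0, 0, 0, \<tau>, 0, 0, 4 / 3]);
         L = pmul (pmul [1, 0, 0, 0, 0, 0, 2 / 9] h) N;
         R = pmul (padd (pmul E E) (pmul [0, 0, 0, 0, 0, 0, 2] (pmul h h))) (padd (map ((*) 7) h) [- 4, 0, 0, 2 * \<tau> / 3])
     in padd R (map ((*) (- 1)) L))"

lemma horner_barrier_poly:
  fixes h :: "real list" and z \<tau> :: real
  defines "E \<equiv> 1 - \<tau> * z ^ 3 / 3 - 2 * z ^ 6 / 9"
  shows "horner (barrier_poly h \<tau>) z =
    (E\<^sup>2 + 2 * z ^ 6 * (horner h z)\<^sup>2) * (7 * horner h z - 4 + 2 * \<tau> * z ^ 3 / 3)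
    - (1 + 2 * z ^ 6 / 9) * horner h z * ((3 * horner h z + z * horner (pdiff h) z) * E + horner h z * (\<tau> * z ^ 3 + 4 * z ^ 6 / 3))"
proof -
  have E: "horner [1, 0, 0, - \<tau> / 3, 0, 0, - 2 / 9] z = E" by (simp add: E_def numeral_eq_Suc algebra_simps)
  have a: "horner [0, 0, 0, \<tau>, 0, 0, 4 / 3] z = \<tau> * z ^ 3 + 4 * z ^ 6 / 3"
    "horner [1, 0, 0, 0, 0, 0, 2 / 9] z = 1 + 2 * z ^ 6 / 9" "horner [0, 0, 0, 0, 0, 0, 2] z = 2 * z ^ 6"
    "horner [- 4, 0, 0, 2 * \<tau> / 3] z = - 4 + 2 * \<tau> * z ^ 3 / 3"
    by (simp_all add: numeral_eq_Suc algebra_simps)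
  show ?thesis
    unfolding barrier_poly_def Let_def horner_padd horner_pmul horner_map_mult E a
    by (simp add: power2_eq_square)
qed

text \<open>The barrier polynomials \<open>h\<close> were found numerically. Their linear coefficients \<open>7/50\<close>, \<open>1/1000\<close> and
\<open>-4/25\<close> are what enters the final bounds: \<open>7/50\<close> is just below \<open>sqrt 2 / 10\<close>, and \<open>-4/25\<close> just below
\<open>-(11/100) sqrt 2\<close>. The two lowest coefficients of the defect vanish: \<open>h(0) = 1\<close> matches the
first mode of \<open>T\<close>, and the linear coefficient is that of the second mode, which the equation leaves free.
The remaining factor is certified on subintervals. The interval ends
\<open>229/200\<close> and \<open>577/400\<close> are just above \<open>(3/2)^(1/3)\<close> and \<open>3^(1/3)\<close>, the values of \<open>z\<close> on the axis.\<close>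

definition upper_plus :: "real list" where "upper_plus = [1, 7/50, -13/100, -4/5, 53/100]"

definition upper_plus_defect :: "real list" where "upper_plus_defect =
    [129/2500, 6457/15000, -6967/6000, -4301/3000, 140587/45000, 98209/15000, -112771/30000,
     -17879507/1125000, 1067983/281250, 24715327/2250000, 605038609/40500000,
     -237828403/10125000, 64460837/40500000, -13816651/60750000, 465881983/40500000,
     -3033881/337500, 1042139/500000, -212/10125, 2809/202500, 0]"

lemma upper_plus_defect_eq: "map ((*) 1) (barrier_poly upper_plus 1) = 0 # 0 # upper_plus_defect"
  by (simp add: barrier_poly_def Let_def upper_plus_def upper_plus_defect_def)

lemma upper_plus_defect_nonneg:
  assumes "0 \<le> z" "z \<le> 229/200"
  shows "horner upper_plus_defect z \<ge> 0"
proof -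
  have 1: "horner upper_plus_defect z \<ge> 0" if "0 \<le> z" "z \<le> 17/50"
    by (rule horner_nonneg_on_interval[OF _ that]) (simp add: upper_plus_defect_def)
  have 2: "horner upper_plus_defect z \<ge> 0" if "17/50 \<le> z" "z \<le> 37/50"
    by (rule horner_nonneg_on_interval[OF _ that]) (simp add: upper_plus_defect_def)
  have 3: "horner upper_plus_defect z \<ge> 0" if "37/50 \<le> z" "z \<le> 1"
    by (rule horner_nonneg_on_interval[OF _ that]) (simp add: upper_plus_defect_def)
  have 4: "horner upper_plus_defect z \<ge> 0" if "1 \<le> z" "z \<le> 229/200"
    by (rule horner_nonneg_on_interval[OF _ that]) (simp add: upper_plus_defect_def)
  from assms show ?thesis using 1 2 3 4 by linarith
qed

lemma upper_plus_pos:
  assumes "0 \<le> z" "z \<le> 229/200"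
  shows "horner upper_plus z > 0"
proof -
  have 1: "horner upper_plus z > 0" if "0 \<le> z" "z \<le> 107/100"
    by (rule horner_pos_on_interval[OF _ that]) (simp add: upper_plus_def)
  have 2: "horner upper_plus z > 0" if "107/100 \<le> z" "z \<le> 229/200"
    by (rule horner_pos_on_interval[OF _ that]) (simp add: upper_plus_def)
  from assms show ?thesis using 1 2 by linarith
qed

definition lower_plus :: "real list" where "lower_plus = [1, 1/1000, 1/20, -39/50, 43/100]"

definition lower_plus_defect :: "real list" where "lower_plus_defect =
    [12501/250000, -13573/60000, 38971/30000, -672811/3000000, -391297/180000, -221137/75000,
     231413/750000, 63763999937/4500000000, -745369789/90000000, 19506629/9375000,
     -74172697843/4050000000, 4099784593/202500000, -1463052751/202500000,
     8690303273/1215000000, -421759277/40500000, 116520541/20250000, -556549/500000, 559/33750,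
     -1849/202500, 0]"

lemma lower_plus_defect_eq: "map ((*) (- 1)) (barrier_poly lower_plus 1) = 0 # 0 # lower_plus_defect"
  by (simp add: barrier_poly_def Let_def lower_plus_def lower_plus_defect_def)

lemma lower_plus_defect_nonneg:
  assumes "0 \<le> z" "z \<le> 229/200"
  shows "horner lower_plus_defect z \<ge> 0"
proof -
  have 1: "horner lower_plus_defect z \<ge> 0" if "0 \<le> z" "z \<le> 11/50"
    by (rule horner_nonneg_on_interval[OF _ that]) (simp add: lower_plus_defect_def)
  have 2: "horner lower_plus_defect z \<ge> 0" if "11/50 \<le> z" "z \<le> 3/5"
    by (rule horner_nonneg_on_interval[OF _ that]) (simp add: lower_plus_defect_def)
  have 3: "horner lower_plus_defect z \<ge> 0" if "3/5 \<le> z" "z \<le> 91/100"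
    by (rule horner_nonneg_on_interval[OF _ that]) (simp add: lower_plus_defect_def)
  have 4: "horner lower_plus_defect z \<ge> 0" if "91/100 \<le> z" "z \<le> 229/200"
    by (rule horner_nonneg_on_interval[OF _ that]) (simp add: lower_plus_defect_def)
  from assms show ?thesis using 1 2 3 4 by linarith
qed

lemma lower_plus_pos:
  assumes "0 \<le> z" "z \<le> 229/200"
  shows "horner lower_plus z > 0"
proof -
  have 1: "horner lower_plus z > 0" if "0 \<le> z" "z \<le> 11/10"
    by (rule horner_pos_on_interval[OF _ that]) (simp add: lower_plus_def)
  have 2: "horner lower_plus z > 0" if "11/10 \<le> z" "z \<le> 229/200"
    by (rule horner_pos_on_interval[OF _ that]) (simp add: lower_plus_def)
  from assms show ?thesis using 1 2 by linarith
qed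

definition upper_minus :: "real list" where "upper_minus = [1, -4/25, -8/25, 9/25]"

definition upper_minus_defect :: "real list" where "upper_minus_defect =
    [136/625, 286/1875, -236/375, -8/375, 20888/5625, -6284/1875, -10672/1875, 1288486/140625,
     -22184/140625, -2797408/421875, 4886144/1265625, 861304/1265625, -1824896/1265625,
     1830808/3796875, 32/50625, 32/5625, 0, 0]"

lemma upper_minus_defect_eq: "map ((*) 1) (barrier_poly upper_minus (- 1)) = 0 # 0 # upper_minus_defect"
  by (simp add: barrier_poly_def Let_def upper_minus_def upper_minus_defect_def)

lemma upper_minus_defect_nonneg:
  assumes "0 \<le> z" "z \<le> 577/400"
  shows "horner upper_minus_defect z \<ge> 0"
proof -
  have 1: "horner upper_minus_defect z \<ge> 0" if "0 \<le> z" "z \<le> 61/100"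
    by (rule horner_nonneg_on_interval[OF _ that]) (simp add: upper_minus_defect_def)
  have 2: "horner upper_minus_defect z \<ge> 0" if "61/100 \<le> z" "z \<le> 577/400"
    by (rule horner_nonneg_on_interval[OF _ that]) (simp add: upper_minus_defect_def)
  from assms show ?thesis using 1 2 by linarith
qed

lemma upper_minus_pos:
  assumes "0 \<le> z" "z \<le> 577/400"
  shows "horner upper_minus z > 0"
  by (rule horner_pos_on_interval[OF _ assms]) (simp add: upper_minus_def)

section \<open>Polynomial barriers and bounds on the coefficient\<close>

context cone_graph
begin

text \<open>In the variable \<open>z\<close> with \<open>tan (\<theta>0 - \<theta>) = sqrt 2 z\<^sup>3 / 3\<close> all coefficients become rational in \<open>z\<close>. The
function \<open>E\<close> is the denominator of \<open>M\<close> and vanishes on the axis, so that \<open>B = sqrt 2 z\<^sup>3 h / E\<close> has the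
same simple pole there as \<open>T\<close>; the bound on \<open>z\<close> in the assumptions is where the axis lies. The prefactor
is chosen so that \<open>B\<close> agrees with \<open>3 tan (\<theta>0 - \<theta>)\<close> to leading order.\<close>

lemma rational_barrier:
  fixes h h' :: "real \<Rightarrow> real" and \<sigma> \<tau> b :: real
  defines "E \<equiv> \<lambda>z. 1 - \<tau> * z ^ 3 / 3 - 2 * z ^ 6 / 9"
  assumes geo: "\<tau> = 1 \<and> t0 = 1 / sqrt 2 \<or> \<tau> = -1 \<and> t0 = sqrt 2" and \<sigma>: "\<sigma> = 1 \<or> \<sigma> = -1"
    and dh: "\<And>z. (h has_real_derivative h' z) (at z)" and h0: "h 0 = 1"
    and hpos: "\<And>z. 0 < z \<Longrightarrow> 2 * z ^ 3 < 9 / 2 + - \<tau> * (3 / 2) \<Longrightarrow> h z > 0"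
    and ineq: "\<And>z. 0 < z \<Longrightarrow> 2 * z ^ 3 < 9 / 2 + - \<tau> * (3 / 2) \<Longrightarrow>
       \<sigma> * ((1 + 2 * z ^ 6 / 9) * h z * ((3 * h z + z * h' z) * E z + h z * (\<tau> * z ^ 3 + 4 * z ^ 6 / 3)))
       \<le> \<sigma> * (((E z)\<^sup>2 + 2 * z ^ 6 * (h z)\<^sup>2) * (7 * h z - 4 + 2 * \<tau> * z ^ 3 / 3))"
    and b: "((\<lambda>\<theta>. exp (4 * w \<theta>) * (T \<theta> - 3 * (\<theta>0 - \<theta>))) \<longlongrightarrow> b) (at_left \<theta>0)"
  shows "\<sigma> * b \<le> \<sigma> * (sqrt 2 * h' 0 * root 3 (3 / sqrt 2) ^ 4)"
proof -
  define z where "z = (\<lambda>\<theta>. root 3 (3 * tan (\<theta>0 - \<theta>) / sqrt 2))"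
  define \<Phi> where "\<Phi> = (\<lambda>z. z ^ 3 * h z / E z)"
  define N where "N = (\<lambda>z. (3 * h z + z * h' z) * E z + h z * (\<tau> * z ^ 3 + 4 * z ^ 6 / 3))"
  define B where "B = (\<lambda>\<theta>. sqrt 2 * \<Phi> (z \<theta>))"
  define B' where "B' = (\<lambda>\<theta>. (1 + 2 * z \<theta> ^ 6 / 9) * N (z \<theta>) / (E (z \<theta>))\<^sup>2)"
  have zfacts: "z \<theta> > 0" "tan (\<theta>0 - \<theta>) = sqrt 2 * z \<theta> ^ 3 / 3" "2 * z \<theta> ^ 3 < 9 / 2 + - \<tau> * (3 / 2)" "E (z \<theta>) > 0"
    "M \<theta> = sqrt 2 * z \<theta> ^ 3 * (4 - 2 * \<tau> * z \<theta> ^ 3 / 3) / E (z \<theta>)"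
    if a: "0 < \<theta>" "\<theta> < \<theta>0" for \<theta>
  proof -
    define y where "y = tan (\<theta>0 - \<theta>)"
    note MF = M_formula[OF a, folded y_def]
    define x where "x = y / sqrt 2"
    have y: "y = sqrt 2 * x" by (simp add: x_def)
    have x0: "x > 0" using MF(1) by (simp add: x_def)
    have xt: "sqrt 2 * x < t0" using MF(2) y by simp
    have z3: "z \<theta> ^ 3 = 3 * x" using MF(1) by (simp add: z_def x_def y_def)
    show "z \<theta> > 0" using MF(1) by (simp add: z_def y_def)
    show "tan (\<theta>0 - \<theta>) = sqrt 2 * z \<theta> ^ 3 / 3" using z3 y by (simp add: y_def)
    have z6: "z \<theta> ^ 6 = 9 * x\<^sup>2"
    proof -
      have "z \<theta> ^ 6 = (z \<theta> ^ 3)\<^sup>2" by (simp add: power_mult[symmetric])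
      then show ?thesis by (simp add: z3 power_mult_distrib)
    qed
    have Ez: "E (z \<theta>) = 1 - \<tau> * x - 2 * x\<^sup>2" by (simp add: E_def z3 z6)
    have s2: "sqrt 2 * sqrt 2 = (2::real)" by simp
    have cases: "2 * z \<theta> ^ 3 < 9 / 2 + - \<tau> * (3 / 2) \<and> E (z \<theta>) > 0 \<and>
       6 * y * (2 * t0 + (t0\<^sup>2 - 1) * y) / ((t0 - y) * (1 + t0 * y)) = sqrt 2 * (3 * x) * (4 - 2 * \<tau> * x) / E (z \<theta>)"
      using geo
    proof
      assume p: "\<tau> = 1 \<and> t0 = 1 / sqrt 2"
      have "sqrt 2 * (sqrt 2 * x) < sqrt 2 * (1 / sqrt 2)" using xt p by (intro mult_strict_left_mono) auto
      then have x1: "2 * x < 1" by (simp add: mult.assoc[symmetric])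
      have Ef: "E (z \<theta>) = (1 - 2 * x) * (1 + x)" unfolding Ez using p by (simp add: algebra_simps power2_eq_square)
      have dn: "(t0 - y) * (1 + t0 * y) = E (z \<theta>) / sqrt 2"
      proof -
        have "t0 - y = (1 - 2 * x) / sqrt 2" using p by (simp add: y field_simps)
        moreover have "t0 * y = x" using p by (simp add: y)
        ultimately show ?thesis unfolding Ef by simp
      qed
      have nm: "6 * y * (2 * t0 + (t0\<^sup>2 - 1) * y) = (3 * x) * (4 - 2 * x)"
      proof -
        have "t0\<^sup>2 = 1 / 2" "2 * t0 = sqrt 2" using p by (simp_all add: power_divide real_div_sqrt)
        moreover have "6 * (q * x) * (q + (1 / 2 - 1) * (q * x)) = 6 * (q * q) * x * (1 - x / 2)" for q :: real
          by (simp add: algebra_simps)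
        ultimately have "6 * y * (2 * t0 + (t0\<^sup>2 - 1) * y) = 6 * (sqrt 2 * sqrt 2) * x * (1 - x / 2)"
          unfolding y by (simp only:)
        then show ?thesis by (simp add: algebra_simps)
      qed
      have "6 * y * (2 * t0 + (t0\<^sup>2 - 1) * y) / ((t0 - y) * (1 + t0 * y)) = sqrt 2 * (3 * x) * (4 - 2 * \<tau> * x) / E (z \<theta>)"
        unfolding dn nm using p by simp
      moreover have "E (z \<theta>) > 0" unfolding Ef using x0 x1 by (intro mult_pos_pos) auto
      ultimately show ?thesis using p x1 z3 by simp
    next
      assume p: "\<tau> = -1 \<and> t0 = sqrt 2"
      have x1: "x < 1" using xt p by simp
      have Ef: "E (z \<theta>) = (1 - x) * (1 + 2 * x)" unfolding Ez using p by (simp add: algebra_simps power2_eq_square)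
      have dn: "(t0 - y) * (1 + t0 * y) = sqrt 2 * E (z \<theta>)"
      proof -
        have "t0 - y = sqrt 2 * (1 - x)" using p by (simp add: y algebra_simps)
        moreover have "t0 * y = 2 * x" using p by (simp add: y)
        ultimately show ?thesis unfolding Ef by simp
      qed
      have nm: "6 * y * (2 * t0 + (t0\<^sup>2 - 1) * y) = sqrt 2 * (sqrt 2 * (3 * x) * (4 + 2 * x))"
      proof -
        have "t0\<^sup>2 = 2" using p by simp
        moreover have "6 * (q * x) * (2 * q + (2 - 1) * (q * x)) = q * (q * (3 * x) * (4 + 2 * x))" for q :: real
          by (simp add: algebra_simps)
        ultimately show ?thesis using p unfolding y by (simp only:)
      qed
      have "6 * y * (2 * t0 + (t0\<^sup>2 - 1) * y) / ((t0 - y) * (1 + t0 * y)) = sqrt 2 * (3 * x) * (4 - 2 * \<tau> * x) / E (z \<theta>)"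
        unfolding dn nm using p by simp
      moreover have "E (z \<theta>) > 0" unfolding Ef using x0 x1 by (intro mult_pos_pos) auto
      ultimately show ?thesis using p x1 z3 by simp
    qed
    then show "2 * z \<theta> ^ 3 < 9 / 2 + - \<tau> * (3 / 2)" "E (z \<theta>) > 0" by auto
    show "M \<theta> = sqrt 2 * z \<theta> ^ 3 * (4 - 2 * \<tau> * z \<theta> ^ 3 / 3) / E (z \<theta>)"
      unfolding MF(3) using cases by (simp add: z3)
  qed
  have dE: "(E has_real_derivative - \<tau> * x\<^sup>2 - 4 * x ^ 5 / 3) (at x)" for x
    unfolding E_def by (auto intro!: derivative_eq_intros)
  have dz: "(z has_real_derivative - (1 + 2 * z \<theta> ^ 6 / 9) / (sqrt 2 * (z \<theta>)\<^sup>2)) (at \<theta>)" if a: "0 < \<theta>" "\<theta> < \<theta>0" for \<theta>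
  proof -
    note zf = zfacts[OF a]
    have c: "cos (\<theta>0 - \<theta>) > 0" using a \<theta>0 by (intro cos_gt_zero_pi) auto
    have t: "((\<lambda>\<theta>. tan (\<theta>0 - \<theta>)) has_real_derivative inverse ((cos (\<theta>0 - \<theta>))\<^sup>2) * (0 - 1)) (at \<theta>)"
      by (rule DERIV_chain2[where f=tan and g="\<lambda>\<theta>. \<theta>0 - \<theta>", OF DERIV_tan DERIV_diff[OF DERIV_const DERIV_ident]]) (use c in auto)
    have sec: "inverse ((cos (\<theta>0 - \<theta>))\<^sup>2) = 1 + (tan (\<theta>0 - \<theta>))\<^sup>2"
      using tan_sec[of "\<theta>0 - \<theta>"] c by (simp add: power_inverse)
    have "((\<lambda>\<theta>. 3 * tan (\<theta>0 - \<theta>) / sqrt 2) has_real_derivative 3 * (inverse ((cos (\<theta>0 - \<theta>))\<^sup>2) * (0 - 1)) / sqrt 2) (at \<theta>)"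
      by (intro DERIV_cdivide DERIV_cmult t)
    moreover have yp: "0 < 3 * tan (\<theta>0 - \<theta>) / sqrt 2"
    proof -
      have "3 * tan (\<theta>0 - \<theta>) / sqrt 2 = z \<theta> ^ 3" unfolding zf(2) by simp
      then show ?thesis using zf(1) by simp
    qed
    have "(root 3 has_real_derivative inverse (real 3 * root 3 (3 * tan (\<theta>0 - \<theta>) / sqrt 2) ^ (3 - Suc 0))) (at (3 * tan (\<theta>0 - \<theta>) / sqrt 2))"
      by (rule DERIV_real_root) (use yp in auto)
    ultimately have "(z has_real_derivative inverse (real 3 * root 3 (3 * tan (\<theta>0 - \<theta>) / sqrt 2) ^ (3 - Suc 0)) *
        (3 * (inverse ((cos (\<theta>0 - \<theta>))\<^sup>2) * (0 - 1)) / sqrt 2)) (at \<theta>)"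
      unfolding z_def by (intro DERIV_chain2[where f="root 3" and g="\<lambda>\<theta>. 3 * tan (\<theta>0 - \<theta>) / sqrt 2"])
    moreover have "inverse (real 3 * root 3 (3 * tan (\<theta>0 - \<theta>) / sqrt 2) ^ (3 - Suc 0)) *
        (3 * (inverse ((cos (\<theta>0 - \<theta>))\<^sup>2) * (0 - 1)) / sqrt 2) = - (1 + (tan (\<theta>0 - \<theta>))\<^sup>2) / (sqrt 2 * (z \<theta>)\<^sup>2)"
    proof -
      have zz: "root 3 (3 * tan (\<theta>0 - \<theta>) / sqrt 2) = z \<theta>" by (simp add: z_def)
      have "inverse (3 * y\<^sup>2) * (3 * (v * (0 - 1)) / q) = - v / (q * y\<^sup>2)" if "y > 0" "q > 0" for y v q :: real
        using that by (simp add: field_simps)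
      from this[of "z \<theta>" "sqrt 2" "1 + (tan (\<theta>0 - \<theta>))\<^sup>2"] zf(1)
      show ?thesis unfolding sec zz by simp
    qed
    moreover have "(tan (\<theta>0 - \<theta>))\<^sup>2 = 2 * z \<theta> ^ 6 / 9"
      unfolding zf(2) by (simp add: power_divide power_mult_distrib power_mult[symmetric])
    ultimately show ?thesis by simp
  qed
  have Np: "(\<Phi> has_real_derivative x\<^sup>2 * N x / (E x)\<^sup>2) (at x)" if "E x \<noteq> 0" for x
  proof -
    have "(\<Phi> has_real_derivative ((3 * x\<^sup>2 * h x + h' x * x ^ 3) * E x - x ^ 3 * h x * (- \<tau> * x\<^sup>2 - 4 * x ^ 5 / 3)) / (E x * E x)) (at x)"
      unfolding \<Phi>_def using that by (intro DERIV_divide DERIV_mult dh dE) (auto intro!: derivative_eq_intros)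
    moreover have "(3 * x\<^sup>2 * h x + h' x * x ^ 3) * E x - x ^ 3 * h x * (- \<tau> * x\<^sup>2 - 4 * x ^ 5 / 3) = x\<^sup>2 * N x"
      unfolding N_def by (simp add: algebra_simps power2_eq_square power3_eq_cube numeral_eq_Suc)
    ultimately show ?thesis by (simp add: power2_eq_square)
  qed
  have dB: "(B has_real_derivative - B' \<theta>) (at \<theta>)" if a: "0 < \<theta>" "\<theta> < \<theta>0" for \<theta>
  proof -
    note zf = zfacts[OF a]
    have "((\<lambda>\<theta>. \<Phi> (z \<theta>)) has_real_derivative ((z \<theta>)\<^sup>2 * N (z \<theta>) / (E (z \<theta>))\<^sup>2) * (- (1 + 2 * z \<theta> ^ 6 / 9) / (sqrt 2 * (z \<theta>)\<^sup>2))) (at \<theta>)"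
      by (rule DERIV_chain2[where f=\<Phi> and g=z, OF Np dz[OF a]]) (use zf in auto)
    from DERIV_cmult[OF this, of "sqrt 2"]
    have "(B has_real_derivative sqrt 2 * (((z \<theta>)\<^sup>2 * N (z \<theta>) / (E (z \<theta>))\<^sup>2) * (- (1 + 2 * z \<theta> ^ 6 / 9) / (sqrt 2 * (z \<theta>)\<^sup>2)))) (at \<theta>)"
      unfolding B_def .
    moreover
    have "s * ((u * n / e) * (- v / (s * u))) = - (v * n / e)" if "s \<noteq> 0" "u \<noteq> 0" for s u n v e :: real
      using that by (simp add: field_simps)
    from this[of "sqrt 2" "(z \<theta>)\<^sup>2" "N (z \<theta>)" "(E (z \<theta>))\<^sup>2" "1 + 2 * z \<theta> ^ 6 / 9"]
    have "sqrt 2 * (((z \<theta>)\<^sup>2 * N (z \<theta>) / (E (z \<theta>))\<^sup>2) * (- (1 + 2 * z \<theta> ^ 6 / 9) / (sqrt 2 * (z \<theta>)\<^sup>2))) = - B' \<theta>"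
      using zf(1) by (simp only: B'_def) simp
    ultimately show ?thesis by (simp only:)
  qed
  have Bp: "B \<theta> > 0" if a: "0 < \<theta>" "\<theta> < \<theta>0" for \<theta>
    using zfacts[OF a] hpos[of "z \<theta>"] unfolding B_def \<Phi>_def by (intro mult_pos_pos divide_pos_pos) auto
  have Bineq: "\<sigma> * B' \<theta> \<le> \<sigma> * ((1 + (B \<theta>)\<^sup>2) * (7 - M \<theta> / B \<theta>))" if a: "0 < \<theta>" "\<theta> < \<theta>0" for \<theta>
  proof -
    note zf = zfacts[OF a]
    define y where "y = z \<theta>"
    have hp: "h y > 0" using hpos[of y] zf by (simp add: y_def)
    have Ep: "E y > 0" and yp: "y > 0" using zf by (simp_all add: y_def)
    have den: "(E y)\<^sup>2 * h y > 0" using Ep hp by simp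
    have "\<sigma> * ((1 + 2 * y ^ 6 / 9) * h y * N y) \<le> \<sigma> * (((E y)\<^sup>2 + 2 * y ^ 6 * (h y)\<^sup>2) * (7 * h y - 4 + 2 * \<tau> * y ^ 3 / 3))"
      using ineq[of y] zf unfolding N_def y_def by simp
    then have "\<sigma> * ((1 + 2 * y ^ 6 / 9) * h y * N y) / ((E y)\<^sup>2 * h y) \<le>
        \<sigma> * (((E y)\<^sup>2 + 2 * y ^ 6 * (h y)\<^sup>2) * (7 * h y - 4 + 2 * \<tau> * y ^ 3 / 3)) / ((E y)\<^sup>2 * h y)"
      using den by (intro divide_right_mono) auto
    moreover have "\<sigma> * ((1 + 2 * y ^ 6 / 9) * h y * N y) / ((E y)\<^sup>2 * h y) = \<sigma> * B' \<theta>"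
      using hp by (simp add: B'_def y_def)
    moreover have "\<sigma> * (((E y)\<^sup>2 + 2 * y ^ 6 * (h y)\<^sup>2) * (7 * h y - 4 + 2 * \<tau> * y ^ 3 / 3)) / ((E y)\<^sup>2 * h y)
       = \<sigma> * ((1 + (B \<theta>)\<^sup>2) * (7 - M \<theta> / B \<theta>))"
    proof -
      have B2: "(B \<theta>)\<^sup>2 = 2 * y ^ 6 * (h y)\<^sup>2 / (E y)\<^sup>2"
        unfolding B_def \<Phi>_def y_def by (simp add: power_mult_distrib power_divide power_mult[symmetric])
      have MB: "M \<theta> / B \<theta> = (4 - 2 * \<tau> * y ^ 3 / 3) / h y"
        unfolding zf(5) B_def \<Phi>_def y_def[symmetric] using yp Ep hp by simp
      have gen: "\<sigma> * ((e2 + c) * (7 * hh - 4 + d)) / (e2 * hh) = \<sigma> * ((1 + c / e2) * (7 - (4 - d) / hh))"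
        if "e2 > 0" "hh > 0" for e2 c hh d :: real
        using that by (simp add: field_simps)
      show ?thesis unfolding B2 MB by (rule gen) (use Ep hp in auto)
    qed
    ultimately show ?thesis by simp
  qed
  have cmp: "\<sigma> * T \<theta> \<le> \<sigma> * B \<theta>" if "0 < \<theta>" "\<theta> < \<theta>0" for \<theta>
    by (rule comparison[OF \<sigma> Bp dB Bineq that])
  define \<phi> where "\<phi> = (\<lambda>y. if y = 0 then h' 0 else (h y / E y - 1) / y)"
  show ?thesis
  proof (rule barrier_bound[OF \<sigma> b, where B=B and \<phi>=\<phi>])
    show "\<forall>\<^sub>F \<theta> in at_left \<theta>0. \<sigma> * T \<theta> \<le> \<sigma> * B \<theta>"
      using eventually_near by eventually_elim (use cmp in auto)
    show "\<forall>\<^sub>F \<theta> in at_left \<theta>0. B \<theta> = 3 * tan (\<theta>0 - \<theta>) + sqrt 2 * (root 3 (3 * tan (\<theta>0 - \<theta>) / sqrt 2)) ^ 4 * \<phi> (root 3 (3 * tan (\<theta>0 - \<theta>) / sqrt 2))"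
      using eventually_near
    proof eventually_elim
      case (elim \<theta>)
      note zf = zfacts[OF conjunct1[OF elim] conjunct2[OF elim]]
      have "B \<theta> = 3 * (sqrt 2 * z \<theta> ^ 3 / 3) + sqrt 2 * z \<theta> ^ 4 * ((h (z \<theta>) / E (z \<theta>) - 1) / z \<theta>)"
        using zf(1) unfolding B_def \<Phi>_def by (simp add: field_simps numeral_eq_Suc)
      then show ?case unfolding zf(2)[symmetric] using zf(1) by (simp add: \<phi>_def z_def)
    qed
    have E0: "E 0 = 1" by (simp add: E_def)
    have "((\<lambda>y. h y / E y) has_real_derivative (h' 0 * E 0 - h 0 * (- \<tau> * 0\<^sup>2 - 4 * 0 ^ 5 / 3)) / (E 0 * E 0)) (at 0)"
      by (intro DERIV_divide dh dE) (simp add: E0)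
    then have "((\<lambda>y. (h y / E y - 1) / y) \<longlongrightarrow> h' 0) (at 0)"
      by (simp add: DERIV_def E0 h0)
    then have "(\<phi> \<longlongrightarrow> h' 0) (at 0)"
      by (rule Lim_transform_eventually) (simp add: eventually_at_filter \<phi>_def)
    then show "(\<phi> \<longlongrightarrow> h' 0) (nhds 0)"
      using tendsto_at_iff_tendsto_nhds[of \<phi> "0::real"] by (simp add: \<phi>_def)
  qed
qed

lemma polynomial_barrier:
  fixes h ps :: "real list" and \<sigma> \<tau> b Z :: real
  assumes geo: "\<tau> = 1 \<and> t0 = 1 / sqrt 2 \<or> \<tau> = -1 \<and> t0 = sqrt 2" and \<sigma>: "\<sigma> = 1 \<or> \<sigma> = -1"
    and ps: "map ((*) \<sigma>) (barrier_poly h \<tau>) = 0 # 0 # ps" and h0: "horner h 0 = 1"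
    and Z: "0 < Z" "9 / 2 - \<tau> * (3 / 2) \<le> 2 * Z ^ 3"
    and pos: "\<And>z. 0 \<le> z \<Longrightarrow> z \<le> Z \<Longrightarrow> horner h z > 0" and ineq: "\<And>z. 0 \<le> z \<Longrightarrow> z \<le> Z \<Longrightarrow> horner ps z \<ge> 0"
    and b: "((\<lambda>\<theta>. exp (4 * w \<theta>) * (T \<theta> - 3 * (\<theta>0 - \<theta>))) \<longlongrightarrow> b) (at_left \<theta>0)"
  shows "\<sigma> * b \<le> \<sigma> * (sqrt 2 * horner (pdiff h) 0 * root 3 (3 / sqrt 2) ^ 4)"
proof (rule rational_barrier[OF geo \<sigma> DERIV_horner h0 _ _ b])
  fix z :: real assume z: "0 < z" "2 * z ^ 3 < 9 / 2 + - \<tau> * (3 / 2)"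
  have zZ: "z \<le> Z"
  proof (rule ccontr)
    assume "\<not> z \<le> Z"
    then have "Z ^ 3 \<le> z ^ 3" using Z(1) by (intro power_mono) auto
    then show False using z(2) Z(2) by simp
  qed
  show "horner h z > 0" using pos z zZ by simp
  have "horner (map ((*) \<sigma>) (barrier_poly h \<tau>)) z = z * (z * horner ps z)" unfolding ps by simp
  also have "\<dots> \<ge> 0" using ineq[of z] z zZ by simp
  finally have "0 \<le> \<sigma> * horner (barrier_poly h \<tau>) z" by (simp add: horner_map_mult)
  then show "\<sigma> * ((1 + 2 * z ^ 6 / 9) * horner h z * ((3 * horner h z + z * horner (pdiff h) z) * (1 - \<tau> * z ^ 3 / 3 - 2 * z ^ 6 / 9)
        + horner h z * (\<tau> * z ^ 3 + 4 * z ^ 6 / 3)))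
     \<le> \<sigma> * (((1 - \<tau> * z ^ 3 / 3 - 2 * z ^ 6 / 9)\<^sup>2 + 2 * z ^ 6 * (horner h z)\<^sup>2) * (7 * horner h z - 4 + 2 * \<tau> * z ^ 3 / 3))"
    unfolding horner_barrier_poly by (simp add: right_diff_distrib)
qed

lemma coefficient_bounds_plus:
  assumes t0: "t0 = 1 / sqrt 2"
    and b: "((\<lambda>\<theta>. exp (4 * w \<theta>) * (T \<theta> - 3 * (\<theta>0 - \<theta>))) \<longlongrightarrow> b) (at_left \<theta>0)"
  shows "0 < b" "b \<le> sqrt 2 * (7 / 50) * root 3 (3 / sqrt 2) ^ 4"
proof -
  have geo: "(1::real) = 1 \<and> t0 = 1 / sqrt 2 \<or> (1::real) = -1 \<and> t0 = sqrt 2" using t0 by simp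
  have "1 * b \<le> 1 * (sqrt 2 * horner (pdiff upper_plus) 0 * root 3 (3 / sqrt 2) ^ 4)"
    by (rule polynomial_barrier[where Z="229 / 200", OF geo _ upper_plus_defect_eq _ _ _ upper_plus_pos upper_plus_defect_nonneg b])
      (simp_all add: power3_eq_cube upper_plus_def)
  then show "b \<le> sqrt 2 * (7 / 50) * root 3 (3 / sqrt 2) ^ 4" by (simp add: upper_plus_def)
  have "- 1 * b \<le> - 1 * (sqrt 2 * horner (pdiff lower_plus) 0 * root 3 (3 / sqrt 2) ^ 4)"
    by (rule polynomial_barrier[where Z="229 / 200", OF geo _ lower_plus_defect_eq _ _ _ lower_plus_pos lower_plus_defect_nonneg b])
      (simp_all add: power3_eq_cube lower_plus_def)
  then have "sqrt 2 * (1 / 1000) * root 3 (3 / sqrt 2) ^ 4 \<le> b" by (simp add: lower_plus_def)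
  moreover have "0 < sqrt 2 * (1 / 1000) * root 3 (3 / sqrt 2) ^ 4" by simp
  ultimately show "0 < b" by linarith
qed

lemma coefficient_bound_minus:
  assumes t0: "t0 = sqrt 2"
    and b: "((\<lambda>\<theta>. exp (4 * w \<theta>) * (T \<theta> - 3 * (\<theta>0 - \<theta>))) \<longlongrightarrow> b) (at_left \<theta>0)"
  shows "b \<le> - (sqrt 2 * (4 / 25) * root 3 (3 / sqrt 2) ^ 4)"
proof -
  have geo: "(- 1::real) = 1 \<and> t0 = 1 / sqrt 2 \<or> (- 1::real) = -1 \<and> t0 = sqrt 2" using t0 by simp
  have "1 * b \<le> 1 * (sqrt 2 * horner (pdiff upper_minus) 0 * root 3 (3 / sqrt 2) ^ 4)"
    by (rule polynomial_barrier[where Z="577 / 400", OF geo _ upper_minus_defect_eq _ _ _ upper_minus_pos upper_minus_defect_nonneg b])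
      (simp_all add: power3_eq_cube upper_minus_def)
  then show ?thesis by (simp add: upper_minus_def)
qed

end

text \<open>With \<open>r = root 3 (3 / sqrt 2)\<close> the left side is \<open>r\<^sup>2 / 9 \<cdot> sqrt 2 \<kappa> r^4\<close>, and \<open>r^6 = 9/2\<close>.\<close>

lemma scaled_coefficient:
  fixes \<kappa> :: real
  shows "(3 * sqrt 2 / 2) powr (2 / 3) / 9 * (sqrt 2 * \<kappa> * root 3 (3 / sqrt 2) ^ 4) = \<kappa> / sqrt 2"
proof -
  define r where "r = root 3 (3 / sqrt 2)"
  have r0: "r > 0" by (simp add: r_def)
  have r3: "r ^ 3 = 3 / sqrt 2" by (simp add: r_def)
  have e: "3 * sqrt 2 / 2 = 3 / sqrt (2::real)"
    by (simp add: field_simps)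
  have "(3 * sqrt 2 / 2) powr (2 / 3) = (r ^ 3) powr (2 / 3)" unfolding e r3 ..
  also have "\<dots> = r\<^sup>2"
    using r0 by (simp add: powr_powr flip: powr_numeral)
  finally have p: "(3 * sqrt 2 / 2) powr (2 / 3) = r\<^sup>2" .
  have "r\<^sup>2 / 9 * (sqrt 2 * \<kappa> * r ^ 4) = (r ^ 3 * r ^ 3) * (sqrt 2 * \<kappa> / 9)" by (simp add: numeral_eq_Suc)
  also have "r ^ 3 * r ^ 3 = 9 / 2" unfolding r3 by simp
  also have "9 / 2 * (sqrt 2 * \<kappa> / 9) = \<kappa> / sqrt 2" by (simp add: field_simps)
  finally show ?thesis unfolding p r_def .
qed

lemma sqrt2_bounds: "7 / 5 \<le> sqrt (2::real)" "sqrt (2::real) \<le> 16 / 11"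
proof -
  have sq: "(7 / 5)\<^sup>2 \<le> (2::real)" "(2::real) \<le> (16 / 11)\<^sup>2" by (simp_all add: power2_eq_square)
  show "7 / 5 \<le> sqrt (2::real)" by (rule real_le_rsqrt[OF sq(1)])
  show "sqrt (2::real) \<le> 16 / 11" by (rule real_le_lsqrt[OF _ sq(2)]) simp
qed

section \<open>From leaves to graphs\<close>

lemma C1_on_compose_swap:
  assumes G: "C1_on W G G'"
  shows "C1_on {z. (snd z, fst z) \<in> W} (\<lambda>z. G (snd z, fst z)) (\<lambda>z h. G' (snd z, fst z) (snd h, fst h))"
proof (rule C1_onI)
  fix z assume z: "z \<in> {z. (snd z, fst z) \<in> W}"
  have sw: "((\<lambda>z. (snd z, fst z)) has_derivative (\<lambda>h. (snd h, fst h))) (at z)"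
    by (intro has_derivative_Pair has_derivative_fst has_derivative_snd has_derivative_ident)
  show "((\<lambda>z. G (snd z, fst z)) has_derivative (\<lambda>h. G' (snd z, fst z) (snd h, fst h))) (at z)"
    by (rule has_derivative_compose[OF sw]) (use C1_onD(1)[OF G] z in simp)
next
  fix h
  show "continuous_on {z. (snd z, fst z) \<in> W} (\<lambda>z. G' (snd z, fst z) (snd h, fst h))"
    by (rule continuous_on_compose2[OF C1_onD(2)[OF G]]) (auto intro!: continuous_intros)
qed

text \<open>For the sector of \<open>U_minus\<close>, whose axis is the one of the second variable, the coordinates are
exchanged so that the angle is again measured from the axis.\<close>

lemma stationary_profile_swap:
  assumes "stationary_profile k l \<Sigma>"
  shows "stationary_profile l k {z. (snd z, fst z) \<in> \<Sigma>}"
  unfolding stationary_profile_def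
proof (intro ballI impI)
  fix z assume z: "z \<in> {z. (snd z, fst z) \<in> \<Sigma>}" "0 < fst z \<and> 0 < snd z"
  then have "(snd z, fst z) \<in> \<Sigma>" "0 < fst (snd z, fst z) \<and> 0 < snd (snd z, fst z)" by auto
  from assms[unfolded stationary_profile_def, rule_format, OF this]
  obtain V G G1 G2 G1' G2' where V: "open V" "(snd z, fst z) \<in> V" "V \<subseteq> {z. fst z > 0 \<and> snd z > 0}"
    and G: "C1_on V G (\<lambda>z h. G1 z * fst h + G2 z * snd h)" and G1: "C1_on V G1 G1'" and G2: "C1_on V G2 G2'"
    and pos: "\<forall>z\<in>V. (G1 z)\<^sup>2 + (G2 z)\<^sup>2 > 0" and SV: "\<Sigma> \<inter> V = {z \<in> V. G z = 0}"
    and eq: "\<forall>z\<in>V. G z = 0 \<longrightarrow>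
        (G1' z (1, 0) + k * G1 z / fst z + G2' z (0, 1) + l * G2 z / snd z) * ((G1 z)\<^sup>2 + (G2 z)\<^sup>2)
        = (G1 z)\<^sup>2 * G1' z (1, 0) + G1 z * G2 z * (G1' z (0, 1) + G2' z (1, 0)) + (G2 z)\<^sup>2 * G2' z (0, 1)"
    by (elim exE conjE)
  let ?V = "{z. (snd z, fst z) \<in> V}"
  have "open ?V"
  proof -
    have "continuous_on UNIV (\<lambda>z::real \<times> real. (snd z, fst z))" by (intro continuous_intros)
    from open_vimage[OF V(1) this] show ?thesis by (simp add: vimage_def)
  qed
  show "\<exists>V G G1 G2 G1' G2'. open V \<and> z \<in> V \<and> V \<subseteq> {z. fst z > 0 \<and> snd z > 0} \<and>
      C1_on V G (\<lambda>z h. G1 z * fst h + G2 z * snd h) \<and> C1_on V G1 G1' \<and> C1_on V G2 G2' \<and>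
      (\<forall>z\<in>V. (G1 z)\<^sup>2 + (G2 z)\<^sup>2 > 0) \<and> {z. (snd z, fst z) \<in> \<Sigma>} \<inter> V = {z \<in> V. G z = 0} \<and>
      (\<forall>z\<in>V. G z = 0 \<longrightarrow>
        (G1' z (1, 0) + l * G1 z / fst z + G2' z (0, 1) + k * G2 z / snd z) * ((G1 z)\<^sup>2 + (G2 z)\<^sup>2)
        = (G1 z)\<^sup>2 * G1' z (1, 0) + G1 z * G2 z * (G1' z (0, 1) + G2' z (1, 0)) + (G2 z)\<^sup>2 * G2' z (0, 1))"
  proof (rule exI[of _ ?V], rule exI[of _ "\<lambda>z. G (snd z, fst z)"], rule exI[of _ "\<lambda>z. G2 (snd z, fst z)"],
      rule exI[of _ "\<lambda>z. G1 (snd z, fst z)"], rule exI[of _ "\<lambda>z h. G2' (snd z, fst z) (snd h, fst h)"],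
      rule exI[of _ "\<lambda>z h. G1' (snd z, fst z) (snd h, fst h)"], intro conjI ballI impI)
    show "C1_on ?V (\<lambda>z. G (snd z, fst z)) (\<lambda>z h. G2 (snd z, fst z) * fst h + G1 (snd z, fst z) * snd h)"
      using C1_on_compose_swap[OF G] by (simp add: add.commute)
    show "C1_on ?V (\<lambda>z. G2 (snd z, fst z)) (\<lambda>z h. G2' (snd z, fst z) (snd h, fst h))"
      "C1_on ?V (\<lambda>z. G1 (snd z, fst z)) (\<lambda>z h. G1' (snd z, fst z) (snd h, fst h))"
      by (rule C1_on_compose_swap[OF G2], rule C1_on_compose_swap[OF G1])
    show "{z. (snd z, fst z) \<in> \<Sigma>} \<inter> ?V = {z \<in> ?V. G (snd z, fst z) = 0}" using SV by auto
    show "open ?V" "z \<in> ?V" "?V \<subseteq> {z. fst z > 0 \<and> snd z > 0}" using \<open>open ?V\<close> V by auto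
    fix y assume y: "y \<in> ?V"
    show "(G2 (snd y, fst y))\<^sup>2 + (G1 (snd y, fst y))\<^sup>2 > 0" using pos y by (simp add: add.commute)
    assume "G (snd y, fst y) = 0"
    with eq y have e: "(G1' (snd y, fst y) (1, 0) + k * G1 (snd y, fst y) / snd y + G2' (snd y, fst y) (0, 1) + l * G2 (snd y, fst y) / fst y)
        * ((G1 (snd y, fst y))\<^sup>2 + (G2 (snd y, fst y))\<^sup>2)
        = (G1 (snd y, fst y))\<^sup>2 * G1' (snd y, fst y) (1, 0) + G1 (snd y, fst y) * G2 (snd y, fst y) * (G1' (snd y, fst y) (0, 1)
          + G2' (snd y, fst y) (1, 0)) + (G2 (snd y, fst y))\<^sup>2 * G2' (snd y, fst y) (0, 1)" by auto
    show "(G2' (snd y, fst y) (snd (1, 0), fst (1, 0)) + l * G2 (snd y, fst y) / fst y + G1' (snd y, fst y) (snd (0, 1), fst (0, 1))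
        + k * G1 (snd y, fst y) / snd y) * ((G2 (snd y, fst y))\<^sup>2 + (G1 (snd y, fst y))\<^sup>2)
        = (G2 (snd y, fst y))\<^sup>2 * G2' (snd y, fst y) (snd (1, 0), fst (1, 0)) + G2 (snd y, fst y) * G1 (snd y, fst y)
          * (G2' (snd y, fst y) (snd (0, 1), fst (0, 1)) + G1' (snd y, fst y) (snd (1, 0), fst (1, 0)))
          + (G1 (snd y, fst y))\<^sup>2 * G1' (snd y, fst y) (snd (0, 1), fst (0, 1))"
      using e by (simp add: ac_simps)
  qed
qed

lemma leaf_stationary_profile:
  assumes leaf: "hardt_simon_leaf U S" and U: "0 \<notin> U"
  shows "stationary_profile 4 2 (profile S)"
proof -
  have S: "S \<subseteq> U" "smooth_hypersurface S" "area_minimizing S" "O5_O3_invariant S" "dilations_foliate S U"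
    using leaf by (auto simp: hardt_simon_leaf_def)
  obtain E where E: "perimeter_minimizing E" "S = boundary_support E"
    using S(3) by (auto simp: area_minimizing_def)
  have "closed S" using closed_boundary_support E by (auto simp: perimeter_minimizing_def)
  have "negligible S"
  proof (rule negligible_if_dilations_disjoint[OF \<open>closed S\<close>])
    show "0 \<notin> S" using S(1) U by auto
    fix c :: real and x assume c: "c > 0" and x: "x \<in> S" "c *\<^sub>R x \<in> S"
    have "c *\<^sub>R x \<in> (*\<^sub>R) c ` S \<inter> (*\<^sub>R) 1 ` S" using x by auto
    then show "c = 1" using S(5) c unfolding dilations_foliate_def by (metis empty_iff zero_less_one)
  qed
  then show ?thesis using stationary_profile_of_invariant_minimizer S by blast
qed

text \<open>Covering by the dilations gives existence, their disjointness uniqueness.\<close>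

lemma leaf_meets_ray_once:
  assumes "dilations_foliate S U" and p: "p \<in> U"
  shows "\<exists>!w. exp w *\<^sub>R p \<in> S"
proof -
  have fol: "\<And>x. x \<in> U \<Longrightarrow> \<exists>c>0. x \<in> (*\<^sub>R) c ` S"
    and disj: "\<And>c d. c > 0 \<Longrightarrow> d > 0 \<Longrightarrow> c \<noteq> d \<Longrightarrow> (*\<^sub>R) c ` S \<inter> (*\<^sub>R) d ` S = {}"
    using assms(1) unfolding dilations_foliate_def by auto
  obtain c q where c: "c > 0" "q \<in> S" "p = c *\<^sub>R q" using fol[OF p] by auto
  show ?thesis
  proof (rule ex1I)
    show "exp (- ln c) *\<^sub>R p \<in> S" using c by (simp add: exp_minus)
    fix v assume v: "exp v *\<^sub>R p \<in> S"
    have "p = exp (- v) *\<^sub>R (exp v *\<^sub>R p)" by (simp add: exp_minus)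
    then have "p \<in> (*\<^sub>R) (exp (- v)) ` S \<inter> (*\<^sub>R) c ` S" using v c by blast
    then have "exp (- v) = c" using disj[of "exp (- v)" c] c by auto
    then have "- v = ln c" by (metis ln_exp)
    then show "v = - ln c" by simp
  qed
qed

lemma profile_meets_ray_once:
  assumes leaf: "hardt_simon_leaf U S" and p: "slice8 z \<in> U"
  shows "\<exists>!w. (exp w * fst z, exp w * snd z) \<in> profile S"
proof -
  have "slice8 (exp w * fst z, exp w * snd z) = exp w *\<^sub>R slice8 z" for w by (simp add: slice8_def)
  then show ?thesis using leaf_meets_ray_once[OF _ p] leaf by (simp add: profile_def hardt_simon_leaf_def)
qed

lemma normalized_scale_tendsto:
  assumes "normalized_scale f"
  shows "((\<lambda>r. f r * r ^ 3) \<longlongrightarrow> 1) at_top"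
proof -
  obtain \<epsilon> where \<epsilon>: "\<epsilon> > 0" "(\<lambda>r. f r - r powr (-3)) \<in> O[at_top](\<lambda>r. r powr (-3 - \<epsilon>))"
    using assms by (auto simp: normalized_scale_def)
  obtain c where c: "\<forall>\<^sub>F r in at_top. norm (f r - r powr (-3)) \<le> c * norm (r powr (-3 - \<epsilon>))"
    using landau_o.bigE[OF \<epsilon>(2)] by blast
  have "((\<lambda>r. f r * r ^ 3 - 1) \<longlongrightarrow> 0) at_top"
  proof (rule Lim_null_comparison)
    show "\<forall>\<^sub>F r in at_top. norm (f r * r ^ 3 - 1) \<le> c * r powr (- \<epsilon>)"
      using c eventually_gt_at_top[of 0]
    proof eventually_elim
      case (elim r)
      have p: "r powr (-3) * r ^ 3 = 1" "r powr (-3 - \<epsilon>) * r ^ 3 = r powr (- \<epsilon>)"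
        using elim(2) by (simp_all add: powr_minus powr_diff field_simps)
      have "f r * r ^ 3 - 1 = (f r - r powr (-3)) * r ^ 3" using p(1) by (simp add: left_diff_distrib)
      then have "norm (f r * r ^ 3 - 1) = norm (f r - r powr (-3)) * r ^ 3" using elim(2) by (simp add: abs_mult)
      also have "\<dots> \<le> c * norm (r powr (-3 - \<epsilon>)) * r ^ 3" using elim by (intro mult_right_mono) auto
      also have "\<dots> = c * r powr (- \<epsilon>)" using p(2) by simp
      finally show ?case .
    qed
    have "((\<lambda>r. r powr (- \<epsilon>)) \<longlongrightarrow> 0) at_top" using \<epsilon>(1) by (intro tendsto_neg_powr filterlim_ident) auto
    from tendsto_mult_right_zero[OF this] show "((\<lambda>r. c * r powr (- \<epsilon>)) \<longlongrightarrow> 0) at_top" .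
  qed
  then show ?thesis by (simp add: LIM_zero_iff)
qed

text \<open>The point of the cone over \<open>(e5, e3)\<close> at distance \<open>r\<close> has coordinates \<open>r sqrt 2 / sqrt 3\<close> and \<open>r / sqrt 3\<close>.\<close>

lemma normal_graph_profile:
  assumes "normal_graph_near_infinity \<sigma> S f"
  obtains R0 where "R0 > 0" "continuous_on {R0<..} f"
    "\<And>r. r > R0 \<Longrightarrow> (r / sqrt 3 * (sqrt 2 + \<sigma> * f r), r / sqrt 3 * (1 - \<sigma> * sqrt 2 * f r)) \<in> profile S"
proof -
  obtain R0 where R0: "R0 > 0" "smooth_on {R0<..} f"
    and G: "normal_graph_point \<sigma> f ` {\<xi> \<in> C0. norm \<xi> > R0} \<subseteq> S"
    using assms unfolding normal_graph_near_infinity_def Let_def by blast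
  have "Ck_on 0 {R0<..} f" using R0(2) unfolding smooth_on_def by blast
  moreover have "(r / sqrt 3 * (sqrt 2 + \<sigma> * f r), r / sqrt 3 * (1 - \<sigma> * sqrt 2 * f r)) \<in> profile S" if r: "r > R0" for r
  proof -
    define a b where "a = r * sqrt 2 / sqrt 3" and "b = r / sqrt 3"
    define \<xi> :: R8 where "\<xi> = (a *\<^sub>R e5, b *\<^sub>R e3)"
    have ab: "a\<^sup>2 = 2 * r\<^sup>2 / 3" "b\<^sup>2 = r\<^sup>2 / 3" "r > 0" using r R0(1)
      by (simp_all add: a_def b_def power_mult_distrib power_divide)
    have n: "norm \<xi> = r"
    proof -
      have "a\<^sup>2 + b\<^sup>2 = r\<^sup>2" using ab by simp
      then show ?thesis using ab(3) by (simp add: \<xi>_def norm_Pair)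
    qed
    have "\<xi> \<in> C0" using ab by (simp add: \<xi>_def C0_def)
    then have "normal_graph_point \<sigma> f \<xi> \<in> S" using G n r by blast
    moreover have "normal_graph_point \<sigma> f \<xi> = slice8 (r / sqrt 3 * (sqrt 2 + \<sigma> * f r), r / sqrt 3 * (1 - \<sigma> * sqrt 2 * f r))"
    proof -
      have "\<sigma> * r * f r * (sqrt 2 / (2 * r)) = \<sigma> * f r * sqrt 2 / 2" using ab by simp
      then have "normal_graph_point \<sigma> f \<xi> = ((a + \<sigma> * f r * sqrt 2 / 2 * a) *\<^sub>R e5, (b + \<sigma> * f r * sqrt 2 / 2 * (-2 * b)) *\<^sub>R e3)"
        unfolding normal_graph_point_def nu_C0_def n using ab(3) by (simp add: \<xi>_def scaleR_left_distrib scaleR_left_diff_distrib)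
      moreover have "a + \<sigma> * f r * sqrt 2 / 2 * a = r / sqrt 3 * (sqrt 2 + \<sigma> * f r)"
        by (simp add: a_def field_simps)
      moreover have "b + \<sigma> * f r * sqrt 2 / 2 * (-2 * b) = r / sqrt 3 * (1 - \<sigma> * sqrt 2 * f r)"
        by (simp add: b_def field_simps)
      ultimately show ?thesis by (simp add: slice8_def)
    qed
    ultimately show ?thesis by (simp add: profile_def)
  qed
  ultimately show ?thesis using that R0(1) by simp
qed

lemma below_cone_angle:
  assumes "0 < \<theta>" "\<theta> < arctan a"
  shows "sin \<theta> > 0" "cos \<theta> > 0" "sin \<theta> < a * cos \<theta>"
proof -
  have h: "\<theta> < pi / 2" using assms(2) arctan_ubound[of a] by linarith
  show "sin \<theta> > 0" using assms h by (intro sin_gt_zero) auto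
  show c: "cos \<theta> > 0" using assms h by (intro cos_gt_zero_pi) auto
  have "tan \<theta> < tan (arctan a)"
    using assms h arctan_ubound[of a] by (intro tan_monotone) auto
  then have "tan \<theta> < a" by (simp add: tan_arctan)
  then show "sin \<theta> < a * cos \<theta>" using c by (simp add: tan_def field_simps)
qed

text \<open>With \<open>\<theta>0 = arctan a\<close>, the point given in the last assumption lies at angle \<open>arctan a - arctan (f r)\<close> by
the addition theorems; since rays meet the curve once, this determines \<open>w\<close> there.\<close>

lemma cone_graph_of_profile:
  fixes k l a R1 :: real and f :: "real \<Rightarrow> real"
  assumes kl: "k > 0" "l > 0" "k + l = 6" and a: "a > 0" "k * a\<^sup>2 = l"
    and stat: "stationary_profile k l \<Sigma>"
    and once: "\<And>s t. 0 < s \<Longrightarrow> 0 < t \<Longrightarrow> t < a * s \<Longrightarrow> \<exists>!w. (exp w * s, exp w * t) \<in> \<Sigma>"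
    and R1: "R1 > 0" and f: "continuous_on {R1<..} f" "((\<lambda>r. f r * r ^ 3) \<longlongrightarrow> 1) at_top"
    and graph: "\<And>r. r > R1 \<Longrightarrow> (r / sqrt (1 + a\<^sup>2) * (1 + a * f r), r / sqrt (1 + a\<^sup>2) * (a - f r)) \<in> \<Sigma>"
  obtains w \<alpha> where "cone_graph k l (arctan a) w \<alpha> f R1"
proof -
  interpret P: polar_graph k l \<Sigma> "arctan a"
  proof
    show "0 < arctan a" "arctan a < pi / 2" using a arctan_ubound by auto
    fix \<theta> assume \<theta>: "0 < \<theta>" "\<theta> < arctan a"
    note sc = below_cone_angle[OF this]
    have "(sin \<theta>)\<^sup>2 < (a * cos \<theta>)\<^sup>2" using sc by (intro power_strict_mono) auto
    then have "k * (sin \<theta>)\<^sup>2 < k * (a * cos \<theta>)\<^sup>2" using kl by simp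
    also have "\<dots> = l * (cos \<theta>)\<^sup>2" by (simp add: power_mult_distrib a(2)[symmetric])
    finally show "l * cot \<theta> - k * tan \<theta> > 0"
      using sc by (simp add: cot_def tan_def field_simps power2_eq_square)
    show "\<exists>!w. polar (w, \<theta>) \<in> \<Sigma>" using once[OF sc(2,1,3)] by (simp add: polar_def)
  qed (rule stat)
  have "cone_graph k l (arctan a) P.w P.\<alpha> f R1"
  proof
    show "k > 0" "l > 0" "k + l = 6" by (rule kl)+
    show "0 < arctan a" "arctan a < pi / 2" by (rule P.\<theta>0)+
    show "k * (tan (arctan a))\<^sup>2 = l" using a by (simp add: tan_arctan)
    show "continuous_on {R1<..} f" "((\<lambda>r. f r * r ^ 3) \<longlongrightarrow> 1) at_top" by (rule f)+
    show "\<bar>P.\<alpha> \<theta>\<bar> < pi / 2" for \<theta> using P.alpha_bounds[of \<theta>] by (simp add: abs_less_iff)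
    show "(P.w has_real_derivative tan (P.\<alpha> \<theta>)) (at \<theta>)" if "0 < \<theta>" "\<theta> < arctan a" for \<theta>
      by (rule P.DERIV_w[OF that])
    show "(P.\<alpha> has_real_derivative 7 - (l * cot \<theta> - k * tan \<theta>) * tan (P.\<alpha> \<theta>)) (at \<theta>)"
      if "0 < \<theta>" "\<theta> < arctan a" for \<theta>
      using P.DERIV_alpha[OF that] kl(3) by (simp add: P.M_def)
    fix r assume r: "r > R1" "f r > 0" "arctan (f r) < arctan a"
    have "polar (ln (r * sqrt (1 + (f r)\<^sup>2)), arctan a - arctan (f r)) =
        (r / sqrt (1 + a\<^sup>2) * (1 + a * f r), r / sqrt (1 + a\<^sup>2) * (a - f r))"
    proof -
      have s: "sqrt (1 + (f r)\<^sup>2) > 0" "sqrt (1 + a\<^sup>2) > 0" by (simp_all add: add_pos_nonneg)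
      have "exp (ln (r * sqrt (1 + (f r)\<^sup>2))) = r * sqrt (1 + (f r)\<^sup>2)" using r R1 s by (intro exp_ln mult_pos_pos) auto
      then show ?thesis using s
        by (simp add: polar_def cos_diff sin_diff cos_arctan sin_arctan field_simps)
    qed
    then have "polar (ln (r * sqrt (1 + (f r)\<^sup>2)), arctan a - arctan (f r)) \<in> \<Sigma>" using graph[OF r(1)] by simp
    then show "P.w (arctan a - arctan (f r)) = ln (r * sqrt (1 + (f r)\<^sup>2))"
      using P.w_unique[of "arctan a - arctan (f r)"] r by simp
  qed
  then show ?thesis by (rule that)
qed

lemma cone_graph_plus:
  assumes leaf: "hardt_simon_leaf U_plus S" and ng: "normal_graph_near_infinity 1 S f" and ns: "normalized_scale f"
  obtains w \<alpha> R1 where "cone_graph 4 2 (arctan (1 / sqrt 2)) w \<alpha> f R1"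
proof -
  obtain R0 where R0: "R0 > 0" "continuous_on {R0<..} f"
    "\<And>r. r > R0 \<Longrightarrow> (r / sqrt 3 * (sqrt 2 + 1 * f r), r / sqrt 3 * (1 - 1 * sqrt 2 * f r)) \<in> profile S"
    using normal_graph_profile[OF ng] by blast
  show ?thesis
  proof (rule cone_graph_of_profile[of 4 2 "1 / sqrt 2" "profile S" R0 f])
    show "stationary_profile 4 2 (profile S)" by (rule leaf_stationary_profile[OF leaf]) (simp add: U_plus_def zero_prod_def)
    show "\<exists>!w. (exp w * s, exp w * t) \<in> profile S" if "0 < s" "0 < t" "t < 1 / sqrt 2 * s" for s t
      using profile_meets_ray_once[OF leaf, of "(s, t)"] that by (simp add: slice8_def U_plus_def field_simps)
    show "((\<lambda>r. f r * r ^ 3) \<longlongrightarrow> 1) at_top" by (rule normalized_scale_tendsto[OF ns])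
    fix r assume r: "r > R0"
    have q: "1 + (1 / sqrt 2)\<^sup>2 = 3 / (2::real)" by (simp add: power_divide)
    have "r / sqrt (1 + (1 / sqrt 2)\<^sup>2) * (1 + 1 / sqrt 2 * f r) = r / sqrt 3 * (sqrt 2 + 1 * f r)"
      "r / sqrt (1 + (1 / sqrt 2)\<^sup>2) * (1 / sqrt 2 - f r) = r / sqrt 3 * (1 - 1 * sqrt 2 * f r)"
      unfolding q by (simp_all add: real_sqrt_divide field_simps)
    then show "(r / sqrt (1 + (1 / sqrt 2)\<^sup>2) * (1 + 1 / sqrt 2 * f r), r / sqrt (1 + (1 / sqrt 2)\<^sup>2) * (1 / sqrt 2 - f r)) \<in> profile S"
      using R0(3)[OF r] by simp
  qed (use R0 in \<open>auto simp: power_divide intro: that\<close>)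
qed

lemma cone_graph_minus:
  assumes leaf: "hardt_simon_leaf U_minus S" and ng: "normal_graph_near_infinity (-1) S f" and ns: "normalized_scale f"
  obtains w \<alpha> R1 where "cone_graph 2 4 (arctan (sqrt 2)) w \<alpha> f R1"
proof -
  let ?\<Sigma> = "{z. (snd z, fst z) \<in> profile S}"
  obtain R0 where R0: "R0 > 0" "continuous_on {R0<..} f"
    "\<And>r. r > R0 \<Longrightarrow> (r / sqrt 3 * (sqrt 2 + (-1) * f r), r / sqrt 3 * (1 - (-1) * sqrt 2 * f r)) \<in> profile S"
    using normal_graph_profile[OF ng] by blast
  show ?thesis
  proof (rule cone_graph_of_profile[of 2 4 "sqrt 2" ?\<Sigma> R0 f])
    show "stationary_profile 2 4 ?\<Sigma>"
      by (rule stationary_profile_swap, rule leaf_stationary_profile[OF leaf]) (simp add: U_minus_def zero_prod_def)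
    show "\<exists>!w. (exp w * s, exp w * t) \<in> ?\<Sigma>" if "0 < s" "0 < t" "t < sqrt 2 * s" for s t
      using profile_meets_ray_once[OF leaf, of "(t, s)"] that by (simp add: slice8_def U_minus_def)
    show "((\<lambda>r. f r * r ^ 3) \<longlongrightarrow> 1) at_top" by (rule normalized_scale_tendsto[OF ns])
    fix r assume r: "r > R0"
    show "(r / sqrt (1 + (sqrt 2)\<^sup>2) * (1 + sqrt 2 * f r), r / sqrt (1 + (sqrt 2)\<^sup>2) * (sqrt 2 - f r)) \<in> ?\<Sigma>"
      using R0(3)[OF r] by simp
  qed (use R0 in \<open>auto intro: that\<close>)
qed

theorem proposition1:
  fixes S_plus S_minus :: "R8 set" and f_plus f_minus :: "real \<Rightarrow> real"
  assumes "hardt_simon_leaf U_plus S_plus"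
    and "hardt_simon_leaf U_minus S_minus"
    and "normal_graph_near_infinity 1 S_plus f_plus"
    and "normal_graph_near_infinity (-1) S_minus f_minus"
    and "normalized_scale f_plus"
    and "normalized_scale f_minus"
  shows "\<exists>b_plus b_minus :: real.
      b_plus > 0 \<and> b_minus < 0 \<and>
      (\<lambda>r. f_plus r - r powr (-3) - b_plus * r powr (-4)) \<in> O[at_top](\<lambda>r. r powr (-6)) \<and>
      (\<lambda>r. f_minus r - r powr (-3) - b_minus * r powr (-4)) \<in> O[at_top](\<lambda>r. r powr (-6)) \<and>
      0 < (3 * sqrt 2 / 2) powr (2 / 3) / 9 * b_plus \<and>
      (3 * sqrt 2 / 2) powr (2 / 3) / 9 * b_plus \<le> 0.1 \<and>
      (3 * sqrt 2 / 2) powr (2 / 3) / 9 * b_minus \<le> - 0.11 \<and>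
      b_plus + b_minus \<le> - (9 / 10 ^ 2) * (3 * sqrt 2 / 2) powr (- 2 / 3) \<and>
      - (9 / 10 ^ 2) * (3 * sqrt 2 / 2) powr (- 2 / 3) < 0 \<and>
      b_plus + b_minus \<noteq> 0"
proof -
  let ?X = "(3 * sqrt 2 / 2) powr (2 / 3) :: real"
  obtain w1 \<alpha>1 R1 where plus: "cone_graph 4 2 (arctan (1 / sqrt 2)) w1 \<alpha>1 f_plus R1"
    using cone_graph_plus[OF assms(1,3,5)] by blast
  obtain w2 \<alpha>2 R2 where minus: "cone_graph 2 4 (arctan (sqrt 2)) w2 \<alpha>2 f_minus R2"
    using cone_graph_minus[OF assms(2,4,6)] by blast
  obtain bp where bp: "(\<lambda>r. f_plus r - r powr (-3) - bp * r powr (-4)) \<in> O[at_top](\<lambda>r. r powr (-6))"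
    "0 < bp" "bp \<le> sqrt 2 * (7 / 50) * root 3 (3 / sqrt 2) ^ 4"
    using cone_graph.expansion[OF plus] cone_graph.coefficient_bounds_plus[OF plus tan_arctan] by blast
  obtain bm where bm: "(\<lambda>r. f_minus r - r powr (-3) - bm * r powr (-4)) \<in> O[at_top](\<lambda>r. r powr (-6))"
    "bm \<le> - (sqrt 2 * (4 / 25) * root 3 (3 / sqrt 2) ^ 4)"
    using cone_graph.expansion[OF minus] cone_graph.coefficient_bound_minus[OF minus tan_arctan] by blast
  have X: "?X > 0" by simp
  have "?X / 9 * bp \<le> ?X / 9 * (sqrt 2 * (7 / 50) * root 3 (3 / sqrt 2) ^ 4)"
    using bp(3) X by (intro mult_left_mono) auto
  also have "\<dots> = 7 / 50 / sqrt 2" by (rule scaled_coefficient)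
  also have "\<dots> \<le> 0.1" using sqrt2_bounds(1) by (simp add: field_simps)
  finally have p: "?X / 9 * bp \<le> 0.1" .
  have "?X / 9 * bm \<le> ?X / 9 * (- (sqrt 2 * (4 / 25) * root 3 (3 / sqrt 2) ^ 4))"
    using bm(2) X by (intro mult_left_mono) auto
  also have "\<dots> = - (4 / 25 / sqrt 2)" using scaled_coefficient[of "4 / 25"] by (simp only: mult_minus_right)
  also have "\<dots> \<le> - 0.11" using sqrt2_bounds(2) by (simp add: field_simps)
  finally have m: "?X / 9 * bm \<le> - 0.11" .
  have m0: "bm < 0"
  proof (rule ccontr)
    assume "\<not> bm < 0"
    then have "0 \<le> ?X / 9 * bm" by simp
    from this m have "0 \<le> - (0.11 :: real)" by (rule order_trans)
    then show False by simp
  qed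
  have inv: "(3 * sqrt 2 / 2) powr (- 2 / 3) = 1 / ?X"
    using powr_minus_divide[of "3 * sqrt 2 / 2" "2 / 3"] by simp
  have "?X / 9 * (bp + bm) \<le> 0.1 + - 0.11" unfolding distrib_left using p m by (rule add_mono)
  also have "\<dots> = - (1 / 100)" by simp
  finally have s: "bp + bm \<le> - (9 / 10 ^ 2) * (3 * sqrt 2 / 2) powr (- 2 / 3)"
    unfolding inv using X by (simp add: field_simps)
  have neg: "- (9 / 10 ^ 2) * (3 * sqrt 2 / 2) powr (- 2 / 3) < (0::real)" by simp
  have nz: "bp + bm \<noteq> 0" using s neg by linarith
  have "0 < ?X / 9 * bp" using bp(2) X by (intro mult_pos_pos) auto
  then show ?thesis using bp(1,2) bm(1) m0 p m s neg nz by (intro exI[of _ bp] exI[of _ bm] conjI)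
qed

end
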